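(* Let $A$ be a primitively generated braided bialgebra over a field $K$, and let $(P,c_P,b_P)$ be its infinitesimal braided Lie algebra, where $P=P(A)$. Then $A$ is isomorphic, as a braided bialgebra, to the universal enveloping algebra $U(P,c_P,b_P)$.
   Context: Fix a field $K$; all vector spaces, tensor products and maps are over $K$ ($K$-linear). An object also denotes its identity map. Braided vector space $(V,c)$: $c:V\otimes V\to V\otimes V$ linear with $(c\otimes V)(V\otimes c)(c\otimes V)=(V\otimes c)(c\otimes V)(V\otimes c)$; a morphism $f:(V,c_V)\to(W,c_W)$ is linear with $c_W(f\otimes f)=(f\otimes f)c_V$. Braided algebra $(A,m,u,c)$: an associative unital algebra and braided vector space with $c(m\otimes A)=(A\otimes m)(c\otimes A)(A\otimes c)$, $c(A\otimes m)=(m\otimes A)(A\otimes c)(c\otimes A)$, $c(u\otimes A)=A\otimes u$, $c(A\otimes u)=u\otimes A$. Braided coalgebra $(C,\Delta,\varepsilon,c)$: a coassociative counital coalgebra and braided vector space with $(\Delta\otimes C)c=(C\otimes c)(c\otimes C)(C\otimes\Delta)$, $(C\otimes\Delta)c=(c\otimes C)(C\otimes c)(\Delta\otimes C)$, $(\varepsilon\otimes C)c=C\otimes\varepsilon$, $(C\otimes\varepsilon)c=\varepsilon\otimes C$. Braided bialgebra $(B,m,u,\Delta,\varepsilon,c)$: a braided algebra and braided coalgebra with $\Delta m=(m\otimes m)(B\otimes c\otimes B)(\Delta\otimes\Delta)$, $\Delta(1)=1\otimes 1$, and $\varepsilon$ an algebra map. Morphisms of braided (bi)algebras are (bi)algebra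 maps that are morphisms of braided vector spaces. $P(B)=\{x\in B\mid \Delta(x)=x\otimes1+1\otimes x\}$. The braiding $c$ of $B$ satisfies $c(P(B)\otimes B)\subseteq B\otimes P(B)$ and $c(B\otimes P(B))\subseteq P(B)\otimes B$, so it restricts to a braiding $c_P$ on $P(B)$; $(P(B),c_P)$ is the infinitesimal part of $B$. $B$ is primitively generated if it is generated as an algebra by $P(B)$. A braided bialgebra map $f:B\to B'$ induces $P(f):P(B)\to P(B')$. Braided tensor algebra $T(V,c)$: the tensor algebra $T(V)$ with the unique braiding $c_T$ extending $c$ and making it a braided algebra, and with $\Delta_T$, $\varepsilon_T$ the algebra maps $\Delta_T:T(V)\to T(V)\otimes_c T(V)$, $\varepsilon_T:T(V)\to K$ such that $\Delta_T(v)=v\otimes1+1\otimes v$, $\varepsilon_T(v)=0$ for $v\in V$, where $T\otimes_cT$ has multiplication $(m_T\otimes m_T)(T\otimes c_T\otimes T)$. A bracket on a braided vector space $(V,c)$ is a family $b=(b^{[n]})_{n\in\mathbb N}$ of linear maps defined together with braided bialgebras $U^{[n]}$ and braided vector space morphisms $i^{[n]}:V\to P^{[n]}:=P(U^{[n]})$ as follows. $U^{[0]}=T(V,c)$ and $i^{[0]}$ is the inclusion. For each $n$, $b^{[n]}:P^{[n]}\to V$ is linear and, with $V^{[n]}:=i^{[n]}(V)$ and $c$ the braiding of $U^{[n]}$, one has on $P^{[n]}\otimes V^{[n]}$ and $V^{[n]}\otimes P^{[n]}$ respectively $c(i^{[n]}b^{[n]}\otimes V^{[n]})=(V^{[n]}\otimes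 i^{[n]}b^{[n]})c$ and $c(V^{[n]}\otimes i^{[n]}b^{[n]})=(i^{[n]}b^{[n]}\otimes V^{[n]})c$ (these make sense as $c$ maps $P^{[n]}\otimes V^{[n]}$ into $V^{[n]}\otimes P^{[n]}$ and conversely). Then $U^{[n+1]}=U^{[n]}/\big((\mathrm{Id}-i^{[n]}b^{[n]})[P^{[n]}]\big)$ (quotient by the two-sided ideal generated) with the unique braided bialgebra structure making the projection $\pi_n^{n+1}:U^{[n]}\to U^{[n+1]}$ a braided bialgebra map, and $i^{[n+1]}=P(\pi_n^{n+1})i^{[n]}$. The universal enveloping algebra is the direct limit $U(V,c,b)=\varinjlim U^{[n]}$ (a braided bialgebra), with canonical map $i_U:V\to U(V,c,b)$. $(V,c,b)$ is a braided Lie algebra if $i_U$ is injective. Infinitesimal braided Lie algebra $(P,c_P,b_P)$ of a braided bialgebra $A$: $(P,c_P)$ is the infinitesimal part, and $b_P=(b_P^{[n]})$ is the bracket on $(P,c_P)$ constructed recursively as follows. $\psi^{[0]}:U^{[0]}=T(P,c_P)\to A$ is the algebra map extending the inclusion $P\subseteq A$ (it is a braided bialgebra map). Given the braided bialgebra map $\psi^{[n]}:U^{[n]}\to A$, $b_P^{[n]}:P^{[n]}\to P$ is the map induced by $\psi^{[n]}$ on primitive elements, and $\psi^{[n+1]}:U^{[n+1]}\to A$ is the unique map with $\psi^{[n+1]}\pi_n^{n+1}=\psi^{[n]}$. (This is a well-defined bracket and $(P,c_P,b_P)$ is a braided Lie algebra.) *)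

theory Defs
  imports "HOL-Algebra.Algebra" "HOL-Algebra.Algebraic_Closure_Type" "HOL-Library.Poly_Mapping"
begin

text \<open>
  The ground field is a type \<open>'k\<close> of class \<^class>\<open>field\<close>, viewed as a ring record by
  \<open>ring_of_type_algebra\<close>. Vector spaces are module records with an explicit carrier; algebras
  also use the ring fields of the record, which are irrelevant for a mere vector space. Functions
  between carriers are meaningful on carriers only.
\<close>

abbreviation ground_field :: "'k::field ring" (\<open>\<bbbK>\<close>)
  where "\<bbbK> \<equiv> ring_of_type_algebra"

definition ground_algebra :: "('k::field, 'k) module" where
  "ground_algebra =
    \<lparr>carrier = UNIV, monoid.mult = (*), one = 1, ring.zero = 0, add = (+), module.smult = (*)\<rparr>"

definition vector_space_over_field :: "('k::field, 'v, 'm) module_scheme \<Rightarrow> bool" where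
  "vector_space_over_field V \<longleftrightarrow> module \<bbbK> V"

definition linear_maps ::
    "('k::field, 'v, 'm) module_scheme \<Rightarrow> ('k, 'w, 'n) module_scheme \<Rightarrow> ('v \<Rightarrow> 'w) set" where
  "linear_maps V W = {f \<in> carrier V \<rightarrow> carrier W.
     (\<forall>x\<in>carrier V. \<forall>y\<in>carrier V. f (x \<oplus>\<^bsub>V\<^esub> y) = f x \<oplus>\<^bsub>W\<^esub> f y) \<and>
     (\<forall>a. \<forall>x\<in>carrier V. f (a \<odot>\<^bsub>V\<^esub> x) = a \<odot>\<^bsub>W\<^esub> f x)}"

definition unital_algebra :: "('k::field, 'a, 'm) module_scheme \<Rightarrow> bool" where
  "unital_algebra A \<longleftrightarrow> vector_space_over_field A \<and> ring A \<and>
     (\<forall>a. \<forall>x\<in>carrier A. \<forall>y\<in>carrier A.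
        (a \<odot>\<^bsub>A\<^esub> x) \<otimes>\<^bsub>A\<^esub> y = a \<odot>\<^bsub>A\<^esub> (x \<otimes>\<^bsub>A\<^esub> y) \<and>
        x \<otimes>\<^bsub>A\<^esub> (a \<odot>\<^bsub>A\<^esub> y) = a \<odot>\<^bsub>A\<^esub> (x \<otimes>\<^bsub>A\<^esub> y))"

definition algebra_maps ::
    "('k::field, 'a, 'm) module_scheme \<Rightarrow> ('k, 'b, 'n) module_scheme \<Rightarrow> ('a \<Rightarrow> 'b) set" where
  "algebra_maps A B = linear_maps A B \<inter> ring_hom A B"

section \<open>Quotients, tensor algebras and tensor powers\<close>

text \<open>
  A quotient is carried by one chosen representative of each coset, so that \<open>coset_rep A J\<close> is
  the canonical projection and iterated quotients keep the element type of the first space.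
\<close>

definition coset_rep :: "('k, 'a, 'm) module_scheme \<Rightarrow> 'a set \<Rightarrow> 'a \<Rightarrow> 'a" where
  "coset_rep A J x = (SOME y. y \<in> J +>\<^bsub>A\<^esub> x)"

definition quotient_algebra :: "('k, 'a, 'm) module_scheme \<Rightarrow> 'a set \<Rightarrow> ('k, 'a) module" where
  "quotient_algebra A J =
    \<lparr>carrier = coset_rep A J ` carrier A,
     monoid.mult = (\<lambda>x y. coset_rep A J (x \<otimes>\<^bsub>A\<^esub> y)),
     one = coset_rep A J \<one>\<^bsub>A\<^esub>,
     ring.zero = coset_rep A J \<zero>\<^bsub>A\<^esub>,
     add = (\<lambda>x y. coset_rep A J (x \<oplus>\<^bsub>A\<^esub> y)),
     module.smult = (\<lambda>a x. coset_rep A J (a \<odot>\<^bsub>A\<^esub> x))\<rparr>"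

text \<open>
  The free unital algebra on the underlying set of \<open>V\<close>: finitely supported combinations of words,
  multiplied by concatenation.
\<close>

definition free_algebra ::
    "('k::field, 'v, 'm) module_scheme \<Rightarrow> ('k, 'v list \<Rightarrow>\<^sub>0 'k) module" where
  "free_algebra V =
    \<lparr>carrier = {f. Poly_Mapping.keys f \<subseteq> lists (carrier V)},
     monoid.mult = (\<lambda>f g. \<Sum>u\<in>Poly_Mapping.keys f. \<Sum>w\<in>Poly_Mapping.keys g.
        Poly_Mapping.single (u @ w) (Poly_Mapping.lookup f u * Poly_Mapping.lookup g w)),
     one = Poly_Mapping.single [] 1,
     ring.zero = 0,
     add = (+),
     module.smult = (\<lambda>a f. Poly_Mapping.map ((*) a) f)\<rparr>"

definition tensor_relations ::
    "('k::field, 'v, 'm) module_scheme \<Rightarrow> ('v list \<Rightarrow>\<^sub>0 'k) set" where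
  "tensor_relations V =
    {Poly_Mapping.single [x \<oplus>\<^bsub>V\<^esub> y] 1 - Poly_Mapping.single [x] 1 - Poly_Mapping.single [y] 1
       | x y. x \<in> carrier V \<and> y \<in> carrier V} \<union>
    {Poly_Mapping.single [a \<odot>\<^bsub>V\<^esub> x] 1 - Poly_Mapping.single [x] a | a x. x \<in> carrier V}"

definition tensor_ideal ::
    "('k::field, 'v, 'm) module_scheme \<Rightarrow> ('v list \<Rightarrow>\<^sub>0 'k) set" where
  "tensor_ideal V = Idl\<^bsub>free_algebra V\<^esub> (tensor_relations V)"

definition tensor_algebra ::
    "('k::field, 'v, 'm) module_scheme \<Rightarrow> ('k, 'v list \<Rightarrow>\<^sub>0 'k) module" where
  "tensor_algebra V = quotient_algebra (free_algebra V) (tensor_ideal V)"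

definition tensor_class ::
    "('k::field, 'v, 'm) module_scheme \<Rightarrow> ('v list \<Rightarrow>\<^sub>0 'k) \<Rightarrow> ('v list \<Rightarrow>\<^sub>0 'k)" where
  "tensor_class V = coset_rep (free_algebra V) (tensor_ideal V)"

text \<open>\<open>pure_tensor V [x1, \<dots>, xn]\<close> is the tensor \<open>x1 \<otimes> \<dots> \<otimes> xn\<close>.\<close>

definition pure_tensor ::
    "('k::field, 'v, 'm) module_scheme \<Rightarrow> 'v list \<Rightarrow> ('v list \<Rightarrow>\<^sub>0 'k)" where
  "pure_tensor V xs = tensor_class V (Poly_Mapping.single xs 1)"

text \<open>
  The \<open>n\<close>-th tensor power of \<open>V\<close> is the homogeneous component of degree \<open>n\<close> of the tensor algebra.
  Tensor products of tensors are products in the tensor algebra, so they are strictly associative;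
  the powers 0 and 1 are copies of the ground field and of \<open>V\<close>.
\<close>

definition tensor_power ::
    "('k::field, 'v, 'm) module_scheme \<Rightarrow> nat \<Rightarrow> ('k, 'v list \<Rightarrow>\<^sub>0 'k) module" where
  "tensor_power V n = (tensor_algebra V)\<lparr>carrier :=
     tensor_class V ` {f. Poly_Mapping.keys f \<subseteq> {xs \<in> lists (carrier V). length xs = n}}\<rparr>"

text \<open>
  The linear map to \<open>M\<close> on the \<open>n\<close>-th tensor power that sends \<open>x1 \<otimes> \<dots> \<otimes> xn\<close> to
  \<open>\<phi> [x1, \<dots>, xn]\<close>, for \<open>\<phi>\<close> multilinear. The chosen representative of a homogeneous tensor
  need not be homogeneous, but, as the tensor ideal is graded, its degree \<open>n\<close> part is again a
  representative.
\<close>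

definition multilinear_lift ::
    "('k::field, 'w, 'm) module_scheme \<Rightarrow> nat \<Rightarrow> ('v list \<Rightarrow> 'w) \<Rightarrow> ('v list \<Rightarrow>\<^sub>0 'k) \<Rightarrow> 'w" where
  "multilinear_lift M n \<phi> t =
     (\<Oplus>\<^bsub>M\<^esub>xs\<in>{xs \<in> Poly_Mapping.keys t. length xs = n}. Poly_Mapping.lookup t xs \<odot>\<^bsub>M\<^esub> \<phi> xs)"

text \<open>The algebra map from the tensor algebra to \<open>A\<close> that extends a linear map \<open>\<phi>\<close>.\<close>

definition tensor_algebra_lift ::
    "('k::field, 'a, 'm) module_scheme \<Rightarrow> ('v \<Rightarrow> 'a) \<Rightarrow> ('v list \<Rightarrow>\<^sub>0 'k) \<Rightarrow> 'a" where
  "tensor_algebra_lift A \<phi> t =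
     (\<Oplus>\<^bsub>A\<^esub>xs\<in>Poly_Mapping.keys t.
        Poly_Mapping.lookup t xs \<odot>\<^bsub>A\<^esub> foldr (\<lambda>x y. \<phi> x \<otimes>\<^bsub>A\<^esub> y) xs \<one>\<^bsub>A\<^esub>)"

text \<open>The \<open>n\<close>-fold tensor power \<open>f \<otimes> \<dots> \<otimes> f\<close> of a linear map \<open>f\<close> with values in \<open>W\<close>.\<close>

definition map_power ::
    "('k::field, 'w, 'm) module_scheme \<Rightarrow> nat \<Rightarrow> ('v \<Rightarrow> 'w) \<Rightarrow> ('v list \<Rightarrow>\<^sub>0 'k) \<Rightarrow> ('w list \<Rightarrow>\<^sub>0 'k)"
  where "map_power W n f = multilinear_lift (tensor_algebra W) n (\<lambda>xs. pure_tensor W (map f xs))"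

text \<open>
  \<open>map_tensor V j k f g\<close> is \<open>f \<otimes> g\<close>, where \<open>f\<close> and \<open>g\<close> are defined on the \<open>j\<close>-th and on the
  \<open>k\<close>-th tensor power of \<open>V\<close> and have values in tensor powers of \<open>V\<close>.
\<close>

definition map_tensor ::
    "('k::field, 'v, 'm) module_scheme \<Rightarrow> nat \<Rightarrow> nat \<Rightarrow>
     (('v list \<Rightarrow>\<^sub>0 'k) \<Rightarrow> ('v list \<Rightarrow>\<^sub>0 'k)) \<Rightarrow> (('v list \<Rightarrow>\<^sub>0 'k) \<Rightarrow> ('v list \<Rightarrow>\<^sub>0 'k)) \<Rightarrow>
     ('v list \<Rightarrow>\<^sub>0 'k) \<Rightarrow> ('v list \<Rightarrow>\<^sub>0 'k)" where
  "map_tensor V j k f g = multilinear_lift (tensor_algebra V) (j + k)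
     (\<lambda>xs. f (pure_tensor V (take j xs)) \<otimes>\<^bsub>tensor_algebra V\<^esub> g (pure_tensor V (drop j xs)))"

section \<open>Braided vector spaces, algebras, coalgebras and bialgebras\<close>

record (overloaded) ('k::zero, 'a) braided = "('k, 'a) module" +
  braid :: "('a list \<Rightarrow>\<^sub>0 'k) \<Rightarrow> ('a list \<Rightarrow>\<^sub>0 'k)"

record (overloaded) ('k::zero, 'a) braided_bialg = "('k, 'a) braided" +
  comult :: "'a \<Rightarrow> ('a list \<Rightarrow>\<^sub>0 'k)"
  counit :: "'a \<Rightarrow> 'k"

definition braided_vector_space :: "('k::field, 'v, 'm) braided_scheme \<Rightarrow> bool" where
  "braided_vector_space V \<longleftrightarrow> vector_space_over_field V \<and>
     braid V \<in> linear_maps (tensor_power V 2) (tensor_power V 2) \<and>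
     (let c1 = map_tensor V 2 1 (braid V) id; c2 = map_tensor V 1 2 id (braid V)
      in \<forall>t\<in>carrier (tensor_power V 3). c1 (c2 (c1 t)) = c2 (c1 (c2 t)))"

definition braided_maps ::
    "('k::field, 'v, 'm) braided_scheme \<Rightarrow> ('k, 'w, 'n) braided_scheme \<Rightarrow> ('v \<Rightarrow> 'w) set" where
  "braided_maps V W = {f \<in> linear_maps V W. \<forall>t\<in>carrier (tensor_power V 2).
     braid W (map_power W 2 f t) = map_power W 2 f (braid V t)}"

text \<open>The structure maps as maps between tensor powers: 2 to 1, 0 to 1, 1 to 2 and 1 to 0.\<close>

definition mult_map ::
    "('k::field, 'a, 'm) module_scheme \<Rightarrow> ('a list \<Rightarrow>\<^sub>0 'k) \<Rightarrow> ('a list \<Rightarrow>\<^sub>0 'k)" where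
  "mult_map A =
     multilinear_lift (tensor_algebra A) 2 (\<lambda>xs. pure_tensor A [xs ! 0 \<otimes>\<^bsub>A\<^esub> xs ! 1])"

definition unit_map ::
    "('k::field, 'a, 'm) module_scheme \<Rightarrow> ('a list \<Rightarrow>\<^sub>0 'k) \<Rightarrow> ('a list \<Rightarrow>\<^sub>0 'k)" where
  "unit_map A = multilinear_lift (tensor_algebra A) 0 (\<lambda>xs. pure_tensor A [\<one>\<^bsub>A\<^esub>])"

definition comult_map ::
    "('k::field, 'a, 'm) braided_bialg_scheme \<Rightarrow> ('a list \<Rightarrow>\<^sub>0 'k) \<Rightarrow> ('a list \<Rightarrow>\<^sub>0 'k)" where
  "comult_map C = multilinear_lift (tensor_algebra C) 1 (\<lambda>xs. comult C (xs ! 0))"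

definition counit_map ::
    "('k::field, 'a, 'm) braided_bialg_scheme \<Rightarrow> ('a list \<Rightarrow>\<^sub>0 'k) \<Rightarrow> ('a list \<Rightarrow>\<^sub>0 'k)" where
  "counit_map C = multilinear_lift (tensor_algebra C) 1
     (\<lambda>xs. counit C (xs ! 0) \<odot>\<^bsub>tensor_algebra C\<^esub> pure_tensor C [])"

definition braided_algebra :: "('k::field, 'a, 'm) braided_scheme \<Rightarrow> bool" where
  "braided_algebra A \<longleftrightarrow> unital_algebra A \<and> braided_vector_space A \<and>
     (let c = braid A; m = mult_map A; u = unit_map A in
      (\<forall>t\<in>carrier (tensor_power A 3).
         c (map_tensor A 2 1 m id t)
           = map_tensor A 1 2 id m (map_tensor A 2 1 c id (map_tensor A 1 2 id c t)) \<and>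
         c (map_tensor A 1 2 id m t)
           = map_tensor A 2 1 m id (map_tensor A 1 2 id c (map_tensor A 2 1 c id t))) \<and>
      (\<forall>t\<in>carrier (tensor_power A 1).
         c (map_tensor A 0 1 u id t) = map_tensor A 1 0 id u t \<and>
         c (map_tensor A 1 0 id u t) = map_tensor A 0 1 u id t))"

definition counital_coalgebra :: "('k::field, 'a, 'm) braided_bialg_scheme \<Rightarrow> bool" where
  "counital_coalgebra C \<longleftrightarrow> vector_space_over_field C \<and>
     comult C \<in> linear_maps C (tensor_power C 2) \<and>
     counit C \<in> linear_maps C ground_algebra \<and>
     (\<forall>x\<in>carrier C.
        map_tensor C 1 1 (comult_map C) id (comult C x)
          = map_tensor C 1 1 id (comult_map C) (comult C x) \<and>
        map_tensor C 1 1 (counit_map C) id (comult C x) = pure_tensor C [x] \<and>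
        map_tensor C 1 1 id (counit_map C) (comult C x) = pure_tensor C [x])"

definition braided_coalgebra :: "('k::field, 'a, 'm) braided_bialg_scheme \<Rightarrow> bool" where
  "braided_coalgebra C \<longleftrightarrow> counital_coalgebra C \<and> braided_vector_space C \<and>
     (let c = braid C; \<Delta> = comult_map C; \<epsilon> = counit_map C in
      \<forall>t\<in>carrier (tensor_power C 2).
         map_tensor C 1 1 \<Delta> id (c t)
           = map_tensor C 1 2 id c (map_tensor C 2 1 c id (map_tensor C 1 1 id \<Delta> t)) \<and>
         map_tensor C 1 1 id \<Delta> (c t)
           = map_tensor C 2 1 c id (map_tensor C 1 2 id c (map_tensor C 1 1 \<Delta> id t)) \<and>
         map_tensor C 1 1 \<epsilon> id (c t) = map_tensor C 1 1 id \<epsilon> t \<and>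
         map_tensor C 1 1 id \<epsilon> (c t) = map_tensor C 1 1 \<epsilon> id t)"

text \<open>The map \<open>(m \<otimes> m)(A \<otimes> c \<otimes> A)\<close> on the fourth tensor power.\<close>

definition braided_mult ::
    "('k::field, 'a, 'm) braided_scheme \<Rightarrow> ('a list \<Rightarrow>\<^sub>0 'k) \<Rightarrow> ('a list \<Rightarrow>\<^sub>0 'k)" where
  "braided_mult A t = map_tensor A 2 2 (mult_map A) (mult_map A)
     (map_tensor A 1 3 id (map_tensor A 2 1 (braid A) id) t)"

definition braided_bialgebra :: "('k::field, 'a, 'm) braided_bialg_scheme \<Rightarrow> bool" where
  "braided_bialgebra B \<longleftrightarrow> braided_algebra B \<and> braided_coalgebra B \<and>
     (\<forall>t\<in>carrier (tensor_power B 2). comult_map B (mult_map B t)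
        = braided_mult B (map_tensor B 1 1 (comult_map B) (comult_map B) t)) \<and>
     comult B \<one>\<^bsub>B\<^esub> = pure_tensor B [\<one>\<^bsub>B\<^esub>, \<one>\<^bsub>B\<^esub>] \<and>
     counit B \<in> algebra_maps B ground_algebra"

definition braided_bialgebra_maps ::
    "('k::field, 'a, 'm) braided_bialg_scheme \<Rightarrow> ('k, 'b, 'n) braided_bialg_scheme \<Rightarrow>
     ('a \<Rightarrow> 'b) set" where
  "braided_bialgebra_maps B C = {f \<in> algebra_maps B C \<inter> braided_maps B C.
     \<forall>x\<in>carrier B. comult C (f x) = map_power C 2 f (comult B x) \<and> counit C (f x) = counit B x}"

definition isomorphic_braided_bialgebras ::
    "('k::field, 'a, 'm) braided_bialg_scheme \<Rightarrow> ('k, 'b, 'n) braided_bialg_scheme \<Rightarrow> bool" where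
  "isomorphic_braided_bialgebras B C \<longleftrightarrow> braided_bialgebra B \<and> braided_bialgebra C \<and>
     (\<exists>f\<in>braided_bialgebra_maps B C. bij_betw f (carrier B) (carrier C))"

section \<open>Primitive elements\<close>

definition primitives :: "('k::field, 'a, 'm) braided_bialg_scheme \<Rightarrow> 'a set" where
  "primitives B = {x \<in> carrier B.
     comult B x = pure_tensor B [x, \<one>\<^bsub>B\<^esub>] \<oplus>\<^bsub>tensor_algebra B\<^esub> pure_tensor B [\<one>\<^bsub>B\<^esub>, x]}"

definition primitively_generated :: "('k::field, 'a, 'm) braided_bialg_scheme \<Rightarrow> bool" where
  "primitively_generated B \<longleftrightarrow>
     (\<forall>S. submodule S \<bbbK> B \<and> subring S B \<and> primitives B \<subseteq> S \<longrightarrow> S = carrier B)"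

text \<open>
  The tensor square of \<open>P = P(B)\<close> is formed from \<open>P\<close> itself; \<open>j\<close> is its inclusion into the tensor
  square of \<open>B\<close>, and the restricted braiding is \<open>c\<close> transported along \<open>j\<close>.
\<close>

definition infinitesimal_part ::
    "('k::field, 'a, 'm) braided_bialg_scheme \<Rightarrow> ('k, 'a) braided" where
  "infinitesimal_part B =
     (let P = braided.truncate (B\<lparr>carrier := primitives B\<rparr>); j = map_power B 2 id
      in P\<lparr>braid := (\<lambda>t. inv_into (carrier (tensor_power P 2)) j (braid B (j t)))\<rparr>)"

section \<open>The braided tensor algebra\<close>

text \<open>Only the restriction of the selected map to the tensor square is (uniquely) determined.\<close>

definition tensor_braided_algebra ::
    "('k::field, 'v, 'm) braided_scheme \<Rightarrow> ('k, 'v list \<Rightarrow>\<^sub>0 'k) braided" where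
  "tensor_braided_algebra V =
     (let T = tensor_algebra V; \<iota> = map_power T 2 (\<lambda>x. pure_tensor V [x])
      in module.extend T (braided.fields (SOME d.
           braided_algebra (module.extend T (braided.fields d)) \<and>
           (\<forall>t\<in>carrier (tensor_power V 2). d (\<iota> t) = \<iota> (braid V t)))))"

text \<open>
  \<open>A \<otimes>\<^sub>c A\<close>: two tensors of degree 2 are juxtaposed to a tensor of degree 4 before
  \<^const>\<open>braided_mult\<close> is applied.
\<close>

definition braided_square ::
    "('k::field, 'a, 'm) braided_scheme \<Rightarrow> ('k, 'a list \<Rightarrow>\<^sub>0 'k) module" where
  "braided_square A = (tensor_power A 2)
     \<lparr>monoid.mult := (\<lambda>s t. braided_mult A (s \<otimes>\<^bsub>tensor_algebra A\<^esub> t)),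
      one := pure_tensor A [\<one>\<^bsub>A\<^esub>, \<one>\<^bsub>A\<^esub>]\<rparr>"

definition braided_tensor_algebra ::
    "('k::field, 'v, 'm) braided_scheme \<Rightarrow> ('k, 'v list \<Rightarrow>\<^sub>0 'k) braided_bialg" where
  "braided_tensor_algebra V =
     (let T = tensor_braided_algebra V
      in braided.extend T (braided_bialg.fields
          (tensor_algebra_lift (braided_square T)
            (\<lambda>v. pure_tensor T [pure_tensor V [v], \<one>\<^bsub>T\<^esub>]
                   \<oplus>\<^bsub>tensor_algebra T\<^esub> pure_tensor T [\<one>\<^bsub>T\<^esub>, pure_tensor V [v]]))
          (tensor_algebra_lift ground_algebra (\<lambda>v. 0))))"

section \<open>Quotients and direct limits of braided bialgebras\<close>

text \<open>
  The structure maps of the quotient are those forced by the projection \<open>\<pi>\<close> being a braided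
  bialgebra map; they do not depend on the preimages chosen by \<^const>\<open>inv_into\<close> whenever a
  braided bialgebra structure of this kind exists.
\<close>

definition quotient_bialgebra ::
    "('k::field, 'a) braided_bialg \<Rightarrow> 'a set \<Rightarrow> ('k, 'a) braided_bialg" where
  "quotient_bialgebra B J =
     (let \<pi> = coset_rep B J; Q = quotient_algebra B J; \<pi>2 = map_power Q 2 \<pi>
      in braided.extend
          (module.extend Q (braided.fields
            (\<lambda>t. \<pi>2 (braid B (inv_into (carrier (tensor_power B 2)) \<pi>2 t)))))
          (braided_bialg.fields
            (\<lambda>x. \<pi>2 (comult B (inv_into (carrier B) \<pi> x)))
            (\<lambda>x. counit B (inv_into (carrier B) \<pi> x))))"

text \<open>The direct limit of a sequence \<open>B 0 \<rightarrow> B 1 \<rightarrow> \<dots>\<close> with transition maps \<open>\<pi> n\<close>.\<close>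

primrec transition :: "(nat \<Rightarrow> 'a \<Rightarrow> 'a) \<Rightarrow> nat \<Rightarrow> nat \<Rightarrow> 'a \<Rightarrow> 'a" where
  "transition \<pi> n 0 = id"
| "transition \<pi> n (Suc j) = \<pi> (n + j) \<circ> transition \<pi> n j"

definition limit_map ::
    "(nat \<Rightarrow> ('k, 'a, 'm) module_scheme) \<Rightarrow> (nat \<Rightarrow> 'a \<Rightarrow> 'a) \<Rightarrow> nat \<Rightarrow> 'a \<Rightarrow> (nat \<times> 'a) set" where
  "limit_map B \<pi> n x = {(m, y). y \<in> carrier (B m) \<and>
     (\<exists>i j. n + i = m + j \<and> transition \<pi> n i x = transition \<pi> m j y)}"

definition limit_algebra ::
    "(nat \<Rightarrow> ('k, 'a, 'm) module_scheme) \<Rightarrow> (nat \<Rightarrow> 'a \<Rightarrow> 'a) \<Rightarrow> ('k, (nat \<times> 'a) set) module" where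
  "limit_algebra B \<pi> =
    \<lparr>carrier = (\<Union>n. limit_map B \<pi> n ` carrier (B n)),
     monoid.mult = (\<lambda>p q. SOME r. \<exists>n. \<exists>x\<in>carrier (B n). \<exists>y\<in>carrier (B n).
       p = limit_map B \<pi> n x \<and> q = limit_map B \<pi> n y \<and> r = limit_map B \<pi> n (x \<otimes>\<^bsub>B n\<^esub> y)),
     one = limit_map B \<pi> 0 \<one>\<^bsub>B 0\<^esub>,
     ring.zero = limit_map B \<pi> 0 \<zero>\<^bsub>B 0\<^esub>,
     add = (\<lambda>p q. SOME r. \<exists>n. \<exists>x\<in>carrier (B n). \<exists>y\<in>carrier (B n).
       p = limit_map B \<pi> n x \<and> q = limit_map B \<pi> n y \<and> r = limit_map B \<pi> n (x \<oplus>\<^bsub>B n\<^esub> y)),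
     module.smult = (\<lambda>a p. SOME r. \<exists>n. \<exists>x\<in>carrier (B n).
       p = limit_map B \<pi> n x \<and> r = limit_map B \<pi> n (a \<odot>\<^bsub>B n\<^esub> x))\<rparr>"

definition limit_bialgebra ::
    "(nat \<Rightarrow> ('k::field, 'a) braided_bialg) \<Rightarrow> (nat \<Rightarrow> 'a \<Rightarrow> 'a) \<Rightarrow>
     ('k, (nat \<times> 'a) set) braided_bialg" where
  "limit_bialgebra B \<pi> =
     (let L = limit_algebra B \<pi>; \<iota> = limit_map B \<pi>; \<iota>2 = (\<lambda>n. map_power L 2 (\<iota> n))
      in braided.extend
          (module.extend L (braided.fields
            (\<lambda>T. SOME S. \<exists>n. \<exists>t\<in>carrier (tensor_power (B n) 2).
               T = \<iota>2 n t \<and> S = \<iota>2 n (braid (B n) t))))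
          (braided_bialg.fields
            (\<lambda>p. SOME S. \<exists>n. \<exists>x\<in>carrier (B n). p = \<iota> n x \<and> S = \<iota>2 n (comult (B n) x))
            (\<lambda>p. SOME a. \<exists>n. \<exists>x\<in>carrier (B n). p = \<iota> n x \<and> a = counit (B n) x)))"

section \<open>Brackets and universal enveloping algebras\<close>

text \<open>
  A stage of the construction is the pair of \<open>U\<^sup>n\<close> and \<open>i\<^sup>n\<close>. Everything here is defined for
  an arbitrary family \<open>b\<close>; it has its intended meaning when \<open>b\<close> is a bracket.
\<close>

type_synonym ('k, 'v) stage =
  "('k, 'v list \<Rightarrow>\<^sub>0 'k) braided_bialg \<times> ('v \<Rightarrow> ('v list \<Rightarrow>\<^sub>0 'k))"

type_synonym ('k, 'v) bracket = "nat \<Rightarrow> ('v list \<Rightarrow>\<^sub>0 'k) \<Rightarrow> 'v"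

definition initial_stage :: "('k::field, 'v) braided \<Rightarrow> ('k, 'v) stage" where
  "initial_stage V = (braided_tensor_algebra V, \<lambda>v. pure_tensor V [v])"

definition stage_ideal ::
    "('k::field, 'v) stage \<Rightarrow> (('v list \<Rightarrow>\<^sub>0 'k) \<Rightarrow> 'v) \<Rightarrow> ('v list \<Rightarrow>\<^sub>0 'k) set" where
  "stage_ideal Ui b = (case Ui of (U, i) \<Rightarrow>
     Idl\<^bsub>U\<^esub> ((\<lambda>x. x \<ominus>\<^bsub>U\<^esub> i (b x)) ` primitives U))"

definition stage_projection ::
    "('k::field, 'v) stage \<Rightarrow> (('v list \<Rightarrow>\<^sub>0 'k) \<Rightarrow> 'v) \<Rightarrow> ('v list \<Rightarrow>\<^sub>0 'k) \<Rightarrow> ('v list \<Rightarrow>\<^sub>0 'k)"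
  where "stage_projection Ui b = coset_rep (fst Ui) (stage_ideal Ui b)"

definition next_stage ::
    "('k::field, 'v) stage \<Rightarrow> (('v list \<Rightarrow>\<^sub>0 'k) \<Rightarrow> 'v) \<Rightarrow> ('k, 'v) stage" where
  "next_stage Ui b =
     (quotient_bialgebra (fst Ui) (stage_ideal Ui b), stage_projection Ui b \<circ> snd Ui)"

primrec enveloping_stage ::
    "('k::field, 'v) braided \<Rightarrow> ('k, 'v) bracket \<Rightarrow> nat \<Rightarrow> ('k, 'v) stage" where
  "enveloping_stage V b 0 = initial_stage V"
| "enveloping_stage V b (Suc n) = next_stage (enveloping_stage V b n) (b n)"

definition enveloping_projection ::
    "('k::field, 'v) braided \<Rightarrow> ('k, 'v) bracket \<Rightarrow> nat \<Rightarrow>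
     ('v list \<Rightarrow>\<^sub>0 'k) \<Rightarrow> ('v list \<Rightarrow>\<^sub>0 'k)" where
  "enveloping_projection V b n = stage_projection (enveloping_stage V b n) (b n)"

definition universal_enveloping ::
    "('k::field, 'v) braided \<Rightarrow> ('k, 'v) bracket \<Rightarrow>
     ('k, (nat \<times> ('v list \<Rightarrow>\<^sub>0 'k)) set) braided_bialg" where
  "universal_enveloping V b =
     limit_bialgebra (\<lambda>n. fst (enveloping_stage V b n)) (enveloping_projection V b)"

definition enveloping_map ::
    "('k::field, 'v) braided \<Rightarrow> ('k, 'v) bracket \<Rightarrow> 'v \<Rightarrow> (nat \<times> ('v list \<Rightarrow>\<^sub>0 'k)) set" where
  "enveloping_map V b v =
     limit_map (\<lambda>n. fst (enveloping_stage V b n)) (enveloping_projection V b) 0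
       (snd (enveloping_stage V b 0) v)"

text \<open>
  In \<open>braided_bracket\<close>, \<open>f\<close> ranges over combinations of words \<open>[w, q]\<close> (respectively \<open>[q, w]\<close>)
  with \<open>w \<in> i(V)\<close> and \<open>q \<in> P(U)\<close> that represent \<open>c(p \<otimes> v)\<close> (respectively \<open>c(v \<otimes> p)\<close>): the
  map \<open>i b\<close> is defined on \<open>P(U)\<close> only, and is applied to the corresponding factor of such an
  expression. By linearity it suffices to consider the tensors \<open>p \<otimes> v\<close> and \<open>v \<otimes> p\<close>.
\<close>

definition braided_bracket :: "('k::field, 'v) braided \<Rightarrow> ('k, 'v) bracket \<Rightarrow> bool" where
  "braided_bracket V b \<longleftrightarrow> (\<forall>n. case enveloping_stage V b n of (U, i) \<Rightarrow>
     b n \<in> linear_maps (U\<lparr>carrier := primitives U\<rparr>) V \<and>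
     (\<forall>p\<in>primitives U. \<forall>v\<in>i ` carrier V.
       (\<exists>f. Poly_Mapping.keys f \<subseteq> {[w, q] | w q. w \<in> i ` carrier V \<and> q \<in> primitives U} \<and>
          braid U (pure_tensor U [p, v]) = tensor_class U f \<and>
          braid U (pure_tensor U [i (b n p), v])
            = multilinear_lift (tensor_algebra U) 2
                (\<lambda>xs. pure_tensor U [xs ! 0, i (b n (xs ! 1))]) f) \<and>
       (\<exists>f. Poly_Mapping.keys f \<subseteq> {[q, w] | q w. q \<in> primitives U \<and> w \<in> i ` carrier V} \<and>
          braid U (pure_tensor U [v, p]) = tensor_class U f \<and>
          braid U (pure_tensor U [v, i (b n p)])
            = multilinear_lift (tensor_algebra U) 2
                (\<lambda>xs. pure_tensor U [i (b n (xs ! 0)), xs ! 1]) f)))"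

definition braided_Lie_algebra :: "('k::field, 'v) braided \<Rightarrow> ('k, 'v) bracket \<Rightarrow> bool" where
  "braided_Lie_algebra V b \<longleftrightarrow> braided_vector_space V \<and> braided_bracket V b \<and>
     inj_on (enveloping_map V b) (carrier V)"

section \<open>The infinitesimal braided Lie algebra\<close>

text \<open>
  The component \<open>\<psi>\<close> is the map to \<open>A\<close>; it induces \<open>b\<^sup>n\<close> on primitive elements, and the next
  \<open>\<psi>\<close> is the factorisation of the present one through the projection.
\<close>

definition induced_bracket ::
    "('k::field, 'a) stage \<Rightarrow> (('a list \<Rightarrow>\<^sub>0 'k) \<Rightarrow> 'a) \<Rightarrow> ('a list \<Rightarrow>\<^sub>0 'k) \<Rightarrow> 'a" where
  "induced_bracket Ui \<psi> = restrict \<psi> (primitives (fst Ui))"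

primrec infinitesimal_stage ::
    "('k::field, 'a) braided_bialg \<Rightarrow> nat \<Rightarrow> ('k, 'a) stage \<times> (('a list \<Rightarrow>\<^sub>0 'k) \<Rightarrow> 'a)" where
  "infinitesimal_stage A 0 =
     (initial_stage (infinitesimal_part A), tensor_algebra_lift A (\<lambda>x. x))"
| "infinitesimal_stage A (Suc n) = (case infinitesimal_stage A n of (Ui, \<psi>) \<Rightarrow>
     let b = induced_bracket Ui \<psi>
     in (next_stage Ui b, \<psi> \<circ> inv_into (carrier (fst Ui)) (stage_projection Ui b)))"

definition infinitesimal_bracket ::
    "('k::field, 'a) braided_bialg \<Rightarrow> ('k, 'a) bracket" where
  "infinitesimal_bracket A n = (case infinitesimal_stage A n of (Ui, \<psi>) \<Rightarrow> induced_bracket Ui \<psi>)"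

end

(*
  Let T = T(P, c_P) and let psi : T -> A be the algebra map extending the inclusion of P = P(A); it
  is onto and respects braidings, comultiplications and counits. Put K_0 = 0 and let K_(n+1) be the
  ideal generated by the elements x - psi(x) with x primitive modulo K_n. Each K_n is a coideal killed
  by psi, compatible with the braiding of T against P, and U^[n] is T / K_n. The reduced
  comultiplication lowers the word-length filtration F_k of T; since the kernel of psi (x) psi on
  F_k (x) F_k is spanned by tensors with a factor in ker psi, induction gives that F_k meets ker psi
  inside K_k. Hence the K_n exhaust ker psi, so the direct limit of the U^[n] is T / ker psi = A.

  It is not necessary to know that the U^[n] are braided bialgebras: their braidings and counits are
  only compared with those of A, from which the structure of the limit is transported.
*)
theory Submission
  imports Defs
begin

section \<open>Vector spaces and linear maps\<close>

text \<open>Two obstacles shape the proof. The structure of the stages is given by choices (coset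
  representatives, \<open>SOME\<close>, \<open>inv_into\<close>), so a structure map is known only
  up to what the chosen preimage may change; the properties of a stage are therefore stated along
  maps from T or to \<open>A\<close>, where the choices cancel. And the comultiplication of T is
  accessible only through its recursion on the first letter of a word. Hence the arguments about T
  run by induction on words, and each computation braids a single letter of P past something; this
  is why the ideals are compared with the braiding against P. The hexagon identities extend such
  statements from letters to products. That the kernel of \<open>psi \<otimes> psi\<close> has the
  expected form is exactness of tensor products over a field. It is used through a linear g with f g
  f = f, which also supplies a linear retraction of \<open>A\<close> onto P. The induction on the
  filtration can start because the counit of \<open>A\<close> sends 1 to 1, so that no nonzero
  scalar is killed by \<open>psi\<close>. Identities between maps of tensor powers are checked on
  pure tensors, with each operator placed at a numbered position.\<close>

lemma ground_simps [simp]: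
  "carrier (\<bbbK> :: 'k::field ring) = UNIV" "x \<oplus>\<^bsub>\<bbbK>\<^esub> y = x + y" "x \<otimes>\<^bsub>\<bbbK>\<^esub> y = x * y"
  "\<zero>\<^bsub>\<bbbK>\<^esub> = (0::'k)" "\<one>\<^bsub>\<bbbK>\<^esub> = (1::'k)"
  by (simp_all add: ring_of_type_algebra_def)

lemma cring_ground: "cring (\<bbbK> :: 'k::field ring)"
  by (rule cring_from_type_algebra)

lemma a_inv_ground [simp]: "\<ominus>\<^bsub>\<bbbK>\<^esub> x = - (x :: 'k::field)"
proof -
  interpret cring "\<bbbK> :: 'k ring" by (rule cring_ground)
  have "x \<oplus>\<^bsub>\<bbbK>\<^esub> (- x) = \<zero>\<^bsub>\<bbbK>\<^esub>" by simp
  then show ?thesis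
    by (intro minus_equality) (simp_all)
qed

locale vspace = fixes V :: "('k::field, 'v, 'm) module_scheme" (structure)
  assumes vs: "vector_space_over_field V"
begin

lemmas vsp = vspace_axioms

sublocale module \<bbbK> V
  using vs by (simp add: vector_space_over_field_def)

lemma smult_cl [simp, intro]: "x \<in> carrier V ==> a \<odot> x \<in> carrier V"
  by (rule smult_closed) simp_all

lemma add_cl [simp, intro]: "x \<in> carrier V ==> y \<in> carrier V ==> x \<oplus> y \<in> carrier V"
  by (rule M.a_closed)

lemma smult_add: "x \<in> carrier V ==> y \<in> carrier V ==> a \<odot> (x \<oplus> y) = a \<odot> x \<oplus> a \<odot> y"
  using smult_r_distr[of a x y] by simp

lemma add_smult: "x \<in> carrier V ==> (a + b) \<odot> x = a \<odot> x \<oplus> b \<odot> x"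
  using smult_l_distr[of a b x] by simp

lemma smult_smult: "x \<in> carrier V ==> a \<odot> (b \<odot> x) = (a * b) \<odot> x"
  using smult_assoc1[of a b x] by simp

lemma one_smult [simp]: "x \<in> carrier V ==> 1 \<odot> x = x"
  using smult_one[of x] by simp

lemma zero_smult [simp]: "x \<in> carrier V ==> 0 \<odot> x = \<zero>"
  using smult_l_null[of x] by simp

lemma smult_zero [simp]: "a \<odot> \<zero> = \<zero>"
  using smult_r_null[of a] by simp

lemma neg_smult: "x \<in> carrier V ==> (- 1) \<odot> x = \<ominus> x"
  using smult_l_minus[of 1 x] by simp

lemma minus_smult: "x \<in> carrier V ==> (- a) \<odot> x = \<ominus> (a \<odot> x)"
  using smult_l_minus[of a x] by simp

lemma smult_neg: "x \<in> carrier V ==> a \<odot> (\<ominus> x) = \<ominus> (a \<odot> x)"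
  using smult_r_minus[of a x] by simp

lemma smult_minus: "x \<in> carrier V ==> y \<in> carrier V ==> a \<odot> (x \<ominus> y) = a \<odot> x \<ominus> a \<odot> y"
  by (simp add: a_minus_def smult_add smult_neg)

lemma minus_cl [simp, intro]: "x \<in> carrier V ==> y \<in> carrier V ==> x \<ominus> y \<in> carrier V"
  by (simp add: a_minus_def)

lemma add4: "[|a \<in> carrier V; b \<in> carrier V; c \<in> carrier V; d \<in> carrier V|] ==>
    (a \<oplus> b) \<oplus> (c \<oplus> d) = (a \<oplus> c) \<oplus> (b \<oplus> d)"
  by (simp add: M.a_ac)

lemma minus_self [simp]: "x \<in> carrier V ==> x \<ominus> x = \<zero>"
  by (simp add: a_minus_def M.r_neg)

lemma minus_zero_iff: "x \<in> carrier V ==> y \<in> carrier V ==> x \<ominus> y = \<zero> \<longleftrightarrow> x = y"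
  by (metis M.minus_equality M.minus_minus M.r_neg a_minus_def M.a_inv_closed M.a_comm)

lemma minus_add_cancel [simp]: "x \<in> carrier V ==> y \<in> carrier V ==> (x \<ominus> y) \<oplus> y = x"
  by (simp add: a_minus_def M.a_assoc M.l_neg)

lemma add_minus_cancel [simp]: "x \<in> carrier V ==> y \<in> carrier V ==> (x \<oplus> y) \<ominus> y = x"
  by (simp add: a_minus_def M.a_assoc M.r_neg)

lemma add_minus_cancel' [simp]: "x \<in> carrier V ==> y \<in> carrier V ==> (x \<oplus> y) \<ominus> x = y"
  by (metis M.a_comm add_minus_cancel)

lemma minus_add4: "[|a \<in> carrier V; b \<in> carrier V; c \<in> carrier V; d \<in> carrier V|] ==>
    (a \<oplus> b) \<ominus> (c \<oplus> d) = (a \<ominus> c) \<oplus> (b \<ominus> d)"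
  by (simp add: a_minus_def M.minus_add M.a_ac)

lemma minus_zero [simp]: "x \<in> carrier V ==> x \<ominus> \<zero> = x"
  by (simp add: a_minus_def)

lemma minus_trans: "[|a \<in> carrier V; b \<in> carrier V; c \<in> carrier V|] ==>
    (a \<ominus> b) \<oplus> (b \<ominus> c) = a \<ominus> c"
  by (metis M.a_assoc M.a_inv_closed a_minus_def minus_add_cancel minus_cl)

lemma minus_minus_swap: "[|z \<in> carrier V; x \<in> carrier V; y \<in> carrier V|] ==>
    (z \<ominus> y) \<ominus> (z \<ominus> x) = x \<ominus> y"
  using minus_trans[of z x y] add_minus_cancel'[of "z \<ominus> x" "x \<ominus> y"] by simp

end

text \<open>Truncation, extension and carrier update give records of other types that share the
  vector space fields; the module axioms have to be moved between them.\<close>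

lemma vspace_cong:
  fixes V :: "('k::field, 'v, 'm) module_scheme" and W :: "('k, 'v, 'n) module_scheme"
  assumes "vspace V" "carrier W = carrier V" "add W = add V" "ring.zero W = ring.zero V" "module.smult W = module.smult V"
  shows "vspace W"
proof -
  interpret V: vspace V by fact
  have W: "\<And>x y. x \<oplus>\<^bsub>W\<^esub> y = x \<oplus>\<^bsub>V\<^esub> y" "\<zero>\<^bsub>W\<^esub> = \<zero>\<^bsub>V\<^esub>" "\<And>a x. a \<odot>\<^bsub>W\<^esub> x = a \<odot>\<^bsub>V\<^esub> x"
    using assms by simp_all
  have "\<exists>y\<in>carrier W. y \<oplus>\<^bsub>W\<^esub> x = \<zero>\<^bsub>W\<^esub>" if "x \<in> carrier W" for x
    using that by (intro bexI[of _ "\<ominus>\<^bsub>V\<^esub> x"]) (simp_all add: assms(2) W V.M.l_neg)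
  then show ?thesis
    unfolding vspace_def vector_space_over_field_def
    by (intro moduleI abelian_groupI cring_ground)
      (simp_all add: assms(2) W V.M.a_assoc V.smult_add V.add_smult V.smult_smult V.M.a_ac)
qed

locale ualg = fixes A :: "('k::field, 'a, 'm) module_scheme" (structure)
  assumes ua: "unital_algebra A"
begin

sublocale vspace A
  using ua by unfold_locales (simp add: unital_algebra_def)

sublocale A: ring A
  using ua by (simp add: unital_algebra_def)

lemma mult_cl [simp, intro]: "x \<in> carrier A ==> y \<in> carrier A ==> x \<otimes> y \<in> carrier A"
  by (rule A.m_closed)

lemma smult_mult: "x \<in> carrier A ==> y \<in> carrier A ==> (a \<odot> x) \<otimes> y = a \<odot> (x \<otimes> y)"
  using ua by (simp add: unital_algebra_def)

lemma mult_smult: "x \<in> carrier A ==> y \<in> carrier A ==> x \<otimes> (a \<odot> y) = a \<odot> (x \<otimes> y)"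
  using ua by (simp add: unital_algebra_def)

end

lemma linI:
  assumes "\<And>x. x \<in> carrier V ==> f x \<in> carrier W"
    "\<And>x y. [|x \<in> carrier V; y \<in> carrier V|] ==> f (x \<oplus>\<^bsub>V\<^esub> y) = f x \<oplus>\<^bsub>W\<^esub> f y"
    "\<And>a x. x \<in> carrier V ==> f (a \<odot>\<^bsub>V\<^esub> x) = a \<odot>\<^bsub>W\<^esub> f x"
  shows "f \<in> linear_maps V W"
  using assms by (auto simp: linear_maps_def)

lemma lin_cl: "f \<in> linear_maps V W ==> x \<in> carrier V ==> f x \<in> carrier W"
  and lin_add: "f \<in> linear_maps V W ==> x \<in> carrier V ==> y \<in> carrier V ==>
      f (x \<oplus>\<^bsub>V\<^esub> y) = f x \<oplus>\<^bsub>W\<^esub> f y"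
  and lin_smult: "f \<in> linear_maps V W ==> x \<in> carrier V ==> f (a \<odot>\<^bsub>V\<^esub> x) = a \<odot>\<^bsub>W\<^esub> f x"
  by (auto simp: linear_maps_def)

lemma lin_zero:
  assumes "f \<in> linear_maps V W" "vspace V" "vspace W"
  shows "f \<zero>\<^bsub>V\<^esub> = \<zero>\<^bsub>W\<^esub>"
proof -
  interpret V: vspace V by fact
  interpret W: vspace W by fact
  have "f (0 \<odot>\<^bsub>V\<^esub> \<zero>\<^bsub>V\<^esub>) = 0 \<odot>\<^bsub>W\<^esub> f \<zero>\<^bsub>V\<^esub>"
    by (rule lin_smult[OF assms(1)]) simp
  then show ?thesis
    using lin_cl[OF assms(1), of "\<zero>\<^bsub>V\<^esub>"] by simp
qed

lemma linear_neg:
  assumes "f \<in> linear_maps V W" "vspace V" "vspace W" "x \<in> carrier V"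
  shows "f (\<ominus>\<^bsub>V\<^esub> x) = \<ominus>\<^bsub>W\<^esub> f x"
proof -
  interpret V: vspace V by fact
  interpret W: vspace W by fact
  show ?thesis
    using lin_smult[OF assms(1,4), of "- 1"] lin_cl[OF assms(1,4)] assms(4)
    by (simp add: V.neg_smult W.neg_smult)
qed

lemma lin_minus:
  assumes "f \<in> linear_maps V W" "vspace V" "vspace W" "x \<in> carrier V" "y \<in> carrier V"
  shows "f (x \<ominus>\<^bsub>V\<^esub> y) = f x \<ominus>\<^bsub>W\<^esub> f y"
proof -
  interpret V: vspace V by fact
  show ?thesis
    using assms by (simp add: a_minus_def lin_add linear_neg)
qed

lemma lin_comp:
  "f \<in> linear_maps U V ==> g \<in> linear_maps V W ==> (\<lambda>x. g (f x)) \<in> linear_maps U W"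
  by (intro linI) (auto simp: lin_cl lin_add lin_smult)

lemma lin_cong:
  "f \<in> linear_maps V W ==> vspace V ==> (\<And>x. x \<in> carrier V ==> g x = f x) ==> g \<in> linear_maps V W"
  by (intro linI) (auto simp: lin_cl lin_add lin_smult vspace.add_cl vspace.smult_cl)

lemma linear_sum:
  assumes "f \<in> linear_maps V W" "g \<in> linear_maps V W" "vspace W"
  shows "(\<lambda>x. f x \<oplus>\<^bsub>W\<^esub> g x) \<in> linear_maps V W"
proof -
  interpret W: vspace W by fact
  show ?thesis
    using assms by (intro linI) (auto simp: lin_cl lin_add lin_smult W.add4 W.smult_add)
qed

lemma lin_diff:
  assumes "f \<in> linear_maps V W" "g \<in> linear_maps V W" "vspace W"
  shows "(\<lambda>x. f x \<ominus>\<^bsub>W\<^esub> g x) \<in> linear_maps V W"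
proof -
  interpret W: vspace W by fact
  show ?thesis
    using assms
    by (intro linI) (auto simp: lin_cl lin_add lin_smult W.minus_add4 W.smult_minus)
qed

lemma linear_const_smult:
  assumes "f \<in> linear_maps V W" "vspace W"
  shows "(\<lambda>x. a \<odot>\<^bsub>W\<^esub> f x) \<in> linear_maps V W"
proof -
  interpret W: vspace W by fact
  show ?thesis
    using assms
    by (intro linI) (auto simp: lin_cl lin_add lin_smult W.smult_add W.smult_smult mult.commute)
qed

lemma linear_zero_map:
  assumes "vspace W"
  shows "(\<lambda>x. \<zero>\<^bsub>W\<^esub>) \<in> linear_maps V W"
proof -
  interpret W: vspace W by fact
  show ?thesis by (intro linI) auto
qed

section \<open>Subspaces, complements and linear spans\<close>

definition subsp :: "('k::field, 'v, 'm) module_scheme => 'v set => bool" where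
  "subsp V S \<longleftrightarrow> S \<subseteq> carrier V \<and> \<zero>\<^bsub>V\<^esub> \<in> S \<and> (\<forall>x\<in>S. \<forall>y\<in>S. x \<oplus>\<^bsub>V\<^esub> y \<in> S) \<and> (\<forall>a. \<forall>x\<in>S. a \<odot>\<^bsub>V\<^esub> x \<in> S)"

lemma subspI:
  "[|S \<subseteq> carrier V; \<zero>\<^bsub>V\<^esub> \<in> S; \<And>x y. x \<in> S ==> y \<in> S ==> x \<oplus>\<^bsub>V\<^esub> y \<in> S; \<And>a x. x \<in> S ==> a \<odot>\<^bsub>V\<^esub> x \<in> S|] ==>
   subsp V S"
  by (auto simp: subsp_def)

lemma subsp_cl: "subsp V S ==> x \<in> S ==> x \<in> carrier V"
  and subsp_zero: "subsp V S ==> \<zero>\<^bsub>V\<^esub> \<in> S"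
  and subsp_add: "subsp V S ==> x \<in> S ==> y \<in> S ==> x \<oplus>\<^bsub>V\<^esub> y \<in> S"
  and subsp_smult: "subsp V S ==> x \<in> S ==> a \<odot>\<^bsub>V\<^esub> x \<in> S"
  by (auto simp: subsp_def)

lemma (in vspace) subsp_minus: "subsp V S ==> x \<in> S ==> y \<in> S ==> x \<ominus> y \<in> S"
proof -
  assume S: "subsp V S" "x \<in> S" "y \<in> S"
  then have "x \<oplus> (- 1) \<odot> y \<in> S" by (intro subsp_add subsp_smult)
  then show ?thesis using S by (simp add: a_minus_def neg_smult subsp_cl[OF S(1)])
qed

lemma (in vspace) subsp_carrier: "subsp V (carrier V)"
  by (intro subspI) auto

lemma (in vspace) subsp_0: "subsp V {\<zero>}"
  by (intro subspI) auto

lemma (in vspace) subsp_vspace: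
  assumes "subsp V S"
  shows "vspace (V\<lparr>carrier := S\<rparr>)"
  unfolding vspace_def vector_space_over_field_def
proof (intro moduleI abelian_groupI cring_ground)
  fix x assume x: "x \<in> carrier (V\<lparr>carrier := S\<rparr>)"
  then have xS: "x \<in> S" by simp
  then have "(- 1) \<odot> x \<in> S" "(- 1) \<odot> x \<oplus> x = \<zero>"
    using assms by (blast intro: subsp_smult, simp add: neg_smult subsp_cl[OF assms] M.l_neg)
  then show "\<exists>y\<in>carrier (V\<lparr>carrier := S\<rparr>). y \<oplus>\<^bsub>V\<lparr>carrier := S\<rparr>\<^esub> x = \<zero>\<^bsub>V\<lparr>carrier := S\<rparr>\<^esub>"
    by auto
qed (use subsp_cl[OF assms] in \<open>auto intro: subsp_add subsp_smult subsp_zero assms M.a_comm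
    simp: M.a_assoc smult_add add_smult smult_smult\<close>)

lemma subsp_image:
  assumes "f \<in> linear_maps V W" "vspace V" "vspace W" "subsp V S"
  shows "subsp W (f ` S)"
proof (rule subspI)
  show "f ` S \<subseteq> carrier W"
    using assms by (auto intro: lin_cl subsp_cl)
  show "\<zero>\<^bsub>W\<^esub> \<in> f ` S"
    using lin_zero[OF assms(1-3)] subsp_zero[OF assms(4)] by (metis image_eqI)
  fix x y assume "x \<in> f ` S" "y \<in> f ` S"
  then obtain u v where "u \<in> S" "v \<in> S" "x = f u" "y = f v" by auto
  then show "x \<oplus>\<^bsub>W\<^esub> y \<in> f ` S"
    using subsp_add[OF assms(4), of u v] subsp_cl[OF assms(4)]
    by (simp flip: lin_add[OF assms(1)])
next
  fix a x assume "x \<in> f ` S"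
  then obtain u where "u \<in> S" "x = f u" by auto
  then show "a \<odot>\<^bsub>W\<^esub> x \<in> f ` S"
    using subsp_smult[OF assms(4), of u a] subsp_cl[OF assms(4)]
    by (simp flip: lin_smult[OF assms(1)])
qed

lemma subsp_vimage:
  assumes "f \<in> linear_maps V W" "vspace V" "vspace W" "subsp W S"
  shows "subsp V {x \<in> carrier V. f x \<in> S}"
proof -
  interpret V: vspace V by fact
  interpret W: vspace W by fact
  show ?thesis
    using assms by (intro subspI) (auto simp: lin_add lin_smult lin_zero
        intro: subsp_add subsp_smult subsp_zero)
qed

lemma subsp_All: "vspace V ==> (\<And>i. i \<in> I ==> subsp V {x \<in> carrier V. P i x}) ==>
    subsp V {x \<in> carrier V. \<forall>i\<in>I. P i x}"
  by (auto simp: subsp_def vspace.add_cl vspace.smult_cl)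
    (metis abelian_group.axioms(1) abelian_monoid.zero_closed module.axioms(2) vector_space_over_field_def vspace.vs)

text \<open>By Zorn there is a maximal subspace \<open>C\<close> that meets \<open>S\<close> only in
  zero. A vector outside \<open>S + C\<close> could be adjoined to \<open>C\<close> without creating
  an intersection with \<open>S\<close>, against maximality.\<close>

lemma (in vspace) complement_exists:
  assumes S: "subsp V S"
  obtains C where "subsp V C" "\<And>x. x \<in> S ==> x \<in> C ==> x = \<zero>"
    "\<And>x. x \<in> carrier V ==> \<exists>s\<in>S. \<exists>c\<in>C. x = s \<oplus> c"
proof -
  let ?A = "{C. subsp V C \<and> S \<inter> C \<subseteq> {\<zero>}}"
  have "{\<zero>} \<in> ?A" using subsp_0 by auto
  moreover have "\<Union>\<C> \<in> ?A" if ne: "\<C> \<noteq> {}" and ch: "subset.chain ?A \<C>" for \<C>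
  proof -
    have sub: "\<And>C. C \<in> \<C> ==> subsp V C" and int: "\<And>C. C \<in> \<C> ==> S \<inter> C \<subseteq> {\<zero>}"
      using ch by (auto simp: subset.chain_def)
    have "subsp V (\<Union>\<C>)"
    proof (rule subspI)
      show "\<Union>\<C> \<subseteq> carrier V" using sub by (auto dest: subsp_cl)
      show "\<zero> \<in> \<Union>\<C>" using ne sub by (auto dest: subsp_zero)
    next
      fix x y assume "x \<in> \<Union>\<C>" "y \<in> \<Union>\<C>"
      then obtain C D where CD: "C \<in> \<C>" "x \<in> C" "D \<in> \<C>" "y \<in> D" by auto
      then have "C \<subseteq> D \<or> D \<subseteq> C"
        using ch unfolding subset.chain_def by blast
      then show "x \<oplus> y \<in> \<Union>\<C>"
        using CD sub by (meson UnionI subsetD subsp_add)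
    next
      fix a x assume "x \<in> \<Union>\<C>"
      then show "a \<odot> x \<in> \<Union>\<C>" using sub by (meson UnionE UnionI subsp_smult)
    qed
    then show ?thesis using int by auto
  qed
  ultimately obtain C where C: "C \<in> ?A" and max: "\<And>Y. Y \<in> ?A ==> C \<subseteq> Y ==> Y = C"
    using subset_Zorn_nonempty[of ?A] by auto
  have sC: "subsp V C" and int: "\<And>x. x \<in> S ==> x \<in> C ==> x = \<zero>" using C by auto
  have "\<exists>s\<in>S. \<exists>c\<in>C. x = s \<oplus> c" if x: "x \<in> carrier V" for x
  proof (rule ccontr)
    assume no: "\<not> ?thesis"
    let ?X = "{c \<oplus> a \<odot> x | c a. c \<in> C}"
    have "subsp V ?X"
    proof (rule subspI)
      show "?X \<subseteq> carrier V" using sC x by (auto dest: subsp_cl)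
      show "\<zero> \<in> ?X" using subsp_zero[OF sC] x by (auto intro!: exI[of _ \<zero>] exI[of _ 0])
    next
      fix y z assume "y \<in> ?X" "z \<in> ?X"
      then obtain c a d b where "y = c \<oplus> a \<odot> x" "c \<in> C" "z = d \<oplus> b \<odot> x" "d \<in> C" by auto
      then have "y \<oplus> z = (c \<oplus> d) \<oplus> (a + b) \<odot> x" "c \<oplus> d \<in> C"
        using sC x by (auto simp: add4 add_smult subsp_cl intro: subsp_add)
      then show "y \<oplus> z \<in> ?X" by blast
    next
      fix b y assume "y \<in> ?X"
      then obtain c a where "y = c \<oplus> a \<odot> x" "c \<in> C" by auto
      then have "b \<odot> y = b \<odot> c \<oplus> (b * a) \<odot> x" "b \<odot> c \<in> C"
        using sC x by (auto simp: smult_add smult_smult subsp_cl intro: subsp_smult)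
      then show "b \<odot> y \<in> ?X" by blast
    qed
    moreover have "S \<inter> ?X \<subseteq> {\<zero>}"
    proof
      fix y assume y: "y \<in> S \<inter> ?X"
      then obtain c a where ca: "y = c \<oplus> a \<odot> x" "c \<in> C" by auto
      show "y \<in> {\<zero>}"
      proof (cases "a = 0")
        case True
        then show ?thesis using ca y int x sC by (auto dest: subsp_cl)
      next
        case False
        have cc: "c \<in> carrier V" "y \<in> carrier V" using ca y S sC by (auto dest: subsp_cl)
        \<comment> \<open>Dividing by the nonzero \<open>a\<close> would write \<open>x\<close> as
          an element of \<open>S\<close> plus one of \<open>C\<close>, which \<open>no\<close>
          excludes.\<close>
        have "a \<odot> x = y \<ominus> c"
          using ca cc x by simp
        then have "x = (1 / a) \<odot> (y \<ominus> c)"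
          using False x by (metis divide_self one_smult smult_smult times_divide_eq_left mult_1)
        also have "\<dots> = (1 / a) \<odot> y \<oplus> (- (1 / a)) \<odot> c"
          using smult_minus[OF cc(2,1), of "1 / a"] minus_smult[OF cc(1), of "1 / a"] unfolding a_minus_def by simp
        finally show ?thesis
          using no y subsp_smult[OF S, of y "1 / a"] subsp_smult[OF sC ca(2), of "- (1 / a)"] by blast
      qed
    qed
    moreover have "C \<subseteq> ?X"
    proof
      fix c assume "c \<in> C"
      then have "c = c \<oplus> 0 \<odot> x" using x sC by (auto dest: subsp_cl)
      with \<open>c \<in> C\<close> show "c \<in> ?X" by blast
    qed
    ultimately have "?X = C" using max by auto
    moreover have "\<zero> \<oplus> 1 \<odot> x \<in> ?X" using subsp_zero[OF sC] by blast
    ultimately have "x \<in> C" using x by simp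
    moreover have "x = \<zero> \<oplus> x" using x by simp
    ultimately show False using no subsp_zero[OF S] by blast
  qed
  with sC int that show ?thesis by blast
qed

text \<open>Choose complements \<open>C\<close> of the kernel of \<open>f\<close> and
  \<open>D\<close> of its image; \<open>g w\<close> is the unique element of \<open>C\<close> with
  \<open>w - f (g w)\<close> in \<open>D\<close>, and uniqueness makes \<open>g\<close> linear. All
  later uses of exactness rest on this: retractions, kernels of tensor squares and slices of
  tensors.\<close>

lemma generalized_inverse:
  assumes f: "f \<in> linear_maps V W" and V: "vspace V" and W: "vspace W"
  obtains g where "g \<in> linear_maps W V" "\<And>x. x \<in> carrier V ==> f (g (f x)) = f x"
proof -
  interpret V: vspace V by fact
  interpret W: vspace W by fact
  have "subsp V {x \<in> carrier V. f x \<in> {\<zero>\<^bsub>W\<^esub>}}"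
    by (rule subsp_vimage[OF f V W W.subsp_0])
  then obtain C where C: "subsp V C" "\<And>x. x \<in> carrier V ==> f x = \<zero>\<^bsub>W\<^esub> ==> x \<in> C ==> x = \<zero>\<^bsub>V\<^esub>"
    "\<And>x. x \<in> carrier V ==> \<exists>s. (s \<in> carrier V \<and> f s = \<zero>\<^bsub>W\<^esub>) \<and> (\<exists>c\<in>C. x = s \<oplus>\<^bsub>V\<^esub> c)"
    by (rule V.complement_exists) auto
  have "subsp W (f ` carrier V)"
    by (rule subsp_image[OF f V W V.subsp_carrier])
  then obtain D where D: "subsp W D" "\<And>x. x \<in> f ` carrier V ==> x \<in> D ==> x = \<zero>\<^bsub>W\<^esub>"
    "\<And>x. x \<in> carrier W ==> \<exists>s\<in>f ` carrier V. \<exists>d\<in>D. x = s \<oplus>\<^bsub>W\<^esub> d"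
    by (rule W.complement_exists) auto
  have "\<exists>c\<in>C. w \<ominus>\<^bsub>W\<^esub> f c \<in> D" if w: "w \<in> carrier W" for w
  proof -
    obtain x d where xd: "x \<in> carrier V" "d \<in> D" "w = f x \<oplus>\<^bsub>W\<^esub> d" using D(3)[OF w] by auto
    obtain s c where sc: "s \<in> carrier V" "f s = \<zero>\<^bsub>W\<^esub>" "c \<in> C" "x = s \<oplus>\<^bsub>V\<^esub> c" using C(3)[OF xd(1)] by auto
    have c: "c \<in> carrier V" using sc C(1) by (auto dest: subsp_cl)
    have d: "d \<in> carrier W" using xd D(1) by (auto dest: subsp_cl)
    have "f x = f c" using sc c lin_cl[OF f c] by (simp add: lin_add[OF f])
    then have "w \<ominus>\<^bsub>W\<^esub> f c = d" using xd d lin_cl[OF f c] by simp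
    then show ?thesis using xd(2) sc(3) by metis
  qed
  then obtain g where g: "\<And>w. w \<in> carrier W ==> g w \<in> C" "\<And>w. w \<in> carrier W ==> w \<ominus>\<^bsub>W\<^esub> f (g w) \<in> D"
    by metis
  have gc: "g w \<in> carrier V" "f (g w) \<in> carrier W" if "w \<in> carrier W" for w
    using g(1)[OF that] C(1) f by (auto dest: subsp_cl lin_cl)
  have uniq: "f c = f c'" "c = c'"
    if w: "w \<in> carrier W" and c: "c \<in> C" "w \<ominus>\<^bsub>W\<^esub> f c \<in> D" and c': "c' \<in> C" "w \<ominus>\<^bsub>W\<^esub> f c' \<in> D" for w c c'
  proof -
    have cV: "c \<in> carrier V" "c' \<in> carrier V" using c c' C(1) by (auto dest: subsp_cl)
    have fV: "f c \<in> carrier W" "f c' \<in> carrier W" using cV f by (auto dest: lin_cl)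
    have "(w \<ominus>\<^bsub>W\<^esub> f c') \<ominus>\<^bsub>W\<^esub> (w \<ominus>\<^bsub>W\<^esub> f c) \<in> D"
      by (rule W.subsp_minus[OF D(1) c'(2) c(2)])
    also have "(w \<ominus>\<^bsub>W\<^esub> f c') \<ominus>\<^bsub>W\<^esub> (w \<ominus>\<^bsub>W\<^esub> f c) = f c \<ominus>\<^bsub>W\<^esub> f c'"
      by (rule W.minus_minus_swap[OF w fV])
    also have "\<dots> = f (c \<ominus>\<^bsub>V\<^esub> c')" using lin_minus[OF f V W cV] by simp
    finally have "f (c \<ominus>\<^bsub>V\<^esub> c') = \<zero>\<^bsub>W\<^esub>"
      using cV by (intro D(2)) auto
    then have "c \<ominus>\<^bsub>V\<^esub> c' = \<zero>\<^bsub>V\<^esub>"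
      using V.subsp_minus[OF C(1) c(1) c'(1)] cV by (intro C(2)) auto
    then show "c = c'" using cV by (simp add: V.minus_zero_iff)
    then show "f c = f c'" by simp
  qed
  have "g \<in> linear_maps W V"
  proof (rule linI)
    fix x assume "x \<in> carrier W" then show "g x \<in> carrier V" by (rule gc)
  next
    fix x y assume xy: "x \<in> carrier W" "y \<in> carrier W"
    show "g (x \<oplus>\<^bsub>W\<^esub> y) = g x \<oplus>\<^bsub>V\<^esub> g y"
    proof (rule uniq(2))
      show "x \<oplus>\<^bsub>W\<^esub> y \<in> carrier W" using xy by simp
      then show "g (x \<oplus>\<^bsub>W\<^esub> y) \<in> C" "x \<oplus>\<^bsub>W\<^esub> y \<ominus>\<^bsub>W\<^esub> f (g (x \<oplus>\<^bsub>W\<^esub> y)) \<in> D" by (rule g)+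
      show "g x \<oplus>\<^bsub>V\<^esub> g y \<in> C" using xy g C(1) by (auto intro: subsp_add)
      have "x \<oplus>\<^bsub>W\<^esub> y \<ominus>\<^bsub>W\<^esub> f (g x \<oplus>\<^bsub>V\<^esub> g y) = (x \<ominus>\<^bsub>W\<^esub> f (g x)) \<oplus>\<^bsub>W\<^esub> (y \<ominus>\<^bsub>W\<^esub> f (g y))"
        using xy by (simp add: lin_add[OF f] gc W.minus_add4)
      then show "x \<oplus>\<^bsub>W\<^esub> y \<ominus>\<^bsub>W\<^esub> f (g x \<oplus>\<^bsub>V\<^esub> g y) \<in> D"
        using xy g D(1) by (auto intro: subsp_add)
    qed
  next
    fix a x assume x: "x \<in> carrier W"
    show "g (a \<odot>\<^bsub>W\<^esub> x) = a \<odot>\<^bsub>V\<^esub> g x"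
    proof (rule uniq(2))
      show "a \<odot>\<^bsub>W\<^esub> x \<in> carrier W" using x by simp
      then show "g (a \<odot>\<^bsub>W\<^esub> x) \<in> C" "a \<odot>\<^bsub>W\<^esub> x \<ominus>\<^bsub>W\<^esub> f (g (a \<odot>\<^bsub>W\<^esub> x)) \<in> D" by (rule g)+
      show "a \<odot>\<^bsub>V\<^esub> g x \<in> C" using x g C(1) by (auto intro: subsp_smult)
      have "a \<odot>\<^bsub>W\<^esub> x \<ominus>\<^bsub>W\<^esub> f (a \<odot>\<^bsub>V\<^esub> g x) = a \<odot>\<^bsub>W\<^esub> (x \<ominus>\<^bsub>W\<^esub> f (g x))"
        using x by (simp add: lin_smult[OF f] gc W.smult_minus)
      then show "a \<odot>\<^bsub>W\<^esub> x \<ominus>\<^bsub>W\<^esub> f (a \<odot>\<^bsub>V\<^esub> g x) \<in> D"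
        using x g D(1) by (auto intro: subsp_smult)
    qed
  qed
  moreover have "f (g (f x)) = f x" if x: "x \<in> carrier V" for x
  proof -
    have fx: "f x \<in> carrier W" using x f by (rule lin_cl[rotated])
    have "f x \<ominus>\<^bsub>W\<^esub> f (g (f x)) = f (x \<ominus>\<^bsub>V\<^esub> g (f x))"
      using lin_minus[OF f V W x gc(1)[OF fx]] by simp
    moreover have "f x \<ominus>\<^bsub>W\<^esub> f (g (f x)) \<in> D" by (rule g(2)[OF fx])
    ultimately have "f x \<ominus>\<^bsub>W\<^esub> f (g (f x)) = \<zero>\<^bsub>W\<^esub>"
      using x gc(1)[OF fx] by (intro D(2)) auto
    then show ?thesis using fx gc(2)[OF fx] by (simp add: W.minus_zero_iff)
  qed
  ultimately show ?thesis using that by blast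
qed

text \<open>Inductive, so that containments and equalities of linear maps on a span follow from its
  generators by rule induction.\<close>

inductive_set lspan :: "('k::field, 'v, 'm) module_scheme => 'v set => 'v set" for V S where
  zero: "\<zero>\<^bsub>V\<^esub> \<in> lspan V S"
| base: "x \<in> S ==> x \<in> lspan V S"
| add: "x \<in> lspan V S ==> y \<in> lspan V S ==> x \<oplus>\<^bsub>V\<^esub> y \<in> lspan V S"
| smult: "x \<in> lspan V S ==> a \<odot>\<^bsub>V\<^esub> x \<in> lspan V S"

lemma lspan_least:
  assumes "subsp V T" "S \<subseteq> T"
  shows "lspan V S \<subseteq> T"
proof
  fix x assume "x \<in> lspan V S"
  then show "x \<in> T"
    by induction (use assms in \<open>auto intro: subsp_zero subsp_add subsp_smult\<close>)
qed

lemma (in vspace) lspan_subsp: "S \<subseteq> carrier V ==> subsp V (lspan V S)"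
  by (intro subspI lspan_least[OF subsp_carrier]) (auto intro: lspan.intros)

lemma lspan_image_subset:
  assumes "f \<in> linear_maps V W" "vspace V" "vspace W" "subsp W T" "S \<subseteq> carrier V"
    "\<And>x. x \<in> S ==> f x \<in> T" "x \<in> lspan V S"
  shows "f x \<in> T"
proof -
  have "lspan V S \<subseteq> {x \<in> carrier V. f x \<in> T}"
    using assms by (intro lspan_least subsp_vimage) auto
  then show ?thesis using assms(7) by auto
qed

lemma lspan_eq:
  assumes f: "f \<in> linear_maps V W" and g: "g \<in> linear_maps V W" and "vspace V" "vspace W" "S \<subseteq> carrier V"
    "\<And>x. x \<in> S ==> f x = g x" "x \<in> lspan V S"
  shows "f x = g x"
proof -
  interpret V: vspace V by fact
  have "subsp V {x \<in> carrier V. f x = g x}"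
    using f g lin_zero[OF f assms(3,4)] lin_zero[OF g assms(3,4)]
    by (intro subspI) (auto simp: lin_add lin_smult)
  then have "lspan V S \<subseteq> {x \<in> carrier V. f x = g x}"
    using assms by (intro lspan_least) auto
  then show ?thesis using assms(7) by auto
qed

section \<open>Images and quotients of algebras\<close>

text \<open>One principle for all derived algebras: operations that are images of those of
  \<open>A\<close> under \<open>h\<close> inherit the axioms. It is applied to quotients, to records
  with equal fields (\<open>h\<close> the identity) and to the direct limit.\<close>

lemma unital_algebra_image:
  fixes A :: "('k::field, 'a, 'm) module_scheme" and B :: "('k, 'b, 'n) module_scheme"
  assumes A: "unital_algebra A" and B: "carrier B = h ` carrier A"
    "\<zero>\<^bsub>B\<^esub> = h \<zero>\<^bsub>A\<^esub>" "\<one>\<^bsub>B\<^esub> = h \<one>\<^bsub>A\<^esub>"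
    "\<And>x y. x \<in> carrier A ==> y \<in> carrier A ==> h x \<oplus>\<^bsub>B\<^esub> h y = h (x \<oplus>\<^bsub>A\<^esub> y)"
    "\<And>x y. x \<in> carrier A ==> y \<in> carrier A ==> h x \<otimes>\<^bsub>B\<^esub> h y = h (x \<otimes>\<^bsub>A\<^esub> y)"
    "\<And>a x. x \<in> carrier A ==> a \<odot>\<^bsub>B\<^esub> h x = h (a \<odot>\<^bsub>A\<^esub> x)"
  shows "unital_algebra B" "h \<in> algebra_maps A B"
proof -
  interpret A: ualg A by (rule ualg.intro) fact
  have ab: "abelian_group B"
  proof (rule abelian_groupI)
    fix x assume "x \<in> carrier B"
    then obtain y where "x = h y" "y \<in> carrier A" using B by auto
    then show "\<exists>y\<in>carrier B. y \<oplus>\<^bsub>B\<^esub> x = \<zero>\<^bsub>B\<^esub>"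
      using B by (auto intro!: bexI[of _ "\<ominus>\<^bsub>A\<^esub> y"] simp: A.M.l_neg)
  next
    fix x y assume "x \<in> carrier B" "y \<in> carrier B"
    then obtain u v where "u \<in> carrier A" "v \<in> carrier A" "x = h u" "y = h v" using B(1) by blast
    then show "x \<oplus>\<^bsub>B\<^esub> y = y \<oplus>\<^bsub>B\<^esub> x" using B(4) A.M.a_comm by metis
  qed (auto simp: B A.M.a_assoc)
  then have "vspace B"
    unfolding vspace_def vector_space_over_field_def
    by (intro moduleI cring_ground) (auto simp: B A.smult_add A.add_smult A.smult_smult)
  moreover have "ring B"
    by (rule ringI[OF ab monoidI]) (auto simp: B A.A.m_assoc A.A.l_distr A.A.r_distr)
  ultimately show "unital_algebra B"
    by (auto simp: unital_algebra_def vspace_def B A.smult_mult A.mult_smult)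
  show "h \<in> algebra_maps A B"
    by (auto simp: algebra_maps_def linear_maps_def ring_hom_def B)
qed

text \<open>A ring ideal absorbs scalars because scaling by \<open>a\<close> is multiplication by
  \<open>a \<odot> \<one>\<close>.\<close>

lemma (in ualg) ideal_smult: "ideal J A ==> x \<in> J ==> a \<odot> x \<in> J"
proof -
  assume J: "ideal J A" "x \<in> J"
  then have "x \<in> carrier A" by (meson additive_subgroup.a_Hcarr ideal_def)
  then have "a \<odot> x = (a \<odot> \<one>) \<otimes> x" by (simp add: smult_mult)
  then show ?thesis using J ideal.I_l_closed[OF J] by simp
qed

lemma (in ualg) ideal_subsp: "ideal J A ==> subsp A J"
  by (intro subspI) (auto intro: ideal_smult additive_subgroup.a_Hcarr[OF ideal.axioms(1)]
      additive_subgroup.zero_closed[OF ideal.axioms(1)] additive_subgroup.a_closed[OF ideal.axioms(1)])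

lemma (in ualg) idealI_subsp:
  assumes "subsp A J" "\<And>a x. a \<in> carrier A ==> x \<in> J ==> a \<otimes> x \<in> J"
    "\<And>a x. a \<in> carrier A ==> x \<in> J ==> x \<otimes> a \<in> J"
  shows "ideal J A"
proof (rule idealI)
  show "subgroup J (add_monoid A)"
  proof (rule group.subgroupI)
    show "group (add_monoid A)" by (rule M.a_group)
    show "J \<subseteq> carrier (add_monoid A)" "J \<noteq> {}" using assms(1) by (auto simp: subsp_def)
    fix x assume "x \<in> J"
    then have "\<ominus> x \<in> J"
      using subsp_smult[OF assms(1), of x "- 1"] by (simp add: neg_smult subsp_cl[OF assms(1)])
    then show "inv\<^bsub>add_monoid A\<^esub> x \<in> J" by (simp add: a_inv_def)
  next
    fix x y assume "x \<in> J" "y \<in> J"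
    then show "x \<otimes>\<^bsub>add_monoid A\<^esub> y \<in> J" using assms(1) by (simp add: subsp_add)
  qed
qed (use assms in \<open>auto intro: A.ring_axioms\<close>)

context ualg begin

context fixes J assumes J: "ideal J A" begin

text \<open>The representative depends on the coset only, since \<open>SOME\<close> sees nothing
  else; hence equal representatives mean equal cosets, while the position of the representative
  relative to \<open>x\<close> is known only up to \<open>J\<close>.\<close>

lemma coset_rep_iff:
  assumes "x \<in> carrier A" "y \<in> carrier A"
  shows "coset_rep A J x = coset_rep A J y \<longleftrightarrow> x \<ominus> y \<in> J"
    and "coset_rep A J x \<in> carrier A" "coset_rep A J x \<ominus> x \<in> J"
proof -
  interpret J: ideal J A by (rule J)
  have rep: "coset_rep A J z \<in> J +> z" if "z \<in> carrier A" for z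
    unfolding coset_rep_def
    by (rule someI) (use that in \<open>auto intro: J.a_rcos_self\<close>)
  have crep: "coset_rep A J z \<in> carrier A \<and> coset_rep A J z \<ominus> z \<in> J" if z: "z \<in> carrier A" for z
  proof -
    obtain j where "j \<in> J" "coset_rep A J z = j \<oplus> z"
      using rep[OF z] by (auto simp: a_r_coset_def')
    then show ?thesis using z J.a_Hcarr by auto
  qed
  then show "coset_rep A J x \<in> carrier A" "coset_rep A J x \<ominus> x \<in> J" using assms by auto
  show "coset_rep A J x = coset_rep A J y \<longleftrightarrow> x \<ominus> y \<in> J"
  proof
    assume eq: "coset_rep A J x = coset_rep A J y"
    have "(coset_rep A J y \<ominus> y) \<ominus> (coset_rep A J x \<ominus> x) \<in> J"
      using crep[OF assms(1)] crep[OF assms(2)] by (auto intro: subsp_minus[OF ideal_subsp[OF J]])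
    also have "(coset_rep A J y \<ominus> y) \<ominus> (coset_rep A J x \<ominus> x) = x \<ominus> y"
      unfolding eq using crep[OF assms(2)] assms by (simp add: minus_minus_swap)
    finally show "x \<ominus> y \<in> J" .
  next
    assume "x \<ominus> y \<in> J"
    then have "J +> x = J +> y"
      using assms J A.quotient_eq_iff_same_a_r_cos by blast
    then show "coset_rep A J x = coset_rep A J y" by (simp add: coset_rep_def)
  qed
qed

lemma
  shows quotient_unital_algebra: "unital_algebra (quotient_algebra A J)"
    and coset_rep_algebra_map: "coset_rep A J \<in> algebra_maps A (quotient_algebra A J)"
proof -
  interpret J: ideal J A by (rule J)
  let ?r = "coset_rep A J"
  have sJ: "subsp A J" by (rule ideal_subsp[OF J])
  have mult: "?r (?r x \<otimes> ?r y) = ?r (x \<otimes> y)" if "x \<in> carrier A" "y \<in> carrier A" for x y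
  proof -
    have c: "?r x \<in> carrier A" "?r y \<in> carrier A" "?r x \<ominus> x \<in> J" "?r y \<ominus> y \<in> J"
      using that coset_rep_iff by auto
    \<comment> \<open>The two representatives are replaced one at a time, so that each difference is
      a multiple of an element of \<open>J\<close>.\<close>
    have "(?r x \<ominus> x) \<otimes> ?r y \<oplus> x \<otimes> (?r y \<ominus> y) \<in> J"
      using c that by (intro subsp_add[OF sJ] J.I_l_closed J.I_r_closed) auto
    also have "(?r x \<ominus> x) \<otimes> ?r y \<oplus> x \<otimes> (?r y \<ominus> y) = ?r x \<otimes> ?r y \<ominus> x \<otimes> y"
      using c(1,2) that minus_trans[of "?r x \<otimes> ?r y" "x \<otimes> ?r y" "x \<otimes> y"]
      by (simp add: a_minus_def A.l_distr A.r_distr A.l_minus A.r_minus)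
    finally show ?thesis using coset_rep_iff(1) c that by auto
  qed
  have add: "?r (?r x \<oplus> ?r y) = ?r (x \<oplus> y)" if "x \<in> carrier A" "y \<in> carrier A" for x y
  proof -
    have c: "?r x \<in> carrier A" "?r y \<in> carrier A" "?r x \<ominus> x \<in> J" "?r y \<ominus> y \<in> J"
      using that coset_rep_iff by auto
    then have "(?r x \<oplus> ?r y) \<ominus> (x \<oplus> y) \<in> J"
      using that sJ by (simp add: minus_add4 subsp_add)
    then show ?thesis using coset_rep_iff(1) c that by auto
  qed
  have smult: "?r (a \<odot> ?r x) = ?r (a \<odot> x)" if "x \<in> carrier A" for x a
  proof -
    have c: "?r x \<in> carrier A" "?r x \<ominus> x \<in> J" using that coset_rep_iff by auto
    then have "a \<odot> ?r x \<ominus> a \<odot> x \<in> J"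
      using that sJ by (simp flip: smult_minus add: subsp_smult)
    then show ?thesis using coset_rep_iff(1) c that by auto
  qed
  show "unital_algebra (quotient_algebra A J)" "?r \<in> algebra_maps A (quotient_algebra A J)"
    by (rule unital_algebra_image[OF ua, where h = ?r]; simp add: quotient_algebra_def mult add smult)+
qed

lemma coset_rep_zero_iff:
  "x \<in> carrier A ==> coset_rep A J x = \<zero>\<^bsub>quotient_algebra A J\<^esub> \<longleftrightarrow> x \<in> J"
  using coset_rep_iff(1)[of x \<zero>] by (simp add: quotient_algebra_def)

end
end

section \<open>The free algebra and the tensor algebra\<close>

declare in_lists_conv_set [simp del] in_listsD [rule del] in_listsI [rule del]

abbreviation (input) "keys \<equiv> Poly_Mapping.keys"
abbreviation (input) "lookup \<equiv> Poly_Mapping.lookup"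
abbreviation (input) "single \<equiv> Poly_Mapping.single"

section \<open>Finitely supported functions and multiplication of words\<close>

lemma poly_mapping_sum_single:
  fixes f :: "'x \<Rightarrow>\<^sub>0 'b::comm_monoid_add"
  assumes "finite A" "keys f \<subseteq> A"
  shows "(\<Sum>x\<in>A. single x (lookup f x)) = f"
proof (rule poly_mapping_eqI)
  fix k
  have "(\<Sum>x\<in>A. lookup f x when x = k) = (\<Sum>x\<in>A. if x = k then lookup f k else 0)"
    by (intro sum.cong) (auto simp: when_def)
  then show "lookup (\<Sum>x\<in>A. single x (lookup f x)) k = lookup f k"
    using assms by (auto simp: lookup_sum lookup_single sum.delta not_in_keys_iff_lookup_eq_zero)
qed

lemma keys_add_subset: "keys f \<subseteq> S ==> keys g \<subseteq> S ==> keys (f + g) \<subseteq> S"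
  using keys_add[of f g] by blast

text \<open>The supports of the summands stay within \<open>S\<close>, so the cases may use facts
  that hold for words from \<open>S\<close> only.\<close>

lemma poly_mapping_span_induct [consumes 1, case_names zero single add]:
  fixes f :: "'x \<Rightarrow>\<^sub>0 'b::comm_monoid_add"
  assumes "keys f \<subseteq> S" "Q 0" "\<And>x a. x \<in> S ==> Q (single x a)"
    "\<And>f g. keys f \<subseteq> S ==> keys g \<subseteq> S ==> Q f ==> Q g ==> Q (f + g)"
  shows "Q f"
proof -
  have "Q (\<Sum>x\<in>A. single x (lookup f x)) \<and> keys (\<Sum>x\<in>A. single x (lookup f x)) \<subseteq> S"
    if "finite A" "A \<subseteq> S" for A
    using that
  proof (induction A)
    case empty
    show ?case using assms(2) by simp
  next
    case (insert x A)
    then show ?case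
      using assms(3)[of x] assms(4)[of "single x (lookup f x)" "\<Sum>x\<in>A. single x (lookup f x)"]
        keys_add_subset[of "single x (lookup f x)" S "\<Sum>x\<in>A. single x (lookup f x)"]
      by simp
  qed
  from this[of "keys f"] show ?thesis
    using assms(1) by (simp add: poly_mapping_sum_single)
qed

text \<open>Linear extension from a basis indexed by any type; both \<open>multilinear_lift\<close>
  and \<open>tensor_algebra_lift\<close> reduce to it.\<close>

definition wlift :: "('k::field, 'w, 'm) module_scheme => ('x => 'w) => ('x \<Rightarrow>\<^sub>0 'k) => 'w" where
  "wlift M \<Phi> f = (\<Oplus>\<^bsub>M\<^esub>x\<in>keys f. lookup f x \<odot>\<^bsub>M\<^esub> \<Phi> x)"

context vspace begin

lemma wlift_superset:
  assumes "finite A" "keys f \<subseteq> A" "\<And>x. x \<in> A ==> \<Phi> x \<in> carrier V"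
  shows "wlift V \<Phi> f = (\<Oplus>x\<in>A. lookup f x \<odot> \<Phi> x)"
  unfolding wlift_def
  by (rule M.add.finprod_mono_neutral_cong_left) (use assms in \<open>auto simp: not_in_keys_iff_lookup_eq_zero\<close>)

lemma wlift_cl: "[|keys f \<subseteq> S; \<And>x. x \<in> S ==> \<Phi> x \<in> carrier V|] ==> wlift V \<Phi> f \<in> carrier V"
  unfolding wlift_def by (intro M.finsum_closed) auto

lemma wlift_add:
  assumes "keys f \<subseteq> S" "keys g \<subseteq> S" "\<And>x. x \<in> S ==> \<Phi> x \<in> carrier V"
  shows "wlift V \<Phi> (f + g) = wlift V \<Phi> f \<oplus> wlift V \<Phi> g"
proof -
  let ?A = "keys f \<union> keys g"
  have A: "\<And>x. x \<in> ?A ==> \<Phi> x \<in> carrier V" using assms by auto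
  have "wlift V \<Phi> (f + g) = (\<Oplus>x\<in>?A. lookup (f + g) x \<odot> \<Phi> x)"
    by (rule wlift_superset) (use A in \<open>auto simp: keys_add\<close>)
  also have "\<dots> = (\<Oplus>x\<in>?A. lookup f x \<odot> \<Phi> x \<oplus> lookup g x \<odot> \<Phi> x)"
    by (rule M.finsum_cong') (use A in \<open>auto simp: lookup_add add_smult\<close>)
  also have "\<dots> = (\<Oplus>x\<in>?A. lookup f x \<odot> \<Phi> x) \<oplus> (\<Oplus>x\<in>?A. lookup g x \<odot> \<Phi> x)"
    by (rule M.finsum_addf) (use A in auto)
  also have "(\<Oplus>x\<in>?A. lookup f x \<odot> \<Phi> x) = wlift V \<Phi> f"
    by (rule wlift_superset[symmetric]) (use A in auto)
  also have "(\<Oplus>x\<in>?A. lookup g x \<odot> \<Phi> x) = wlift V \<Phi> g"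
    by (rule wlift_superset[symmetric]) (use A in auto)
  finally show ?thesis .
qed

lemma wlift_zero [simp]: "wlift V \<Phi> 0 = \<zero>"
  by (simp add: wlift_def)

lemma wlift_single: "\<Phi> x \<in> carrier V ==> wlift V \<Phi> (single x a) = a \<odot> \<Phi> x"
  by (cases "a = 0") (simp_all add: wlift_def)

end

definition fmul :: "('v list \<Rightarrow>\<^sub>0 'k::field) => ('v list \<Rightarrow>\<^sub>0 'k) => ('v list \<Rightarrow>\<^sub>0 'k)" where
  "fmul f g = (\<Sum>u\<in>keys f. \<Sum>w\<in>keys g. single (u @ w) (lookup f u * lookup g w))"

text \<open>Summation over fixed larger index sets makes the product visibly bilinear. Sums over
  \<open>keys\<close> hide this, because the support of a sum may shrink by cancellation.\<close>

lemma fmul_superset: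
  assumes "finite A" "finite B" "keys f \<subseteq> A" "keys g \<subseteq> B"
  shows "fmul f g = (\<Sum>u\<in>A. \<Sum>w\<in>B. single (u @ w) (lookup f u * lookup g w))"
  unfolding fmul_def
  by (rule sum.mono_neutral_cong_left sum.neutral ballI
    | use assms in \<open>auto simp: not_in_keys_iff_lookup_eq_zero\<close>)+

lemma fmul_add_left: "fmul (f + f') g = fmul f g + fmul f' g"
proof -
  have "keys (f + f') \<subseteq> keys f \<union> keys f'" by (rule keys_add)
  then show ?thesis
    by (simp add: fmul_superset[of "keys f \<union> keys f'" "keys g"] lookup_add distrib_right single_add sum.distrib)
qed

lemma fmul_add_right: "fmul f (g + g') = fmul f g + fmul f g'"
proof -
  have "keys (g + g') \<subseteq> keys g \<union> keys g'" by (rule keys_add)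
  then show ?thesis
    by (simp add: fmul_superset[of "keys f" "keys g \<union> keys g'"] lookup_add distrib_left single_add sum.distrib)
qed

lemma fmul_zero [simp]: "fmul 0 f = 0" "fmul f 0 = 0"
  by (simp_all add: fmul_def)

lemma fmul_single [simp]: "fmul (single u a) (single w b) = single (u @ w) (a * b)"
  by (simp add: fmul_superset[of "{u}" "{w}"])

lemma fmul_assoc: "fmul (fmul f g) h = fmul f (fmul g h)"
proof -
  have U: "\<And>f. keys f \<subseteq> UNIV" by simp
  show ?thesis
  proof (rule poly_mapping_span_induct[OF U[of f]])
    fix u :: "'a list" and a :: 'b
    show "fmul (fmul (single u a) g) h = fmul (single u a) (fmul g h)"
    proof (rule poly_mapping_span_induct[OF U[of g]])
      fix v :: "'a list" and b :: 'b
      show "fmul (fmul (single u a) (single v b)) h = fmul (single u a) (fmul (single v b) h)"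
        by (rule poly_mapping_span_induct[OF U[of h]]) (simp_all add: fmul_add_right mult.assoc)
    qed (simp_all add: fmul_add_left fmul_add_right)
  qed (simp_all add: fmul_add_left)
qed

lemma keys_fmul: "keys f \<subseteq> lists S ==> keys g \<subseteq> lists S ==> keys (fmul f g) \<subseteq> lists S"
proof (induction f rule: poly_mapping_span_induct)
  case (single u a)
  from single(2) show ?case
  proof (induction g rule: poly_mapping_span_induct)
    case (single w b)
    then show ?case using \<open>u \<in> lists S\<close> by auto
  next
    case (add f g)
    then show ?case by (simp only: fmul_add_right keys_add_subset)
  qed simp
next
  case (add f h)
  then show ?case by (simp only: fmul_add_left keys_add_subset)
qed simp

lemma fmul_one [simp]: "fmul (single [] 1) f = f" "fmul f (single [] 1) = f"
proof -
  have U: "keys f \<subseteq> UNIV" by simp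
  show "fmul (single [] 1) f = f"
    by (rule poly_mapping_span_induct[OF U]) (simp_all add: fmul_add_right)
  show "fmul f (single [] 1) = f"
    by (rule poly_mapping_span_induct[OF U]) (simp_all add: fmul_add_left)
qed

lemma lookup_scale: "lookup (Poly_Mapping.map ((*) a) f) x = a * lookup f (x :: 'x)" for a :: "'k::field"
  by (transfer) (simp add: when_def)

lemma scale_simps [simp]:
  fixes a :: "'k::field"
  shows "Poly_Mapping.map ((*) a) 0 = 0"
    "Poly_Mapping.map ((*) a) (f + g) = Poly_Mapping.map ((*) a) f + Poly_Mapping.map ((*) a) g"
    "Poly_Mapping.map ((*) a) (single x b) = single x (a * b)"
    "Poly_Mapping.map ((*) (a + b)) f = Poly_Mapping.map ((*) a) f + Poly_Mapping.map ((*) b) f"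
    "Poly_Mapping.map ((*) a) (Poly_Mapping.map ((*) b) f) = Poly_Mapping.map ((*) (a * b)) f"
    "Poly_Mapping.map ((*) 1) f = f"
  by (rule poly_mapping_eqI; simp add: lookup_scale lookup_add lookup_single when_def algebra_simps)+

lemma keys_scale: "keys (Poly_Mapping.map ((*) (a::'k::field)) f) \<subseteq> keys f"
  by (auto simp: in_keys_iff lookup_scale)

lemma keys_scale_subset: "keys f \<subseteq> S ==> keys (Poly_Mapping.map ((*) (a::'k::field)) f) \<subseteq> S"
  using keys_scale[of a f] by blast

lemma free_algebra_simps:
  fixes V :: "('k::field, 'v, 'm) module_scheme"
  shows "carrier (free_algebra V) = {f. keys f \<subseteq> lists (carrier V)}"
  "f \<otimes>\<^bsub>free_algebra V\<^esub> g = fmul f g" "\<one>\<^bsub>free_algebra V\<^esub> = single [] 1" "\<zero>\<^bsub>free_algebra V\<^esub> = 0"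
  "f \<oplus>\<^bsub>free_algebra V\<^esub> g = f + g" "a \<odot>\<^bsub>free_algebra V\<^esub> f = Poly_Mapping.map ((*) a) f"
  by (simp_all add: free_algebra_def fmul_def)

lemma fmul_scale: "fmul (Poly_Mapping.map ((*) a) f) g = Poly_Mapping.map ((*) a) (fmul f g)"
  "fmul f (Poly_Mapping.map ((*) a) g) = Poly_Mapping.map ((*) a) (fmul f g)" for a :: "'k::field"
proof -
  \<comment> \<open>Scaling is multiplication by a multiple of the empty word, on either side, so
    that both rules become associativity.\<close>
  have 1: "Poly_Mapping.map ((*) a) h = fmul (single [] a) h"
    "Poly_Mapping.map ((*) a) h = fmul h (single [] a)" for h :: "'a list \<Rightarrow>\<^sub>0 'k"
  proof -
    have U: "keys h \<subseteq> UNIV" by simp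
    show "Poly_Mapping.map ((*) a) h = fmul (single [] a) h"
      by (rule poly_mapping_span_induct[OF U]) (simp_all add: fmul_add_right)
    show "Poly_Mapping.map ((*) a) h = fmul h (single [] a)"
      by (rule poly_mapping_span_induct[OF U]) (simp_all add: fmul_add_left mult.commute[of _ a] del: mult.commute)
  qed
  show "fmul (Poly_Mapping.map ((*) a) f) g = Poly_Mapping.map ((*) a) (fmul f g)"
    by (simp add: 1(1) fmul_assoc)
  show "fmul f (Poly_Mapping.map ((*) a) g) = Poly_Mapping.map ((*) a) (fmul f g)"
    by (simp add: 1(2) fmul_assoc)
qed

lemma free_unital_algebra:
  fixes V :: "('k::field, 'v, 'm) module_scheme"
  shows "unital_algebra (free_algebra V)"
proof -
  have add: "keys (f + g) \<subseteq> lists (carrier V)"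
    if "keys f \<subseteq> lists (carrier V)" "keys g \<subseteq> lists (carrier V)" for f g :: "_ \<Rightarrow>\<^sub>0 'k"
    using that by (rule keys_add_subset)
  have ab: "abelian_group (free_algebra V)"
  proof (rule abelian_groupI)
    fix f assume "f \<in> carrier (free_algebra V)"
    then show "\<exists>g\<in>carrier (free_algebra V). g \<oplus>\<^bsub>free_algebra V\<^esub> f = \<zero>\<^bsub>free_algebra V\<^esub>"
      by (intro bexI[of _ "- f"]) (auto simp: free_algebra_simps)
  qed (simp_all add: free_algebra_simps add add.assoc add.commute)
  have "vspace (free_algebra V)"
    unfolding vspace_def vector_space_over_field_def
    by (intro moduleI cring_ground ab) (simp_all add: free_algebra_simps keys_scale_subset)
  moreover have "ring (free_algebra V)"
    by (rule ringI[OF ab monoidI])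
      (simp_all add: free_algebra_simps keys_fmul fmul_assoc fmul_add_left fmul_add_right)
  ultimately show ?thesis
    by (auto simp: unital_algebra_def vspace_def free_algebra_simps fmul_scale)
qed

lemma free_minus:
  assumes "f \<in> carrier (free_algebra V)" "g \<in> carrier (free_algebra V)"
  shows "f \<ominus>\<^bsub>free_algebra V\<^esub> g = f - g"
proof -
  interpret F: ualg "free_algebra V" by (rule ualg.intro[OF free_unital_algebra])
  have "\<ominus>\<^bsub>free_algebra V\<^esub> g = - g"
    using assms by (intro F.M.minus_equality) (auto simp: free_algebra_simps)
  then show ?thesis by (simp add: a_minus_def free_algebra_simps)
qed

text \<open>Words of all lengths at once, as the universal property concerns the whole tensor
  algebra. Linearity in a letter is asked with the other letters fixed; the empty word has no letter
  and gets its own clause.\<close>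

definition multilin :: "('k::field, 'v, 'm) module_scheme => ('k, 'w, 'n) module_scheme => ('v list => 'w) => bool"
  where "multilin V M \<Phi> \<longleftrightarrow> \<Phi> [] \<in> carrier M \<and>
     (\<forall>a\<in>lists (carrier V). \<forall>b\<in>lists (carrier V). (\<lambda>x. \<Phi> (a @ x # b)) \<in> linear_maps V M)"

lemma multilin_cl: "multilin V M \<Phi> ==> xs \<in> lists (carrier V) ==> \<Phi> xs \<in> carrier M"
proof (cases xs)
  case (Cons x b)
  assume "multilin V M \<Phi>" "xs \<in> lists (carrier V)"
  then have b: "b \<in> lists (carrier V)" "x \<in> carrier V" using Cons by simp_all
  then have "(\<lambda>x. \<Phi> ([] @ x # b)) \<in> linear_maps V M"
    using \<open>multilin V M \<Phi>\<close> unfolding multilin_def by blast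
  from lin_cl[OF this b(2)] show ?thesis using Cons by simp
qed (simp add: multilin_def)

lemma multilin_linear:
  "multilin V M \<Phi> ==> a \<in> lists (carrier V) ==> b \<in> lists (carrier V) ==> (\<lambda>x. \<Phi> (a @ x # b)) \<in> linear_maps V M"
  by (auto simp: multilin_def)

section \<open>The tensor algebra and its universal property\<close>

locale tens = fixes V :: "('k::field, 'v, 'm) module_scheme"
  assumes tens_vs: "vector_space_over_field V"
begin

lemmas tns = tens_axioms

sublocale V: vspace V by (rule vspace.intro[OF tens_vs])

abbreviation "TA \<equiv> tensor_algebra V"
abbreviation "CT \<equiv> carrier (tensor_algebra V)"
abbreviation "oneT \<equiv> \<one>\<^bsub>tensor_algebra V\<^esub>"
abbreviation "zeroT \<equiv> \<zero>\<^bsub>tensor_algebra V\<^esub>"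
abbreviation "wrd \<equiv> lists (carrier V)"
abbreviation "Fr \<equiv> free_algebra V"
abbreviation tmul (infixl "\<bullet>" 72) where "s \<bullet> t \<equiv> s \<otimes>\<^bsub>tensor_algebra V\<^esub> t"

sublocale F: ualg "free_algebra V" by (rule ualg.intro[OF free_unital_algebra])

lemma tensor_relations_subset: "tensor_relations V \<subseteq> carrier Fr"
proof -
  have "keys (f - g) \<subseteq> wrd" if "keys f \<subseteq> wrd" "keys g \<subseteq> wrd" for f g :: "_ \<Rightarrow>\<^sub>0 'k"
    using that keys_diff[of f g] by blast
  note diff = this
  have "keys (single [x \<oplus>\<^bsub>V\<^esub> y] 1 - single [x] 1 - single [y] (1 :: 'k)) \<subseteq> wrd"
    if "x \<in> carrier V" "y \<in> carrier V" for x y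
    using that by (intro diff) simp_all
  moreover have "keys (single [a \<odot>\<^bsub>V\<^esub> x] 1 - single [x] a) \<subseteq> wrd" if "x \<in> carrier V" for a x
    using that by (intro diff) simp_all
  ultimately show ?thesis
    unfolding tensor_relations_def free_algebra_simps by blast
qed

lemma tensor_ideal: "ideal (tensor_ideal V) Fr"
  unfolding tensor_ideal_def by (rule F.A.genideal_ideal[OF tensor_relations_subset])

sublocale R: ualg "tensor_algebra V"
  unfolding tensor_algebra_def by (rule ualg.intro[OF F.quotient_unital_algebra[OF tensor_ideal]])

lemma tensor_class_algebra_map: "tensor_class V \<in> algebra_maps Fr TA"
  unfolding tensor_class_def tensor_algebra_def by (rule F.coset_rep_algebra_map[OF tensor_ideal])

lemma tensor_class_linear: "tensor_class V \<in> linear_maps Fr TA"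
  using tensor_class_algebra_map by (simp add: algebra_maps_def)

lemma carrier_TA: "CT = tensor_class V ` carrier Fr"
  by (simp add: tensor_algebra_def quotient_algebra_def tensor_class_def)

lemma single_Fr: "xs \<in> wrd ==> single xs a \<in> carrier Fr"
  by (simp add: free_algebra_simps)

lemma pure_cl [simp]: "xs \<in> wrd ==> pure_tensor V xs \<in> CT"
  by (simp add: pure_tensor_def carrier_TA single_Fr)

lemma tensor_class_single: "xs \<in> wrd ==> tensor_class V (single xs a) = a \<odot>\<^bsub>TA\<^esub> pure_tensor V xs"
  using lin_smult[OF tensor_class_linear single_Fr, of xs a 1]
  by (simp add: pure_tensor_def free_algebra_simps)

lemma pure_append: "xs \<in> wrd ==> ys \<in> wrd ==> pure_tensor V (xs @ ys) = pure_tensor V xs \<bullet> pure_tensor V ys"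
  using tensor_class_algebra_map ring_hom_mult[of "tensor_class V" Fr TA "single xs 1" "single ys 1"]
    single_Fr[of xs 1] single_Fr[of ys 1]
  by (simp add: pure_tensor_def algebra_maps_def free_algebra_simps)

lemma pure_Nil: "pure_tensor V [] = oneT"
  by (simp add: pure_tensor_def tensor_class_def tensor_algebra_def quotient_algebra_def free_algebra_simps)

lemma carrier_TA_span: "CT = lspan TA (pure_tensor V ` wrd)"
proof
  show "CT \<subseteq> lspan TA (pure_tensor V ` wrd)"
  proof
    fix t assume "t \<in> CT"
    then obtain f where f: "t = tensor_class V f" "keys f \<subseteq> wrd"
      by (auto simp: carrier_TA free_algebra_simps)
    have "tensor_class V f \<in> lspan TA (pure_tensor V ` wrd)"
      using f(2)
    proof (induction f rule: poly_mapping_span_induct)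
      case zero
      have "tensor_class V 0 = zeroT"
        using lin_zero[OF tensor_class_linear F.vsp R.vsp] by (simp add: free_algebra_simps)
      then show ?case by (simp add: lspan.zero)
    next
      case (single x a)
      then show ?case by (auto simp: tensor_class_single intro: lspan.intros)
    next
      case (add f g)
      then show ?case
        using lin_add[OF tensor_class_linear, of f g] by (auto simp: free_algebra_simps intro: lspan.add)
    qed
    with f show "t \<in> lspan TA (pure_tensor V ` wrd)" by simp
  qed
  show "lspan TA (pure_tensor V ` wrd) \<subseteq> CT"
    by (rule lspan_least[OF R.subsp_carrier]) auto
qed

text \<open>The kernel of a linear map on the free algebra is in general not an ideal, so
  \<open>I\<close> collects the elements whose products with words on both sides are all killed.
  \<open>I\<close> is an ideal that contains the relations, hence the tensor ideal, and evaluation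
  on the chosen representatives does not depend on the choice.\<close>

theorem wlift_linear:
  assumes M: "vspace M" and \<Phi>: "multilin V M \<Phi>"
  shows "wlift M \<Phi> \<in> linear_maps TA M"
    and "f \<in> carrier Fr ==> wlift M \<Phi> (tensor_class V f) = wlift M \<Phi> f"
    and "xs \<in> wrd ==> wlift M \<Phi> (pure_tensor V xs) = \<Phi> xs"
proof -
  interpret M: vspace M by fact
  note \<Phi>c = multilin_cl[OF \<Phi>]
  have LF: "wlift M \<Phi> \<in> linear_maps Fr M"
  proof (rule linI)
    fix f assume "f \<in> carrier Fr"
    then show "wlift M \<Phi> f \<in> carrier M"
      by (intro M.wlift_cl[of _ wrd]) (auto simp: free_algebra_simps \<Phi>c)
  next
    fix f g assume "f \<in> carrier Fr" "g \<in> carrier Fr"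
    then show "wlift M \<Phi> (f \<oplus>\<^bsub>Fr\<^esub> g) = wlift M \<Phi> f \<oplus>\<^bsub>M\<^esub> wlift M \<Phi> g"
      by (simp add: free_algebra_simps) (intro M.wlift_add[of _ wrd], auto simp: \<Phi>c)
  next
    fix a f assume "f \<in> carrier Fr"
    then have "keys f \<subseteq> wrd" by (simp add: free_algebra_simps)
    then have "wlift M \<Phi> (Poly_Mapping.map ((*) a) f) = a \<odot>\<^bsub>M\<^esub> wlift M \<Phi> f"
    proof (induction f rule: poly_mapping_span_induct)
      case (single x b)
      then show ?case by (simp add: M.wlift_single \<Phi>c M.smult_smult)
    next
      case (add f g)
      then show ?case
        using keys_scale[of a f] keys_scale[of a g]
        by (simp add: M.wlift_add[of _ wrd] \<Phi>c M.smult_add M.wlift_cl[of _ wrd] subset_trans)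
    qed simp
    then show "wlift M \<Phi> (a \<odot>\<^bsub>Fr\<^esub> f) = a \<odot>\<^bsub>M\<^esub> wlift M \<Phi> f"
      by (simp add: free_algebra_simps)
  qed
  have LFs: "wlift M \<Phi> (single xs a) = a \<odot>\<^bsub>M\<^esub> \<Phi> xs" if "xs \<in> wrd" for xs a
    using that by (simp add: M.wlift_single \<Phi>c)
  define I where "I = {f \<in> carrier Fr. \<forall>u\<in>wrd. \<forall>w\<in>wrd.
    wlift M \<Phi> (single u 1 \<otimes>\<^bsub>Fr\<^esub> f \<otimes>\<^bsub>Fr\<^esub> single w 1) = \<zero>\<^bsub>M\<^esub>}"
  have lin_uw: "(\<lambda>f. wlift M \<Phi> (single u 1 \<otimes>\<^bsub>Fr\<^esub> f \<otimes>\<^bsub>Fr\<^esub> single w 1)) \<in> linear_maps Fr M"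
    if "u \<in> wrd" "w \<in> wrd" for u w
  proof (rule lin_comp[OF _ LF])
    show "(\<lambda>f. single u 1 \<otimes>\<^bsub>Fr\<^esub> f \<otimes>\<^bsub>Fr\<^esub> single w 1) \<in> linear_maps Fr Fr"
      using that by (intro linI) (auto simp: single_Fr F.A.l_distr F.A.r_distr F.smult_mult F.mult_smult)
  qed
  have sub: "subsp Fr I"
  proof -
    have "subsp Fr {f \<in> carrier Fr. wlift M \<Phi> (single u 1 \<otimes>\<^bsub>Fr\<^esub> f \<otimes>\<^bsub>Fr\<^esub> single w 1) \<in> {\<zero>\<^bsub>M\<^esub>}}"
      if "u \<in> wrd" "w \<in> wrd" for u w
      by (rule subsp_vimage[OF lin_uw[OF that] F.vsp M M.subsp_0])
    then show ?thesis
      unfolding I_def by (intro subsp_All[OF F.vsp]) auto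
  qed
  have "ideal I Fr"
  proof (rule F.idealI_subsp[OF sub])
    fix a f assume a: "a \<in> carrier Fr" and f: "f \<in> I"
    have fc: "f \<in> carrier Fr" using f by (simp add: I_def)
    from a have ka: "keys a \<subseteq> wrd" by (simp add: free_algebra_simps)
    show "a \<otimes>\<^bsub>Fr\<^esub> f \<in> I"
      using ka
    proof (induction a rule: poly_mapping_span_induct)
      case zero
      then show ?case using subsp_zero[OF sub] by (simp add: free_algebra_simps)
    next
      case (single v c)
      have "wlift M \<Phi> (single u 1 \<otimes>\<^bsub>Fr\<^esub> (single v c \<otimes>\<^bsub>Fr\<^esub> f) \<otimes>\<^bsub>Fr\<^esub> single w 1) = \<zero>\<^bsub>M\<^esub>" if "u \<in> wrd" "w \<in> wrd" for u w
      proof -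
        have "single u 1 \<otimes>\<^bsub>Fr\<^esub> (single v c \<otimes>\<^bsub>Fr\<^esub> f) \<otimes>\<^bsub>Fr\<^esub> single w 1
            = c \<odot>\<^bsub>Fr\<^esub> (single (u @ v) 1 \<otimes>\<^bsub>Fr\<^esub> f \<otimes>\<^bsub>Fr\<^esub> single w 1)"
          by (simp add: free_algebra_simps fmul_scale flip: fmul_assoc)
            (simp flip: fmul_scale)
        then show ?thesis
          using f that single fc lin_smult[OF LF]
          by (simp add: I_def single_Fr)
      qed
      then show ?case using fc single by (simp add: I_def single_Fr)
    next
      case (add a b)
      then have "a \<otimes>\<^bsub>Fr\<^esub> f \<oplus>\<^bsub>Fr\<^esub> b \<otimes>\<^bsub>Fr\<^esub> f \<in> I" by (intro subsp_add[OF sub])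
      then show ?case by (simp add: free_algebra_simps fmul_add_left)
    qed
    show "f \<otimes>\<^bsub>Fr\<^esub> a \<in> I"
      using ka
    proof (induction a rule: poly_mapping_span_induct)
      case zero
      then show ?case using subsp_zero[OF sub] by (simp add: free_algebra_simps)
    next
      case (single v c)
      have "wlift M \<Phi> (single u 1 \<otimes>\<^bsub>Fr\<^esub> (f \<otimes>\<^bsub>Fr\<^esub> single v c) \<otimes>\<^bsub>Fr\<^esub> single w 1) = \<zero>\<^bsub>M\<^esub>" if "u \<in> wrd" "w \<in> wrd" for u w
      proof -
        have "single u 1 \<otimes>\<^bsub>Fr\<^esub> (f \<otimes>\<^bsub>Fr\<^esub> single v c) \<otimes>\<^bsub>Fr\<^esub> single w 1
            = c \<odot>\<^bsub>Fr\<^esub> (single u 1 \<otimes>\<^bsub>Fr\<^esub> f \<otimes>\<^bsub>Fr\<^esub> single (v @ w) 1)"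
          by (simp add: free_algebra_simps fmul_assoc flip: fmul_scale(2))
        then show ?thesis
          using f that single fc lin_smult[OF LF]
          by (simp add: I_def single_Fr)
      qed
      then show ?case using fc single by (simp add: I_def single_Fr)
    next
      case (add a b)
      then have "f \<otimes>\<^bsub>Fr\<^esub> a \<oplus>\<^bsub>Fr\<^esub> f \<otimes>\<^bsub>Fr\<^esub> b \<in> I" by (intro subsp_add[OF sub])
      then show ?case by (simp add: free_algebra_simps fmul_add_right)
    qed
  qed
  moreover have "tensor_relations V \<subseteq> I"
  proof
    fix r assume r: "r \<in> tensor_relations V"
    then have rF: "r \<in> carrier Fr" using tensor_relations_subset by auto
    have "wlift M \<Phi> (single u 1 \<otimes>\<^bsub>Fr\<^esub> r \<otimes>\<^bsub>Fr\<^esub> single w 1) = \<zero>\<^bsub>M\<^esub>" if uw: "u \<in> wrd" "w \<in> wrd" for u w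
    proof -
      let ?L = "\<lambda>f. wlift M \<Phi> (single u 1 \<otimes>\<^bsub>Fr\<^esub> f \<otimes>\<^bsub>Fr\<^esub> single w 1)"
      have Ls: "?L (single [x] c) = c \<odot>\<^bsub>M\<^esub> \<Phi> (u @ x # w)" if "x \<in> carrier V" for x c
        using that uw by (simp add: free_algebra_simps LFs)
      note lin = multilin_linear[OF \<Phi> uw]
      note Lm = lin_minus[OF lin_uw[OF uw] F.vsp M]
      have min: "?L (f - g) = ?L f \<ominus>\<^bsub>M\<^esub> ?L g" "f - g \<in> carrier Fr" if "f \<in> carrier Fr" "g \<in> carrier Fr" for f g
        using Lm[OF that] F.minus_cl[OF that] free_minus[OF that] by simp_all
      from r consider x y where "x \<in> carrier V" "y \<in> carrier V" "r = single [x \<oplus>\<^bsub>V\<^esub> y] 1 - single [x] 1 - single [y] 1"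
        | a x where "x \<in> carrier V" "r = single [a \<odot>\<^bsub>V\<^esub> x] 1 - single [x] a"
        by (auto simp: tensor_relations_def)
      then show ?thesis
      proof cases
        case 1
        then show ?thesis
          using lin_add[OF lin 1(1,2)] lin_cl[OF lin 1(1)] lin_cl[OF lin 1(2)]
          by (simp add: min single_Fr Ls)
      next
        case 2
        then show ?thesis
          using lin_smult[OF lin 2(1)] lin_cl[OF lin 2(1)]
          by (simp add: min single_Fr Ls)
      qed
    qed
    then show "r \<in> I" using rF by (simp add: I_def)
  qed
  ultimately have "tensor_ideal V \<subseteq> I"
    unfolding tensor_ideal_def by (rule F.A.genideal_minimal)
  then have ker: "wlift M \<Phi> f = \<zero>\<^bsub>M\<^esub>" if "f \<in> tensor_ideal V" for f
  proof -
    have "f \<in> I" using that \<open>tensor_ideal V \<subseteq> I\<close> by auto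
    then have "f \<in> carrier Fr" "wlift M \<Phi> (single [] 1 \<otimes>\<^bsub>Fr\<^esub> f \<otimes>\<^bsub>Fr\<^esub> single [] 1) = \<zero>\<^bsub>M\<^esub>"
      unfolding I_def by blast+
    then show ?thesis by (simp add: free_algebra_simps)
  qed
  have cls: "wlift M \<Phi> (tensor_class V f) = wlift M \<Phi> f" if f: "f \<in> carrier Fr" for f
  proof -
    have c: "tensor_class V f \<in> carrier Fr" "tensor_class V f \<ominus>\<^bsub>Fr\<^esub> f \<in> tensor_ideal V"
      unfolding tensor_class_def by (rule F.coset_rep_iff[OF tensor_ideal f f])+
    then have "wlift M \<Phi> (tensor_class V f) \<ominus>\<^bsub>M\<^esub> wlift M \<Phi> f = \<zero>\<^bsub>M\<^esub>"
      using lin_minus[OF LF F.vsp M c(1) f] ker by simp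
    then show ?thesis using c f by (simp add: M.minus_zero_iff lin_cl[OF LF])
  qed
  then show "f \<in> carrier Fr ==> wlift M \<Phi> (tensor_class V f) = wlift M \<Phi> f" .
  show "wlift M \<Phi> \<in> linear_maps TA M"
  proof (rule linI)
    fix t assume "t \<in> CT"
    then show "wlift M \<Phi> t \<in> carrier M"
      by (auto simp: carrier_TA cls lin_cl[OF LF])
  next
    fix s t assume "s \<in> CT" "t \<in> CT"
    then obtain f g where "f \<in> carrier Fr" "g \<in> carrier Fr" "s = tensor_class V f" "t = tensor_class V g"
      by (auto simp: carrier_TA)
    then show "wlift M \<Phi> (s \<oplus>\<^bsub>TA\<^esub> t) = wlift M \<Phi> s \<oplus>\<^bsub>M\<^esub> wlift M \<Phi> t"
      by (simp add: cls lin_add[OF LF] flip: lin_add[OF tensor_class_linear])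
  next
    fix a s assume "s \<in> CT"
    then obtain f where "f \<in> carrier Fr" "s = tensor_class V f" by (auto simp: carrier_TA)
    then show "wlift M \<Phi> (a \<odot>\<^bsub>TA\<^esub> s) = a \<odot>\<^bsub>M\<^esub> wlift M \<Phi> s"
      by (simp add: cls lin_smult[OF LF] flip: lin_smult[OF tensor_class_linear])
  qed
  show "wlift M \<Phi> (pure_tensor V xs) = \<Phi> xs" if "xs \<in> wrd"
    using that by (simp add: pure_tensor_def cls single_Fr LFs \<Phi>c)
qed

lemma tensor_induct [consumes 1, case_names pure add smult]:
  assumes "t \<in> CT" "\<And>xs. xs \<in> wrd ==> Q (pure_tensor V xs)"
    "\<And>s t. [|s \<in> CT; t \<in> CT; Q s; Q t|] ==> Q (s \<oplus>\<^bsub>TA\<^esub> t)"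
    "\<And>a s. [|s \<in> CT; Q s|] ==> Q (a \<odot>\<^bsub>TA\<^esub> s)"
  shows "Q t"
proof -
  have "Q zeroT" using assms(4)[of "pure_tensor V []" 0] assms(2)[of "[]"] by simp
  have "t \<in> lspan TA (pure_tensor V ` wrd)" using assms(1) carrier_TA_span by simp
  then have "t \<in> CT \<and> Q t"
    by induction (use assms \<open>Q zeroT\<close> in auto)
  then show ?thesis ..
qed

lemma linear_eq_on_TA:
  assumes "f \<in> linear_maps TA M" "g \<in> linear_maps TA M" "\<And>xs. xs \<in> wrd ==> f (pure_tensor V xs) = g (pure_tensor V xs)"
    "t \<in> CT"
  shows "f t = g t"
  using assms(4)
  by (induction rule: tensor_induct) (auto simp: assms lin_add[OF assms(1)] lin_add[OF assms(2)]
      lin_smult[OF assms(1)] lin_smult[OF assms(2)])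

lemma pure_multilin: "multilin V TA (pure_tensor V)"
proof -
  have "(\<lambda>x. pure_tensor V (a @ x # b)) \<in> linear_maps V TA" if ab: "a \<in> wrd" "b \<in> wrd" for a b
  proof -
    have 1: "(\<lambda>x. pure_tensor V [x]) \<in> linear_maps V TA"
    proof -
      \<comment> \<open>Linearity in a one-letter word is imposed by the relations; products with
        words carry it to every position.\<close>
      have rel: "tensor_class V f = tensor_class V g" if "f \<in> carrier Fr" "g \<in> carrier Fr" "f - g \<in> tensor_relations V" for f g
        unfolding tensor_class_def F.coset_rep_iff(1)[OF tensor_ideal that(1,2)]
        using that F.A.genideal_self[OF tensor_relations_subset] free_minus[OF that(1,2)] by (auto simp: tensor_ideal_def)
      show ?thesis
      proof (rule linI)
        fix x y assume xy: "x \<in> carrier V" "y \<in> carrier V"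
        then have "tensor_class V (single [x \<oplus>\<^bsub>V\<^esub> y] 1) = tensor_class V (single [x] 1 \<oplus>\<^bsub>Fr\<^esub> single [y] 1)"
          by (intro rel F.add_cl single_Fr)
            (auto simp: single_Fr free_algebra_simps(5) tensor_relations_def diff_diff_eq)
        then show "pure_tensor V [x \<oplus>\<^bsub>V\<^esub> y] = pure_tensor V [x] \<oplus>\<^bsub>TA\<^esub> pure_tensor V [y]"
          using xy by (simp add: pure_tensor_def lin_add[OF tensor_class_linear] single_Fr)
      next
        fix c x assume x: "x \<in> carrier V"
        then have "tensor_class V (single [c \<odot>\<^bsub>V\<^esub> x] 1) = tensor_class V (single [x] c)"
          by (intro rel) (auto simp: single_Fr tensor_relations_def)
        then show "pure_tensor V [c \<odot>\<^bsub>V\<^esub> x] = c \<odot>\<^bsub>TA\<^esub> pure_tensor V [x]"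
          using x by (simp add: tensor_class_single)
      qed auto
    qed
    have "(\<lambda>x. pure_tensor V a \<bullet> pure_tensor V [x] \<bullet> pure_tensor V b) \<in> linear_maps V TA"
      using ab by (intro linI) (simp_all add: lin_add[OF 1] lin_smult[OF 1] R.A.l_distr R.A.r_distr R.smult_mult R.mult_smult)
    moreover have "pure_tensor V (a @ x # b) = pure_tensor V a \<bullet> pure_tensor V [x] \<bullet> pure_tensor V b" if "x \<in> carrier V" for x
      using ab that pure_append[of a "[x]"] pure_append[of "a @ [x]" b] by simp
    ultimately show ?thesis
      by (rule lin_cong[OF _ V.vsp])
  qed
  then show ?thesis by (simp add: multilin_def)
qed

end

section \<open>Tensor powers and whiskered operators\<close>

text \<open>The span of the pure tensors with factors in prescribed sets. Arbitrary sets are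
  allowed: singletons hold a factor fixed while an induction hypothesis acts on the others.\<close>

definition tspan :: "('k::field, 'v, 'm) module_scheme => 'v set list => ('v list \<Rightarrow>\<^sub>0 'k) set" where
  "tspan V Ss = lspan (tensor_algebra V) (pure_tensor V ` {xs. list_all2 (\<in>) xs Ss})"

text \<open>The operator \<open>id \<otimes> f \<otimes> id\<close> with \<open>f\<close> at
  position \<open>i\<close>, as one endomorphism of the whole tensor algebra, so that the number of
  factors to the right is not recorded. Words too short to contain the block go to zero, which keeps
  the map multilinear.\<close>

definition whisker :: "('k::field, 'v, 'm) module_scheme => nat => nat =>
    (('v list \<Rightarrow>\<^sub>0 'k) => ('v list \<Rightarrow>\<^sub>0 'k)) => ('v list \<Rightarrow>\<^sub>0 'k) => ('v list \<Rightarrow>\<^sub>0 'k)" where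
  "whisker V i j f = wlift (tensor_algebra V) (\<lambda>xs. if i + j \<le> length xs
     then pure_tensor V (take i xs) \<otimes>\<^bsub>tensor_algebra V\<^esub>
       (f (pure_tensor V (take j (drop i xs))) \<otimes>\<^bsub>tensor_algebra V\<^esub> pure_tensor V (drop (i + j) xs))
     else \<zero>\<^bsub>tensor_algebra V\<^esub>)"

definition tmap :: "('k::field, 'w, 'm) module_scheme => ('v => 'w) => ('v list \<Rightarrow>\<^sub>0 'k) => ('w list \<Rightarrow>\<^sub>0 'k)" where
  "tmap W f = wlift (tensor_algebra W) (\<lambda>xs. pure_tensor W (map f xs))"

abbreviation hom_power :: "('k::field, 'v, 'm) module_scheme => nat => nat => (('v list \<Rightarrow>\<^sub>0 'k) => ('v list \<Rightarrow>\<^sub>0 'k)) set"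
  where "hom_power V j k \<equiv> linear_maps (tensor_power V j) (tensor_power V k)"

text \<open>\<open>F\<close> acts through \<open>f\<close> on the \<open>j\<close> factors after the
  first \<open>i\<close>. A relation instead of a function, so that composites, sums and differences
  of whiskered operators are covered together with their local parts.\<close>

definition local_at :: "('k::field, 'v, 'm) module_scheme => nat => nat =>
    (('v list \<Rightarrow>\<^sub>0 'k) => ('v list \<Rightarrow>\<^sub>0 'k)) => (('v list \<Rightarrow>\<^sub>0 'k) => ('v list \<Rightarrow>\<^sub>0 'k)) => bool" where
  "local_at V i j F f \<longleftrightarrow> F \<in> linear_maps (tensor_algebra V) (tensor_algebra V) \<and>
     (\<forall>t\<in>carrier (tensor_power V j). f t \<in> carrier (tensor_algebra V)) \<and>
     (\<forall>s\<in>carrier (tensor_power V i). \<forall>t\<in>carrier (tensor_power V j). \<forall>u\<in>carrier (tensor_algebra V).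
       F (s \<otimes>\<^bsub>tensor_algebra V\<^esub> (t \<otimes>\<^bsub>tensor_algebra V\<^esub> u)) = s \<otimes>\<^bsub>tensor_algebra V\<^esub> (f t \<otimes>\<^bsub>tensor_algebra V\<^esub> u))"

lemma tensor_power_simps [simp]:
  "s \<oplus>\<^bsub>tensor_power V n\<^esub> t = s \<oplus>\<^bsub>tensor_algebra V\<^esub> t" "a \<odot>\<^bsub>tensor_power V n\<^esub> t = a \<odot>\<^bsub>tensor_algebra V\<^esub> t"
  "\<zero>\<^bsub>tensor_power V n\<^esub> = \<zero>\<^bsub>tensor_algebra V\<^esub>"
  by (simp_all add: tensor_power_def)

context tens begin

abbreviation "Rn n \<equiv> carrier (tensor_power V n)"
abbreviation "pt \<equiv> pure_tensor V"
abbreviation "C \<equiv> carrier V"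
abbreviation "Wh \<equiv> whisker V"

lemma class_image_span:
  assumes "S \<subseteq> wrd"
  shows "tensor_class V ` {f. keys f \<subseteq> S} = lspan TA (pt ` S)"
proof
  show "tensor_class V ` {f. keys f \<subseteq> S} \<subseteq> lspan TA (pt ` S)"
  proof clarify
    fix f :: "'v list \<Rightarrow>\<^sub>0 'k" assume "keys f \<subseteq> S"
    then show "tensor_class V f \<in> lspan TA (pt ` S)"
    proof (induction f rule: poly_mapping_span_induct)
      case zero
      have "tensor_class V 0 = zeroT"
        using lin_zero[OF tensor_class_linear F.vsp R.vsp] by (simp add: free_algebra_simps)
      then show ?case by (simp add: lspan.zero)
    next
      case (single x a)
      then have "x \<in> wrd" using assms by auto
      with single show ?case by (auto simp: tensor_class_single intro: lspan.intros)
    next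
      case (add f g)
      then have "f \<in> carrier Fr" "g \<in> carrier Fr" using assms by (auto simp: free_algebra_simps)
      with add show ?case
        using lin_add[OF tensor_class_linear, of f g] by (auto simp: free_algebra_simps intro: lspan.add)
    qed
  qed
  have "subsp Fr {f. keys f \<subseteq> S}"
    using assms by (intro subspI) (auto simp: free_algebra_simps(1,4,5,6) dest: subsetD[OF keys_add] subsetD[OF keys_scale])
  then have "subsp TA (tensor_class V ` {f. keys f \<subseteq> S})"
    by (rule subsp_image[OF tensor_class_linear F.vsp R.vsp])
  then show "lspan TA (pt ` S) \<subseteq> tensor_class V ` {f. keys f \<subseteq> S}"
    by (rule lspan_least) (auto simp: pure_tensor_def)
qed

lemma list_all2_wrd: "list_all2 (\<in>) xs Ss ==> Ss \<in> lists (Pow C) ==> xs \<in> wrd"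
  by (induction xs Ss rule: list_all2_induct) auto

lemma list_all2_replicate: "list_all2 (\<in>) xs (replicate n S) \<longleftrightarrow> xs \<in> lists S \<and> length xs = n"
  by (fastforce simp: list_all2_conv_all_nth in_lists_conv_set in_set_conv_nth)

lemma Rn_span: "Rn n = lspan TA (pt ` {xs \<in> wrd. length xs = n})"
  by (simp add: tensor_power_def class_image_span)

lemma Rn_tspan: "Rn n = tspan V (replicate n C)"
  by (simp add: Rn_span tspan_def list_all2_replicate)

lemma Rn_subsp: "subsp TA (Rn n)"
  unfolding Rn_span by (rule R.lspan_subsp) auto

lemma Rn_cl [simp, intro]: "t \<in> Rn n ==> t \<in> CT"
  using subsp_cl[OF Rn_subsp] .

lemma Rn_add [simp, intro]: "s \<in> Rn n ==> t \<in> Rn n ==> s \<oplus>\<^bsub>TA\<^esub> t \<in> Rn n"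
  by (rule subsp_add[OF Rn_subsp])

lemma Rn_smult [simp, intro]: "s \<in> Rn n ==> a \<odot>\<^bsub>TA\<^esub> s \<in> Rn n"
  by (rule subsp_smult[OF Rn_subsp])

lemma Rn_zero [simp, intro]: "zeroT \<in> Rn n"
  by (rule subsp_zero[OF Rn_subsp])

lemma Rn_pure [simp, intro]: "xs \<in> wrd ==> length xs = n ==> pt xs \<in> Rn n"
  unfolding Rn_span by (rule lspan.base) simp

lemma vspace_Rn: "vspace (tensor_power V n)"
  using R.subsp_vspace[OF Rn_subsp[of n]] by (simp add: tensor_power_def)

lemma tp_induct [consumes 1, case_names pure add smult]:
  assumes "t \<in> Rn n" "\<And>xs. xs \<in> wrd ==> length xs = n ==> Q (pt xs)"
    "\<And>s t. [|s \<in> Rn n; t \<in> Rn n; Q s; Q t|] ==> Q (s \<oplus>\<^bsub>TA\<^esub> t)"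
    "\<And>a s. [|s \<in> Rn n; Q s|] ==> Q (a \<odot>\<^bsub>TA\<^esub> s)"
  shows "Q t"
proof -
  \<comment> \<open>Some word of length \<open>n\<close> is needed to reach the zero tensor as a
    multiple of a pure one; the zero vector always supplies it.\<close>
  let ?z = "replicate n \<zero>\<^bsub>V\<^esub>"
  have "?z \<in> wrd" by (induction n) auto
  then have "Q (0 \<odot>\<^bsub>TA\<^esub> pt ?z)" by (intro assms) auto
  then have Q0: "Q zeroT" using \<open>?z \<in> wrd\<close> by simp
  have "t \<in> lspan TA (pt ` {xs \<in> wrd. length xs = n})" using assms(1) Rn_span by simp
  then have "t \<in> Rn n \<and> Q t"
    by induction (use assms Q0 in auto)
  then show ?thesis ..
qed

lemma tspan_subsp: "Ss \<in> lists (Pow C) ==> subsp TA (tspan V Ss)"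
  unfolding tspan_def by (rule R.lspan_subsp) (auto dest: list_all2_wrd)

lemma tspan_pure: "list_all2 (\<in>) xs Ss ==> pt xs \<in> tspan V Ss"
  unfolding tspan_def by (rule lspan.base) simp

lemma tspan_least:
  assumes "subsp TA T" "\<And>xs. list_all2 (\<in>) xs Ss ==> pt xs \<in> T"
  shows "tspan V Ss \<subseteq> T"
  unfolding tspan_def using assms by (intro lspan_least) auto

lemma tspan_mono: "list_all2 (\<subseteq>) Ss Ts ==> Ts \<in> lists (Pow C) ==> tspan V Ss \<subseteq> tspan V Ts"
proof (rule tspan_least[OF tspan_subsp], assumption, rule tspan_pure)
  fix xs assume "list_all2 (\<subseteq>) Ss Ts" "list_all2 (\<in>) xs Ss"
  then show "list_all2 (\<in>) xs Ts"
    unfolding list_all2_conv_all_nth by (metis subsetD)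
qed

lemma tspan_Rn:
  assumes "Ss \<in> lists (Pow C)"
  shows "tspan V Ss \<subseteq> Rn (length Ss)"
proof (rule tspan_least[OF Rn_subsp])
  fix xs assume "list_all2 (\<in>) xs Ss"
  then show "pt xs \<in> Rn (length Ss)"
    using list_all2_wrd[of xs Ss] assms list_all2_lengthD[of _ xs Ss] by (intro Rn_pure) simp_all
qed

lemma tspan_cl: "Ss \<in> lists (Pow C) ==> t \<in> tspan V Ss ==> t \<in> CT"
  by (rule subsp_cl[OF tspan_subsp])

lemma rmult_linear: "u \<in> CT ==> (\<lambda>s. s \<bullet> u) \<in> linear_maps TA TA"
  and lmult_linear: "u \<in> CT ==> (\<lambda>s. u \<bullet> s) \<in> linear_maps TA TA"
  by (auto intro!: linI simp: R.A.l_distr R.A.r_distr R.smult_mult R.mult_smult)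

lemma tspan_mult:
  assumes A: "As \<in> lists (Pow C)" and B: "Bs \<in> lists (Pow C)" and s: "s \<in> tspan V As" and t: "t \<in> tspan V Bs"
  shows "s \<bullet> t \<in> tspan V (As @ Bs)"
proof -
  have AB: "subsp TA (tspan V (As @ Bs))" using A B by (intro tspan_subsp) auto
  have 1: "pt xs \<bullet> t \<in> tspan V (As @ Bs)" if xs: "list_all2 (\<in>) xs As" for xs
  proof (rule lspan_image_subset[OF lmult_linear R.vsp R.vsp AB])
    show "pt xs \<in> CT" using list_all2_wrd[OF xs A] by simp
    show "t \<in> lspan TA (pt ` {xs. list_all2 (\<in>) xs Bs})" using t by (simp add: tspan_def)
    fix y assume "y \<in> pt ` {xs. list_all2 (\<in>) xs Bs}"
    then obtain ys where ys: "y = pt ys" "list_all2 (\<in>) ys Bs" by auto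
    then show "pt xs \<bullet> y \<in> tspan V (As @ Bs)"
      using xs list_all2_wrd[OF xs A] list_all2_wrd[OF ys(2) B]
      by (simp flip: pure_append add: list_all2_appendI tspan_pure)
  qed (use list_all2_wrd B in auto)
  show ?thesis
  proof (rule lspan_image_subset[OF rmult_linear R.vsp R.vsp AB])
    show "t \<in> CT" by (rule tspan_cl[OF B t])
    show "s \<in> lspan TA (pt ` {xs. list_all2 (\<in>) xs As})" using s by (simp add: tspan_def)
  qed (use list_all2_wrd A 1 in auto)
qed

lemma Rn_mult [simp, intro]: "s \<in> Rn m ==> t \<in> Rn n ==> s \<bullet> t \<in> Rn (m + n)"
  using tspan_mult[of "replicate m C" "replicate n C" s t]
  by (simp add: Rn_tspan replicate_add) (auto simp: in_lists_conv_set)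

lemma Rn_one [simp, intro]: "oneT \<in> Rn 0"
  using Rn_pure[of "[]" 0] by (simp add: pure_Nil)

lemma pure_linear_Rn: "[|a \<in> wrd; b \<in> wrd; n = length a + length b + 1|] ==> (\<lambda>x. pt (a @ x # b)) \<in> linear_maps V (tensor_power V n)"
proof -
  assume ab: "a \<in> wrd" "b \<in> wrd" "n = length a + length b + 1"
  note l = multilin_linear[OF pure_multilin ab(1,2)]
  show ?thesis
    using ab by (intro linI) (simp_all add: lin_add[OF l] lin_smult[OF l])
qed

lemma lin_rmult: "f \<in> linear_maps V TA ==> u \<in> CT ==> (\<lambda>x. f x \<bullet> u) \<in> linear_maps V TA"
  and lin_lmult: "f \<in> linear_maps V TA ==> u \<in> CT ==> (\<lambda>x. u \<bullet> f x) \<in> linear_maps V TA"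
  using lin_comp[OF _ rmult_linear] lin_comp[OF _ lmult_linear] by blast+

section \<open>Operators inserted at a position of a tensor\<close>

lemma hom_cl: "f \<in> hom_power V j k ==> t \<in> Rn j ==> f t \<in> Rn k"
  by (rule lin_cl)

lemma hom_linear_pure:
  assumes "f \<in> hom_power V j k" "a \<in> wrd" "b \<in> wrd" "j = length a + length b + 1"
  shows "(\<lambda>x. f (pt (a @ x # b))) \<in> linear_maps V TA"
proof -
  have "(\<lambda>x. f (pt (a @ x # b))) \<in> linear_maps V (tensor_power V k)"
    by (rule lin_comp[OF pure_linear_Rn[OF assms(2-4)] assms(1)])
  then show ?thesis by (auto simp: linear_maps_def)
qed

lemma wrd_take [simp]: "xs \<in> wrd ==> take i xs \<in> wrd" and wrd_drop [simp]: "xs \<in> wrd ==> drop i xs \<in> wrd"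
  by (auto simp: in_lists_conv_set dest: in_set_takeD in_set_dropD)

text \<open>The varying letter lies in a word that is too short, to the left of the block, inside
  the block or to its right; linearity of \<open>f\<close> enters in the third case.\<close>

lemma whisker_multilin:
  assumes f: "f \<in> hom_power V j k"
  shows "multilin V TA (\<lambda>xs. if i + j \<le> length xs
     then pt (take i xs) \<bullet> (f (pt (take j (drop i xs))) \<bullet> pt (drop (i + j) xs)) else zeroT)"
    (is "multilin V TA ?\<Phi>")
proof -
  have fc: "f (pt xs) \<in> CT" if "xs \<in> wrd" "length xs = j" for xs
    using hom_cl[OF f Rn_pure[OF that]] by simp
  have pl: "(\<lambda>x. pt (a @ x # b)) \<in> linear_maps V TA" if "a \<in> wrd" "b \<in> wrd" for a b
    by (rule multilin_linear[OF pure_multilin that])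
  have "(\<lambda>x. ?\<Phi> (a @ x # b)) \<in> linear_maps V TA" if ab: "a \<in> wrd" "b \<in> wrd" for a b
  proof -
    \<comment> \<open>The cases depend on lengths only; \<open>undefined\<close> holds the place of
      the varying letter.\<close>
    consider "length (a @ undefined # b) < i + j" | "i + j \<le> length (a @ undefined # b)" "length a < i"
      | "i + j \<le> length (a @ undefined # b)" "i \<le> length a" "length a < i + j"
      | "i + j \<le> length (a @ undefined # b)" "i + j \<le> length a" by linarith
    then show ?thesis
    proof cases
      case 1
      then show ?thesis using linear_zero_map[OF R.vsp] by simp
    next
      case 2
      define p where "p = i - length a - 1"
      have i: "i = length a + Suc p" using 2 by (simp add: p_def)
      have "(\<lambda>x. pt (a @ x # take p b) \<bullet> (f (pt (take j (drop p b))) \<bullet> pt (drop (p + j) b))) \<in> linear_maps V TA"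
        using ab 2 i by (intro lin_rmult pl R.mult_cl fc) auto
      then show ?thesis using 2 unfolding i by (simp add: add.commute)
    next
      case 3
      define p where "p = length a - i"
      define q where "q = j - p - 1"
      have j: "j = p + Suc q" "length a = i + p" using 3 by (simp_all add: p_def q_def)
      have "(\<lambda>x. pt (take i a) \<bullet> (f (pt (drop i a @ x # take q b)) \<bullet> pt (drop q b))) \<in> linear_maps V TA"
        using ab 3 j by (intro lin_lmult lin_rmult hom_linear_pure[OF f]) auto
      then show ?thesis using 3 j by simp
    next
      case 4
      have "(\<lambda>x. pt (take i a) \<bullet> (f (pt (take j (drop i a))) \<bullet> pt (drop (i + j) a @ x # b))) \<in> linear_maps V TA"
        using ab 4 by (intro lin_lmult pl fc) auto
      then show ?thesis using 4 by simp
    qed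
  qed
  moreover have "?\<Phi> [] \<in> CT" using fc[of "[]"] by auto
  ultimately show ?thesis unfolding multilin_def by blast
qed

lemma whisker_linear: "f \<in> hom_power V j k ==> Wh i j f \<in> linear_maps TA TA"
  unfolding whisker_def by (rule wlift_linear(1)[OF R.vsp whisker_multilin])

lemma whisker_cl [simp]: "f \<in> hom_power V j k ==> t \<in> CT ==> Wh i j f t \<in> CT"
  by (rule lin_cl[OF whisker_linear])

lemma whisker_pure:
  assumes "f \<in> hom_power V j k" "a \<in> wrd" "b \<in> wrd" "c \<in> wrd" "length a = i" "length b = j"
  shows "Wh i j f (pt (a @ b @ c)) = pt a \<bullet> (f (pt b) \<bullet> pt c)"
  unfolding whisker_def using assms
  by (subst wlift_linear(3)[OF R.vsp whisker_multilin]) auto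

text \<open>The three factors are extended from pure tensors to arbitrary ones in the order
  \<open>u\<close>, \<open>t\<close>, \<open>s\<close>, by linearity in each.\<close>

lemma whisker_key:
  assumes f: "f \<in> hom_power V j k" and s: "s \<in> Rn i" and t: "t \<in> Rn j" and u: "u \<in> CT"
  shows "Wh i j f (s \<bullet> (t \<bullet> u)) = s \<bullet> (f t \<bullet> u)"
proof -
  note l = whisker_linear[OF f, of i]
  note fc = Rn_cl[OF hom_cl[OF f]]
  have 1: "Wh i j f (pt a \<bullet> (pt b \<bullet> u)) = pt a \<bullet> (f (pt b) \<bullet> u)"
    if "a \<in> wrd" "length a = i" "b \<in> wrd" "length b = j" for a b
    using u
  proof (induction rule: tensor_induct)
    case (pure c)
    then show ?case using whisker_pure[OF f, of a b c i] that by (simp add: pure_append)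
  qed (use that fc[OF Rn_pure[of b]] in \<open>auto simp: R.A.r_distr R.mult_smult lin_add[OF l] lin_smult[OF l]\<close>)
  have 2: "Wh i j f (pt a \<bullet> (t \<bullet> u)) = pt a \<bullet> (f t \<bullet> u)" if "a \<in> wrd" "length a = i" for a
    using t
  proof (induction rule: tp_induct)
    case (pure b)
    then show ?case using 1 that by simp
  qed (use that u fc in \<open>auto simp: R.A.r_distr R.mult_smult R.A.l_distr R.smult_mult lin_add[OF l] lin_smult[OF l]
      lin_add[OF f, simplified] lin_smult[OF f, simplified]\<close>)
  show ?thesis
    using s
  proof (induction rule: tp_induct)
    case (pure a)
    then show ?case using 2 by simp
  qed (use t u fc in \<open>auto simp: R.A.l_distr R.smult_mult lin_add[OF l] lin_smult[OF l]\<close>)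
qed

lemma whisker_0: "f \<in> hom_power V j k ==> t \<in> Rn j ==> Wh 0 j f t = f t"
  using whisker_key[of f j k "oneT" 0 t "oneT"] hom_cl[of f j k t] by simp

lemma split_wrd:
  assumes "xs \<in> wrd" "i + j \<le> length xs"
  shows "\<exists>a b c. xs = a @ b @ c \<and> a \<in> wrd \<and> b \<in> wrd \<and> c \<in> wrd \<and> length a = i \<and> length b = j \<and> length xs = i + j + length c"
proof -
  have "drop (i + j) xs = drop j (drop i xs)" by (simp add: add.commute)
  then have "xs = take i xs @ take j (drop i xs) @ drop (i + j) xs" by (metis append_take_drop_id)
  then show ?thesis
    using assms
    by (rule_tac exI[of _ "take i xs"], rule_tac exI[of _ "take j (drop i xs)"],
        rule_tac exI[of _ "drop (i + j) xs"]) simp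
qed

lemma whisker_deg:
  assumes f: "f \<in> hom_power V j k" and t: "t \<in> Rn n" and n: "n = i + j + d"
  shows "Wh i j f t \<in> Rn (i + k + d)"
  using t
proof (induction rule: tp_induct)
  case (pure xs)
  have "i + j \<le> length xs" using pure n by simp
  then obtain a b1 b2 where ab: "xs = a @ b1 @ b2" "a \<in> wrd" "length a = i"
    and b: "b1 \<in> wrd" "b2 \<in> wrd" "length b1 = j" "length xs = i + j + length b2"
    using split_wrd[OF pure(1)] by blast
  have d: "length b2 = d" using b pure n by simp
  have "Wh i j f (pt xs) = pt a \<bullet> (f (pt b1) \<bullet> pt b2)"
    using whisker_pure[OF f ab(2) b(1,2)] ab b by simp
  also have "\<dots> \<in> Rn (i + (k + d))"
    using ab b d by (intro Rn_mult hom_cl[OF f] Rn_pure)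
  finally show ?case by (simp add: add.assoc)
qed (simp_all add: lin_add[OF whisker_linear[OF f]] lin_smult[OF whisker_linear[OF f]])

lemma whisker_hom: "f \<in> hom_power V j k ==> Wh i j f \<in> hom_power V (i + j + d) (i + k + d)"
  using whisker_linear[of f j k i]
  by (intro linI) (auto simp: whisker_deg lin_add lin_smult)

lemma whisker_short:
  assumes f: "f \<in> hom_power V j k" and t: "t \<in> Rn n" and n: "n < i + j"
  shows "Wh i j f t = zeroT"
  using t
proof (induction rule: tp_induct)
  case (pure xs)
  then show ?case
    unfolding whisker_def using n
    by (subst wlift_linear(3)[OF R.vsp whisker_multilin[OF f]]) auto
qed (simp_all add: lin_add[OF whisker_linear[OF f]] lin_smult[OF whisker_linear[OF f]])

lemma whisker_zero [simp]: "f \<in> hom_power V j k ==> Wh i j f zeroT = zeroT"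
  by (rule lin_zero[OF whisker_linear R.vsp R.vsp])

lemma whisker_left:
  assumes f: "f \<in> hom_power V j k" and s: "s \<in> Rn a" and t: "t \<in> CT"
  shows "Wh (a + i) j f (s \<bullet> t) = s \<bullet> Wh i j f t"
  using t
proof (induction rule: tensor_induct)
  case (pure xs)
  show ?case
  proof (cases "i + j \<le> length xs")
    case True
    obtain x y1 y2 where x: "xs = x @ y1 @ y2" "x \<in> wrd" "length x = i"
        and y: "y1 \<in> wrd" "y2 \<in> wrd" "length y1 = j" "length xs = i + j + length y2"
      using split_wrd[OF pure(1) True] by blast
    have "s \<bullet> pt xs = (s \<bullet> pt x) \<bullet> (pt y1 \<bullet> pt y2)"
      using s x y by (simp add: pure_append R.A.m_assoc)
    also have "Wh (a + i) j f \<dots> = (s \<bullet> pt x) \<bullet> (f (pt y1) \<bullet> pt y2)"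
      using s x y by (intro whisker_key[OF f]) auto
    also have "\<dots> = s \<bullet> Wh i j f (pt xs)"
      using s x y whisker_pure[OF f x(2) y(1,2)] Rn_cl[OF hom_cl[OF f Rn_pure[of y1]]] by (simp add: R.A.m_assoc)
    finally show ?thesis .
  next
    case False
    then have "Wh i j f (pt xs) = zeroT" "Wh (a + i) j f (s \<bullet> pt xs) = zeroT"
      using pure s by (auto intro!: whisker_short[OF f])
    then show ?thesis using s by simp
  qed
qed (use s f in \<open>simp_all add: lin_add[OF whisker_linear[OF f]] lin_smult[OF whisker_linear[OF f]] R.A.r_distr R.mult_smult\<close>)

lemma whisker_right:
  assumes f: "f \<in> hom_power V j k" and t: "t \<in> Rn n" and n: "i + j \<le> n" and u: "u \<in> CT"
  shows "Wh i j f (t \<bullet> u) = Wh i j f t \<bullet> u"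
  using t
proof (induction rule: tp_induct)
  case (pure xs)
  obtain x y1 y2 where x: "xs = x @ y1 @ y2" "x \<in> wrd" "length x = i"
        and y: "y1 \<in> wrd" "y2 \<in> wrd" "length y1 = j" "length xs = i + j + length y2"
      using split_wrd[OF pure(1), of i j] n unfolding pure(2) by blast
  have fc: "f (pt y1) \<in> CT" using hom_cl[OF f Rn_pure[of y1]] y by simp
  have "pt xs \<bullet> u = pt x \<bullet> (pt y1 \<bullet> (pt y2 \<bullet> u))"
    using u x y by (simp add: pure_append R.A.m_assoc)
  also have "Wh i j f \<dots> = pt x \<bullet> (f (pt y1) \<bullet> (pt y2 \<bullet> u))"
    using u x y by (intro whisker_key[OF f]) auto
  also have "\<dots> = Wh i j f (pt xs) \<bullet> u"
    using u x y whisker_pure[OF f x(2) y(1,2)] fc by (simp add: R.A.m_assoc)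
  finally show ?case .
qed (use u f in \<open>simp_all add: lin_add[OF whisker_linear[OF f]] lin_smult[OF whisker_linear[OF f]] R.A.l_distr R.smult_mult\<close>)

text \<open>Interchange law: the two blocks are disjoint, and the right one is renumbered because
  \<open>f\<close> turns \<open>j\<close> factors into \<open>k\<close>.\<close>

lemma whisker_commute:
  assumes f: "f \<in> hom_power V j k" and g: "g \<in> hom_power V l m" and t: "t \<in> CT"
  shows "Wh i j f (Wh (i + j + d) l g t) = Wh (i + k + d) l g (Wh i j f t)"
  using t
proof (induction rule: tensor_induct)
  case (pure xs)
  note lf = whisker_linear[OF f, of i] and lg = whisker_linear[OF g]
  show ?case
  proof (cases "i + j \<le> length xs")
    case True
    obtain x y1 y2 where x: "xs = x @ y1 @ y2" "x \<in> wrd" "length x = i"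
        and y: "y1 \<in> wrd" "y2 \<in> wrd" "length y1 = j" "length xs = i + j + length y2"
      using split_wrd[OF pure(1) True] by blast
    have fc: "f (pt y1) \<in> Rn k" using hom_cl[OF f Rn_pure[of y1]] y by simp
    have "Wh (i + j + d) l g (pt xs) = (pt x \<bullet> pt y1) \<bullet> Wh d l g (pt y2)"
      using whisker_left[OF g, of "pt x \<bullet> pt y1" "i + j" "pt y2" d] x y by (simp add: pure_append R.A.m_assoc)
    also have "\<dots> = pt x \<bullet> (pt y1 \<bullet> Wh d l g (pt y2))"
      using x y g by (simp add: R.A.m_assoc)
    also have "Wh i j f \<dots> = pt x \<bullet> (f (pt y1) \<bullet> Wh d l g (pt y2))"
      using x y g by (intro whisker_key[OF f]) auto
    finally have 1: "Wh i j f (Wh (i + j + d) l g (pt xs)) = pt x \<bullet> (f (pt y1) \<bullet> Wh d l g (pt y2))" .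
    have "Wh i j f (pt xs) = (pt x \<bullet> f (pt y1)) \<bullet> pt y2"
      using whisker_pure[OF f x(2) y(1,2)] x y fc by (simp add: R.A.m_assoc)
    also have "Wh (i + k + d) l g \<dots> = (pt x \<bullet> f (pt y1)) \<bullet> Wh d l g (pt y2)"
      using x y fc by (intro whisker_left[OF g]) auto
    finally show ?thesis using 1 x y fc g by (simp add: R.A.m_assoc)
  next
    case False
    then have "Wh i j f (pt xs) = zeroT" "Wh (i + j + d) l g (pt xs) = zeroT"
      using pure by (auto intro!: whisker_short[OF f] whisker_short[OF g])
    then show ?thesis using f g by simp
  qed
qed (use f g in \<open>simp_all add: lin_add[OF whisker_linear[OF f]] lin_smult[OF whisker_linear[OF f]]
    lin_add[OF whisker_linear[OF g]] lin_smult[OF whisker_linear[OF g]]\<close>)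

section \<open>Operators that act on consecutive factors\<close>

lemma local_at_key: "[|local_at V i j F f; s \<in> Rn i; t \<in> Rn j; u \<in> CT|] ==> F (s \<bullet> (t \<bullet> u)) = s \<bullet> (f t \<bullet> u)"
  and local_at_linear: "local_at V i j F f ==> F \<in> linear_maps TA TA"
  and local_at_cl: "local_at V i j F f ==> t \<in> Rn j ==> f t \<in> CT"
  by (auto simp: local_at_def)

lemma local_at_whisker: "f \<in> hom_power V j k ==> local_at V i j (Wh i j f) f"
  by (auto simp: local_at_def whisker_linear whisker_key dest: hom_cl)

lemma local_at_shift:
  assumes f: "f \<in> hom_power V j k" and n: "a + j \<le> n"
  shows "local_at V i n (Wh (i + a) j f) (Wh a j f)"
  unfolding local_at_def using whisker_left[OF f] whisker_right[OF f _ n] f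
  by (auto simp: whisker_linear)

lemma local_at_comp:
  assumes "local_at V i k G g" "local_at V i j F f" "\<And>t. t \<in> Rn j ==> f t \<in> Rn k"
  shows "local_at V i j (\<lambda>t. G (F t)) (\<lambda>t. g (f t))"
  using assms unfolding local_at_def by (auto intro: lin_comp)

lemma local_at_sum:
  assumes "local_at V i j G g" "local_at V i j F f"
  shows "local_at V i j (\<lambda>t. G t \<oplus>\<^bsub>TA\<^esub> F t) (\<lambda>t. g t \<oplus>\<^bsub>TA\<^esub> f t)"
  using assms unfolding local_at_def
  by (auto intro!: linear_sum R.vsp simp: R.A.l_distr R.A.r_distr)

lemma local_at_diff:
  assumes "local_at V i j G g" "local_at V i j F f"
  shows "local_at V i j (\<lambda>t. G t \<ominus>\<^bsub>TA\<^esub> F t) (\<lambda>t. g t \<ominus>\<^bsub>TA\<^esub> f t)"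
proof -
  have dist: "s \<bullet> ((x \<ominus>\<^bsub>TA\<^esub> y) \<bullet> u) = s \<bullet> (x \<bullet> u) \<ominus>\<^bsub>TA\<^esub> s \<bullet> (y \<bullet> u)"
    if "s \<in> CT" "x \<in> CT" "y \<in> CT" "u \<in> CT" for s x y u
    using that by (simp add: a_minus_def R.A.l_distr R.A.r_distr R.A.l_minus R.A.r_minus)
  show ?thesis
    using assms unfolding local_at_def
    by (auto intro!: lin_diff R.vsp simp: dist)
qed

lemma local_at_id: "local_at V i j (\<lambda>t. t) (\<lambda>t. t)"
  by (auto simp: local_at_def intro: linI)

lemma tspan_append_cases:
  assumes "list_all2 (\<in>) xs (As @ Bs @ Cs)"
  obtains a b c where "xs = a @ b @ c" "list_all2 (\<in>) a As" "list_all2 (\<in>) b Bs" "list_all2 (\<in>) c Cs"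
  using assms by (auto simp: list_all2_append2)

text \<open>Moves a containment from a long tensor to the factors on which the operator acts. With
  \<open>local_at_eq\<close> and \<open>tmap_local_at\<close> it allows statements about operators
  to be proved in their smallest degree.\<close>

lemma local_at_tspan:
  assumes F: "local_at V i j F f" and ok: "As @ Bs @ Cs \<in> lists (Pow C)" "Bs' \<in> lists (Pow C)"
    and len: "length As = i" "length Bs = j"
    and f: "\<And>t. t \<in> tspan V Bs ==> f t \<in> tspan V Bs'"
    and t: "t \<in> tspan V (As @ Bs @ Cs)"
  shows "F t \<in> tspan V (As @ Bs' @ Cs)"
proof (rule lspan_image_subset[OF local_at_linear[OF F] R.vsp R.vsp])
  show "subsp TA (tspan V (As @ Bs' @ Cs))" using ok by (intro tspan_subsp) simp
  show "t \<in> lspan TA (pt ` {xs. list_all2 (\<in>) xs (As @ Bs @ Cs)})" using t by (simp add: tspan_def)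
  show "pt ` {xs. list_all2 (\<in>) xs (As @ Bs @ Cs)} \<subseteq> CT" using ok list_all2_wrd by blast
  fix x assume "x \<in> pt ` {xs. list_all2 (\<in>) xs (As @ Bs @ Cs)}"
  then obtain a b c where x: "x = pt (a @ b @ c)" and l: "list_all2 (\<in>) a As" "list_all2 (\<in>) b Bs" "list_all2 (\<in>) c Cs"
    by (auto elim!: tspan_append_cases)
  have w: "a \<in> wrd" "b \<in> wrd" "c \<in> wrd" using l ok list_all2_wrd by auto
  have "F x = pt a \<bullet> (f (pt b) \<bullet> pt c)"
    unfolding x using w l len by (simp add: pure_append local_at_key[OF F] list_all2_lengthD Rn_pure)
  also have "\<dots> \<in> tspan V (As @ Bs' @ Cs)"
    using l ok by (intro tspan_mult f tspan_pure) auto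
  finally show "F x \<in> tspan V (As @ Bs' @ Cs)" .
qed

lemma local_at_eq:
  assumes F: "local_at V i j F f" and G: "local_at V i j G g" and ok: "As @ Bs @ Cs \<in> lists (Pow C)"
    and len: "length As = i" "length Bs = j"
    and fg: "\<And>t. t \<in> tspan V Bs ==> f t = g t"
    and t: "t \<in> tspan V (As @ Bs @ Cs)"
  shows "F t = G t"
proof (rule lspan_eq[OF local_at_linear[OF F] local_at_linear[OF G] R.vsp R.vsp])
  show "t \<in> lspan TA (pt ` {xs. list_all2 (\<in>) xs (As @ Bs @ Cs)})" using t by (simp add: tspan_def)
  show "pt ` {xs. list_all2 (\<in>) xs (As @ Bs @ Cs)} \<subseteq> CT" using ok list_all2_wrd by blast
  fix x assume "x \<in> pt ` {xs. list_all2 (\<in>) xs (As @ Bs @ Cs)}"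
  then obtain a b c where x: "x = pt (a @ b @ c)" and l: "list_all2 (\<in>) a As" "list_all2 (\<in>) b Bs" "list_all2 (\<in>) c Cs"
    by (auto elim!: tspan_append_cases)
  have w: "a \<in> wrd" "b \<in> wrd" "c \<in> wrd" using l ok list_all2_wrd by auto
  have "F x = pt a \<bullet> (f (pt b) \<bullet> pt c)" "G x = pt a \<bullet> (g (pt b) \<bullet> pt c)"
    unfolding x using w l len by (simp_all add: pure_append local_at_key[OF F] local_at_key[OF G] list_all2_lengthD Rn_pure)
  then show "F x = G x" using fg[OF tspan_pure[OF l(2)]] by simp
qed

lemma local_at_eq_Rn:
  assumes F: "local_at V i j F f" and G: "local_at V i j G g" and n: "i + j \<le> n"
    and fg: "\<And>t. t \<in> Rn j ==> f t = g t" and t: "t \<in> Rn n"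
  shows "F t = G t"
proof -
  obtain d where d: "n = i + (j + d)" using n by (metis add.assoc le_add_diff_inverse)
  show ?thesis
  proof (rule local_at_eq[OF F G])
    show "replicate i C @ replicate j C @ replicate d C \<in> lists (Pow C)"
      by (auto simp: in_lists_conv_set)
    show "t \<in> tspan V (replicate i C @ replicate j C @ replicate d C)"
      using t by (simp add: Rn_tspan d flip: replicate_add)
  qed (auto simp: fg simp flip: Rn_tspan)
qed

end

section \<open>Functoriality, multilinear maps and kernels\<close>

lemma tensI: "vspace V ==> tens V"
  by (rule tens.intro) (rule vspace.vs)

context
  fixes V :: "('k::field, 'v, 'm) module_scheme" and W :: "('k, 'w, 'n) module_scheme" and f :: "'v => 'w"
  assumes V: "tens V" and W: "tens W" and f: "f \<in> linear_maps V W"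
begin

interpretation V: tens V by (rule V)
interpretation W: tens W by (rule W)

lemma map_wrd: "xs \<in> lists (carrier V) ==> map f xs \<in> lists (carrier W)"
  using lin_cl[OF f] by (auto simp: in_lists_conv_set)

lemma tmap_multilin: "multilin V (tensor_algebra W) (\<lambda>xs. pure_tensor W (map f xs))"
  unfolding multilin_def
proof (intro conjI ballI)
  fix a b assume "a \<in> lists (carrier V)" "b \<in> lists (carrier V)"
  then show "(\<lambda>x. pure_tensor W (map f (a @ x # b))) \<in> linear_maps V (tensor_algebra W)"
    using lin_comp[OF f multilin_linear[OF W.pure_multilin], of "map f a" "map f b"] by (simp add: map_wrd)
qed simp

lemma tmap_linear: "tmap W f \<in> linear_maps (tensor_algebra V) (tensor_algebra W)"
  unfolding tmap_def by (rule V.wlift_linear(1)[OF W.R.vsp tmap_multilin])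

lemma tmap_pure: "xs \<in> lists (carrier V) ==> tmap W f (pure_tensor V xs) = pure_tensor W (map f xs)"
  unfolding tmap_def by (rule V.wlift_linear(3)[OF W.R.vsp tmap_multilin])

lemmas tmap_cl = lin_cl[OF tmap_linear] and tmap_add = lin_add[OF tmap_linear]
  and tmap_smult = lin_smult[OF tmap_linear]
  and tmap_zero = lin_zero[OF tmap_linear V.R.vsp W.R.vsp]
  and tmap_minus = lin_minus[OF tmap_linear V.R.vsp W.R.vsp]

lemma tmap_mult:
  assumes s: "s \<in> carrier (tensor_algebra V)" and t: "t \<in> carrier (tensor_algebra V)"
  shows "tmap W f (s \<otimes>\<^bsub>tensor_algebra V\<^esub> t) = tmap W f s \<otimes>\<^bsub>tensor_algebra W\<^esub> tmap W f t"
proof -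
  have 1: "tmap W f (pure_tensor V xs \<otimes>\<^bsub>tensor_algebra V\<^esub> t) = tmap W f (pure_tensor V xs) \<otimes>\<^bsub>tensor_algebra W\<^esub> tmap W f t"
    if xs: "xs \<in> lists (carrier V)" for xs
    using t
  proof (induction rule: V.tensor_induct)
    case (pure ys)
    then show ?case using xs
      by (simp flip: V.pure_append add: tmap_pure) (simp add: W.pure_append map_wrd)
  qed (use xs in \<open>simp_all add: V.R.A.r_distr V.R.mult_smult tmap_add tmap_smult tmap_cl W.R.A.r_distr W.R.mult_smult\<close>)
  show ?thesis
    using s by (induction rule: V.tensor_induct)
      (use t in \<open>simp_all add: 1 V.R.A.l_distr V.R.smult_mult tmap_add tmap_smult tmap_cl W.R.A.l_distr W.R.smult_mult\<close>)
qed

lemma tmap_tspan: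
  assumes Ss: "Ss \<in> lists (Pow (carrier V))" and Ts: "Ts \<in> lists (Pow (carrier W))"
    and ST: "list_all2 (\<lambda>S T. f ` S \<subseteq> T) Ss Ts" and t: "t \<in> tspan V Ss"
  shows "tmap W f t \<in> tspan W Ts"
proof (rule lspan_image_subset[OF tmap_linear V.R.vsp W.R.vsp W.tspan_subsp[OF Ts]])
  show "t \<in> lspan (tensor_algebra V) (pure_tensor V ` {xs. list_all2 (\<in>) xs Ss})"
    using t by (simp add: tspan_def)
  fix x assume "x \<in> pure_tensor V ` {xs. list_all2 (\<in>) xs Ss}"
  then obtain xs where xs: "x = pure_tensor V xs" "list_all2 (\<in>) xs Ss" by auto
  have "list_all2 (\<in>) (map f xs) Ts"
    using xs(2) ST by (fastforce simp: list_all2_conv_all_nth)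
  then show "tmap W f x \<in> tspan W Ts"
    using xs V.list_all2_wrd[OF xs(2) Ss] by (simp add: tmap_pure W.tspan_pure)
qed (use V.list_all2_wrd Ss in auto)

lemma tmap_Rn:
  assumes "t \<in> carrier (tensor_power V n)"
  shows "tmap W f t \<in> carrier (tensor_power W n)"
  using assms
  by (induction rule: V.tp_induct) (auto simp: tmap_pure tmap_add tmap_smult map_wrd)

lemma tmap_local_at:
  assumes F: "local_at V i j F h" and G: "local_at W i j G g" and ok: "As @ Bs @ Cs \<in> lists (Pow (carrier V))"
    and len: "length As = i" "length Bs = j"
    and fg: "\<And>t. t \<in> tspan V Bs ==> tmap W f (h t) = g (tmap W f t)"
    and t: "t \<in> tspan V (As @ Bs @ Cs)"
  shows "tmap W f (F t) = G (tmap W f t)"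
proof (rule lspan_eq[OF lin_comp[OF V.local_at_linear[OF F] tmap_linear] lin_comp[OF tmap_linear W.local_at_linear[OF G]]
      V.R.vsp W.R.vsp])
  show "t \<in> lspan V.TA (V.pt ` {xs. list_all2 (\<in>) xs (As @ Bs @ Cs)})" using t by (simp add: tspan_def)
  show "V.pt ` {xs. list_all2 (\<in>) xs (As @ Bs @ Cs)} \<subseteq> V.CT" using ok V.list_all2_wrd by blast
  fix x assume "x \<in> V.pt ` {xs. list_all2 (\<in>) xs (As @ Bs @ Cs)}"
  then obtain a b c where x: "x = V.pt (a @ b @ c)" and l: "list_all2 (\<in>) a As" "list_all2 (\<in>) b Bs" "list_all2 (\<in>) c Cs"
    by (auto elim!: V.tspan_append_cases)
  have w: "a \<in> V.wrd" "b \<in> V.wrd" "c \<in> V.wrd" using l ok V.list_all2_wrd by auto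
  have la: "length a = i" "length b = j" using l len by (auto dest: list_all2_lengthD)
  have hb: "h (V.pt b) \<in> V.CT" using V.local_at_cl[OF F] w la by simp
  have "tmap W f (F x) = tmap W f (V.pt a) \<otimes>\<^bsub>tensor_algebra W\<^esub> (tmap W f (h (V.pt b)) \<otimes>\<^bsub>tensor_algebra W\<^esub> tmap W f (V.pt c))"
    unfolding x using w la hb by (simp add: V.pure_append V.local_at_key[OF F] tmap_mult)
  also have "tmap W f (h (V.pt b)) = g (tmap W f (V.pt b))" by (rule fg[OF V.tspan_pure[OF l(2)]])
  also have "tmap W f (V.pt a) \<otimes>\<^bsub>tensor_algebra W\<^esub> (g (tmap W f (V.pt b)) \<otimes>\<^bsub>tensor_algebra W\<^esub> tmap W f (V.pt c)) = G (tmap W f x)"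
    unfolding x using w la by (simp add: V.pure_append tmap_mult W.local_at_key[OF G] tmap_cl tmap_Rn)
  finally show "tmap W f (F x) = G (tmap W f x)" .
qed

lemma tmap_local_at_Rn:
  assumes F: "local_at V i j F h" and G: "local_at W i j G g" and n: "i + j \<le> n"
    and fg: "\<And>t. t \<in> carrier (tensor_power V j) ==> tmap W f (h t) = g (tmap W f t)"
    and t: "t \<in> carrier (tensor_power V n)"
  shows "tmap W f (F t) = G (tmap W f t)"
proof -
  obtain d where d: "n = i + (j + d)" using n by (metis add.assoc le_add_diff_inverse)
  show ?thesis
  proof (rule tmap_local_at[OF F G])
    show "replicate i (carrier V) @ replicate j (carrier V) @ replicate d (carrier V) \<in> lists (Pow (carrier V))"
      by (auto simp: in_lists_conv_set)
    show "t \<in> tspan V (replicate i (carrier V) @ replicate j (carrier V) @ replicate d (carrier V))"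
      using t by (simp add: V.Rn_tspan d flip: replicate_add)
  qed (auto simp: fg simp flip: V.Rn_tspan)
qed

text \<open>The context fixes the map \<open>f\<close> only, so the basic facts on
  \<open>tmap W g\<close> enter as hypotheses; \<open>tmap_cong_tspan\<close> supplies them outside
  the context.\<close>

lemma tmap_eq_tspan:
  assumes g: "g \<in> linear_maps V W" and Ss: "Ss \<in> lists (Pow (carrier V))"
    and eq: "\<And>S x. S \<in> set Ss ==> x \<in> S ==> g x = f x" and t: "t \<in> tspan V Ss"
    and tg: "tmap W g \<in> linear_maps (tensor_algebra V) (tensor_algebra W)"
      "\<And>xs. xs \<in> lists (carrier V) ==> tmap W g (pure_tensor V xs) = pure_tensor W (map g xs)"
  shows "tmap W g t = tmap W f t"
proof (rule lspan_eq[OF tg(1) tmap_linear V.R.vsp W.R.vsp])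
  show "t \<in> lspan V.TA (V.pt ` {xs. list_all2 (\<in>) xs Ss})" using t by (simp add: tspan_def)
  show "V.pt ` {xs. list_all2 (\<in>) xs Ss} \<subseteq> V.CT" using Ss V.list_all2_wrd by blast
  fix x assume "x \<in> V.pt ` {xs. list_all2 (\<in>) xs Ss}"
  then obtain xs where xs: "x = V.pt xs" "list_all2 (\<in>) xs Ss" by auto
  have "map g xs = map f xs"
    using xs(2) eq[OF nth_mem] by (intro nth_equalityI) (auto simp: list_all2_conv_all_nth)
  then show "tmap W g x = tmap W f x"
    unfolding xs(1) tmap_pure[OF V.list_all2_wrd[OF xs(2) Ss]] tg(2)[OF V.list_all2_wrd[OF xs(2) Ss]] by (simp only:)
qed

end

lemma tmap_comp:
  assumes V: "tens V" and W: "tens W" and U: "tens U" and f: "f \<in> linear_maps V W" and g: "g \<in> linear_maps W U"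
    and t: "t \<in> carrier (tensor_algebra V)"
  shows "tmap U g (tmap W f t) = tmap U (\<lambda>x. g (f x)) t"
proof -
  interpret V: tens V by fact
  have gf: "(\<lambda>x. g (f x)) \<in> linear_maps V U" by (rule lin_comp[OF f g])
  show ?thesis
  proof (rule V.linear_eq_on_TA[OF lin_comp[OF tmap_linear[OF V W f] tmap_linear[OF W U g]] tmap_linear[OF V U gf] _ t])
    fix xs assume "xs \<in> V.wrd"
    then show "tmap U g (tmap W f (V.pt xs)) = tmap U (\<lambda>x. g (f x)) (V.pt xs)"
      by (simp add: tmap_pure[OF V W f] tmap_pure[OF V U gf] tmap_pure[OF W U g] map_wrd[OF V W f] comp_def)
  qed
qed

lemma tmap_cong_tspan:
  assumes V: "tens V" and W: "tens W" and f: "f \<in> linear_maps V W" and g: "g \<in> linear_maps V W"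
    and "Ss \<in> lists (Pow (carrier V))" "\<And>S x. S \<in> set Ss ==> x \<in> S ==> g x = f x" "t \<in> tspan V Ss"
  shows "tmap W g t = tmap W f t"
  by (rule tmap_eq_tspan[OF V W f g assms(5-7) tmap_linear[OF V W g] tmap_pure[OF V W g]])

context tens begin

lemma id_linear: "(\<lambda>x. x) \<in> linear_maps V V"
  by (intro linI) auto

lemma tmap_id: "t \<in> CT ==> tmap V (\<lambda>x. x) t = t"
  by (rule linear_eq_on_TA[OF tmap_linear[OF tns tns id_linear], of "\<lambda>t. t"])
    (auto intro: linI simp: tmap_pure[OF tns tns id_linear])

lemma tmap_id_tspan:
  assumes "f \<in> linear_maps V V" "Ss \<in> lists (Pow C)" "\<And>S x. S \<in> set Ss ==> x \<in> S ==> f x = x" "t \<in> tspan V Ss"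
  shows "tmap V f t = t"
  using tmap_cong_tspan[OF tns tns id_linear assms] tmap_id tspan_cl[OF assms(2,4)] by simp

text \<open>Multilinearity in the single degree \<open>n\<close>, for functions that are meaningful
  on words of that length; extension by zero turns it into \<open>multilin\<close>.\<close>

definition mlin :: "nat => ('k, 'w, 'n) module_scheme => ('v list => 'w) => bool" where
  "mlin n M \<phi> \<longleftrightarrow> (n = 0 \<longrightarrow> \<phi> [] \<in> carrier M) \<and>
     (\<forall>a\<in>wrd. \<forall>b\<in>wrd. n = length a + length b + 1 \<longrightarrow> (\<lambda>x. \<phi> (a @ x # b)) \<in> linear_maps V M)"

lemma mlin_multilin: "vspace M ==> mlin n M \<phi> ==> multilin V M (\<lambda>xs. if length xs = n then \<phi> xs else \<zero>\<^bsub>M\<^esub>)"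
proof -
  assume M: "vspace M" and m: "mlin n M \<phi>"
  interpret M: vspace M by fact
  have "(\<lambda>x. if length (a @ x # b) = n then \<phi> (a @ x # b) else \<zero>\<^bsub>M\<^esub>) \<in> linear_maps V M" if "a \<in> wrd" "b \<in> wrd" for a b
    using m that linear_zero_map[OF M] unfolding mlin_def by (cases "length a + length b + 1 = n") auto
  moreover have "(if length [] = n then \<phi> [] else \<zero>\<^bsub>M\<^esub>) \<in> carrier M" using m by (auto simp: mlin_def)
  ultimately show ?thesis unfolding multilin_def by blast
qed

text \<open>Dropping the keys of other lengths amounts to extending \<open>\<phi>\<close> by zero. A
  chosen representative that is not homogeneous does no harm, because the zero extension is subject
  to the universal property.\<close>

lemma multilinear_lift_eq:
  assumes M: "vspace M" and m: "mlin n M \<phi>" and t: "t \<in> CT"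
  shows "multilinear_lift M n \<phi> t = wlift M (\<lambda>xs. if length xs = n then \<phi> xs else \<zero>\<^bsub>M\<^esub>) t"
proof -
  interpret M: vspace M by fact
  obtain f where f: "f \<in> carrier Fr" "t = tensor_class V f" using t by (auto simp: carrier_TA)
  have "t \<in> carrier Fr" unfolding f(2) tensor_class_def by (rule F.coset_rep_iff(2)[OF tensor_ideal f(1) f(1)])
  then have k: "keys t \<subseteq> wrd" by (simp add: free_algebra_simps)
  have c: "(if length xs = n then \<phi> xs else \<zero>\<^bsub>M\<^esub>) \<in> carrier M" if "xs \<in> wrd" for xs
    by (rule multilin_cl[OF mlin_multilin[OF M m] that])
  have c': "\<phi> xs \<in> carrier M" if "xs \<in> wrd" "length xs = n" for xs
    using c[OF that(1)] that(2) by simp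
  show ?thesis
    unfolding multilinear_lift_def wlift_def
    by (rule M.M.add.finprod_mono_neutral_cong_left) (use k c' in auto)
qed

lemma multilinear_lift_linear:
  assumes M: "vspace M" and m: "mlin n M \<phi>"
  shows "multilinear_lift M n \<phi> \<in> linear_maps TA M"
  by (rule lin_cong[OF wlift_linear(1)[OF M mlin_multilin[OF M m]] R.vsp multilinear_lift_eq[OF M m]])

lemma multilinear_lift_pure:
  assumes M: "vspace M" and m: "mlin n M \<phi>" and "xs \<in> wrd" "length xs = n"
  shows "multilinear_lift M n \<phi> (pt xs) = \<phi> xs"
  using assms by (simp add: multilinear_lift_eq[OF M m] wlift_linear(3)[OF M mlin_multilin[OF M m]])

lemma linear_to_Rn:
  assumes "F \<in> linear_maps TA TA" "\<And>xs. xs \<in> wrd ==> length xs = j ==> F (pt xs) \<in> Rn k"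
  shows "F \<in> hom_power V j k"
proof (rule linI)
  fix t assume "t \<in> Rn j"
  then show "F t \<in> Rn k"
    by (induction rule: tp_induct) (auto simp: assms lin_add[OF assms(1)] lin_smult[OF assms(1)])
qed (auto simp: lin_add[OF assms(1)] lin_smult[OF assms(1)])

lemma hom_eq_pure:
  assumes "F \<in> linear_maps (tensor_power V n) M" "G \<in> linear_maps (tensor_power V n) M"
    "\<And>xs. xs \<in> wrd ==> length xs = n ==> F (pt xs) = G (pt xs)" "t \<in> Rn n"
  shows "F t = G t"
  using assms(4)
  by (induction rule: tp_induct) (auto simp: assms(3) lin_add[OF assms(1), simplified] lin_add[OF assms(2), simplified]
      lin_smult[OF assms(1), simplified] lin_smult[OF assms(2), simplified])

lemma linear_restrict: "F \<in> linear_maps TA M ==> F \<in> linear_maps (tensor_power V n) M"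
  by (auto simp: linear_maps_def)

text \<open>The bridge between the formulas of the definitions and whiskered operators. The right
  block is treated first, so that the position of \<open>g\<close> is not moved by the degree change
  that \<open>f\<close> causes.\<close>

lemma map_tensor_eq:
  assumes f: "f \<in> hom_power V j j'" and g: "g \<in> hom_power V k k'" and t: "t \<in> Rn (j + k)"
  shows "map_tensor V j k f g t = Wh 0 j f (Wh j k g t)"
proof -
  let ?\<phi> = "\<lambda>xs. f (pt (take j xs)) \<bullet> g (pt (drop j xs))"
  have fc: "f (pt xs) \<in> CT" if "xs \<in> wrd" "length xs = j" for xs
    using hom_cl[OF f Rn_pure[OF that]] by simp
  have gc: "g (pt xs) \<in> CT" if "xs \<in> wrd" "length xs = k" for xs
    using hom_cl[OF g Rn_pure[OF that]] by simp
  have m: "mlin (j + k) TA ?\<phi>"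
    unfolding mlin_def
  proof (intro conjI impI ballI)
    assume "j + k = 0"
    then show "?\<phi> [] \<in> CT" using fc[of "[]"] gc[of "[]"] by simp
  next
    fix a b assume ab: "a \<in> wrd" "b \<in> wrd" "j + k = length a + length b + 1"
    show "(\<lambda>x. ?\<phi> (a @ x # b)) \<in> linear_maps V TA"
    proof (cases "length a < j")
      case True
      define p where "p = j - length a - 1"
      have j: "j = length a + Suc p" using True by (simp add: p_def)
      have "(\<lambda>x. f (pt (a @ x # take p b)) \<bullet> g (pt (drop p b))) \<in> linear_maps V TA"
        using ab j by (intro lin_rmult hom_linear_pure[OF f] gc) auto
      then show ?thesis unfolding j by simp
    next
      case False
      have "(\<lambda>x. f (pt (take j a)) \<bullet> g (pt (drop j a @ x # b))) \<in> linear_maps V TA"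
        using ab False by (intro lin_lmult hom_linear_pure[OF g] fc) auto
      then show ?thesis using False by simp
    qed
  qed
  show ?thesis
    unfolding map_tensor_def
  proof (rule hom_eq_pure[OF linear_restrict linear_restrict _ t])
    show "multilinear_lift TA (j + k) ?\<phi> \<in> linear_maps TA TA"
      by (rule multilinear_lift_linear[OF R.vsp m])
    show "(\<lambda>t. Wh 0 j f (Wh j k g t)) \<in> linear_maps TA TA"
      using lin_comp[OF whisker_linear[OF g] whisker_linear[OF f]] .
    fix xs assume xs: "xs \<in> wrd" "length xs = j + k"
    have "Wh j k g (pt (take j xs @ drop j xs @ [])) = pt (take j xs) \<bullet> g (pt (drop j xs))"
      using xs by (subst whisker_pure[OF g]) (auto simp: pure_Nil gc)
    then have "?\<phi> xs = Wh 0 j f (Wh j k g (pt (take j xs @ drop j xs @ [])))"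
      using xs whisker_right[OF f Rn_pure, of "take j xs" j 0 "g (pt (drop j xs))"] gc[of "drop j xs"]
        whisker_0[OF f Rn_pure, of "take j xs"] by simp
    then show "multilinear_lift TA (j + k) ?\<phi> (pt xs) = Wh 0 j f (Wh j k g (pt xs))"
      using multilinear_lift_pure[OF R.vsp m xs] by simp
  qed
qed

lemma hom_id: "id \<in> hom_power V j j"
  by (auto intro: linI)

lemma whisker_id: "t \<in> Rn n ==> i + j \<le> n ==> Wh i j id t = t"
  using local_at_eq_Rn[OF local_at_whisker[OF hom_id] local_at_id[of i j], of n t] by (simp add: id_def)

lemma map_tensor_left: "f \<in> hom_power V j j' ==> t \<in> Rn (j + k) ==> map_tensor V j k f id t = Wh 0 j f t"
  using map_tensor_eq[OF _ hom_id] whisker_id by simp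

lemma map_tensor_right: "g \<in> hom_power V k k' ==> t \<in> Rn (j + k) ==> map_tensor V j k id g t = Wh j k g t"
  using map_tensor_eq[OF hom_id, of g k k' t j] whisker_deg[of g k k' t "j + k" j 0] whisker_id[of _ "j + k'" 0 j] by simp

lemma map_power_eq:
  assumes W: "tens W" and f: "f \<in> linear_maps V W" and t: "t \<in> Rn n"
  shows "map_power W n f t = tmap W f t"
proof -
  interpret W: tens W by fact
  have m: "mlin n (tensor_algebra W) (\<lambda>xs. pure_tensor W (map f xs))"
    using tmap_multilin[OF tns W f] unfolding mlin_def multilin_def by auto
  show ?thesis
    unfolding map_power_def
    by (rule hom_eq_pure[OF linear_restrict[OF multilinear_lift_linear[OF W.R.vsp m]]
          linear_restrict[OF tmap_linear[OF tns W f]] _ t])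
      (simp add: multilinear_lift_pure[OF W.R.vsp m] tmap_pure[OF tns W f])
qed

definition unpure :: "('v list \<Rightarrow>\<^sub>0 'k) => 'v" where
  "unpure = multilinear_lift V 1 hd"

lemma unpure_mlin: "mlin 1 V hd"
  unfolding mlin_def by (auto intro: linI)

lemma unpure_linear: "unpure \<in> linear_maps TA V"
  unfolding unpure_def by (rule multilinear_lift_linear[OF V.vsp unpure_mlin])

lemma unpure_pure [simp]: "x \<in> C ==> unpure (pt [x]) = x"
  unfolding unpure_def using multilinear_lift_pure[OF V.vsp unpure_mlin, of "[x]"] by simp

lemma pure1_linear: "(\<lambda>x. pt [x]) \<in> linear_maps V TA" "(\<lambda>x. pt [x]) \<in> linear_maps V (tensor_power V 1)"
  using multilin_linear[OF pure_multilin, of "[]" "[]"] pure_linear_Rn[of "[]" "[]" 1] by simp_all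

lemma pure_unpure: "t \<in> Rn 1 ==> pt [unpure t] = t"
proof (induction rule: tp_induct)
  case (pure xs)
  then obtain x where "xs = [x]" by (auto simp: length_Suc_conv)
  then show ?case using pure by simp
qed (simp_all add: lin_add[OF unpure_linear] lin_smult[OF unpure_linear] lin_cl[OF unpure_linear]
    lin_add[OF pure1_linear(1)] lin_smult[OF pure1_linear(1)])

lemma Rn1_E: assumes "t \<in> Rn 1" obtains x where "x \<in> C" "t = pt [x]"
  using that[of "unpure t"] pure_unpure[OF assms] lin_cl[OF unpure_linear] assms by auto

lemma tspan1:
  assumes S: "subsp V S"
  shows "tspan V [S] = (\<lambda>x. pt [x]) ` S"
proof
  have "{xs. list_all2 (\<in>) xs [S]} = (\<lambda>x. [x]) ` S"
    by (auto simp: list_all2_Cons2)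
  then have e: "tspan V [S] = lspan TA ((\<lambda>x. pt [x]) ` S)" by (simp add: tspan_def image_image)
  show "tspan V [S] \<subseteq> (\<lambda>x. pt [x]) ` S"
    unfolding e by (rule lspan_least[OF subsp_image[OF pure1_linear(1) V.vsp R.vsp S]]) simp
  show "(\<lambda>x. pt [x]) ` S \<subseteq> tspan V [S]"
    unfolding e by (auto intro: lspan.base)
qed

lemma hom_1_I:
  assumes "h \<in> linear_maps V (tensor_power V k)"
  shows "multilinear_lift TA 1 (\<lambda>xs. h (xs ! 0)) \<in> hom_power V 1 k"
    and "x \<in> C ==> multilinear_lift TA 1 (\<lambda>xs. h (xs ! 0)) (pt [x]) = h x"
proof -
  have m: "mlin 1 TA (\<lambda>xs. h (xs ! 0))"
    using assms unfolding mlin_def by (auto simp: linear_maps_def)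
  show "multilinear_lift TA 1 (\<lambda>xs. h (xs ! 0)) \<in> hom_power V 1 k"
    by (rule linear_to_Rn[OF multilinear_lift_linear[OF R.vsp m]])
      (use lin_cl[OF assms] in \<open>auto simp: multilinear_lift_pure[OF R.vsp m, simplified] length_Suc_conv\<close>)
  show "x \<in> C ==> multilinear_lift TA 1 (\<lambda>xs. h (xs ! 0)) (pt [x]) = h x"
    by (simp add: multilinear_lift_pure[OF R.vsp m, simplified])
qed

text \<open>The kernel of \<open>p \<otimes> p\<close> for a linear map \<open>p\<close> with kernel \<open>K\<close>.\<close>

definition Nker :: "'v set => ('v list \<Rightarrow>\<^sub>0 'k) set" where
  "Nker K = lspan TA (tspan V [K, C] \<union> tspan V [C, K])"

lemma Nker_subsp: "K \<subseteq> C ==> subsp TA (Nker K)"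
  unfolding Nker_def by (rule R.lspan_subsp) (auto dest: tspan_cl[rotated])

lemma Nker_incl: "K \<subseteq> C ==> tspan V [K, C] \<subseteq> Nker K" "K \<subseteq> C ==> tspan V [C, K] \<subseteq> Nker K"
  unfolding Nker_def by (auto intro: lspan.base)

lemma Nker_Rn: "K \<subseteq> C ==> Nker K \<subseteq> Rn 2"
  unfolding Nker_def using tspan_Rn[of "[K, C]"] tspan_Rn[of "[C, K]"]
  by (intro lspan_least[OF Rn_subsp]) (auto simp: numeral_2_eq_2)

lemma Nker_least: "[|subsp TA T; tspan V [K, C] \<subseteq> T; tspan V [C, K] \<subseteq> T|] ==> Nker K \<subseteq> T"
  unfolding Nker_def by (rule lspan_least) auto

lemma Nker_mono: "K \<subseteq> L ==> L \<subseteq> C ==> Nker K \<subseteq> Nker L"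
  using tspan_mono[of "[K, C]" "[L, C]"] tspan_mono[of "[C, K]" "[C, L]"] Nker_incl[of L]
  by (intro Nker_least Nker_subsp) auto

lemma Rn2_E: assumes "xs \<in> wrd" "length xs = 2" obtains x y where "xs = [x, y]" "x \<in> C" "y \<in> C"
  using assms by (auto simp: numeral_2_eq_2 length_Suc_conv)

lemma Nker_zero: "t \<in> Nker {\<zero>\<^bsub>V\<^esub>} ==> t = zeroT"
proof -
  have z: "pt [\<zero>\<^bsub>V\<^esub>, x] = zeroT" "pt [x, \<zero>\<^bsub>V\<^esub>] = zeroT" if "x \<in> C" for x
    using lin_zero[OF multilin_linear[OF pure_multilin, of "[]" "[x]"] V.vsp R.vsp]
      lin_zero[OF multilin_linear[OF pure_multilin, of "[x]" "[]"] V.vsp R.vsp] that by simp_all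
  have "Nker {\<zero>\<^bsub>V\<^esub>} \<subseteq> {zeroT}"
    by (intro Nker_least R.subsp_0 tspan_least) (auto simp: list_all2_Cons2 z)
  then show "t \<in> Nker {\<zero>\<^bsub>V\<^esub>} ==> t = zeroT" by blast
qed

text \<open>Exactness of tensor products over a field. With \<open>q = g f\<close> for a generalized
  inverse \<open>g\<close> on \<open>S\<close>, \<open>q \<otimes> q\<close> kills \<open>t\<close>,
  and \<open>a \<otimes> b - q a \<otimes> q b\<close> splits as
  \<open>(a - q a) \<otimes> b + q a \<otimes> (b - q b)\<close>, where \<open>a - q a\<close> and
  \<open>b - q b\<close> lie in the kernel.\<close>

lemma tmap_kernel:
  assumes W: "tens W" and f: "f \<in> linear_maps V W" and S: "subsp V S"
    and t: "t \<in> tspan V [S, S]" "tmap W f t = \<zero>\<^bsub>tensor_algebra W\<^esub>"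
  shows "t \<in> Nker {x \<in> S. f x = \<zero>\<^bsub>W\<^esub>}"
proof -
  interpret W: tens W by fact
  have SC: "S \<subseteq> C" using S by (simp add: subsp_def)
  let ?S = "V\<lparr>carrier := S\<rparr>"
  have fS: "f \<in> linear_maps ?S W" using f SC by (auto simp: linear_maps_def subset_eq)
  obtain g where g: "g \<in> linear_maps W ?S" "\<And>x. x \<in> carrier ?S ==> f (g (f x)) = f x"
    using generalized_inverse[OF fS V.subsp_vspace[OF S] W.V.vsp] by blast
  have gV: "g \<in> linear_maps W V" using g(1) SC by (auto simp: linear_maps_def)
  let ?q = "\<lambda>x. g (f x)"
  let ?K = "{x \<in> S. f x = \<zero>\<^bsub>W\<^esub>}"
  have qV: "?q \<in> linear_maps V V" by (rule lin_comp[OF f gV])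
  have KC: "?K \<subseteq> C" using SC by auto
  have q0: "tmap V ?q t = zeroT"
    using tmap_comp[OF tns W tns f gV tspan_cl[OF _ t(1)]] t(2) SC
      tmap_zero[OF W tns gV] by simp
  have diff: "x \<ominus>\<^bsub>V\<^esub> ?q x \<in> ?K" if "x \<in> S" for x
  proof -
    have "f x \<in> carrier W" using that SC f by (auto intro: lin_cl)
    then have "g (f x) \<in> S" using lin_cl[OF g(1)] by simp
    then show ?thesis
      using that SC g(2)[of x] lin_minus[OF f V.vsp W.V.vsp, of x "g (f x)"] lin_cl[OF f]
      by (auto simp: V.subsp_minus[OF S])
  qed
  have "t \<ominus>\<^bsub>TA\<^esub> tmap V ?q t \<in> Nker ?K"
  proof (rule lspan_image_subset[OF lin_diff[OF _ tmap_linear[OF tns tns qV] R.vsp]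
        R.vsp R.vsp Nker_subsp[OF KC]])
    show "(\<lambda>t. t) \<in> linear_maps TA TA" by (auto intro: linI)
    show "t \<in> lspan TA (pt ` {xs. list_all2 (\<in>) xs [S, S]})" using t(1) by (simp add: tspan_def)
    show "pt ` {xs. list_all2 (\<in>) xs [S, S]} \<subseteq> CT" using SC by (auto dest!: list_all2_wrd)
    fix x assume "x \<in> pt ` {xs. list_all2 (\<in>) xs [S, S]}"
    then obtain a b where x: "x = pt [a, b]" "a \<in> S" "b \<in> S" by (auto simp: list_all2_Cons2)
    then have ab: "a \<in> C" "b \<in> C" using SC by auto
    have qc: "?q a \<in> C" "?q b \<in> C" using ab lin_cl[OF qV] by auto
    have "x \<ominus>\<^bsub>TA\<^esub> tmap V ?q x = pt [a \<ominus>\<^bsub>V\<^esub> ?q a, b] \<oplus>\<^bsub>TA\<^esub> pt [?q a, b \<ominus>\<^bsub>V\<^esub> ?q b]"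
      using ab qc lin_minus[OF multilin_linear[OF pure_multilin, of "[]" "[b]"] V.vsp R.vsp, of a "?q a"]
        lin_minus[OF multilin_linear[OF pure_multilin, of "[?q a]" "[]"] V.vsp R.vsp, of b "?q b"]
      unfolding x by (simp add: tmap_pure[OF tns tns qV] R.minus_trans)
    also have "\<dots> \<in> Nker ?K"
    proof (rule subsp_add[OF Nker_subsp[OF KC]])
      show "pt [a \<ominus>\<^bsub>V\<^esub> ?q a, b] \<in> Nker ?K"
        by (rule subsetD[OF Nker_incl(1)[OF KC] tspan_pure]) (use diff[OF x(2)] ab in simp)
      show "pt [?q a, b \<ominus>\<^bsub>V\<^esub> ?q b] \<in> Nker ?K"
        by (rule subsetD[OF Nker_incl(2)[OF KC] tspan_pure]) (use diff[OF x(3)] qc in simp)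
    qed
    finally show "x \<ominus>\<^bsub>TA\<^esub> tmap V ?q x \<in> Nker ?K" .
  qed
  then show ?thesis using q0 tspan_cl[OF _ t(1)] SC by simp
qed

lemma tmap_Nker:
  assumes W: "tens W" and f: "f \<in> linear_maps V W" and K: "K \<subseteq> C" "\<And>x. x \<in> K ==> f x = \<zero>\<^bsub>W\<^esub>" and t: "t \<in> Nker K"
  shows "tmap W f t = \<zero>\<^bsub>tensor_algebra W\<^esub>"
proof -
  interpret W: tens W by fact
  have z: "pure_tensor W [\<zero>\<^bsub>W\<^esub>, x] = \<zero>\<^bsub>tensor_algebra W\<^esub>" "pure_tensor W [x, \<zero>\<^bsub>W\<^esub>] = \<zero>\<^bsub>tensor_algebra W\<^esub>" if "x \<in> carrier W" for x
    using lin_zero[OF multilin_linear[OF W.pure_multilin, of "[]" "[x]"] W.V.vsp W.R.vsp]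
      lin_zero[OF multilin_linear[OF W.pure_multilin, of "[x]" "[]"] W.V.vsp W.R.vsp] that by simp_all
  have sub: "subsp TA {t \<in> CT. tmap W f t \<in> {\<zero>\<^bsub>tensor_algebra W\<^esub>}}"
    by (rule subsp_vimage[OF tmap_linear[OF tns W f] R.vsp W.R.vsp W.R.subsp_0])
  have "Nker K \<subseteq> {t \<in> CT. tmap W f t \<in> {\<zero>\<^bsub>tensor_algebra W\<^esub>}}"
    using K lin_cl[OF f]
    by (intro Nker_least sub tspan_least) (auto simp: list_all2_Cons2 tmap_pure[OF tns W f] z)
  then show ?thesis using t by auto
qed

text \<open>Proved by splitting \<open>h\<close> with a generalized inverse.\<close>

lemma slice_right:
  assumes h: "h \<in> hom_power V 1 k" and S: "S \<subseteq> C" and t: "t \<in> tspan V [S, C]" and z: "Wh 1 1 h t = zeroT"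
  shows "t \<in> tspan V [S, {x \<in> C. h (pt [x]) = zeroT}]"
proof -
  obtain g where g: "g \<in> hom_power V k 1" "\<And>x. x \<in> Rn 1 ==> h (g (h x)) = h x"
    using generalized_inverse[OF h vspace_Rn vspace_Rn] by blast
  let ?e = "\<lambda>t. g (h t)"
  have e: "?e \<in> hom_power V 1 1" by (rule lin_comp[OF h g(1)])
  have loc: "local_at V 1 1 (\<lambda>t. t \<ominus>\<^bsub>TA\<^esub> Wh 1 1 ?e t) (\<lambda>t. t \<ominus>\<^bsub>TA\<^esub> ?e t)"
    by (rule local_at_diff[OF local_at_id local_at_whisker[OF e]])
  let ?K = "{x \<in> C. h (pt [x]) = zeroT}"
  have KC: "?K \<subseteq> C" by auto
  \<comment> \<open>As \<open>h g h = h\<close>, the operator \<open>id - g h\<close> takes values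
    in the kernel of \<open>h\<close>.\<close>
  have k: "t \<ominus>\<^bsub>TA\<^esub> ?e t \<in> tspan V [?K]" if t: "t \<in> tspan V [C]" for t
  proof -
    have t1: "t \<in> Rn 1" using t by (simp add: Rn_tspan)
    have et: "?e t \<in> Rn 1" by (rule hom_cl[OF e t1])
    have d: "t \<ominus>\<^bsub>TA\<^esub> ?e t \<in> Rn 1" by (rule R.subsp_minus[OF Rn_subsp t1 et])
    then obtain y where y: "y \<in> C" "t \<ominus>\<^bsub>TA\<^esub> ?e t = pt [y]" by (rule Rn1_E)
    have "h (t \<ominus>\<^bsub>TA\<^esub> ?e t) = zeroT"
    proof -
      have "t \<ominus>\<^bsub>TA\<^esub> ?e t = t \<ominus>\<^bsub>tensor_power V 1\<^esub> ?e t"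
        using t1 et by (simp add: a_minus_def R.neg_smult[symmetric] vspace.neg_smult[OF vspace_Rn, symmetric])
      then have "h (t \<ominus>\<^bsub>TA\<^esub> ?e t) = h t \<ominus>\<^bsub>tensor_power V k\<^esub> h (?e t)"
        using lin_minus[OF h vspace_Rn vspace_Rn t1 et] by simp
      also have "\<dots> = zeroT"
        using g(2)[OF t1] vspace.minus_self[OF vspace_Rn hom_cl[OF h t1]] by simp
      finally show ?thesis .
    qed
    then show ?thesis using y by (auto intro!: tspan_pure)
  qed
  \<comment> \<open>\<open>g h\<close> factors through \<open>h\<close>, which kills
    \<open>t\<close> in the second slot; thus \<open>t\<close> equals its image under
    \<open>id - g h\<close> in that slot.\<close>
  have "Wh 1 1 ?e t = Wh 1 k g (Wh 1 1 h t)"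
  proof (rule local_at_eq[OF local_at_whisker[OF e] local_at_comp[OF local_at_whisker[OF g(1)] local_at_whisker[OF h]]])
    show "[S] @ [C] @ [] \<in> lists (Pow C)" using S by simp
    show "t \<in> tspan V ([S] @ [C] @ [])" using t by simp
  qed (auto intro: hom_cl[OF h])
  then have "Wh 1 1 ?e t = zeroT" using z g(1) by simp
  moreover have "t \<ominus>\<^bsub>TA\<^esub> Wh 1 1 ?e t \<in> tspan V ([S] @ [?K] @ [])"
    by (rule local_at_tspan[OF loc, where Bs = "[C]"]) (use S t k in auto)
  ultimately show ?thesis using tspan_cl[OF _ t] S by simp
qed

lemma slice_left:
  assumes h: "h \<in> hom_power V 1 k" and S: "S \<subseteq> C" and t: "t \<in> tspan V [C, S]" and z: "Wh 0 1 h t = zeroT"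
  shows "t \<in> tspan V [{x \<in> C. h (pt [x]) = zeroT}, S]"
proof -
  obtain g where g: "g \<in> hom_power V k 1" "\<And>x. x \<in> Rn 1 ==> h (g (h x)) = h x"
    using generalized_inverse[OF h vspace_Rn vspace_Rn] by blast
  let ?e = "\<lambda>t. g (h t)"
  have e: "?e \<in> hom_power V 1 1" by (rule lin_comp[OF h g(1)])
  have loc: "local_at V 0 1 (\<lambda>t. t \<ominus>\<^bsub>TA\<^esub> Wh 0 1 ?e t) (\<lambda>t. t \<ominus>\<^bsub>TA\<^esub> ?e t)"
    by (rule local_at_diff[OF local_at_id local_at_whisker[OF e]])
  let ?K = "{x \<in> C. h (pt [x]) = zeroT}"
  have k: "t \<ominus>\<^bsub>TA\<^esub> ?e t \<in> tspan V [?K]" if t: "t \<in> tspan V [C]" for t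
  proof -
    have t1: "t \<in> Rn 1" using t by (simp add: Rn_tspan)
    have et: "?e t \<in> Rn 1" by (rule hom_cl[OF e t1])
    have d: "t \<ominus>\<^bsub>TA\<^esub> ?e t \<in> Rn 1" by (rule R.subsp_minus[OF Rn_subsp t1 et])
    then obtain y where y: "y \<in> C" "t \<ominus>\<^bsub>TA\<^esub> ?e t = pt [y]" by (rule Rn1_E)
    have "h (t \<ominus>\<^bsub>TA\<^esub> ?e t) = zeroT"
    proof -
      have "t \<ominus>\<^bsub>TA\<^esub> ?e t = t \<ominus>\<^bsub>tensor_power V 1\<^esub> ?e t"
        using t1 et by (simp add: a_minus_def R.neg_smult[symmetric] vspace.neg_smult[OF vspace_Rn, symmetric])
      then have "h (t \<ominus>\<^bsub>TA\<^esub> ?e t) = h t \<ominus>\<^bsub>tensor_power V k\<^esub> h (?e t)"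
        using lin_minus[OF h vspace_Rn vspace_Rn t1 et] by simp
      also have "\<dots> = zeroT"
        using g(2)[OF t1] vspace.minus_self[OF vspace_Rn hom_cl[OF h t1]] by simp
      finally show ?thesis .
    qed
    then show ?thesis using y by (auto intro!: tspan_pure)
  qed
  have "Wh 0 1 ?e t = Wh 0 k g (Wh 0 1 h t)"
  proof (rule local_at_eq[OF local_at_whisker[OF e] local_at_comp[OF local_at_whisker[OF g(1)] local_at_whisker[OF h]]])
    show "[] @ [C] @ [S] \<in> lists (Pow C)" using S by simp
    show "t \<in> tspan V ([] @ [C] @ [S])" using t by simp
  qed (auto intro: hom_cl[OF h])
  then have "Wh 0 1 ?e t = zeroT" using z g(1) by simp
  moreover have "t \<ominus>\<^bsub>TA\<^esub> Wh 0 1 ?e t \<in> tspan V ([] @ [?K] @ [S])"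
    by (rule local_at_tspan[OF loc, where Bs = "[C]"]) (use S t k in auto)
  ultimately show ?thesis using tspan_cl[OF _ t] S by simp
qed

end

section \<open>Braided algebras as whiskered operators\<close>

lemma length_1_iff: "length xs = 1 \<longleftrightarrow> (\<exists>x. xs = [x])"
  and length_2_iff: "length xs = 2 \<longleftrightarrow> (\<exists>x y. xs = [x, y])"
  and length_3_iff: "length xs = 3 \<longleftrightarrow> (\<exists>x y z. xs = [x, y, z])"
  by (auto simp: length_Suc_conv eval_nat_numeral)

text \<open>From here on, positions and degrees are normalized to numerals.\<close>

declare One_nat_def [simp del] One_nat_def [symmetric, simp] Suc_eq_plus1 [symmetric, simp]
  Suc_eq_plus1_left [symmetric, simp]

context tens begin

lemma whisker_short2:
  assumes f: "f \<in> hom_power V j k" and g: "g \<in> hom_power V l m" and t: "t \<in> Rn n"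
    and n: "n < i' + l \<or> n + m < i + j + l"
  shows "whisker V i j f (whisker V i' l g t) = zeroT"
proof (cases "n < i' + l")
  case True
  then show ?thesis using whisker_short[OF g t] f by simp
next
  case False
  then obtain d where "n = i' + l + d" by (metis le_Suc_ex not_less)
  then show ?thesis using n whisker_short[OF f whisker_deg[OF g t]] by simp
qed

text \<open>An identity checked in degree \<open>j\<close> spreads to all tensors with at least
  \<open>i + j\<close> factors. On shorter ones the operators do not fit, and the two sides are
  compared separately; both are then zero, by \<open>whisker_short\<close> and
  \<open>whisker_short2\<close>.\<close>

lemma local_at_eq_TA:
  assumes F: "local_at V i j F f" and G: "local_at V i j G g"
    and fg: "\<And>t. t \<in> Rn j ==> f t = g t"
    and short: "\<And>n t. n < i + j ==> t \<in> Rn n ==> F t = G t" and t: "t \<in> CT"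
  shows "F t = G t"
proof (rule linear_eq_on_TA[OF local_at_linear[OF F] local_at_linear[OF G] _ t])
  fix xs assume "xs \<in> wrd"
  then show "F (pt xs) = G (pt xs)"
    using local_at_eq_Rn[OF F G _ fg, of "length xs" "pt xs"] short[of "length xs" "pt xs"]
    by (cases "length xs < i + j") auto
qed

lemma split_wrd_lt:
  assumes "xs \<in> wrd" "i < length xs"
  shows "\<exists>a x c. xs = a @ x # c \<and> a \<in> wrd \<and> x \<in> C \<and> c \<in> wrd \<and> length a = i"
proof -
  have "i + 1 \<le> length xs" using assms(2) by simp
  from split_wrd[OF assms(1) this] obtain a b c where
    "xs = a @ b @ c" "a \<in> wrd" "b \<in> wrd" "c \<in> wrd" "length a = i" "length b = 1" by blast
  then obtain x where "xs = a @ x # c" "x \<in> C" by (auto simp: length_1_iff)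
  then show ?thesis using \<open>a \<in> wrd\<close> \<open>c \<in> wrd\<close> \<open>length a = i\<close> by blast
qed

end

locale bvs = fixes V :: "('k::field, 'v, 'm) braided_scheme"
  assumes bvs: "braided_vector_space V"
begin

sublocale tens V
  using bvs by unfold_locales (simp add: braided_vector_space_def)

lemma braid_hom: "braid V \<in> hom_power V 2 2"
  using bvs by (simp add: braided_vector_space_def)

abbreviation "D i \<equiv> whisker V i 2 (braid V)"

lemmas D_linear = whisker_linear[OF braid_hom]
lemmas D_cl [simp] = whisker_cl[OF braid_hom]
lemmas D_0 = whisker_0[OF braid_hom]

lemma D_Rn: "t \<in> Rn n ==> D i t \<in> Rn n"
  using whisker_deg[OF braid_hom, of t n i "n - (i + 2)"] whisker_short[OF braid_hom, of t n i]
  by (cases "n < i + 2") simp_all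

lemma base_braid_rel:
  assumes t: "t \<in> Rn 3"
  shows "D 0 (D 1 (D 0 t)) = D 1 (D 0 (D 1 t))"
proof -
  have "map_tensor V 2 1 (braid V) id u = D 0 u" "map_tensor V 1 2 id (braid V) u = D 1 u" if "u \<in> Rn 3" for u
    using map_tensor_left[OF braid_hom, of u 1] map_tensor_right[OF braid_hom, of u 1] that by simp_all
  then show ?thesis
    using bvs t unfolding braided_vector_space_def Let_def by (auto simp: D_Rn)
qed

lemma local_D: "local_at V i 3 (D i) (D 0)" "local_at V i 3 (D (Suc i)) (D 1)"
  and local_D2: "local_at V i 2 (D i) (D 0)"
  using local_at_shift[OF braid_hom, of 0 3 i] local_at_shift[OF braid_hom, of 1 3 i]
    local_at_shift[OF braid_hom, of 0 2 i] by simp_all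

text \<open>The second position is a variable with an equation, so that instances at positions such
  as 0, 1 or 1, 2 match terms with normalized numerals.\<close>

lemma braid_rel: "j = Suc i ==> t \<in> CT ==> D i (D j (D i t)) = D j (D i (D j t))"
proof (erule ssubst, rule local_at_eq_TA[of i 3, OF local_at_comp[OF local_D(1) local_at_comp[OF local_D(2) local_D(1)]]
      local_at_comp[OF local_D(2) local_at_comp[OF local_D(1) local_D(2)]] base_braid_rel])
  fix n t assume nt: "n < i + 3" "t \<in> Rn n"
  then have "D (Suc i) t = zeroT" "D (Suc i) (D i t) = zeroT"
    using whisker_short[OF braid_hom nt(2), of "Suc i"] whisker_short2[OF braid_hom braid_hom nt(2), of i "Suc i"] by simp_all
  then show "D i (D (Suc i) (D i t)) = D (Suc i) (D i (D (Suc i) t))"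
    using braid_hom by simp
qed (auto intro: D_Rn)

lemma D_D: "i + 2 \<le> j ==> t \<in> CT ==> D i (D j t) = D j (D i t)"
  by (drule le_Suc_ex, erule exE) (simp only: whisker_commute[OF braid_hom braid_hom])

end

section \<open>Algebras and braided algebras in terms of positions\<close>

locale talg = fixes A :: "('k::field, 'v, 'm) module_scheme"
  assumes talg_ua: "unital_algebra A"
begin

sublocale A: ualg A by (rule ualg.intro[OF talg_ua])
sublocale tens A by (rule tensI[OF A.vsp])

lemma mult_map_hom: "mult_map A \<in> hom_power A 2 1"
  and mult_map_pure: "x \<in> C ==> y \<in> C ==> mult_map A (pt [x, y]) = pt [x \<otimes>\<^bsub>A\<^esub> y]"
  and unit_map_hom: "unit_map A \<in> hom_power A 0 1"
  and unit_map_pure: "unit_map A (pt []) = pt [\<one>\<^bsub>A\<^esub>]"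
proof -
  have m: "mlin 2 TA (\<lambda>xs. pt [xs ! 0 \<otimes>\<^bsub>A\<^esub> xs ! 1])"
    unfolding mlin_def
  proof (intro conjI impI ballI)
    fix a b assume ab: "a \<in> wrd" "b \<in> wrd" "2 = length a + length b + 1"
    then consider y where "a = []" "b = [y]" "y \<in> C" | y where "a = [y]" "b = []" "y \<in> C"
      by (cases a; cases b) auto
    then show "(\<lambda>x. pt [(a @ x # b) ! 0 \<otimes>\<^bsub>A\<^esub> (a @ x # b) ! 1]) \<in> linear_maps A TA"
    proof cases
      case 1
      have "(\<lambda>x. x \<otimes>\<^bsub>A\<^esub> y) \<in> linear_maps A A"
        using 1 by (auto intro!: linI simp: A.A.l_distr A.smult_mult)
      from lin_comp[OF this pure1_linear(1)] show ?thesis using 1 by simp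
    next
      case 2
      have "(\<lambda>x. y \<otimes>\<^bsub>A\<^esub> x) \<in> linear_maps A A"
        using 2 by (auto intro!: linI simp: A.A.r_distr A.mult_smult)
      from lin_comp[OF this pure1_linear(1)] show ?thesis using 2 by simp
    qed
  qed simp
  have u: "mlin 0 TA (\<lambda>xs. pt [\<one>\<^bsub>A\<^esub>])" unfolding mlin_def by simp
  show p: "mult_map A (pt [x, y]) = pt [x \<otimes>\<^bsub>A\<^esub> y]" if "x \<in> C" "y \<in> C" for x y
    unfolding mult_map_def using that multilinear_lift_pure[OF R.vsp m, of "[x, y]"] by simp
  show q: "unit_map A (pt []) = pt [\<one>\<^bsub>A\<^esub>]"
    unfolding unit_map_def by (simp add: multilinear_lift_pure[OF R.vsp u])
  show "mult_map A \<in> hom_power A 2 1"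
    by (rule linear_to_Rn)
      (use p in \<open>auto elim!: Rn2_E simp: mult_map_def multilinear_lift_linear[OF R.vsp m, simplified]\<close>)
  show "unit_map A \<in> hom_power A 0 1"
    by (rule linear_to_Rn)
      (use q in \<open>auto simp: unit_map_def multilinear_lift_linear[OF R.vsp u]\<close>)
qed

abbreviation "M i \<equiv> whisker A i 2 (mult_map A)"
abbreviation "E i \<equiv> whisker A i 0 (unit_map A)"

lemmas M_linear = whisker_linear[OF mult_map_hom] and E_linear = whisker_linear[OF unit_map_hom]
lemmas M_cl [simp] = whisker_cl[OF mult_map_hom] and E_cl [simp] = whisker_cl[OF unit_map_hom]

lemma M_pure: "[|a \<in> wrd; x \<in> C; y \<in> C; c \<in> wrd; length a = i|] ==> M i (pt (a @ x # y # c)) = pt (a @ (x \<otimes>\<^bsub>A\<^esub> y) # c)"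
  using whisker_pure[OF mult_map_hom, of a "[x, y]" c i]
  by (simp add: mult_map_pure flip: pure_append)

lemma E_pure: "[|a \<in> wrd; c \<in> wrd; length a = i|] ==> E i (pt (a @ c)) = pt (a @ \<one>\<^bsub>A\<^esub> # c)"
  using whisker_pure[OF unit_map_hom, of a "[]" c i]
  by (simp add: unit_map_pure flip: pure_append)

lemma M_assoc:
  assumes "j = Suc i" "t \<in> CT"
  shows "M i (M i t) = M i (M j t)"
proof (rule linear_eq_on_TA[OF lin_comp[OF M_linear M_linear] lin_comp[OF M_linear M_linear] _ assms(2)])
  fix xs assume xs: "xs \<in> wrd"
  show "M i (M i (pt xs)) = M i (M j (pt xs))"
  proof (cases "i + 3 \<le> length xs")
    case True
    obtain a b c where a: "xs = a @ b @ c" "a \<in> wrd" "b \<in> wrd" "c \<in> wrd" "length a = i" "length b = 3"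
      using split_wrd[OF xs True] by blast
    then obtain x y z where b: "b = [x, y, z]" by (auto simp: length_3_iff)
    then show ?thesis
      using a assms(1) M_pure[of a x y "z # c" i] M_pure[of "a @ [x]" y z c j] M_pure[of a "x \<otimes>\<^bsub>A\<^esub> y" z c i]
        M_pure[of a x "y \<otimes>\<^bsub>A\<^esub> z" c i] by (simp add: A.A.m_assoc)
  next
    case False
    then have "M i (M i (pt xs)) = zeroT" "M i (M j (pt xs)) = zeroT"
      using assms(1) by (intro whisker_short2[OF mult_map_hom mult_map_hom Rn_pure[OF xs refl]]; simp)+
    then show ?thesis by simp
  qed
qed

lemma M_E:
  assumes "t \<in> Rn n" "i < n"
  shows "M i (E i t) = t" "M i (E (Suc i) t) = t"
proof -
  have *: "M i (E i (pt xs)) = pt xs \<and> M i (E (Suc i) (pt xs)) = pt xs" if xs: "xs \<in> wrd" "length xs = n" for xs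
  proof -
    obtain a x c where a: "xs = a @ x # c" "a \<in> wrd" "x \<in> C" "c \<in> wrd" "length a = i"
      using split_wrd_lt[OF xs(1), of i] assms(2) unfolding xs(2) by blast
    then show ?thesis
      using E_pure[of a "x # c" i] E_pure[of "a @ [x]" c "Suc i"] M_pure[of a "\<one>\<^bsub>A\<^esub>" x c i] M_pure[of a x "\<one>\<^bsub>A\<^esub>" c i]
      by simp
  qed
  show "M i (E i t) = t" "M i (E (Suc i) t) = t"
    using assms(1) by (induction rule: tp_induct)
      (simp_all add: * lin_add[OF M_linear] lin_smult[OF M_linear] lin_add[OF E_linear] lin_smult[OF E_linear])
qed

end

locale balg = fixes B :: "('k::field, 'v, 'm) braided_scheme"
  assumes balg: "braided_algebra B"
begin

sublocale talg B
  using balg by unfold_locales (simp add: braided_algebra_def)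

notation tmul (infixl "\<bullet>" 72)

sublocale bvs B
  using balg by unfold_locales (simp add: braided_algebra_def)

lemma DM_deg:
  "t \<in> Rn n ==> i + 2 \<le> n ==> D i t \<in> Rn n"
  "t \<in> Rn (Suc n) ==> i < n ==> M i t \<in> Rn n"
  "t \<in> Rn n ==> i \<le> n ==> E i t \<in> Rn (Suc n)"
proof -
  show "D i t \<in> Rn n" if "t \<in> Rn n" "i + 2 \<le> n"
    using whisker_deg[OF braid_hom that(1), of i "n - (i + 2)"] that(2) by simp
  show "M i t \<in> Rn n" if "t \<in> Rn (Suc n)" "i < n"
    using whisker_deg[OF mult_map_hom that(1), of i "n - Suc i"] that(2) by simp
  show "E i t \<in> Rn (Suc n)" if "t \<in> Rn n" "i \<le> n"
    using whisker_deg[OF unit_map_hom that(1), of i "n - i"] that(2) by simp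
qed

text \<open>The hexagon axioms, with \<open>c \<otimes> id\<close> and \<open>id \<otimes> c\<close>
  read as the braiding at positions 0 and 1.\<close>

lemma base_hex:
  assumes t: "t \<in> Rn 3"
  shows "D 0 (M 0 t) = M 1 (D 0 (D 1 t))" "D 0 (M 1 t) = M 0 (D 1 (D 0 t))"
proof -
  have l: "map_tensor B 2 1 f id u = whisker B 0 2 f u" if "f \<in> hom_power B 2 k" "u \<in> Rn 3" for f u k
    using map_tensor_left[OF that(1), of u 1] that(2) by simp
  have r: "map_tensor B 1 2 id f u = whisker B 1 2 f u" if "f \<in> hom_power B 2 k" "u \<in> Rn 3" for f u k
    using map_tensor_right[OF that(1), of u 1] that(2) by simp
  note eqs = l[OF braid_hom] r[OF braid_hom] l[OF mult_map_hom] r[OF mult_map_hom]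
  have m: "M 0 t \<in> Rn 2" "M 1 t \<in> Rn 2" "D 0 t \<in> Rn 3" "D 1 t \<in> Rn 3" "D 1 (D 0 t) \<in> Rn 3" "D 0 (D 1 t) \<in> Rn 3"
    using t DM_deg by auto
  have "braid B (M 0 t) = M 1 (D 0 (D 1 t))" "braid B (M 1 t) = M 0 (D 1 (D 0 t))"
    using balg t m unfolding braided_algebra_def Let_def by (auto simp: eqs)
  then show "D 0 (M 0 t) = M 1 (D 0 (D 1 t))" "D 0 (M 1 t) = M 0 (D 1 (D 0 t))"
    using m by (simp_all add: D_0)
qed

lemma base_unit:
  assumes t: "t \<in> Rn 1"
  shows "D 0 (E 0 t) = E 1 t" "D 0 (E 1 t) = E 0 t"
proof -
  have "map_tensor B 0 1 (unit_map B) id t = E 0 t" "map_tensor B 1 0 id (unit_map B) t = E 1 t"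
    using map_tensor_left[OF unit_map_hom, of t 1] map_tensor_right[OF unit_map_hom, of t 1] t by simp_all
  then have "braid B (E 0 t) = E 1 t" "braid B (E 1 t) = E 0 t"
    using balg t unfolding braided_algebra_def Let_def by auto
  moreover have "E 0 t \<in> Rn 2" "E 1 t \<in> Rn 2"
    using DM_deg(3)[OF t, of 0] DM_deg(3)[OF t, of 1] by simp_all
  ultimately show "D 0 (E 0 t) = E 1 t" "D 0 (E 1 t) = E 0 t" by (simp_all add: D_0)
qed

lemma local_M: "local_at B i 3 (M i) (M 0)" "local_at B i 3 (M (Suc i)) (M 1)"
  and local_E1: "local_at B i 1 (E i) (E 0)" "local_at B i 1 (E (Suc i)) (E 1)"
  using local_at_shift[OF mult_map_hom, of 0 3 i] local_at_shift[OF mult_map_hom, of 1 3 i]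
    local_at_shift[OF unit_map_hom, of 0 1 i] local_at_shift[OF unit_map_hom, of 1 1 i] by simp_all

lemma deg3: "t \<in> Rn 3 ==> D 0 t \<in> Rn 3" "t \<in> Rn 3 ==> D 1 t \<in> Rn 3" "t \<in> Rn 3 ==> M 0 t \<in> Rn 2"
  "t \<in> Rn 3 ==> M 1 t \<in> Rn 2" "t \<in> Rn 1 ==> E 0 t \<in> Rn 2" "t \<in> Rn 1 ==> E 1 t \<in> Rn 2"
  using DM_deg(1)[of t 3 0] DM_deg(1)[of t 3 1] DM_deg(2)[of t 2 0] DM_deg(2)[of t 2 1] DM_deg(3)[of t 1 0]
    DM_deg(3)[of t 1 1] by simp_all

lemma hex1: "j = Suc i ==> t \<in> CT ==> D i (M i t) = M j (D i (D j t))"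
proof (erule ssubst, rule local_at_eq_TA[of i 3, OF local_at_comp[OF local_D2 local_M(1)]
      local_at_comp[OF local_M(2) local_at_comp[OF local_D(1) local_D(2)]] base_hex(1)])
  fix n t assume nt: "n < i + 3" "t \<in> Rn n"
  then have "D i (M i t) = zeroT" "D (Suc i) t = zeroT"
    using whisker_short2[OF braid_hom mult_map_hom nt(2), of i i] whisker_short[OF braid_hom nt(2), of "Suc i"] by simp_all
  then show "D i (M i t) = M (Suc i) (D i (D (Suc i) t))"
    using braid_hom mult_map_hom by simp
qed (auto intro: deg3)

lemma hex2: "j = Suc i ==> t \<in> CT ==> D i (M j t) = M i (D j (D i t))"
proof (erule ssubst, rule local_at_eq_TA[of i 3, OF local_at_comp[OF local_D2 local_M(2)]
      local_at_comp[OF local_M(1) local_at_comp[OF local_D(2) local_D(1)]] base_hex(2)])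
  fix n t assume nt: "n < i + 3" "t \<in> Rn n"
  then have "D i (M (Suc i) t) = zeroT" "D (Suc i) (D i t) = zeroT"
    using whisker_short2[OF braid_hom mult_map_hom nt(2), of "Suc i" i] whisker_short2[OF braid_hom braid_hom nt(2), of i "Suc i"] by simp_all
  then show "D i (M (Suc i) t) = M i (D (Suc i) (D i t))"
    using braid_hom mult_map_hom by simp
qed (auto intro: deg3)

lemma D_E: "[|t \<in> Rn n; i < n|] ==> D i (E i t) = E (Suc i) t" "[|t \<in> Rn n; i < n|] ==> D i (E (Suc i) t) = E i t"
proof -
  show "D i (E i t) = E (Suc i) t" if "t \<in> Rn n" "i < n"
    by (rule local_at_eq_Rn[of i 1, OF local_at_comp[OF local_D2 local_E1(1)] local_E1(2) _ base_unit(1) that(1)])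
      (use that in \<open>auto intro: deg3\<close>)
  show "D i (E (Suc i) t) = E i t" if "t \<in> Rn n" "i < n"
    by (rule local_at_eq_Rn[of i 1, OF local_at_comp[OF local_D2 local_E1(2)] local_E1(1) _ base_unit(2) that(1)])
      (use that in \<open>auto intro: deg3\<close>)
qed

lemma D_M: "i + 2 \<le> j ==> t \<in> CT ==> D i (M j t) = M j (D i t)"
  by (drule le_Suc_ex, erule exE) (simp only: whisker_commute[OF braid_hom mult_map_hom])

lemma M_D: "i < j ==> t \<in> CT ==> M i (D (Suc j) t) = D j (M i t)"
  using whisker_commute[OF mult_map_hom braid_hom, of t i "j - Suc i"] by simp

lemma M_M: "i < j ==> t \<in> CT ==> M i (M (Suc j) t) = M j (M i t)"
  using whisker_commute[OF mult_map_hom mult_map_hom, of t i "j - Suc i"] by simp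

lemma E_D: "i \<le> j ==> t \<in> CT ==> E i (D j t) = D (Suc j) (E i t)"
  using whisker_commute[OF unit_map_hom braid_hom, of t i "j - i"] by simp

lemma E_M: "i \<le> j ==> t \<in> CT ==> E i (M j t) = M (Suc j) (E i t)"
  using whisker_commute[OF unit_map_hom mult_map_hom, of t i "j - i"] by simp

lemma D_E_right: "i + 2 \<le> j ==> t \<in> CT ==> D i (E j t) = E j (D i t)"
  by (drule le_Suc_ex, erule exE) (simp only: whisker_commute[OF braid_hom unit_map_hom])

text \<open>The braiding at position 0 of the last three factors is the braiding at position 1 of
  all four.\<close>

lemma braided_mult_eq: "t \<in> Rn 4 ==> braided_mult B t = M 0 (M 2 (D 1 t))"
proof -
  assume t: "t \<in> Rn 4"
  let ?c = "map_tensor B 2 1 (braid B) id"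
  have ceq: "?c u = D 0 u" if "u \<in> Rn 3" for u
    using map_tensor_left[OF braid_hom, of u 1] that by simp
  have D03: "D 0 \<in> hom_power B 3 3" using whisker_hom[OF braid_hom, of 0 1] by simp
  have c: "?c \<in> hom_power B 3 3"
    by (rule lin_cong[OF D03 vspace_Rn ceq])
  have "map_tensor B 1 3 id ?c t = whisker B 1 3 ?c t"
    using map_tensor_right[OF c, of t 1] t by simp
  also have "\<dots> = D 1 t"
    by (rule local_at_eq_Rn[OF local_at_whisker[OF c] local_at_shift[OF braid_hom, of 0 3 1], simplified])
      (use ceq t in auto)
  finally have 1: "map_tensor B 1 3 id ?c t = D 1 t" .
  have d: "D 1 t \<in> Rn 4" using DM_deg(1)[OF t, of 1] by simp
  have "map_tensor B 2 2 (mult_map B) (mult_map B) (D 1 t) = M 0 (M 2 (D 1 t))"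
    using map_tensor_eq[OF mult_map_hom mult_map_hom, of "D 1 t"] d by simp
  then show ?thesis unfolding braided_mult_def 1 .
qed

lemma pure_cons: "x \<in> C ==> xs \<in> wrd ==> pt (x # xs) = pt [x] \<bullet> pt xs"
  using pure_append[of "[x]" xs] by simp

lemma E_mult: "x \<in> C ==> t \<in> CT ==> E 0 (pt [x] \<bullet> t) = pt [\<one>\<^bsub>B\<^esub>, x] \<bullet> t"
  "x \<in> C ==> t \<in> CT ==> E 1 (pt [x] \<bullet> t) = pt [x, \<one>\<^bsub>B\<^esub>] \<bullet> t"
proof -
  assume x: "x \<in> C" "t \<in> CT"
  show "E 0 (pt [x] \<bullet> t) = pt [\<one>\<^bsub>B\<^esub>, x] \<bullet> t"
    using whisker_right[OF unit_map_hom Rn_pure, of "[x]" 1 0 t] E_pure[of "[]" "[x]" 0] x by simp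
  show "E 1 (pt [x] \<bullet> t) = pt [x, \<one>\<^bsub>B\<^esub>] \<bullet> t"
    using whisker_right[OF unit_map_hom Rn_pure, of "[x]" 1 1 t] E_pure[of "[x]" "[]" 1] x by simp
qed

text \<open>Multiplying by \<open>x \<otimes> 1 + 1 \<otimes> x\<close> inserts units into
  \<open>x \<otimes> t\<close>; these travel through the braiding and cancel against a
  multiplication. What is left acts on three factors: \<open>x\<close> is multiplied into the first
  factor of \<open>t\<close>, or braided past it and multiplied into the second.\<close>

lemma braided_mult_primitive:
  assumes x: "x \<in> C" and t: "t \<in> Rn 2"
  shows "braided_mult B ((pt [x, \<one>\<^bsub>B\<^esub>] \<oplus>\<^bsub>TA\<^esub> pt [\<one>\<^bsub>B\<^esub>, x]) \<bullet> t) = M 0 (pt [x] \<bullet> t) \<oplus>\<^bsub>TA\<^esub> M 1 (D 0 (pt [x] \<bullet> t))"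
proof -
  define u where "u = pt [x] \<bullet> t"
  have u: "u \<in> Rn 3" using Rn_mult[of "pt [x]" 1 t 2] x t by (simp add: u_def)
  have p: "pt [x, \<one>\<^bsub>B\<^esub>] \<in> Rn 2" "pt [\<one>\<^bsub>B\<^esub>, x] \<in> Rn 2" using x by (auto intro!: Rn_pure)
  have "(pt [x, \<one>\<^bsub>B\<^esub>] \<oplus>\<^bsub>TA\<^esub> pt [\<one>\<^bsub>B\<^esub>, x]) \<bullet> t = E 1 u \<oplus>\<^bsub>TA\<^esub> E 0 u"
    using x t by (simp only: u_def E_mult Rn_cl) (simp add: R.A.l_distr)
  moreover have "(pt [x, \<one>\<^bsub>B\<^esub>] \<oplus>\<^bsub>TA\<^esub> pt [\<one>\<^bsub>B\<^esub>, x]) \<bullet> t \<in> Rn 4"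
    using Rn_mult[of "pt [x, \<one>\<^bsub>B\<^esub>] \<oplus>\<^bsub>TA\<^esub> pt [\<one>\<^bsub>B\<^esub>, x]" 2 t 2] p t by auto
  ultimately have "braided_mult B ((pt [x, \<one>\<^bsub>B\<^esub>] \<oplus>\<^bsub>TA\<^esub> pt [\<one>\<^bsub>B\<^esub>, x]) \<bullet> t)
      = M 0 (M 2 (D 1 (E 1 u))) \<oplus>\<^bsub>TA\<^esub> M 0 (M 2 (D 1 (E 0 u)))"
    using u by (simp add: braided_mult_eq lin_add[OF D_linear] lin_add[OF M_linear])
  also have "D 1 (E 1 u) = E 2 u" using D_E(1)[OF u, of 1] by simp
  also have "M 2 (E 2 u) = u" using M_E(1)[OF u, of 2] by simp
  also have "D 1 (E 0 u) = E 0 (D 0 u)" using E_D[of 0 0 u] u by simp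
  also have "M 2 (E 0 (D 0 u)) = E 0 (M 1 (D 0 u))" using E_M[of 0 1 "D 0 u"] u by simp
  also have "M 0 (E 0 (M 1 (D 0 u))) = M 1 (D 0 u)"
    by (rule M_E(1)[OF deg3(4)[OF deg3(1)[OF u]]]) simp
  finally show ?thesis by (simp add: u_def)
qed

end

text \<open>What \<open>A\<close> and the braided tensor algebra share; it makes primitivity modulo
  a subspace available for both.\<close>

locale bcoalg = fixes B :: "('k::field, 'v, 'm) braided_bialg_scheme"
  assumes bcoalg_balg: "braided_algebra B" and comult_linear: "comult B \<in> linear_maps B (tensor_power B 2)"
begin

sublocale balg B by (rule balg.intro[OF bcoalg_balg])

lemma comult_hom: "comult_map B \<in> hom_power B 1 2"
  and comult_map_pure: "x \<in> C ==> comult_map B (pt [x]) = comult B x"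
  unfolding comult_map_def using hom_1_I[OF comult_linear] by auto

notation tmul (infixl "\<bullet>" 72)

abbreviation "Cm i \<equiv> whisker B i 1 (comult_map B)"

lemmas Cm_linear = whisker_linear[OF comult_hom]
lemmas Cm_cl [simp] = whisker_cl[OF comult_hom]

text \<open>The reduced comultiplication; its zeros are the primitive elements. At a group-like unit
  its value is \<open>-(1 \<otimes> 1)\<close>.\<close>

definition "pr x = comult B x \<ominus>\<^bsub>TA\<^esub> (pt [x, \<one>\<^bsub>B\<^esub>] \<oplus>\<^bsub>TA\<^esub> pt [\<one>\<^bsub>B\<^esub>, x])"

text \<open>For a coideal \<open>K\<close> these are the elements whose class modulo
  \<open>K\<close> is primitive.\<close>

definition "prim_mod K = {x \<in> C. pr x \<in> Nker K}"

lemma comult_cl: "x \<in> C ==> comult B x \<in> Rn 2"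
  using lin_cl[OF comult_linear] .

lemma pr_linear: "pr \<in> linear_maps B (tensor_power B 2)"
proof -
  have 1: "(\<lambda>x. pt ([] @ x # [\<one>\<^bsub>B\<^esub>])) \<in> linear_maps B TA" "(\<lambda>x. pt ([\<one>\<^bsub>B\<^esub>] @ x # [])) \<in> linear_maps B TA"
    by (rule multilin_linear[OF pure_multilin]; simp)+
  have c: "comult B \<in> linear_maps B TA" using comult_linear by (auto simp: linear_maps_def)
  have l: "pr \<in> linear_maps B TA"
    unfolding pr_def using 1 c by (intro lin_diff linear_sum R.vsp) simp_all
  have "pr x \<in> Rn 2" if "x \<in> C" for x
    unfolding pr_def using that comult_cl[OF that]
    by (intro R.subsp_minus[OF Rn_subsp] Rn_add Rn_pure) simp_all
  then show ?thesis using l by (auto simp: linear_maps_def)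
qed

lemma prim_mod_subsp: "K \<subseteq> C ==> subsp B (prim_mod K)"
  unfolding prim_mod_def
  by (rule subsp_vimage[OF _ A.vsp R.vsp Nker_subsp]) (use pr_linear in \<open>auto simp: linear_maps_def\<close>)

definition "pr_map = multilinear_lift TA 1 (\<lambda>xs. pr (xs ! 0))"

lemma pr_map_hom: "pr_map \<in> hom_power B 1 2"
  and pr_map_pure: "x \<in> C ==> pr_map (pt [x]) = pr x"
  unfolding pr_map_def using hom_1_I[OF pr_linear] by auto

text \<open>\<open>Cm\<close> and the unit insertions have rules for passing through the braiding;
  in this form \<open>pr\<close> inherits them.\<close>

lemma pr_map_eq: "i < n ==> t \<in> Rn n ==> whisker B i 1 pr_map t = Cm i t \<ominus>\<^bsub>TA\<^esub> (E (Suc i) t \<oplus>\<^bsub>TA\<^esub> E i t)"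
proof (rule local_at_eq_Rn[of i 1, OF local_at_whisker[OF pr_map_hom]
      local_at_diff[OF local_at_whisker[OF comult_hom] local_at_sum[OF local_E1(2) local_E1(1)]]])
  fix t assume "t \<in> Rn 1"
  then obtain x where "x \<in> C" "t = pt [x]" by (rule Rn1_E)
  then show "pr_map t = comult_map B t \<ominus>\<^bsub>TA\<^esub> (E 1 t \<oplus>\<^bsub>TA\<^esub> E 0 t)"
    using E_pure[of "[x]" "[]" 1] E_pure[of "[]" "[x]" 0] by (simp add: pr_map_pure comult_map_pure pr_def)
qed simp_all

text \<open>Turns membership in \<open>N\<close> into the equation \<open>q t = 0\<close>, the form
  that the slice lemmas consume.\<close>

lemma quotient_projection:
  assumes "subsp (tensor_power B n) N"
  obtains q where "q \<in> hom_power B n n" "\<And>t. t \<in> Rn n ==> q t = zeroT \<longleftrightarrow> t \<in> N"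
proof -
  let ?R = "tensor_power B n"
  interpret Rn: vspace ?R by (rule vspace_Rn)
  have N: "\<And>t. t \<in> N ==> t \<in> Rn n" using assms by (auto simp: subsp_def)
  have incl: "(\<lambda>t. t) \<in> linear_maps (?R\<lparr>carrier := N\<rparr>) ?R" using N by (auto intro: linI)
  obtain g where g: "g \<in> linear_maps ?R (?R\<lparr>carrier := N\<rparr>)" "\<And>t. t \<in> N ==> g t = t"
    using generalized_inverse[OF incl Rn.subsp_vspace[OF assms] vspace_Rn] by auto
  have gR: "g \<in> hom_power B n n" using g(1) N by (auto simp: linear_maps_def)
  have gN: "g t \<in> N" if "t \<in> Rn n" for t using lin_cl[OF g(1)] that by simp
  let ?q = "\<lambda>t. t \<ominus>\<^bsub>?R\<^esub> g t"
  have "?q \<in> hom_power B n n" by (rule lin_diff[OF _ gR vspace_Rn]) (auto intro: linI)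
  moreover have "?q t = zeroT \<longleftrightarrow> t \<in> N" if t: "t \<in> Rn n" for t
    using Rn.minus_zero_iff[OF t N[OF gN[OF t]]] gN[OF t] g(2)[of t] by auto
  ultimately show ?thesis using that by blast
qed

context
  fixes S K
  assumes S: "subsp B S" and K: "K \<subseteq> C"
begin

lemma SC: "S \<subseteq> C" using S by (simp add: subsp_def)

text \<open>Both maps below are obtained from \<open>pr\<close> by composing with a projection whose kernel is \<open>Nker K\<close>;
  the braiding moves \<open>pr\<close> across \<open>S\<close>, so that its slices stay primitive modulo \<open>K\<close>.\<close>

lemma braid_prim_mod_right:
  assumes a: "\<And>t. t \<in> tspan B [C, S] ==> braid B t \<in> tspan B [S, C]"
    and b: "\<And>t. t \<in> tspan B [C, S] ==> Cm 1 (D 0 t) = D 0 (D 1 (Cm 0 t))"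
    and c: "\<And>t. t \<in> tspan B [K, S] ==> braid B t \<in> tspan B [S, K]"
    and t: "t \<in> tspan B [prim_mod K, S]"
  shows "braid B t \<in> tspan B [S, prim_mod K]"
proof -
  have "subsp (tensor_power B 2) (Nker K)"
    using Nker_subsp[OF K] Nker_Rn[OF K] by (auto simp: subsp_def)
  then obtain q where q: "q \<in> hom_power B 2 2" "\<And>t. t \<in> Rn 2 ==> q t = zeroT \<longleftrightarrow> t \<in> Nker K"
    by (rule quotient_projection) blast
  let ?h = "\<lambda>t. q (pr_map t)"
  have h: "?h \<in> hom_power B 1 2" by (rule lin_comp[OF pr_map_hom q(1)])
  have Xs: "prim_mod K \<subseteq> C" by (auto simp: prim_mod_def)
  have t0: "t \<in> tspan B [C, S]"
    using subsetD[OF tspan_mono[of "[prim_mod K, S]" "[C, S]"] t] Xs SC by simp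
  have t2: "t \<in> Rn 2" using subsetD[OF tspan_Rn t0] SC by simp
  have D0t: "D 0 t = braid B t" by (rule D_0[OF t2])
  have d2: "D 0 t \<in> Rn 2" using DM_deg(1)[OF t2] by simp
  \<comment> \<open>The two spans stand for \<open>Nker K \<otimes> S\<close> and, after the
    braiding, \<open>S \<otimes> Nker K\<close>.\<close>
  let ?N1 = "lspan TA (tspan B [K, C, S] \<union> tspan B [C, K, S])"
  let ?N2 = "lspan TA (tspan B [S, K, C] \<union> tspan B [S, C, K])"
  have ok: "tspan B [K, C, S] \<union> tspan B [C, K, S] \<subseteq> CT" "tspan B [S, K, C] \<union> tspan B [S, C, K] \<subseteq> CT"
    using K SC by (auto dest: tspan_cl[rotated])
  note N1 = R.lspan_subsp[OF ok(1)] and N2 = R.lspan_subsp[OF ok(2)]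
  have 1: "whisker B 0 1 pr_map t \<in> ?N1"
  proof (rule lspan_image_subset[OF whisker_linear[OF pr_map_hom] R.vsp R.vsp N1])
    show "t \<in> lspan TA (pt ` {xs. list_all2 (\<in>) xs [prim_mod K, S]})" using t by (simp add: tspan_def)
    show "pt ` {xs. list_all2 (\<in>) xs [prim_mod K, S]} \<subseteq> CT" using Xs SC by (auto dest!: list_all2_wrd)
    fix y assume "y \<in> pt ` {xs. list_all2 (\<in>) xs [prim_mod K, S]}"
    then obtain x s where y: "y = pt [x, s]" "x \<in> prim_mod K" "s \<in> S" by (auto simp: list_all2_Cons2)
    then have xs: "x \<in> C" "s \<in> C" "pr x \<in> Nker K" using SC by (auto simp: prim_mod_def)
    have "whisker B 0 1 pr_map y = pr x \<bullet> pt [s]"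
      using whisker_pure[OF pr_map_hom, of "[]" "[x]" "[s]" 0] xs lin_cl[OF pr_linear xs(1)]
      by (simp add: y pr_map_pure pure_Nil)
    also have "\<dots> \<in> ?N1"
    proof -
      have "Nker K \<subseteq> {u \<in> CT. u \<bullet> pt [s] \<in> ?N1}"
      proof (rule Nker_least[OF subsp_vimage[OF rmult_linear R.vsp R.vsp N1]])
        show "pt [s] \<in> CT" using xs by simp
        have s: "pt [s] \<in> tspan B [S]" using y by (intro tspan_pure) simp
        show "tspan B [K, C] \<subseteq> {u \<in> CT. u \<bullet> pt [s] \<in> ?N1}"
          using tspan_mult[of "[K, C]" "[S]" _ "pt [s]"] s K SC tspan_cl[of "[K, C]"] by (auto intro: lspan.base)
        show "tspan B [C, K] \<subseteq> {u \<in> CT. u \<bullet> pt [s] \<in> ?N1}"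
          using tspan_mult[of "[C, K]" "[S]" _ "pt [s]"] s K SC tspan_cl[of "[C, K]"] by (auto intro: lspan.base)
      qed
      then show ?thesis using xs by auto
    qed
    finally show "whisker B 0 1 pr_map y \<in> ?N1" .
  qed
  have mv1: "D 1 u \<in> tspan B [T, S, U]" if "\<And>t. t \<in> tspan B [U, S] ==> braid B t \<in> tspan B [S, U]"
    "T \<subseteq> C" "U \<subseteq> C" "u \<in> tspan B [T, U, S]" for T U u
    using local_at_tspan[OF local_at_whisker[OF braid_hom, of 1], of "[T]" "[U, S]" "[]" "[S, U]" u] that SC by simp
  have mv0: "D 0 u \<in> tspan B [S, U, T]" if "\<And>t. t \<in> tspan B [U, S] ==> braid B t \<in> tspan B [S, U]"
    "T \<subseteq> C" "U \<subseteq> C" "u \<in> tspan B [U, S, T]" for T U u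
    using local_at_tspan[OF local_at_whisker[OF braid_hom, of 0], of "[]" "[U, S]" "[T]" "[S, U]" u] that SC by simp
  have 2: "D 0 (D 1 u) \<in> ?N2" if "u \<in> ?N1" for u
  proof (rule lspan_image_subset[OF lin_comp[OF D_linear D_linear] R.vsp R.vsp N2 ok(1) _ that])
    fix u assume "u \<in> tspan B [K, C, S] \<union> tspan B [C, K, S]"
    then show "D 0 (D 1 u) \<in> ?N2"
      using mv1[of C K u] mv0[of K C "D 1 u"] mv1[of K C u] mv0[of C K "D 1 u"] a c K
      by (auto intro: lspan.base)
  qed
  have 3: "whisker B 1 2 q u = zeroT" if "u \<in> ?N2" for u
  proof -
    have g: "whisker B 1 2 q (pt [s, x, y]) = zeroT" if "s \<in> C" "x \<in> C" "y \<in> C" "pt [x, y] \<in> Nker K" for s x y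
      using whisker_pure[OF q(1), of "[s]" "[x, y]" "[]" 1] that q(2)[of "pt [x, y]"] by simp
    have "whisker B 1 2 q u \<in> {zeroT}"
    proof (rule lspan_image_subset[OF whisker_linear[OF q(1)] R.vsp R.vsp R.subsp_0 ok(2) _ that])
      have z: "subsp TA {u \<in> CT. whisker B 1 2 q u \<in> {zeroT}}"
        by (rule subsp_vimage[OF whisker_linear[OF q(1)] R.vsp R.vsp R.subsp_0])
      have n: "pt [x, y] \<in> Nker K" if "x \<in> K \<and> y \<in> C \<or> x \<in> C \<and> y \<in> K" for x y
        using that Nker_incl[OF K] tspan_pure[of "[x, y]" "[K, C]"] tspan_pure[of "[x, y]" "[C, K]"] by auto
      have "tspan B [S, K, C] \<subseteq> {u \<in> CT. whisker B 1 2 q u \<in> {zeroT}}"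
        "tspan B [S, C, K] \<subseteq> {u \<in> CT. whisker B 1 2 q u \<in> {zeroT}}"
        using K SC by (intro tspan_least[OF z]; auto simp: list_all2_Cons2 intro!: g n)+
      then show "\<And>x. x \<in> tspan B [S, K, C] \<union> tspan B [S, C, K] ==> whisker B 1 2 q x \<in> {zeroT}" by auto
    qed
    then show ?thesis by simp
  qed
  \<comment> \<open>\<open>Cm\<close> and both unit insertions pass the factor from \<open>S\<close>
    through the same operator \<open>D 0 (D 1 _)\<close>, hence so does \<open>pr\<close>.\<close>
  have "whisker B 1 1 pr_map (D 0 t) = Cm 1 (D 0 t) \<ominus>\<^bsub>TA\<^esub> (E 2 (D 0 t) \<oplus>\<^bsub>TA\<^esub> E 1 (D 0 t))"
    using pr_map_eq[OF _ d2, of 1] by simp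
  also have "E 2 (D 0 t) = D 0 (D 1 (E 1 t))"
    using D_E_right[of 0 2 t] D_E(1)[OF t2, of 1] t2 by simp
  also have "E 1 (D 0 t) = D 0 (D 1 (E 0 t))"
    using E_D[of 0 0 t] D_E(1)[OF d2, of 0] t2 by simp
  also have "Cm 1 (D 0 t) = D 0 (D 1 (Cm 0 t))" by (rule b[OF t0])
  also have "D 0 (D 1 (Cm 0 t)) \<ominus>\<^bsub>TA\<^esub> (D 0 (D 1 (E 1 t)) \<oplus>\<^bsub>TA\<^esub> D 0 (D 1 (E 0 t)))
      = D 0 (D 1 (Cm 0 t \<ominus>\<^bsub>TA\<^esub> (E 1 t \<oplus>\<^bsub>TA\<^esub> E 0 t)))"
    using t2 by (simp add: lin_add[OF D_linear] lin_minus[OF D_linear R.vsp R.vsp])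
  also have "Cm 0 t \<ominus>\<^bsub>TA\<^esub> (E 1 t \<oplus>\<^bsub>TA\<^esub> E 0 t) = whisker B 0 1 pr_map t"
    using pr_map_eq[OF _ t2, of 0] by simp
  finally have "whisker B 1 1 pr_map (D 0 t) \<in> ?N2" using 2[OF 1] by simp
  then have "whisker B 1 2 q (whisker B 1 1 pr_map (D 0 t)) = zeroT" by (rule 3)
  moreover have "whisker B 1 1 ?h (D 0 t) = whisker B 1 2 q (whisker B 1 1 pr_map (D 0 t))"
    by (rule local_at_eq_Rn[OF local_at_whisker[OF h] local_at_comp[OF local_at_whisker[OF q(1)] local_at_whisker[OF pr_map_hom]]])
      (use d2 hom_cl[OF pr_map_hom] in auto)
  ultimately have "D 0 t \<in> tspan B [S, {x \<in> C. ?h (pt [x]) = zeroT}]"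
    using a[OF t0] D0t by (intro slice_right[OF h SC]) simp_all
  moreover have "{x \<in> C. ?h (pt [x]) = zeroT} = prim_mod K"
    using q(2)[OF lin_cl[OF pr_linear]] by (auto simp: prim_mod_def pr_map_pure)
  ultimately show ?thesis using D0t by simp
qed

lemma braid_prim_mod_left:
  assumes a: "\<And>t. t \<in> tspan B [S, C] ==> braid B t \<in> tspan B [C, S]"
    and b: "\<And>t. t \<in> tspan B [S, C] ==> Cm 0 (D 0 t) = D 1 (D 0 (Cm 1 t))"
    and c: "\<And>t. t \<in> tspan B [S, K] ==> braid B t \<in> tspan B [K, S]"
    and t: "t \<in> tspan B [S, prim_mod K]"
  shows "braid B t \<in> tspan B [prim_mod K, S]"
proof -
  have "subsp (tensor_power B 2) (Nker K)"
    using Nker_subsp[OF K] Nker_Rn[OF K] by (auto simp: subsp_def)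
  then obtain q where q: "q \<in> hom_power B 2 2" "\<And>t. t \<in> Rn 2 ==> q t = zeroT \<longleftrightarrow> t \<in> Nker K"
    by (rule quotient_projection) blast
  let ?h = "\<lambda>t. q (pr_map t)"
  have h: "?h \<in> hom_power B 1 2" by (rule lin_comp[OF pr_map_hom q(1)])
  have Xs: "prim_mod K \<subseteq> C" by (auto simp: prim_mod_def)
  have t0: "t \<in> tspan B [S, C]"
    using subsetD[OF tspan_mono[of "[S, prim_mod K]" "[S, C]"] t] Xs SC by simp
  have t2: "t \<in> Rn 2" using subsetD[OF tspan_Rn t0] SC by simp
  have D0t: "D 0 t = braid B t" by (rule D_0[OF t2])
  have d2: "D 0 t \<in> Rn 2" using DM_deg(1)[OF t2] by simp
  let ?N1 = "lspan TA (tspan B [S, K, C] \<union> tspan B [S, C, K])"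
  let ?N2 = "lspan TA (tspan B [K, C, S] \<union> tspan B [C, K, S])"
  have ok: "tspan B [S, K, C] \<union> tspan B [S, C, K] \<subseteq> CT" "tspan B [K, C, S] \<union> tspan B [C, K, S] \<subseteq> CT"
    using K SC by (auto dest: tspan_cl[rotated])
  note N1 = R.lspan_subsp[OF ok(1)] and N2 = R.lspan_subsp[OF ok(2)]
  have 1: "whisker B 1 1 pr_map t \<in> ?N1"
  proof (rule lspan_image_subset[OF whisker_linear[OF pr_map_hom] R.vsp R.vsp N1])
    show "t \<in> lspan TA (pt ` {xs. list_all2 (\<in>) xs [S, prim_mod K]})" using t by (simp add: tspan_def)
    show "pt ` {xs. list_all2 (\<in>) xs [S, prim_mod K]} \<subseteq> CT" using Xs SC by (auto dest!: list_all2_wrd)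
    fix y assume "y \<in> pt ` {xs. list_all2 (\<in>) xs [S, prim_mod K]}"
    then obtain x s where y: "y = pt [s, x]" "x \<in> prim_mod K" "s \<in> S" by (auto simp: list_all2_Cons2)
    then have xs: "x \<in> C" "s \<in> C" "pr x \<in> Nker K" using SC by (auto simp: prim_mod_def)
    have "whisker B 1 1 pr_map y = pt [s] \<bullet> pr x"
      using whisker_pure[OF pr_map_hom, of "[s]" "[x]" "[]" 1] xs Rn_cl[OF lin_cl[OF pr_linear xs(1)]]
      by (simp add: y pr_map_pure pure_Nil)
    also have "\<dots> \<in> ?N1"
    proof -
      have "Nker K \<subseteq> {u \<in> CT. pt [s] \<bullet> u \<in> ?N1}"
      proof (rule Nker_least[OF subsp_vimage[OF lmult_linear R.vsp R.vsp N1]])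
        show "pt [s] \<in> CT" using xs by simp
        have s: "pt [s] \<in> tspan B [S]" using y by (intro tspan_pure) simp
        show "tspan B [K, C] \<subseteq> {u \<in> CT. pt [s] \<bullet> u \<in> ?N1}"
          using tspan_mult[of "[S]" "[K, C]" "pt [s]"] s K SC tspan_cl[of "[K, C]"] by (auto intro: lspan.base)
        show "tspan B [C, K] \<subseteq> {u \<in> CT. pt [s] \<bullet> u \<in> ?N1}"
          using tspan_mult[of "[S]" "[C, K]" "pt [s]"] s K SC tspan_cl[of "[C, K]"] by (auto intro: lspan.base)
      qed
      then show ?thesis using xs by auto
    qed
    finally show "whisker B 1 1 pr_map y \<in> ?N1" .
  qed
  have mv1: "D 1 u \<in> tspan B [T, U, S]" if "\<And>t. t \<in> tspan B [S, U] ==> braid B t \<in> tspan B [U, S]"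
    "T \<subseteq> C" "U \<subseteq> C" "u \<in> tspan B [T, S, U]" for T U u
    using local_at_tspan[OF local_at_whisker[OF braid_hom, of 1], of "[T]" "[S, U]" "[]" "[U, S]" u] that SC by simp
  have mv0: "D 0 u \<in> tspan B [U, S, T]" if "\<And>t. t \<in> tspan B [S, U] ==> braid B t \<in> tspan B [U, S]"
    "T \<subseteq> C" "U \<subseteq> C" "u \<in> tspan B [S, U, T]" for T U u
    using local_at_tspan[OF local_at_whisker[OF braid_hom, of 0], of "[]" "[S, U]" "[T]" "[U, S]" u] that SC by simp
  have 2: "D 1 (D 0 u) \<in> ?N2" if "u \<in> ?N1" for u
  proof (rule lspan_image_subset[OF lin_comp[OF D_linear D_linear] R.vsp R.vsp N2 ok(1) _ that])
    fix u assume "u \<in> tspan B [S, K, C] \<union> tspan B [S, C, K]"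
    then show "D 1 (D 0 u) \<in> ?N2"
      using mv0[of C K u] mv1[of K C "D 0 u"] mv0[of K C u] mv1[of C K "D 0 u"] a c K
      by (auto intro: lspan.base)
  qed
  have 3: "whisker B 0 2 q u = zeroT" if "u \<in> ?N2" for u
  proof -
    have g: "whisker B 0 2 q (pt [x, y, s]) = zeroT" if "s \<in> C" "x \<in> C" "y \<in> C" "pt [x, y] \<in> Nker K" for s x y
      using whisker_pure[OF q(1), of "[]" "[x, y]" "[s]" 0] that q(2)[of "pt [x, y]"] by simp
    have "whisker B 0 2 q u \<in> {zeroT}"
    proof (rule lspan_image_subset[OF whisker_linear[OF q(1)] R.vsp R.vsp R.subsp_0 ok(2) _ that])
      have z: "subsp TA {u \<in> CT. whisker B 0 2 q u \<in> {zeroT}}"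
        by (rule subsp_vimage[OF whisker_linear[OF q(1)] R.vsp R.vsp R.subsp_0])
      have n: "pt [x, y] \<in> Nker K" if "x \<in> K \<and> y \<in> C \<or> x \<in> C \<and> y \<in> K" for x y
        using that Nker_incl[OF K] tspan_pure[of "[x, y]" "[K, C]"] tspan_pure[of "[x, y]" "[C, K]"] by auto
      have "tspan B [K, C, S] \<subseteq> {u \<in> CT. whisker B 0 2 q u \<in> {zeroT}}"
        "tspan B [C, K, S] \<subseteq> {u \<in> CT. whisker B 0 2 q u \<in> {zeroT}}"
        using K SC by (intro tspan_least[OF z]; auto simp: list_all2_Cons2 intro!: g n)+
      then show "\<And>x. x \<in> tspan B [K, C, S] \<union> tspan B [C, K, S] ==> whisker B 0 2 q x \<in> {zeroT}" by auto
    qed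
    then show ?thesis by simp
  qed
  have "whisker B 0 1 pr_map (D 0 t) = Cm 0 (D 0 t) \<ominus>\<^bsub>TA\<^esub> (E 1 (D 0 t) \<oplus>\<^bsub>TA\<^esub> E 0 (D 0 t))"
    using pr_map_eq[OF _ d2, of 0] by simp
  also have "E 1 (D 0 t) = D 1 (D 0 (E 2 t))"
    using D_E_right[of 0 2 t] D_E(2)[OF d2, of 1] t2 by simp
  also have "E 0 (D 0 t) = D 1 (D 0 (E 1 t))"
    using E_D[of 0 0 t] D_E(2)[OF t2, of 0] t2 by simp
  also have "Cm 0 (D 0 t) = D 1 (D 0 (Cm 1 t))" by (rule b[OF t0])
  also have "D 1 (D 0 (Cm 1 t)) \<ominus>\<^bsub>TA\<^esub> (D 1 (D 0 (E 2 t)) \<oplus>\<^bsub>TA\<^esub> D 1 (D 0 (E 1 t)))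
      = D 1 (D 0 (Cm 1 t \<ominus>\<^bsub>TA\<^esub> (E 2 t \<oplus>\<^bsub>TA\<^esub> E 1 t)))"
    using t2 by (simp add: lin_add[OF D_linear] lin_minus[OF D_linear R.vsp R.vsp])
  also have "Cm 1 t \<ominus>\<^bsub>TA\<^esub> (E 2 t \<oplus>\<^bsub>TA\<^esub> E 1 t) = whisker B 1 1 pr_map t"
    using pr_map_eq[OF _ t2, of 1] by simp
  finally have "whisker B 0 1 pr_map (D 0 t) \<in> ?N2" using 2[OF 1] by simp
  then have "whisker B 0 2 q (whisker B 0 1 pr_map (D 0 t)) = zeroT" by (rule 3)
  moreover have "whisker B 0 1 ?h (D 0 t) = whisker B 0 2 q (whisker B 0 1 pr_map (D 0 t))"
    by (rule local_at_eq_Rn[OF local_at_whisker[OF h] local_at_comp[OF local_at_whisker[OF q(1)] local_at_whisker[OF pr_map_hom]]])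
      (use d2 hom_cl[OF pr_map_hom] in auto)
  ultimately have "D 0 t \<in> tspan B [{x \<in> C. ?h (pt [x]) = zeroT}, S]"
    using a[OF t0] D0t by (intro slice_left[OF h SC]) simp_all
  moreover have "{x \<in> C. ?h (pt [x]) = zeroT} = prim_mod K"
    using q(2)[OF lin_cl[OF pr_linear]] by (auto simp: prim_mod_def pr_map_pure)
  ultimately show ?thesis using D0t by simp
qed

end

end

section \<open>The braided tensor algebra exists\<close>

text \<open>Only closure and the relations of the braid group are assumed, so that the identities
  for crossings of blocks are proved without tensors.\<close>

locale braid_action =
  fixes \<sigma> :: "nat => 'x => 'x" and Cc :: "'x set"
  assumes act_cl [simp]: "x \<in> Cc ==> \<sigma> i x \<in> Cc"
    and act_far: "i + 2 \<le> j ==> x \<in> Cc ==> \<sigma> i (\<sigma> j x) = \<sigma> j (\<sigma> i x)"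
    and act_braid: "x \<in> Cc ==> \<sigma> i (\<sigma> (Suc i) (\<sigma> i x)) = \<sigma> (Suc i) (\<sigma> i (\<sigma> (Suc i) x))"
begin

text \<open>\<open>strand i n\<close> moves the strand at position \<open>i\<close> past the next \<open>n\<close> strands; \<open>block i m n\<close> moves
  the \<open>m\<close> strands starting at position \<open>i\<close> past the next \<open>n\<close> strands.\<close>

primrec strand :: "nat => nat => 'x => 'x" where
  "strand i 0 x = x"
| "strand i (Suc n) x = \<sigma> (i + n) (strand i n x)"

primrec block :: "nat => nat => nat => 'x => 'x" where
  "block i 0 n x = x"
| "block i (Suc m) n x = strand i n (block (Suc i) m n x)"

lemma strand_cl [simp]: "x \<in> Cc ==> strand i n x \<in> Cc"
  by (induction n) auto

lemma block_cl [simp]: "x \<in> Cc ==> block i m n x \<in> Cc"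
  by (induction m arbitrary: i) auto

lemma strand_add: "strand i (n + n') x = strand (i + n) n' (strand i n x)"
  by (induction n') (auto simp: add.assoc)

lemma block_add_left: "block i (m + m') n x = block i m n (block (i + m) m' n x)"
  by (induction m arbitrary: i) auto

lemma strand_act: "i + n + 1 \<le> j ==> x \<in> Cc ==> strand i n (\<sigma> j x) = \<sigma> j (strand i n x)"
  by (induction n) (auto simp: act_far)

lemma act_strand: "j + 2 \<le> i ==> x \<in> Cc ==> \<sigma> j (strand i n x) = strand i n (\<sigma> j x)"
proof (induction n)
  case (Suc n)
  then show ?case using act_far[of j "i + n" "strand i n x"] by simp
qed simp

lemma act_block: "j + 2 \<le> i ==> x \<in> Cc ==> \<sigma> j (block i m n x) = block i m n (\<sigma> j x)"
  by (induction m arbitrary: i) (auto simp: act_strand)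

lemma strand_strand: "i + n + 1 \<le> k ==> x \<in> Cc ==> strand i n (strand k n' x) = strand k n' (strand i n x)"
  by (induction n') (auto simp: strand_act)

lemma strand_block: "i + n + 1 \<le> k ==> x \<in> Cc ==> strand i n (block k m n' x) = block k m n' (strand i n x)"
  by (induction m arbitrary: k) (auto simp: strand_strand)

text \<open>Less immediate than \<open>block_add_left\<close>: each strand of the left bundle has to
  be taken past crossings of the later ones, which are far enough away to commute by
  \<open>strand_block\<close>.\<close>

lemma block_add_right: "x \<in> Cc ==> block i m (n + n') x = block (i + n) m n' (block i m n x)"
  by (induction m arbitrary: i) (auto simp: strand_add strand_block)

text \<open>The braid relation enters here: for \<open>i = j\<close> the crossing commutes past the
  block that starts two positions later and is then moved by one braid relation.\<close>

lemma block_act1: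
  "i \<le> j ==> j + 1 < i + N ==> x \<in> Cc ==> block i N 1 (\<sigma> j x) = \<sigma> (Suc j) (block i N 1 x)"
proof (induction N arbitrary: i)
  case (Suc N)
  have st: "strand k 1 y = \<sigma> k y" for k y using strand.simps(2)[of k 0 y] by simp
  show ?case
  proof (cases "i = j")
    case False
    then show ?thesis using Suc act_far[of i "Suc j" "block (Suc i) N 1 x"] by (simp add: st)
  next
    case True
    then obtain N' where "N = Suc N'" using Suc.prems by (cases N) auto
    then show ?thesis
      using True Suc.prems by (simp add: st act_block[symmetric] act_braid)
  qed
qed simp

lemma block_0 [simp]: "block i N 0 x = x"
  by (induction N arbitrary: i) auto

lemma block_act:
  "i \<le> j ==> j + 1 < i + N ==> x \<in> Cc ==> block i N p (\<sigma> j x) = \<sigma> (j + p) (block i N p x)"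
proof (induction p)
  case (Suc p)
  then show ?case
    using block_add_right[of "\<sigma> j x" i N p 1] block_add_right[of x i N p 1]
      block_act1[of "i + p" "j + p" N "block i N p x"] by simp
qed simp

lemma block_strand:
  "i \<le> k ==> k + q < i + N ==> x \<in> Cc ==> block i N p (strand k q x) = strand (k + p) q (block i N p x)"
  by (induction q) (auto simp: block_act add.assoc add.commute[of _ p] add.left_commute[of _ p])

lemma block_block:
  "i \<le> k ==> k + m + n \<le> i + N ==> x \<in> Cc ==> block i N p (block k m n x) = block (k + p) m n (block i N p x)"
  by (induction m arbitrary: k) (auto simp: block_strand)

text \<open>Yang-Baxter equation for blocks: by \<open>block_add_left\<close> it says that a
  crossing inside a bundle of \<open>m + n\<close> strands slides through the crossing of the whole
  bundle with \<open>p\<close> strands.\<close>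

lemma block_braid:
  assumes "x \<in> Cc"
  shows "block i n p (block (i + n) m p (block i m n x)) = block (i + p) m n (block i m p (block (i + m) n p x))"
  using block_add_left[of i n m p "block i m n x"] block_block[of i i m n "n + m" x p]
    block_add_left[of i m n p x] assms by (simp add: add.commute[of n m])

end

primrec chop :: "nat list => 'a list => 'a list list" where
  "chop [] xs = []"
| "chop (n # ns) xs = take n xs # chop ns (drop n xs)"

lemma length_chop [simp]: "length (chop ns xs) = length ns"
  by (induction ns arbitrary: xs) auto

lemma chop_concat: "chop (map length xss) (concat xss) = xss"
  by (induction xss) auto

lemma chop_append: "length xs = sum_list as ==> chop (as @ bs) (xs @ ys) = chop as xs @ chop bs ys"
  by (induction as arbitrary: xs) auto

lemma chop_lists: "xs \<in> lists S ==> chop ns xs \<in> lists (lists S)"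
  by (induction ns arbitrary: xs) (auto simp: in_lists_conv_set dest: in_set_takeD in_set_dropD)

lemma braided_algebraI:
  fixes B :: "('k::field, 'v, 'm) braided_scheme"
  assumes ua: "unital_algebra B" and hom: "braid B \<in> hom_power B 2 2"
    and hex: "\<And>t. t \<in> carrier (tensor_power B 3) ==>
      braid B (whisker B 0 2 (mult_map B) t) = whisker B 1 2 (mult_map B) (whisker B 0 2 (braid B) (whisker B 1 2 (braid B) t))"
      "\<And>t. t \<in> carrier (tensor_power B 3) ==>
      braid B (whisker B 1 2 (mult_map B) t) = whisker B 0 2 (mult_map B) (whisker B 1 2 (braid B) (whisker B 0 2 (braid B) t))"
    and br: "\<And>t. t \<in> carrier (tensor_power B 3) ==>
      whisker B 0 2 (braid B) (whisker B 1 2 (braid B) (whisker B 0 2 (braid B) t))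
        = whisker B 1 2 (braid B) (whisker B 0 2 (braid B) (whisker B 1 2 (braid B) t))"
    and un: "\<And>t. t \<in> carrier (tensor_power B 1) ==> braid B (whisker B 0 0 (unit_map B) t) = whisker B 1 0 (unit_map B) t"
      "\<And>t. t \<in> carrier (tensor_power B 1) ==> braid B (whisker B 1 0 (unit_map B) t) = whisker B 0 0 (unit_map B) t"
  shows "braided_algebra B"
proof -
  interpret talg B by (rule talg.intro) fact
  have l: "map_tensor B 2 1 f id u = whisker B 0 2 f u" if "f \<in> hom_power B 2 k" "u \<in> Rn 3" for f u k
    using map_tensor_left[OF that(1), of u 1] that(2) by simp
  have r: "map_tensor B 1 2 id f u = whisker B 1 2 f u" if "f \<in> hom_power B 2 k" "u \<in> Rn 3" for f u k
    using map_tensor_right[OF that(1), of u 1] that(2) by simp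
  have D: "whisker B 0 2 (braid B) t \<in> Rn 3" "whisker B 1 2 (braid B) t \<in> Rn 3" if "t \<in> Rn 3" for t
    using whisker_deg[OF hom that, of 0 1] whisker_deg[OF hom that, of 1 0] by simp_all
  have "map_tensor B 0 1 (unit_map B) id t = whisker B 0 0 (unit_map B) t"
    "map_tensor B 1 0 id (unit_map B) t = whisker B 1 0 (unit_map B) t" if "t \<in> Rn 1" for t
    using map_tensor_left[OF unit_map_hom, of t 1] map_tensor_right[OF unit_map_hom, of t 1] that by simp_all
  then show ?thesis
    unfolding braided_algebra_def braided_vector_space_def Let_def
    using ua hom by (auto simp: l[OF hom] r[OF hom] l[OF mult_map_hom] r[OF mult_map_hom] D hex br un tens_vs)
qed

text \<open>Records may differ in type, braiding or coalgebra maps. The tensor constructions read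
  only the fields compared here, so they are literally equal as functions.\<close>

definition same_alg :: "('k, 'v, 'm) module_scheme => ('k, 'v, 'n) module_scheme => bool" where
  "same_alg V W \<longleftrightarrow> carrier W = carrier V \<and> add W = add V \<and> ring.zero W = ring.zero V \<and>
     module.smult W = module.smult V \<and> monoid.mult W = monoid.mult V \<and> one W = one V"

lemma same_alg_tensor:
  fixes V :: "('k::field, 'v, 'm) module_scheme" and W :: "('k, 'v, 'n) module_scheme"
  assumes "same_alg V W"
  shows "tensor_algebra W = tensor_algebra V" "pure_tensor W = pure_tensor V" "tensor_power W = tensor_power V"
    "tensor_class W = tensor_class V" "mult_map W = mult_map V" "unit_map W = unit_map V" "map_tensor W = map_tensor V"
    "whisker W = whisker V" "tspan W = tspan V"
proof -
  have c: "carrier W = carrier V" "\<And>x y. x \<oplus>\<^bsub>W\<^esub> y = x \<oplus>\<^bsub>V\<^esub> y" "\<And>a x. a \<odot>\<^bsub>W\<^esub> x = a \<odot>\<^bsub>V\<^esub> x"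
    "\<And>x y. x \<otimes>\<^bsub>W\<^esub> y = x \<otimes>\<^bsub>V\<^esub> y" "\<one>\<^bsub>W\<^esub> = \<one>\<^bsub>V\<^esub>"
    using assms by (simp_all add: same_alg_def)
  have f: "free_algebra W = free_algebra V" by (simp add: free_algebra_def c)
  have r: "tensor_relations W = tensor_relations V" by (simp add: tensor_relations_def c)
  show a: "tensor_algebra W = tensor_algebra V" "tensor_class W = tensor_class V"
    by (simp_all add: tensor_algebra_def tensor_class_def tensor_ideal_def f r fun_eq_iff)
  show p: "pure_tensor W = pure_tensor V" by (simp add: pure_tensor_def fun_eq_iff a)
  show "tensor_power W = tensor_power V" by (simp add: tensor_power_def fun_eq_iff a c)
  show "mult_map W = mult_map V" "unit_map W = unit_map V" "map_tensor W = map_tensor V"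
    by (simp_all add: mult_map_def unit_map_def map_tensor_def fun_eq_iff a p c)
  show "whisker W = whisker V" "tspan W = tspan V"
    unfolding whisker_def tspan_def fun_eq_iff a p by simp_all
qed

lemma unital_algebra_cong:
  fixes V :: "('k::field, 'v, 'm) module_scheme" and W :: "('k, 'v, 'n) module_scheme"
  assumes "same_alg V W" "unital_algebra V"
  shows "unital_algebra W"
  by (rule unital_algebra_image(1)[OF assms(2), of W "\<lambda>x. x"]) (use assms(1) in \<open>simp_all add: same_alg_def\<close>)

section \<open>The braiding of the tensor algebra from crossings of blocks\<close>

locale tensor_braiding = bvs
begin

sublocale T: talg "tensor_algebra V"
  by (rule talg.intro[OF R.ua])

notation tmul (infixl "\<bullet>" 72)
notation T.tmul (infixl "\<star>" 72)

sublocale braid_action D "CT"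
  by unfold_locales (simp, erule (1) D_D, rule braid_rel[OF refl])

lemma strand_linear: "strand i n \<in> linear_maps TA TA"
proof (induction n)
  case 0
  have "strand i 0 = (\<lambda>x. x)" by (simp add: fun_eq_iff)
  then show ?case by (auto intro: linI)
next
  case (Suc n)
  have "strand i (Suc n) = (\<lambda>x. D (i + n) (strand i n x))" by (simp add: fun_eq_iff)
  then show ?case using lin_comp[OF Suc D_linear] by simp
qed

lemma block_linear: "block i m n \<in> linear_maps TA TA"
proof (induction m arbitrary: i)
  case 0
  have "block i 0 n = (\<lambda>x. x)" by (simp add: fun_eq_iff)
  then show ?case by (auto intro: linI)
next
  case (Suc m)
  have "block i (Suc m) n = (\<lambda>x. strand i n (block (Suc i) m n x))" by (simp add: fun_eq_iff)
  then show ?case using lin_comp[OF Suc strand_linear] by simp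
qed

lemma strand_Rn: "t \<in> Rn N ==> strand i n t \<in> Rn N"
  by (induction n) (auto simp: D_Rn)

lemma block_Rn: "t \<in> Rn N ==> block i m n t \<in> Rn N"
  by (induction m arbitrary: i) (auto simp: strand_Rn)

lemma strand_left: "s \<in> Rn a ==> t \<in> CT ==> strand (a + i) n (s \<bullet> t) = s \<bullet> strand i n t"
  by (induction n) (auto simp: add.assoc whisker_left[OF braid_hom])

lemma block_left: "s \<in> Rn a ==> t \<in> CT ==> block (a + i) m n (s \<bullet> t) = s \<bullet> block i m n t"
proof (induction m arbitrary: i)
  case (Suc m)
  then show ?case using strand_left[of s a] Suc.IH[of "Suc i"] by simp
qed simp

lemma strand_right: "t \<in> Rn N ==> i + n < N ==> u \<in> CT ==> strand i n (t \<bullet> u) = strand i n t \<bullet> u"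
  by (induction n) (auto simp: whisker_right[OF braid_hom strand_Rn])

lemma block_right: "t \<in> Rn N ==> i + m + n \<le> N ==> u \<in> CT ==> block i m n (t \<bullet> u) = block i m n t \<bullet> u"
  by (induction m arbitrary: i) (auto simp: strand_right[OF block_Rn])

definition "split_word xss = T.pt (map pt xss)"

text \<open>Reads a tensor of degree \<open>sum_list ns\<close> over \<open>V\<close> as a tensor of
  words of lengths \<open>ns\<close> over the tensor algebra. In this reading the braiding of T
  becomes a crossing of blocks of strands in \<open>V\<close>.\<close>

definition "split_at ns = multilinear_lift T.TA (sum_list ns) (\<lambda>xs. split_word (chop ns xs))"

lemma split_word_lists: "xss \<in> lists wrd ==> map pt xss \<in> T.wrd"
  by (auto simp: in_lists_conv_set)

lemma split_word_cl: "xss \<in> lists wrd ==> split_word xss \<in> T.CT"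
  unfolding split_word_def by (rule T.pure_cl[OF split_word_lists])

lemma split_word_append: "xss \<in> lists wrd ==> yss \<in> lists wrd ==> split_word (xss @ yss) = split_word xss \<star> split_word yss"
  unfolding split_word_def using T.pure_append[OF split_word_lists split_word_lists] by simp

text \<open>The varying letter lies in the first block, which is a single letter over T and depends
  linearly on it, or in a later block, where the induction hypothesis applies.\<close>

lemma split_at_mlin: "mlin (sum_list ns) T.TA (\<lambda>xs. split_word (chop ns xs))"
proof -
  have "(\<lambda>x. split_word (chop ns (a @ x # b))) \<in> linear_maps V T.TA"
    if "a \<in> wrd" "b \<in> wrd" "sum_list ns = length a + length b + 1" for a b
    using that
  proof (induction ns arbitrary: a)
    case (Cons n ns)
    have app: "split_word (xs # xss) = split_word [xs] \<star> split_word xss" if "xs \<in> wrd" "xss \<in> lists wrd" for xs xss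
      using split_word_append[of "[xs]" xss] that by simp
    show ?case
    proof (cases "length a < n")
      case True
      define p where "p = n - length a - 1"
      have n: "n = length a + Suc p" using True by (simp add: p_def)
      let ?b1 = "take p b" and ?b2 = "drop p b"
      have "(\<lambda>x. split_word [a @ x # ?b1]) \<in> linear_maps V T.TA"
        unfolding split_word_def using lin_comp[OF multilin_linear[OF pure_multilin, of a ?b1] T.pure1_linear(1)] Cons.prems
        by simp
      from T.rmult_linear[of "split_word (chop ns ?b2)", THEN lin_comp[OF this]]
      have "(\<lambda>x. split_word [a @ x # ?b1] \<star> split_word (chop ns ?b2)) \<in> linear_maps V T.TA"
        using Cons.prems by (simp add: split_word_cl chop_lists)
      then show ?thesis
        by (rule lin_cong[OF _ V.vsp]) (use Cons.prems n app[of "a @ _ # ?b1" "chop ns ?b2"] in \<open>simp add: chop_lists\<close>)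
    next
      case False
      have "(\<lambda>x. split_word (chop ns (drop n a @ x # b))) \<in> linear_maps V T.TA"
        using Cons.prems False by (intro Cons.IH) auto
      from T.lmult_linear[of "split_word [take n a]", THEN lin_comp[OF this]]
      have "(\<lambda>x. split_word [take n a] \<star> split_word (chop ns (drop n a @ x # b))) \<in> linear_maps V T.TA"
        using Cons.prems by (simp add: split_word_cl)
      then show ?thesis
        by (rule lin_cong[OF _ V.vsp])
          (use Cons.prems False app[of "take n a" "chop ns (drop n a @ _ # b)"] in \<open>simp add: chop_lists\<close>)
    qed
  qed simp
  moreover have "split_word (chop ns []) \<in> T.CT" by (intro split_word_cl chop_lists) simp
  ultimately show ?thesis unfolding mlin_def by blast
qed

lemma split_at_linear: "split_at ns \<in> linear_maps TA T.TA"
  unfolding split_at_def by (rule multilinear_lift_linear[OF T.R.vsp split_at_mlin])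

lemma split_at_pure: "xs \<in> wrd ==> length xs = sum_list ns ==> split_at ns (pt xs) = split_word (chop ns xs)"
  unfolding split_at_def by (rule multilinear_lift_pure[OF T.R.vsp split_at_mlin])

lemma split_at_concat: "xss \<in> lists wrd ==> map length xss = ns ==> split_at ns (pt (concat xss)) = split_word xss"
  using split_at_pure[of "concat xss" ns] chop_concat[of xss]
  by (auto simp: length_concat in_lists_conv_set)

lemma split_at_cl: "t \<in> CT ==> split_at ns t \<in> T.CT"
  by (rule lin_cl[OF split_at_linear])

lemma split_at_deg: "t \<in> Rn (sum_list ns) ==> split_at ns t \<in> T.Rn (length ns)"
proof (induction rule: tp_induct)
  case (pure xs)
  then show ?case
    by (simp add: split_at_pure split_word_def) (intro T.Rn_pure split_word_lists chop_lists, auto)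
qed (simp_all add: lin_add[OF split_at_linear] lin_smult[OF split_at_linear])

lemma split_at_mult:
  assumes s: "s \<in> Rn (sum_list as)" and t: "t \<in> Rn (sum_list bs)"
  shows "split_at (as @ bs) (s \<bullet> t) = split_at as s \<star> split_at bs t"
proof -
  have 1: "split_at (as @ bs) (pt xs \<bullet> t) = split_at as (pt xs) \<star> split_at bs t"
    if xs: "xs \<in> wrd" "length xs = sum_list as" for xs
    using t
  proof (induction rule: tp_induct)
    case (pure ys)
    then show ?case using xs
      by (simp flip: pure_append add: split_at_pure chop_append split_word_append chop_lists)
  qed (use xs in \<open>simp_all add: R.A.r_distr R.mult_smult lin_add[OF split_at_linear] lin_smult[OF split_at_linear]
      split_at_cl T.R.A.r_distr T.R.mult_smult\<close>)
  show ?thesis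
    using s by (induction rule: tp_induct)
      (use t in \<open>simp_all add: 1 R.A.l_distr R.smult_mult lin_add[OF split_at_linear] lin_smult[OF split_at_linear]
      split_at_cl T.R.A.l_distr T.R.smult_mult\<close>)
qed

text \<open>The braiding of two words: the strands of \<open>u\<close> cross those of
  \<open>w\<close>, and the result is cut in the exchanged lengths. It is extended to tensors one
  argument at a time, first in \<open>w\<close> and then in \<open>u\<close>.\<close>

definition "cross_word u w = split_at [length w, length u] (block 0 (length u) (length w) (pt (u @ w)))"

definition "cross_right t u = wlift T.TA (cross_word u) t"

definition "cross s t = wlift T.TA (cross_right t) s"

lemma cross_word_multilin: "u \<in> wrd ==> multilin V T.TA (cross_word u)"
  unfolding multilin_def
proof (intro conjI ballI)
  assume u: "u \<in> wrd"
  then show "cross_word u [] \<in> T.CT" unfolding cross_word_def by (intro split_at_cl block_cl) simp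
  fix a b assume ab: "a \<in> wrd" "b \<in> wrd"
  show "(\<lambda>x. cross_word u (a @ x # b)) \<in> linear_maps V T.TA"
    unfolding cross_word_def
    using lin_comp[OF lin_comp[OF multilin_linear[OF pure_multilin, of "u @ a" b] block_linear] split_at_linear] u ab
    by simp
qed

lemma cross_word_linear_left: "[|a \<in> wrd; b \<in> wrd; w \<in> wrd|] ==> (\<lambda>x. cross_word (a @ x # b) w) \<in> linear_maps V T.TA"
  unfolding cross_word_def
  using lin_comp[OF lin_comp[OF multilin_linear[OF pure_multilin, of a "b @ w"] block_linear] split_at_linear]
  by (simp del: block.simps)

lemma cross_right_linear: "u \<in> wrd ==> (\<lambda>t. cross_right t u) \<in> linear_maps TA T.TA"
  and cross_right_pure: "u \<in> wrd ==> w \<in> wrd ==> cross_right (pt w) u = cross_word u w"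
  unfolding cross_right_def using wlift_linear[OF T.R.vsp cross_word_multilin] by auto

lemma cross_right_multilin:
  assumes t: "t \<in> CT"
  shows "multilin V T.TA (cross_right t)"
  unfolding multilin_def
proof (intro conjI ballI)
  show "cross_right t [] \<in> T.CT" using lin_cl[OF cross_right_linear t] by simp
  fix a b assume ab: "a \<in> wrd" "b \<in> wrd"
  show "(\<lambda>x. cross_right t (a @ x # b)) \<in> linear_maps V T.TA"
    using t
  proof (induction rule: tensor_induct)
    case (pure w)
    show ?case
      by (rule lin_cong[OF cross_word_linear_left[OF ab pure] V.vsp]) (use ab pure in \<open>simp add: cross_right_pure\<close>)
  next
    case (add s t)
    show ?case
      by (rule lin_cong[OF linear_sum[OF add(3,4) T.R.vsp] V.vsp])
        (use ab add in \<open>simp add: lin_add[OF cross_right_linear]\<close>)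
  next
    case (smult c s)
    show ?case
      by (rule lin_cong[OF linear_const_smult[OF smult(2) T.R.vsp, of c] V.vsp])
        (use ab smult in \<open>simp add: lin_smult[OF cross_right_linear]\<close>)
  qed
qed

lemma cross_linear_left: "t \<in> CT ==> (\<lambda>s. cross s t) \<in> linear_maps TA T.TA"
  and cross_pure_left: "t \<in> CT ==> u \<in> wrd ==> cross (pt u) t = cross_right t u"
  unfolding cross_def using wlift_linear[OF T.R.vsp cross_right_multilin] by auto

lemma cross_linear_right:
  assumes s: "s \<in> CT"
  shows "(\<lambda>t. cross s t) \<in> linear_maps TA T.TA"
  using s
proof (induction rule: tensor_induct)
  case (pure u)
  show ?case
    by (rule lin_cong[OF cross_right_linear[OF pure] R.vsp]) (use pure in \<open>simp add: cross_pure_left\<close>)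
next
  case (add s t)
  show ?case
    by (rule lin_cong[OF linear_sum[OF add(3,4) T.R.vsp] R.vsp])
      (use add in \<open>simp add: lin_add[OF cross_linear_left]\<close>)
next
  case (smult c s)
  show ?case
    by (rule lin_cong[OF linear_const_smult[OF smult(2) T.R.vsp, of c] R.vsp])
      (use smult in \<open>simp add: lin_smult[OF cross_linear_left]\<close>)
qed

definition "tensor_braid = multilinear_lift T.TA 2 (\<lambda>ss. cross (ss ! 0) (ss ! 1))"

lemma tensor_braid_mlin: "T.mlin 2 T.TA (\<lambda>ss. cross (ss ! 0) (ss ! 1))"
  unfolding T.mlin_def
proof (intro conjI impI ballI)
  fix a b assume "a \<in> T.wrd" "b \<in> T.wrd" "2 = length a + length b + 1"
  then consider y where "a = []" "b = [y]" "y \<in> T.C" | y where "a = [y]" "b = []" "y \<in> T.C"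
    by (cases a; cases b) auto
  then show "(\<lambda>x. cross ((a @ x # b) ! 0) ((a @ x # b) ! 1)) \<in> linear_maps TA T.TA"
    by cases (auto simp: cross_linear_left cross_linear_right)
qed simp

lemma tensor_braid_pure: "s \<in> CT ==> t \<in> CT ==> tensor_braid (T.pt [s, t]) = cross s t"
  unfolding tensor_braid_def using T.multilinear_lift_pure[OF T.R.vsp tensor_braid_mlin, of "[s, t]"] by simp

lemma cross_eq_word: "u \<in> wrd ==> w \<in> wrd ==> cross (pt u) (pt w) = cross_word u w"
  by (simp add: cross_pure_left cross_right_pure)

lemma cross_deg2:
  assumes s: "s \<in> CT" and t: "t \<in> CT"
  shows "cross s t \<in> T.Rn 2"
proof -
  have 0: "cross (pt u) (pt w) \<in> T.Rn 2" if "u \<in> wrd" "w \<in> wrd" for u w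
    using split_at_deg[of "block 0 (length u) (length w) (pt (u @ w))" "[length w, length u]"] block_Rn that
    by (simp add: cross_eq_word cross_word_def add.commute)
  have 1: "cross (pt u) t \<in> T.Rn 2" if u: "u \<in> wrd" for u
    using t by (induction rule: tensor_induct)
      (use u 0 in \<open>simp_all add: lin_add[OF cross_linear_right] lin_smult[OF cross_linear_right]\<close>)
  show ?thesis
    using s by (induction rule: tensor_induct)
      (use t 1 in \<open>simp_all add: lin_add[OF cross_linear_left] lin_smult[OF cross_linear_left]\<close>)
qed

lemma tensor_braid_hom: "tensor_braid \<in> hom_power TA 2 2"
proof (rule T.linear_to_Rn)
  show "tensor_braid \<in> linear_maps T.TA T.TA"
    unfolding tensor_braid_def by (rule T.multilinear_lift_linear[OF T.R.vsp tensor_braid_mlin])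
  fix ss assume "ss \<in> T.wrd" "length ss = 2"
  then obtain s t where "ss = [s, t]" "s \<in> CT" "t \<in> CT" by (auto elim: T.Rn2_E)
  then show "tensor_braid (T.pt ss) \<in> T.Rn 2" by (simp add: tensor_braid_pure cross_deg2)
qed

abbreviation "TD i \<equiv> whisker TA i 2 tensor_braid"

lemma split4:
  assumes "xs \<in> wrd" "length xs = sum_list (as @ [m, n] @ bs)"
  obtains a u w b where "xs = a @ u @ w @ b" "a \<in> wrd" "u \<in> wrd" "w \<in> wrd" "b \<in> wrd"
    "length a = sum_list as" "length u = m" "length w = n" "length b = sum_list bs"
proof -
  obtain a u v where 1: "xs = a @ u @ v" "a \<in> wrd" "u \<in> wrd" "v \<in> wrd" "length a = sum_list as" "length u = m"
    "length xs = sum_list as + m + length v"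
    using split_wrd[OF assms(1), of "sum_list as" m] assms(2) by auto
  obtain w b where 2: "v = w @ b" "w \<in> wrd" "b \<in> wrd" "length w = n" "length v = n + length b"
    using split_wrd[OF 1(4), of n 0] assms(2) 1(7) by auto
  show ?thesis using that 1 2 assms(2) by auto
qed

text \<open>The dictionary: the braiding at place \<open>i\<close> becomes the crossing of blocks
  that starts after \<open>sum_list as\<close> strands. With the counterparts for product and unit,
  the axioms become identities of blocks.\<close>

lemma TD_split_at:
  assumes t: "t \<in> Rn (sum_list (as @ [m, n] @ bs))" and i: "length as = i"
  shows "TD i (split_at (as @ [m, n] @ bs) t) = split_at (as @ [n, m] @ bs) (block (sum_list as) m n t)"
proof (rule hom_eq_pure[OF linear_restrict linear_restrict _ t])
  show "(\<lambda>t. TD i (split_at (as @ [m, n] @ bs) t)) \<in> linear_maps TA T.TA"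
    by (rule lin_comp[OF split_at_linear T.whisker_linear[OF tensor_braid_hom]])
  show "(\<lambda>t. split_at (as @ [n, m] @ bs) (block (sum_list as) m n t)) \<in> linear_maps TA T.TA"
    by (rule lin_comp[OF block_linear split_at_linear])
  fix xs assume "xs \<in> wrd" "length xs = sum_list (as @ [m, n] @ bs)"
  then obtain a u w b where xs: "xs = a @ u @ w @ b" "a \<in> wrd" "u \<in> wrd" "w \<in> wrd" "b \<in> wrd"
    "length a = sum_list as" "length u = m" "length w = n" "length b = sum_list bs" by (rule split4)
  have p: "pt xs = pt a \<bullet> (pt (u @ w) \<bullet> pt b)" using xs by (simp add: pure_append R.A.m_assoc)
  have s2: "split_at [m, n] (pt (u @ w)) = T.pt [pt u, pt w]"
    using split_at_pure[of "u @ w" "[m, n]"] xs by (simp add: split_word_def)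
  have sa: "split_at as (pt a) \<in> T.Rn i" using split_at_deg[of "pt a" as] xs i by simp
  have sb: "split_at bs (pt b) \<in> T.CT" using split_at_cl xs by simp
  have "split_at (as @ [m, n] @ bs) (pt xs) = split_at as (pt a) \<star> (T.pt [pt u, pt w] \<star> split_at bs (pt b))"
    using xs(2-) split_at_mult[of "pt a" as "pt (u @ w) \<bullet> pt b" "[m, n] @ bs"] split_at_mult[of "pt (u @ w)" "[m, n]" "pt b" bs]
      Rn_mult[of "pt (u @ w)" "m + n" "pt b" "sum_list bs"]
    by (simp add: p s2 add.assoc)
  then have "TD i (split_at (as @ [m, n] @ bs) (pt xs)) = split_at as (pt a) \<star> (cross_word u w \<star> split_at bs (pt b))"
    using T.whisker_key[OF tensor_braid_hom sa, of "T.pt [pt u, pt w]" "split_at bs (pt b)"] sb xs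
    by (simp add: tensor_braid_pure cross_eq_word T.Rn_pure)
  also have "cross_word u w = split_at [n, m] (block 0 m n (pt (u @ w)))" using xs by (simp add: cross_word_def)
  also have "split_at as (pt a) \<star> (split_at [n, m] (block 0 m n (pt (u @ w))) \<star> split_at bs (pt b))
      = split_at (as @ [n, m] @ bs) (pt a \<bullet> (block 0 m n (pt (u @ w)) \<bullet> pt b))"
    using xs split_at_mult[of "pt a" as "block 0 m n (pt (u @ w)) \<bullet> pt b" "[n, m] @ bs"]
      split_at_mult[of "block 0 m n (pt (u @ w))" "[n, m]" "pt b" bs] block_Rn[of "pt (u @ w)" "m + n" 0 m n]
      Rn_mult[of "block 0 m n (pt (u @ w))" "m + n" "pt b" "sum_list bs"]
    by (simp add: add.assoc add.left_commute add.commute[of m])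
  also have "pt a \<bullet> (block 0 m n (pt (u @ w)) \<bullet> pt b) = block (sum_list as) m n (pt xs)"
    using xs(2-) block_left[of "pt a" "sum_list as" "pt (u @ w) \<bullet> pt b" 0 m n] block_right[of "pt (u @ w)" "m + n" 0 m n "pt b"]
    by (simp add: p)
  finally show "TD i (split_at (as @ [m, n] @ bs) (pt xs)) = split_at (as @ [n, m] @ bs) (block (sum_list as) m n (pt xs))" .
qed

lemma TM_split_at:
  assumes t: "t \<in> Rn (sum_list (as @ [m, n] @ bs))" and i: "length as = i"
  shows "T.M i (split_at (as @ [m, n] @ bs) t) = split_at (as @ [m + n] @ bs) t"
proof (rule hom_eq_pure[OF linear_restrict linear_restrict[OF split_at_linear] _ t])
  show "(\<lambda>t. T.M i (split_at (as @ [m, n] @ bs) t)) \<in> linear_maps TA T.TA"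
    by (rule lin_comp[OF split_at_linear T.M_linear])
  fix xs assume "xs \<in> wrd" "length xs = sum_list (as @ [m, n] @ bs)"
  then obtain a u w b where xs: "xs = a @ u @ w @ b" "a \<in> wrd" "u \<in> wrd" "w \<in> wrd" "b \<in> wrd"
    "length a = sum_list as" "length u = m" "length w = n" "length b = sum_list bs" by (rule split4)
  then show "T.M i (split_at (as @ [m, n] @ bs) (pt xs)) = split_at (as @ [m + n] @ bs) (pt xs)"
    using T.M_pure[of "map pt (chop as a)" "pt u" "pt w" "map pt (chop bs b)" i] i
    by (simp add: split_at_pure chop_append split_word_def split_word_lists chop_lists flip: pure_append)
qed

lemma TE_split_at:
  assumes t: "t \<in> Rn (sum_list (as @ bs))" and i: "length as = i"
  shows "T.E i (split_at (as @ bs) t) = split_at (as @ [0] @ bs) t"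
proof (rule hom_eq_pure[OF linear_restrict linear_restrict[OF split_at_linear] _ t])
  show "(\<lambda>t. T.E i (split_at (as @ bs) t)) \<in> linear_maps TA T.TA"
    by (rule lin_comp[OF split_at_linear T.E_linear])
  fix xs assume xs: "xs \<in> wrd" "length xs = sum_list (as @ bs)"
  obtain a b where ab: "xs = a @ b" "a \<in> wrd" "b \<in> wrd" "length a = sum_list as" "length b = sum_list bs"
    using split_wrd[OF xs(1), of "sum_list as" 0] xs(2) by auto
  then show "T.E i (split_at (as @ bs) (pt xs)) = split_at (as @ [0] @ bs) (pt xs)"
    using T.E_pure[of "map pt (chop as a)" "map pt (chop bs b)" i] i
    by (simp add: split_at_pure chop_append split_word_def split_word_lists chop_lists pure_Nil)
qed

lemma T_Rn_span: "T.Rn k \<subseteq> lspan T.TA (split_word ` {xss \<in> lists wrd. length xss = k})"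
proof -
  let ?L = "\<lambda>k. lspan T.TA (split_word ` {xss \<in> lists wrd. length xss = k})"
  have sub: "subsp T.TA (?L k)" for k
    by (rule T.R.lspan_subsp) (auto simp: split_word_cl)
  have base: "T.pt ss \<in> ?L (length ss)" if "ss \<in> T.wrd" for ss
    using that
  proof (induction ss rule: list.induct)
    case Nil
    have "split_word [] \<in> ?L 0" by (rule lspan.base) auto
    then show ?case by (simp add: split_word_def)
  next
    case (Cons s ss)
    have 1: "T.pt [pt u] \<star> y \<in> ?L (Suc (length ss))" if u: "u \<in> wrd" and y: "y \<in> ?L (length ss)" for u y
    proof (rule lspan_image_subset[OF T.lmult_linear T.R.vsp T.R.vsp sub _ _ y])
      fix z assume "z \<in> split_word ` {xss \<in> lists wrd. length xss = length ss}"
      then obtain xss where z: "z = split_word xss" "xss \<in> lists wrd" "length xss = length ss" by auto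
      have "T.pt [pt u] \<star> z = split_word (u # xss)"
        using split_word_append[of "[u]" xss] u z by (simp add: split_word_def)
      then show "T.pt [pt u] \<star> z \<in> ?L (Suc (length ss))" using u z by (auto intro!: lspan.base)
    qed (use u in \<open>auto simp: split_word_cl\<close>)
    have sc: "s \<in> CT" "ss \<in> T.wrd" using Cons.prems by auto
    have y: "T.pt ss \<in> ?L (length ss)" by (rule Cons.IH[OF sc(2)])
    have yc: "T.pt ss \<in> T.CT" using sc by simp
    have "T.pt [s] \<star> T.pt ss \<in> ?L (Suc (length ss))"
      using sc(1)
    proof (induction rule: tensor_induct)
      case (pure u) then show ?case by (rule 1[OF _ y])
    next
      case (add s t)
      then show ?case using yc by (simp add: lin_add[OF T.pure1_linear(1)] T.R.A.l_distr lspan.add)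
    next
      case (smult a s)
      then show ?case using yc by (simp add: lin_smult[OF T.pure1_linear(1)] T.R.smult_mult lspan.smult)
    qed
    then show ?case using T.pure_append[of "[s]" ss] sc by simp
  qed
  show ?thesis
    unfolding T.Rn_span by (rule lspan_least[OF sub]) (use base in auto)
qed

text \<open>Tensors over T are spanned by tensors of words, hence an identity may be tested on the
  values of \<open>split_at\<close>, for all lengths of the words.\<close>

lemma T_eq_split:
  assumes F: "F \<in> linear_maps T.TA M" and G: "G \<in> linear_maps T.TA M" and M: "vspace M"
    and eq: "\<And>ns t. length ns = k ==> t \<in> Rn (sum_list ns) ==> F (split_at ns t) = G (split_at ns t)"
    and t: "t \<in> T.Rn k"
  shows "F t = G t"
proof (rule lspan_eq[OF F G T.R.vsp M _ _ subsetD[OF T_Rn_span t]])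
  fix x assume "x \<in> split_word ` {xss \<in> lists wrd. length xss = k}"
  then obtain xss where x: "x = split_word xss" "xss \<in> lists wrd" "length xss = k" by auto
  have "concat xss \<in> wrd" using x(2) by (auto simp: in_lists_conv_set)
  then have "x = split_at (map length xss) (pt (concat xss))" "pt (concat xss) \<in> Rn (sum_list (map length xss))"
    using x split_at_concat[OF x(2) refl] by (auto simp: length_concat)
  then show "F x = G x" using eq[of "map length xss" "pt (concat xss)"] x by simp
qed (auto simp: split_word_cl)

definition "T_record = module.extend TA (braided.fields tensor_braid)"

lemma same_T: "same_alg TA T_record" "braid T_record = tensor_braid"
  by (simp_all add: same_alg_def T_record_def module.defs braided.defs)

lemma TD_linear: "TD i \<in> linear_maps T.TA T.TA"
  by (rule T.whisker_linear[OF tensor_braid_hom])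

text \<open>On split tensors the hexagons are \<open>block_add_left\<close> and
  \<open>block_add_right\<close>, the braid relation is \<open>block_braid\<close>, and the unit
  axioms concern blocks of length zero.\<close>

theorem T_braided_algebra: "braided_algebra T_record"
proof (rule braided_algebraI)
  note sa = same_alg_tensor[OF same_T(1)]
  show "unital_algebra T_record" by (rule unital_algebra_cong[OF same_T(1) R.ua])
  show "braid T_record \<in> hom_power T_record 2 2" unfolding sa same_T(2) by (rule tensor_braid_hom)
  have l3: "\<exists>m n p. ns = [m, n, p]" if "length ns = 3" for ns :: "nat list"
    using that by (auto simp: length_3_iff)
  have tb: "tensor_braid t = TD 0 t" if "t \<in> T.Rn 2" for t
    using T.whisker_0[OF tensor_braid_hom that] by simp
  have M2: "T.M 0 t \<in> T.Rn 2" "T.M 1 t \<in> T.Rn 2" if "t \<in> T.Rn 3" for t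
    using T.whisker_deg[OF T.mult_map_hom that, of 0 1] T.whisker_deg[OF T.mult_map_hom that, of 1 0] by simp_all
  have E2: "T.E 0 t \<in> T.Rn 2" "T.E 1 t \<in> T.Rn 2" if "t \<in> T.Rn 1" for t
    using T.whisker_deg[OF T.unit_map_hom that, of 0 1] T.whisker_deg[OF T.unit_map_hom that, of 1 0] by simp_all
  show "braid T_record (whisker T_record 0 2 (mult_map T_record) t) =
      whisker T_record 1 2 (mult_map T_record) (whisker T_record 0 2 (braid T_record) (whisker T_record 1 2 (braid T_record) t))"
    if t: "t \<in> carrier (tensor_power T_record 3)" for t
    unfolding sa same_T(2) tb[OF M2(1)[OF t[unfolded sa]]]
  proof (rule T_eq_split[OF lin_comp[OF T.M_linear TD_linear] lin_comp[OF lin_comp[OF TD_linear TD_linear] T.M_linear] T.R.vsp _ t[unfolded sa]])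
    fix ns :: "nat list" and t assume ns: "length ns = 3" and t: "t \<in> Rn (sum_list ns)"
    from l3[OF ns] obtain m n p where [simp]: "ns = [m, n, p]" by blast
    have t': "t \<in> Rn (m + (n + p))" using t by simp
    note b = block_Rn[OF t'] block_Rn[OF block_Rn[OF t']]
    show "TD 0 (T.M 0 (split_at ns t)) = T.M 1 (TD 0 (TD 1 (split_at ns t)))"
      using b t' TM_split_at[of t "[]" m n "[p]" 0] TD_split_at[of t "[]" "m + n" p "[]" 0] TD_split_at[of t "[m]" n p "[]" 1]
        TD_split_at[of "block m n p t" "[]" m p "[n]" 0] TM_split_at[of "block 0 m p (block m n p t)" "[p]" m n "[]" 1]
        block_add_left[of 0 m n p t]
      by (simp add: add.assoc add.commute add.left_commute)
  qed
  show "braid T_record (whisker T_record 1 2 (mult_map T_record) t) =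
      whisker T_record 0 2 (mult_map T_record) (whisker T_record 1 2 (braid T_record) (whisker T_record 0 2 (braid T_record) t))"
    if t: "t \<in> carrier (tensor_power T_record 3)" for t
    unfolding sa same_T(2) tb[OF M2(2)[OF t[unfolded sa]]]
  proof (rule T_eq_split[OF lin_comp[OF T.M_linear TD_linear] lin_comp[OF lin_comp[OF TD_linear TD_linear] T.M_linear] T.R.vsp _ t[unfolded sa]])
    fix ns :: "nat list" and t assume ns: "length ns = 3" and t: "t \<in> Rn (sum_list ns)"
    from l3[OF ns] obtain m n p where [simp]: "ns = [m, n, p]" by blast
    have t': "t \<in> Rn (m + (n + p))" using t by simp
    note b = block_Rn[OF t'] block_Rn[OF block_Rn[OF t']]
    show "TD 0 (T.M 1 (split_at ns t)) = T.M 0 (TD 1 (TD 0 (split_at ns t)))"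
      using b t' TM_split_at[of t "[m]" n p "[]" 1] TD_split_at[of t "[]" m "n + p" "[]" 0] TD_split_at[of t "[]" m n "[p]" 0]
        TD_split_at[of "block 0 m n t" "[n]" m p "[]" 1] TM_split_at[of "block n m p (block 0 m n t)" "[]" n p "[m]" 0]
        block_add_right[of t 0 m n p]
      by (simp add: add.assoc add.commute add.left_commute)
  qed
  show "whisker T_record 0 2 (braid T_record) (whisker T_record 1 2 (braid T_record) (whisker T_record 0 2 (braid T_record) t)) =
      whisker T_record 1 2 (braid T_record) (whisker T_record 0 2 (braid T_record) (whisker T_record 1 2 (braid T_record) t))"
    if t: "t \<in> carrier (tensor_power T_record 3)" for t
    unfolding sa same_T(2)
  proof (rule T_eq_split[OF lin_comp[OF lin_comp[OF TD_linear TD_linear] TD_linear] lin_comp[OF lin_comp[OF TD_linear TD_linear] TD_linear] T.R.vsp _ t[unfolded sa]])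
    fix ns :: "nat list" and t assume ns: "length ns = 3" and t: "t \<in> Rn (sum_list ns)"
    from l3[OF ns] obtain m n p where [simp]: "ns = [m, n, p]" by blast
    have t': "t \<in> Rn (m + (n + p))" using t by simp
    note b = block_Rn[OF t'] block_Rn[OF block_Rn[OF t']]
    show "TD 0 (TD 1 (TD 0 (split_at ns t))) = TD 1 (TD 0 (TD 1 (split_at ns t)))"
      using b t' TD_split_at[of t "[]" m n "[p]" 0] TD_split_at[of "block 0 m n t" "[n]" m p "[]" 1]
        TD_split_at[of "block n m p (block 0 m n t)" "[]" n p "[m]" 0]
        TD_split_at[of t "[m]" n p "[]" 1] TD_split_at[of "block m n p t" "[]" m p "[n]" 0]
        TD_split_at[of "block 0 m p (block m n p t)" "[p]" m n "[]" 1] block_braid[of t 0 n p m]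
      by (simp add: add.assoc add.commute add.left_commute)
  qed
  show "braid T_record (whisker T_record 0 0 (unit_map T_record) t) = whisker T_record 1 0 (unit_map T_record) t"
    if t: "t \<in> carrier (tensor_power T_record 1)" for t
    unfolding sa same_T(2) tb[OF E2(1)[OF t[unfolded sa]]]
  proof (rule T_eq_split[OF lin_comp[OF T.E_linear TD_linear] T.E_linear T.R.vsp _ t[unfolded sa]])
    fix ns :: "nat list" and t assume ns: "length ns = 1" and t: "t \<in> Rn (sum_list ns)"
    then obtain m where [simp]: "ns = [m]" by (auto simp: length_1_iff)
    show "TD 0 (T.E 0 (split_at ns t)) = T.E 1 (split_at ns t)"
      using t TE_split_at[of t "[]" "[m]" 0] TE_split_at[of t "[m]" "[]" 1] TD_split_at[of t "[]" 0 m "[]" 0] by simp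
  qed
  show "braid T_record (whisker T_record 1 0 (unit_map T_record) t) = whisker T_record 0 0 (unit_map T_record) t"
    if t: "t \<in> carrier (tensor_power T_record 1)" for t
    unfolding sa same_T(2) tb[OF E2(2)[OF t[unfolded sa]]]
  proof (rule T_eq_split[OF lin_comp[OF T.E_linear TD_linear] T.E_linear T.R.vsp _ t[unfolded sa]])
    fix ns :: "nat list" and t assume ns: "length ns = 1" and t: "t \<in> Rn (sum_list ns)"
    then obtain m where [simp]: "ns = [m]" by (auto simp: length_1_iff)
    show "TD 0 (T.E 1 (split_at ns t)) = T.E 0 (split_at ns t)"
      using t TE_split_at[of t "[]" "[m]" 0] TE_split_at[of t "[m]" "[]" 1] TD_split_at[of t "[]" m 0 "[]" 0] by simp
  qed
qed

lemma tmap_pure1: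
  assumes "t \<in> Rn 2"
  shows "tmap TA (\<lambda>x. pt [x]) t = split_at [1, 1] t"
proof (rule hom_eq_pure[OF linear_restrict[OF tmap_linear[OF tns T.tns pure1_linear(1)]]
      linear_restrict[OF split_at_linear] _ assms])
  fix xs assume "xs \<in> wrd" "length xs = 2"
  then show "tmap TA (\<lambda>x. pt [x]) (pt xs) = split_at [1, 1] (pt xs)"
    by (auto simp: length_2_iff tmap_pure[OF tns T.tns pure1_linear(1)] split_at_pure split_word_def take_Cons' drop_Cons')
qed

lemma tensor_braid_extends:
  assumes t: "t \<in> Rn 2"
  shows "tensor_braid (map_power TA 2 (\<lambda>x. pt [x]) t) = map_power TA 2 (\<lambda>x. pt [x]) (braid V t)"
proof -
  have bt: "braid V t \<in> Rn 2" by (rule hom_cl[OF braid_hom t])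
  have "split_at [1, 1] t \<in> T.Rn 2" using split_at_deg[of t "[1, 1]"] t by simp
  then have "tensor_braid (split_at [1, 1] t) = TD 0 (split_at [1, 1] t)"
    using T.whisker_0[OF tensor_braid_hom] by simp
  also have "\<dots> = split_at [1, 1] (block 0 1 1 t)"
    using TD_split_at[of t "[]" 1 1 "[]" 0] t by simp
  also have "block 0 1 1 t = braid V t"
    using block.simps(2)[of 0 0 1 t] strand.simps(2)[of 0 0 t] D_0[OF t] by simp
  finally show ?thesis
    using t bt by (simp add: map_power_eq[OF T.tns pure1_linear(1)] tmap_pure1)
qed

end

section \<open>The braided tensor algebra as a coalgebra\<close>

lemma braided_algebra_cong:
  fixes B :: "('k::field, 'v, 'm) braided_scheme" and B' :: "('k, 'v, 'n) braided_scheme"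
  assumes "same_alg B B'" "braid B' = braid B" "braided_algebra B"
  shows "braided_algebra B'"
proof -
  have "vector_space_over_field B'"
    using unital_algebra_cong[OF assms(1)] assms(3) by (simp add: unital_algebra_def braided_algebra_def)
  then show ?thesis
    using unital_algebra_cong[OF assms(1)] assms(3)
    unfolding braided_algebra_def braided_vector_space_def same_alg_tensor[OF assms(1)] assms(2) by simp
qed

context talg begin

lemma mult_tspan:
  assumes S: "S1 \<subseteq> C" "S2 \<subseteq> C" "S3 \<subseteq> C" and m: "\<And>x y. x \<in> S1 ==> y \<in> S2 ==> x \<otimes>\<^bsub>A\<^esub> y \<in> S3"
    and t: "t \<in> tspan A (As @ [S1, S2] @ Cs)" and ok: "As @ Cs \<in> lists (Pow C)" and i: "length As = i"
  shows "M i t \<in> tspan A (As @ [S3] @ Cs)"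
proof (rule local_at_tspan[OF local_at_whisker[OF mult_map_hom], of As "[S1, S2]" Cs])
  fix u assume u: "u \<in> tspan A [S1, S2]"
  have u2: "u \<in> Rn 2" using subsetD[OF tspan_Rn u] S by simp
  have "M 0 u \<in> tspan A [S3]"
  proof (rule lspan_image_subset[OF M_linear R.vsp R.vsp tspan_subsp])
    show "u \<in> lspan TA (pt ` {xs. list_all2 (\<in>) xs [S1, S2]})" using u by (simp add: tspan_def)
    show "pt ` {xs. list_all2 (\<in>) xs [S1, S2]} \<subseteq> CT" using S by (auto dest!: list_all2_wrd)
    fix x assume "x \<in> pt ` {xs. list_all2 (\<in>) xs [S1, S2]}"
    then obtain a b where "x = pt [a, b]" "a \<in> S1" "b \<in> S2" by (auto simp: list_all2_Cons2)
    moreover have "a \<in> C" "b \<in> C" using calculation S by auto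
    ultimately show "M 0 x \<in> tspan A [S3]"
      using M_pure[of "[]" a b "[]" 0] m by (auto intro!: tspan_pure)
  qed (use S in auto)
  then show "mult_map A u \<in> tspan A [S3]" using whisker_0[OF mult_map_hom u2] by simp
qed (use assms in auto)

end

context tens begin

lemma tspan_imageI:
  assumes "F \<in> linear_maps TA TA" "Ss \<in> lists (Pow C)" "subsp TA T" "\<And>xs. list_all2 (\<in>) xs Ss ==> F (pt xs) \<in> T" "t \<in> tspan V Ss"
  shows "F t \<in> T"
  by (rule lspan_image_subset[OF assms(1) R.vsp R.vsp assms(3), of "pt ` {xs. list_all2 (\<in>) xs Ss}"])
    (use assms(2,4,5) list_all2_wrd in \<open>auto simp: tspan_def\<close>)

lemma tspan_eqI:
  assumes "F \<in> linear_maps TA M" "G \<in> linear_maps TA M" "vspace M" "Ss \<in> lists (Pow C)"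
    "\<And>xs. list_all2 (\<in>) xs Ss ==> F (pt xs) = G (pt xs)" "t \<in> tspan V Ss"
  shows "F t = G t"
  by (rule lspan_eq[OF assms(1,2) R.vsp assms(3), of "pt ` {xs. list_all2 (\<in>) xs Ss}"])
    (use assms(4,5,6) list_all2_wrd in \<open>auto simp: tspan_def\<close>)

lemma tspan_Rn': "t \<in> tspan V Ss ==> Ss \<in> lists (Pow C) ==> length Ss = n ==> t \<in> Rn n"
  using tspan_Rn by blast

lemma Rn_tspan2: "t \<in> Rn 2 \<longleftrightarrow> t \<in> tspan V [C, C]" "t \<in> Rn 1 \<longleftrightarrow> t \<in> tspan V [C]" "t \<in> Rn 3 \<longleftrightarrow> t \<in> tspan V [C, C, C]"
  using Rn_tspan[of "Suc (Suc 0)"] Rn_tspan[of "Suc 0"] Rn_tspan[of "Suc (Suc (Suc 0))"]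
  by (simp_all only: replicate.simps) simp_all

text \<open>Words are evaluated by folding from the right, so multilinearity comes from linearity of
  the products with a letter in each factor. The braided square is available in this form.\<close>

lemma tensor_algebra_lift_linear:
  fixes B :: "('k, 'b, 'n) module_scheme"
  assumes B: "vspace B" and one: "\<one>\<^bsub>B\<^esub> \<in> carrier B"
    and l: "\<forall>b\<in>carrier B. (\<lambda>x. f x \<otimes>\<^bsub>B\<^esub> b) \<in> linear_maps V B"
    and r: "\<forall>x\<in>C. (\<lambda>b. f x \<otimes>\<^bsub>B\<^esub> b) \<in> linear_maps B B"
  shows "tensor_algebra_lift B f \<in> linear_maps TA B" "tensor_algebra_lift B f oneT = \<one>\<^bsub>B\<^esub>"
    "[|x \<in> C; t \<in> CT|] ==> tensor_algebra_lift B f (pt [x] \<bullet> t) = f x \<otimes>\<^bsub>B\<^esub> tensor_algebra_lift B f t"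
proof -
  define \<Phi> where "\<Phi> = (\<lambda>xs. foldr (\<lambda>x y. f x \<otimes>\<^bsub>B\<^esub> y) xs \<one>\<^bsub>B\<^esub>)"
  let ?L = "tensor_algebra_lift B f"
  have eq: "?L = wlift B \<Phi>" by (simp add: tensor_algebra_lift_def wlift_def fun_eq_iff \<Phi>_def)
  have \<Phi>: "\<Phi> [] = \<one>\<^bsub>B\<^esub>" "\<Phi> (x # xs) = f x \<otimes>\<^bsub>B\<^esub> \<Phi> xs" for x xs by (simp_all add: \<Phi>_def)
  have cl: "\<Phi> xs \<in> carrier B" if "xs \<in> wrd" for xs
    using that by (induction xs rule: list.induct) (use one lin_cl[OF bspec[OF r]] in \<open>auto simp: \<Phi>\<close>)
  have mul: "multilin V B \<Phi>" unfolding multilin_def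
  proof (intro conjI ballI)
    show "\<Phi> [] \<in> carrier B" using one by (simp add: \<Phi>)
    fix a b assume a: "a \<in> wrd" and b: "b \<in> wrd"
    show "(\<lambda>x. \<Phi> (a @ x # b)) \<in> linear_maps V B" using a
    proof (induction a rule: list.induct)
      case Nil
      then show ?case using bspec[OF l cl[OF b]] by (simp add: \<Phi>)
    next
      case (Cons y a)
      then show ?case using lin_comp[of "\<lambda>x. \<Phi> (a @ x # b)" V B, OF _ bspec[OF r, of y]] by (simp add: \<Phi>)
    qed
  qed
  note wl = wlift_linear[OF B mul, folded eq]
  show lin: "?L \<in> linear_maps TA B" by (rule wl(1))
  show "?L oneT = \<one>\<^bsub>B\<^esub>" using wl(3)[of "[]"] by (simp add: pure_Nil \<Phi>)
  show "?L (pt [x] \<bullet> t) = f x \<otimes>\<^bsub>B\<^esub> ?L t" if x: "x \<in> C" and t: "t \<in> CT" for x t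
  proof (rule linear_eq_on_TA[OF lin_comp[OF lmult_linear lin] lin_comp[OF lin bspec[OF r x]] _ t])
    fix xs assume "xs \<in> wrd"
    then show "?L (pt [x] \<bullet> pt xs) = f x \<otimes>\<^bsub>B\<^esub> ?L (pt xs)"
      using wl(3)[of "x # xs"] wl(3)[of xs] x pure_append[of "[x]" xs] by (simp add: \<Phi>)
  qed (use x in simp)
qed

lemma TA_word_induct [consumes 1, case_names one cons add smult]:
  assumes "t \<in> CT" "Q oneT" "\<And>x t. [|x \<in> C; t \<in> CT; Q t|] ==> Q (pt [x] \<otimes>\<^bsub>TA\<^esub> t)"
    "\<And>s t. [|s \<in> CT; t \<in> CT; Q s; Q t|] ==> Q (s \<oplus>\<^bsub>TA\<^esub> t)"
    "\<And>a s. [|s \<in> CT; Q s|] ==> Q (a \<odot>\<^bsub>TA\<^esub> s)"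
  shows "Q t"
  using assms(1)
proof (induction rule: tensor_induct)
  case (pure xs)
  then show ?case
  proof (induction xs rule: list.induct)
    case Nil
    then show ?case using assms(2) by (simp add: pure_Nil)
  next
    case (Cons x xs)
    then show ?case using assms(3)[of x "pt xs"] pure_append[of "[x]" xs] by simp
  qed
qed (use assms in auto)

end

context balg begin

lemma local_D0: "local_at B i 2 (D i) (D 0)" and local_M0: "local_at B i 2 (M i) (M 0)"
  using local_at_shift[OF braid_hom, of 0 2 i] local_at_shift[OF mult_map_hom, of 0 2 i] by simp_all

lemma D_tspan:
  assumes "\<And>t. t \<in> tspan B [S1, S2] ==> D 0 t \<in> tspan B [S3, S4]" "t \<in> tspan B (As @ [S1, S2] @ Cs)"
    "As @ [S1, S2, S3, S4] @ Cs \<in> lists (Pow C)" "length As = i"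
  shows "D i t \<in> tspan B (As @ [S3, S4] @ Cs)"
  by (rule local_at_tspan[OF local_D0, of As "[S1, S2]" Cs]) (use assms in auto)

lemma D_one: "x \<in> C ==> D 0 (pt [x, \<one>\<^bsub>B\<^esub>]) = pt [\<one>\<^bsub>B\<^esub>, x]" "x \<in> C ==> D 0 (pt [\<one>\<^bsub>B\<^esub>, x]) = pt [x, \<one>\<^bsub>B\<^esub>]"
proof -
  assume x: "x \<in> C"
  have e: "E 1 (pt [x]) = pt [x, \<one>\<^bsub>B\<^esub>]" "E 0 (pt [x]) = pt [\<one>\<^bsub>B\<^esub>, x]"
    using E_pure[of "[x]" "[]" 1] E_pure[of "[]" "[x]" 0] x by simp_all
  show "D 0 (pt [x, \<one>\<^bsub>B\<^esub>]) = pt [\<one>\<^bsub>B\<^esub>, x]" "D 0 (pt [\<one>\<^bsub>B\<^esub>, x]) = pt [x, \<one>\<^bsub>B\<^esub>]"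
    using D_E[of "pt [x]" 1 0] x unfolding e[symmetric] by (simp_all add: Rn_pure)
qed

end

section \<open>Comultiplication of the braided tensor algebra\<close>

locale tbialg = bvs V for V :: "('k::field, 'v, 'm) braided_scheme"
begin

abbreviation "TB \<equiv> tensor_braided_algebra V"
abbreviation "TT \<equiv> braided_tensor_algebra V"

text \<open>The braiding is a \<open>SOME\<close>, and the construction from blocks provides a
  witness. The axioms of a braided algebra and the values on pairs of letters are all that is known
  of the chosen map; everything about longer words is deduced from these.\<close>

lemma TB_props:
  "braided_algebra TB" "same_alg TA TB"
  "t \<in> Rn 2 ==> braid TB (tmap TA (\<lambda>x. pt [x]) t) = tmap TA (\<lambda>x. pt [x]) (braid V t)"
proof -
  interpret tensor_braiding V by unfold_locales
  let ?P = "\<lambda>d. braided_algebra (module.extend TA (braided.fields d)) \<and>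
    (\<forall>t\<in>Rn 2. d (map_power TA 2 (\<lambda>x. pt [x]) t) = map_power TA 2 (\<lambda>x. pt [x]) (braid V t))"
  have "?P tensor_braid" using T_braided_algebra tensor_braid_extends by (simp add: T_record_def)
  then have P: "?P (SOME d. ?P d)" by (rule someI[where P = ?P])
  have eq: "TB = module.extend TA (braided.fields (SOME d. ?P d))"
    by (simp add: tensor_braided_algebra_def Let_def)
  have br: "braid TB = (SOME d. ?P d)" unfolding eq by (simp add: module.defs braided.defs)
  show "braided_algebra TB" using P eq by simp
  show "same_alg TA TB" unfolding eq by (simp add: same_alg_def module.defs braided.defs)
  show "t \<in> Rn 2 ==> braid TB (tmap TA (\<lambda>x. pt [x]) t) = tmap TA (\<lambda>x. pt [x]) (braid V t)"
    using P br hom_cl[OF braid_hom] by (simp add: map_power_eq[OF T.tns pure1_linear(1)])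
qed

lemma TT_TB: "same_alg TB TT" "braid TT = braid TB"
  "comult TT = tensor_algebra_lift (braided_square TB)
     (\<lambda>v. pure_tensor TB [pt [v], \<one>\<^bsub>TB\<^esub>] \<oplus>\<^bsub>tensor_algebra TB\<^esub> pure_tensor TB [\<one>\<^bsub>TB\<^esub>, pt [v]])"
  "counit TT = tensor_algebra_lift ground_algebra (\<lambda>v. 0)"
  by (simp_all add: braided_tensor_algebra_def Let_def same_alg_def braided.defs braided_bialg.defs)

lemma TT_TA: "same_alg TA TT"
  using TB_props(2) TT_TB(1) by (simp add: same_alg_def)

lemma TT_fields [simp]: "carrier TT = CT" "x \<oplus>\<^bsub>TT\<^esub> y = x \<oplus>\<^bsub>TA\<^esub> y" "x \<otimes>\<^bsub>TT\<^esub> y = x \<otimes>\<^bsub>TA\<^esub> y"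
  "a \<odot>\<^bsub>TT\<^esub> x = a \<odot>\<^bsub>TA\<^esub> x" "\<one>\<^bsub>TT\<^esub> = oneT" "\<zero>\<^bsub>TT\<^esub> = zeroT"
  using TT_TA by (simp_all add: same_alg_def)

lemma TB_fields: "carrier TB = CT" "x \<oplus>\<^bsub>TB\<^esub> y = x \<oplus>\<^bsub>TA\<^esub> y" "x \<otimes>\<^bsub>TB\<^esub> y = x \<otimes>\<^bsub>TA\<^esub> y"
  "a \<odot>\<^bsub>TB\<^esub> x = a \<odot>\<^bsub>TA\<^esub> x" "\<one>\<^bsub>TB\<^esub> = oneT" "\<zero>\<^bsub>TB\<^esub> = zeroT"
  using TB_props(2) by (simp_all add: same_alg_def)

lemma TT_braided: "braided_algebra TT"
  by (rule braided_algebra_cong[OF TT_TB(1,2) TB_props(1)])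

lemma linear_TT: "linear_maps TT M = linear_maps TA M" "linear_maps M TT = linear_maps M TA"
  by (simp_all add: linear_maps_def)

text \<open>The recursion on the first letter, through which the comultiplication of T is accessible
  from here on.\<close>

lemma comult_word:
  shows "comult TT \<in> linear_maps TA (tensor_power TT 2)"
    and "comult TT oneT = pure_tensor TT [oneT, oneT]"
    and "[|x \<in> C; t \<in> CT|] ==> comult TT (pt [x] \<otimes>\<^bsub>TA\<^esub> t) =
      braided_mult TT ((pure_tensor TT [pt [x], oneT] \<oplus>\<^bsub>tensor_algebra TT\<^esub> pure_tensor TT [oneT, pt [x]])
        \<otimes>\<^bsub>tensor_algebra TT\<^esub> comult TT t)"
proof -
  interpret T: balg TT by (rule balg.intro[OF TT_braided])
  note sa = same_alg_tensor[OF TT_TB(1), symmetric]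
  have bm_eq: "braided_mult TB = braided_mult TT"
    by (simp add: braided_mult_def fun_eq_iff sa TT_TB(2))
  let ?Q = "braided_square TB"
  have Qf: "carrier ?Q = T.Rn 2" "\<And>s t. s \<oplus>\<^bsub>?Q\<^esub> t = s \<oplus>\<^bsub>T.TA\<^esub> t" "\<And>a t. a \<odot>\<^bsub>?Q\<^esub> t = a \<odot>\<^bsub>T.TA\<^esub> t" "\<zero>\<^bsub>?Q\<^esub> = T.zeroT"
    "\<And>s t. s \<otimes>\<^bsub>?Q\<^esub> t = braided_mult TT (s \<otimes>\<^bsub>T.TA\<^esub> t)" "\<one>\<^bsub>?Q\<^esub> = T.pt [oneT, oneT]"
    by (simp_all add: braided_square_def bm_eq sa TB_fields)
  have Q: "vspace ?Q"
    by (rule vspace_cong[OF T.vspace_Rn[of 2]]) (simp_all add: braided_square_def sa)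
  have linQ: "linear_maps M ?Q = linear_maps M (tensor_power TT 2)" for M :: "('k, 'x, 'y) module_scheme"
    by (simp add: linear_maps_def Qf)
  define \<phi> where "\<phi> = (\<lambda>v. T.pt [pt [v], oneT] \<oplus>\<^bsub>T.TA\<^esub> T.pt [oneT, pt [v]])"
  have ceq: "comult TT = tensor_algebra_lift ?Q \<phi>"
    by (simp add: TT_TB(3) fun_eq_iff \<phi>_def sa TB_fields)
  have \<phi>l: "\<phi> \<in> linear_maps V T.TA"
  proof -
    have "(\<lambda>x. T.pt ([] @ x # [\<one>\<^bsub>TT\<^esub>])) \<in> linear_maps TA T.TA" "(\<lambda>x. T.pt ([\<one>\<^bsub>TT\<^esub>] @ x # [])) \<in> linear_maps TA T.TA"
      using multilin_linear[OF T.pure_multilin, of "[]" "[\<one>\<^bsub>TT\<^esub>]"] multilin_linear[OF T.pure_multilin, of "[\<one>\<^bsub>TT\<^esub>]" "[]"]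
      by (simp_all add: linear_TT)
    from this[THEN lin_comp[OF pure1_linear(1)]] show ?thesis
      unfolding \<phi>_def by (intro linear_sum T.R.vsp) simp_all
  qed
  have \<phi>2: "\<phi> x \<in> T.Rn 2" if "x \<in> C" for x
    unfolding \<phi>_def using that by (intro T.Rn_add T.Rn_pure) simp_all
  have bm: "braided_mult TT t = T.M 0 (T.M 2 (T.D 1 t))" "braided_mult TT t \<in> T.Rn 2" if "t \<in> T.Rn 4" for t
    using T.braided_mult_eq[OF that] T.DM_deg(1)[OF that, of 1] T.DM_deg(2)[of "T.D 1 t" 3 2] T.DM_deg(2)[of "T.M 2 (T.D 1 t)" 2 0]
    by simp_all
  have m4: "s \<otimes>\<^bsub>T.TA\<^esub> t \<in> T.Rn 4" if "s \<in> T.Rn 2" "t \<in> T.Rn 2" for s t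
    using T.Rn_mult[OF that] by simp
  have bml: "(\<lambda>t. T.M 0 (T.M 2 (T.D 1 t))) \<in> linear_maps T.TA T.TA"
    by (rule lin_comp[OF lin_comp[OF T.D_linear T.M_linear] T.M_linear])
  have toQ: "G \<in> linear_maps N ?Q"
    if "F \<in> linear_maps N T.TA" "vspace N" "\<And>x. x \<in> carrier N ==> G x = F x" "\<And>x. x \<in> carrier N ==> G x \<in> T.Rn 2"
    for F G and N :: "('k, 'x, 'y) module_scheme"
    using lin_cong[OF that(1,2,3)] that(4) unfolding linQ by (auto simp: linear_maps_def)
  have l: "(\<lambda>x. \<phi> x \<otimes>\<^bsub>?Q\<^esub> b) \<in> linear_maps V ?Q" if b: "b \<in> carrier ?Q" for b
  proof (rule toQ[OF lin_comp[OF lin_comp[OF \<phi>l T.rmult_linear] bml] V.vsp])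
    have "b \<in> T.Rn 2" using b by (simp only: Qf)
    then show "b \<in> T.CT" by (rule T.Rn_cl)
    fix x assume "x \<in> C"
    from m4[OF \<phi>2[OF this] \<open>b \<in> T.Rn 2\<close>]
    show "\<phi> x \<otimes>\<^bsub>?Q\<^esub> b = T.M 0 (T.M 2 (T.D 1 (\<phi> x \<otimes>\<^bsub>T.TA\<^esub> b)))" "\<phi> x \<otimes>\<^bsub>?Q\<^esub> b \<in> T.Rn 2"
      unfolding Qf by (rule bm)+
  qed
  have r: "(\<lambda>b. \<phi> x \<otimes>\<^bsub>?Q\<^esub> b) \<in> linear_maps ?Q ?Q" if x: "x \<in> C" for x
  proof (rule toQ[OF _ Q])
    show "(\<lambda>b. T.M 0 (T.M 2 (T.D 1 (\<phi> x \<otimes>\<^bsub>T.TA\<^esub> b)))) \<in> linear_maps ?Q T.TA"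
      using T.linear_restrict[OF lin_comp[OF T.lmult_linear[OF T.Rn_cl[OF \<phi>2[OF x]]] bml], of 2] by (simp add: linear_maps_def Qf)
    fix b assume "b \<in> carrier ?Q"
    then have "b \<in> T.Rn 2" by (simp only: Qf)
    from m4[OF \<phi>2[OF x] this]
    show "\<phi> x \<otimes>\<^bsub>?Q\<^esub> b = T.M 0 (T.M 2 (T.D 1 (\<phi> x \<otimes>\<^bsub>T.TA\<^esub> b)))" "\<phi> x \<otimes>\<^bsub>?Q\<^esub> b \<in> T.Rn 2"
      unfolding Qf by (rule bm)+
  qed
  have o: "\<one>\<^bsub>?Q\<^esub> \<in> carrier ?Q" unfolding Qf by (rule T.Rn_pure) simp_all
  have l': "\<forall>b\<in>carrier ?Q. (\<lambda>x. \<phi> x \<otimes>\<^bsub>?Q\<^esub> b) \<in> linear_maps V ?Q" using l by blast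
  have r': "\<forall>x\<in>C. (\<lambda>b. \<phi> x \<otimes>\<^bsub>?Q\<^esub> b) \<in> linear_maps ?Q ?Q" using r by blast
  note L = tensor_algebra_lift_linear[OF Q o l' r', folded ceq]
  show "comult TT \<in> linear_maps TA (tensor_power TT 2)" using L(1) unfolding linQ .
  show "comult TT oneT = T.pt [oneT, oneT]" using L(2) unfolding Qf .
  show "comult TT (pt [x] \<otimes>\<^bsub>TA\<^esub> t) = braided_mult TT ((T.pt [pt [x], oneT] \<oplus>\<^bsub>T.TA\<^esub> T.pt [oneT, pt [x]]) \<otimes>\<^bsub>T.TA\<^esub> comult TT t)"
    if "x \<in> C" "t \<in> CT"
    using L(3)[OF that] unfolding Qf \<phi>_def .
qed

sublocale T: bcoalg "braided_tensor_algebra V"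
  by unfold_locales (simp_all add: TT_braided comult_word(1) linear_TT)

notation tmul (infixl "\<bullet>" 72)
notation T.tmul (infixl "\<star>" 72)

lemmas one_word = comult_word(2)

text \<open>Working form of the recursion: a letter is either multiplied into the first tensor
  factor, or braided past it and multiplied into the second. Four-fold tensors no longer
  occur.\<close>

lemma comult_cons: "[|x \<in> C; t \<in> CT|] ==>
  comult TT (pt [x] \<bullet> t) = T.M 0 (T.pt [pt [x]] \<star> comult TT t) \<oplus>\<^bsub>T.TA\<^esub> T.M 1 (T.D 0 (T.pt [pt [x]] \<star> comult TT t))"
  using T.braided_mult_primitive[of "pt [x]" "comult TT t"] T.comult_cl[of t] by (simp add: comult_word(3))

lemma R1_sub [simp]: "Rn n \<subseteq> CT" by auto

lemma Cm_pure1: "[|x \<in> CT; y \<in> CT|] ==> T.Cm 1 (T.pt [x, y]) = T.pt [x] \<star> comult TT y"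
  using T.whisker_pure[OF T.comult_hom, of "[x]" "[y]" "[]" 1] T.comult_cl[of y]
  by (simp add: T.comult_map_pure T.pure_Nil)

lemma Cm_pure0: "[|x \<in> CT; y \<in> CT|] ==> T.Cm 0 (T.pt [x, y]) = comult TT x \<star> T.pt [y]"
  using T.whisker_pure[OF T.comult_hom, of "[]" "[x]" "[y]" 0] T.comult_cl[of x]
  by (simp add: T.comult_map_pure T.pure_Nil)

lemma local_Cm: "local_at TT i 1 (T.Cm i) (T.Cm 0)" "local_at TT i 2 (T.Cm i) (T.Cm 0)" "local_at TT i 2 (T.Cm (Suc i)) (T.Cm 1)"
  using T.local_at_shift[OF T.comult_hom, of 0 1 i] T.local_at_shift[OF T.comult_hom, of 0 2 i]
    T.local_at_shift[OF T.comult_hom, of 1 2 i] by simp_all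

lemma deg_Cm: "t \<in> T.Rn 2 ==> T.Cm 0 t \<in> T.Rn 3" "t \<in> T.Rn 2 ==> T.Cm 1 t \<in> T.Rn 3" "t \<in> T.Rn 2 ==> T.M 0 t \<in> T.Rn 1"
proof -
  assume t: "t \<in> T.Rn 2"
  show "T.Cm 0 t \<in> T.Rn 3" using T.whisker_deg[OF T.comult_hom t, of 0 1] by simp
  show "T.Cm 1 t \<in> T.Rn 3" using T.whisker_deg[OF T.comult_hom t, of 1 0] by simp
  show "T.M 0 t \<in> T.Rn 1" using T.DM_deg(2)[of t 1 0] t by simp
qed

text \<open>\<open>comult_cons\<close> as an identity of operators at any position, for use inside
  longer tensors. The first of the two multiplied factors consists of letters, in
  \<open>Rn 1\<close>.\<close>

lemma comult_mult_op:
  assumes t: "t \<in> tspan TT (As @ [Rn 1, CT] @ Cs)" and ok: "As @ Cs \<in> lists (Pow CT)" and i: "length As = i"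
  shows "T.Cm i (T.M i t) = T.M i (T.Cm (Suc i) t) \<oplus>\<^bsub>T.TA\<^esub> T.M (Suc i) (T.D i (T.Cm (Suc i) t))"
proof (rule T.local_at_eq[of i 2, OF T.local_at_comp[OF local_Cm(1) T.local_M0]
      T.local_at_sum[OF T.local_at_comp[OF T.local_M(1) local_Cm(3)]
        T.local_at_comp[OF T.local_M(2) T.local_at_comp[OF T.local_D(1) local_Cm(3)]]], of As "[Rn 1, CT]" Cs])
  fix t assume "t \<in> tspan TT [Rn 1, CT]"
  then show "T.Cm 0 (T.M 0 t) = T.M 0 (T.Cm 1 t) \<oplus>\<^bsub>T.TA\<^esub> T.M 1 (T.D 0 (T.Cm 1 t))"
  proof (rule T.tspan_eqI[OF lin_comp[OF T.M_linear T.Cm_linear]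
        linear_sum[OF lin_comp[OF T.Cm_linear T.M_linear] lin_comp[OF lin_comp[OF T.Cm_linear T.D_linear] T.M_linear]
          T.R.vsp] T.R.vsp, rotated 2])
    fix ss assume "list_all2 (\<in>) ss [Rn 1, CT]"
    then obtain v s where ss: "ss = [v, s]" "v \<in> Rn 1" "s \<in> CT" by (auto simp: list_all2_Cons2)
    then obtain x where x: "x \<in> C" "v = pt [x]" by (auto elim: Rn1_E)
    have "T.M 0 (T.pt ss) = T.pt [v \<bullet> s]" using T.M_pure[of "[]" v s "[]" 0] ss by simp
    then show "T.Cm 0 (T.M 0 (T.pt ss)) = T.M 0 (T.Cm 1 (T.pt ss)) \<oplus>\<^bsub>T.TA\<^esub> T.M 1 (T.D 0 (T.Cm 1 (T.pt ss)))"
      using ss x comult_cons[OF x(1) ss(3)] T.whisker_0[OF T.comult_hom T.Rn_pure, of "[v \<bullet> s]"]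
      by (simp add: Cm_pure1 T.comult_map_pure)
  qed simp
qed (use assms deg_Cm T.DM_deg T.deg3 in auto)

end

context tbialg begin

section \<open>Crossing with a letter\<close>

lemma pt2_linear: "v \<in> CT ==> (\<lambda>s. T.pt [v, s]) \<in> linear_maps TA T.TA"
  "v \<in> CT ==> (\<lambda>s. T.pt [s, v]) \<in> linear_maps TA T.TA"
  using multilin_linear[OF T.pure_multilin, of "[v]" "[]"] multilin_linear[OF T.pure_multilin, of "[]" "[v]"]
  by (simp_all add: linear_TT)

lemma emb_linear: "(\<lambda>x. pt [x]) \<in> linear_maps V TT"
  by (simp add: linear_TT pure1_linear)

lemma braid_emb:
  assumes "t \<in> Rn 2"
  shows "braid TT (tmap TT (\<lambda>x. pt [x]) t) = tmap TT (\<lambda>x. pt [x]) (braid V t)"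
  using TB_props(3)[OF assms] by (simp add: TT_TB(2) tmap_def same_alg_tensor[OF TT_TA])

lemma pt_emb: "[|x \<in> C; y \<in> C|] ==> T.pt [pt [x], pt [y]] = tmap TT (\<lambda>x. pt [x]) (pt [x, y])"
  by (simp add: tmap_pure[OF tns T.tns emb_linear])

lemma tmap_emb_Rn: "t \<in> Rn 2 ==> tmap TT (\<lambda>x. pt [x]) t \<in> tspan TT [Rn 1, Rn 1]"
  by (rule tmap_tspan[OF tns T.tns emb_linear, of "[C, C]"]) (auto simp: Rn_tspan2(1) intro!: Rn_pure)

lemma D_11: "t \<in> tspan TT [Rn 1, Rn 1] ==> T.D 0 t \<in> tspan TT [Rn 1, Rn 1]"
proof (rule T.tspan_imageI[OF T.D_linear _ T.tspan_subsp])
  fix ss assume "list_all2 (\<in>) ss [Rn 1, Rn 1]"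
  then obtain x y where ss: "ss = [pt [x], pt [y]]" "x \<in> C" "y \<in> C"
    by (auto simp: list_all2_Cons2 elim!: Rn1_E)
  have "T.D 0 (T.pt ss) = braid TT (T.pt ss)" using ss by (intro T.D_0 T.Rn_pure) auto
  also have "\<dots> = tmap TT (\<lambda>x. pt [x]) (braid V (pt [x, y]))"
    using ss by (simp add: pt_emb braid_emb Rn_pure)
  finally show "T.D 0 (T.pt ss) \<in> tspan TT [Rn 1, Rn 1]"
    using tmap_emb_Rn[OF hom_cl[OF braid_hom Rn_pure, of "[x, y]"]] ss by simp
qed auto

lemma M_pt3: "[|x \<in> CT; y \<in> CT; z \<in> CT|] ==> T.M 0 (T.pt [x, y, z]) = T.pt [x \<bullet> y, z]"
  "[|x \<in> CT; y \<in> CT; z \<in> CT|] ==> T.M 1 (T.pt [x, y, z]) = T.pt [x, y \<bullet> z]"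
  using T.M_pure[of "[]" x y "[z]" 0] T.M_pure[of "[x]" y z "[]" 1] by simp_all

lemma Rn_mult_Suc: "x \<in> Rn 1 ==> y \<in> Rn n ==> x \<bullet> y \<in> Rn (Suc n)"
  using Rn_mult[of x 1 y n] by simp

text \<open>The braiding of T is prescribed on pairs of letters. Peeling one letter off the word by
  a hexagon identity shows that the letter and the word keep their degrees when they cross.\<close>

lemma D_homogeneous_right: "[|v \<in> Rn 1; s \<in> Rn n|] ==> T.D 0 (T.pt [v, s]) \<in> tspan TT [Rn n, Rn 1]"
proof (induction n arbitrary: v s)
  case 0
  note l = lin_comp[OF pt2_linear(1) T.D_linear, of v 0]
  have sub: "subsp T.TA (tspan TT [Rn 0, Rn 1])" by (rule T.tspan_subsp) simp
  from 0(2,1) show ?case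
  proof (induction s rule: tp_induct)
    case (pure xs)
    then show ?case using T.D_one(1)[of v] by (auto simp: pure_Nil intro!: T.tspan_pure)
  qed (auto simp: lin_add[OF l] lin_smult[OF l] intro: subsp_add[OF sub] subsp_smult[OF sub])
next
  case (Suc n)
  note l = lin_comp[OF pt2_linear(1) T.D_linear, of v 0]
  have sub: "subsp T.TA (tspan TT [Rn (Suc n), Rn 1])" by (rule T.tspan_subsp) simp
  from Suc.prems(2,1) show ?case
  proof (induction s rule: tp_induct)
    case (pure xs)
    then obtain y ys where xs: "xs = y # ys" "y \<in> C" "ys \<in> wrd" "length ys = n" by (cases xs) auto
    let ?t = "T.pt [v, pt [y], pt ys]"
    have e: "T.pt [v, pt xs] = T.M 1 ?t"
      using M_pt3(2)[of v "pt [y]" "pt ys"] pure_append[of "[y]" ys] xs pure by (simp add: Rn_cl)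
    have eq: "T.D 0 (T.pt [v, pt xs]) = T.M 0 (T.D 1 (T.D 0 ?t))"
      unfolding e using xs pure by (intro T.hex2) (auto simp: Rn_cl)
    have "T.D 0 ?t \<in> tspan TT ([] @ [Rn 1, Rn 1] @ [Rn n])"
      by (rule T.D_tspan[OF D_11]) (use xs pure in \<open>auto intro!: T.tspan_pure Rn_pure\<close>)
    then have d: "T.D 0 ?t \<in> tspan TT ([Rn 1] @ [Rn 1, Rn n] @ [])" by simp
    have "T.D 1 (T.D 0 ?t) \<in> tspan TT ([Rn 1] @ [Rn n, Rn 1] @ [])"
    proof (rule T.D_tspan[OF _ d])
      fix t assume "t \<in> tspan TT [Rn 1, Rn n]"
      then show "T.D 0 t \<in> tspan TT [Rn n, Rn 1]"
        by (rule T.tspan_imageI[OF T.D_linear _ T.tspan_subsp, rotated 3])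
          (auto simp: list_all2_Cons2 intro: Suc.IH)
    qed auto
    then have dd: "T.D 1 (T.D 0 ?t) \<in> tspan TT ([] @ [Rn 1, Rn n] @ [Rn 1])" by simp
    have "T.M 0 (T.D 1 (T.D 0 ?t)) \<in> tspan TT ([] @ [Rn (Suc n)] @ [Rn 1])"
      by (rule T.mult_tspan[OF _ _ _ _ dd]) (simp_all add: Rn_mult_Suc)
    then show ?case unfolding eq by simp
  qed (auto simp: lin_add[OF l] lin_smult[OF l] intro: subsp_add[OF sub] subsp_smult[OF sub])
qed

lemma D_homogeneous_left: "[|v \<in> Rn 1; s \<in> Rn n|] ==> T.D 0 (T.pt [s, v]) \<in> tspan TT [Rn 1, Rn n]"
proof (induction n arbitrary: v s)
  case 0
  note l = lin_comp[OF pt2_linear(2) T.D_linear, of v 0]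
  have sub: "subsp T.TA (tspan TT [Rn 1, Rn 0])" by (rule T.tspan_subsp) simp
  from 0(2,1) show ?case
  proof (induction s rule: tp_induct)
    case (pure xs)
    then show ?case using T.D_one(2)[of v] by (auto simp: pure_Nil intro!: T.tspan_pure)
  qed (auto simp: lin_add[OF l] lin_smult[OF l] intro: subsp_add[OF sub] subsp_smult[OF sub])
next
  case (Suc n)
  note l = lin_comp[OF pt2_linear(2) T.D_linear, of v 0]
  have sub: "subsp T.TA (tspan TT [Rn 1, Rn (Suc n)])" by (rule T.tspan_subsp) simp
  from Suc.prems(2,1) show ?case
  proof (induction s rule: tp_induct)
    case (pure xs)
    then obtain y ys where xs: "xs = y # ys" "y \<in> C" "ys \<in> wrd" "length ys = n" by (cases xs) auto
    let ?t = "T.pt [pt [y], pt ys, v]"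
    have e: "T.pt [pt xs, v] = T.M 0 ?t"
      using M_pt3(1)[of "pt [y]" "pt ys" v] pure_append[of "[y]" ys] xs pure by (simp add: Rn_cl)
    have eq: "T.D 0 (T.pt [pt xs, v]) = T.M 1 (T.D 0 (T.D 1 ?t))"
      unfolding e using xs pure by (intro T.hex1) (auto simp: Rn_cl)
    have d: "?t \<in> tspan TT ([Rn 1] @ [Rn n, Rn 1] @ [])"
      using xs pure by (auto intro!: T.tspan_pure Rn_pure)
    have "T.D 1 ?t \<in> tspan TT ([Rn 1] @ [Rn 1, Rn n] @ [])"
    proof (rule T.D_tspan[OF _ d])
      fix t assume "t \<in> tspan TT [Rn n, Rn 1]"
      then show "T.D 0 t \<in> tspan TT [Rn 1, Rn n]"
        by (rule T.tspan_imageI[OF T.D_linear _ T.tspan_subsp, rotated 3])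
          (auto simp: list_all2_Cons2 intro: Suc.IH)
    qed auto
    then have "T.D 0 (T.D 1 ?t) \<in> tspan TT ([] @ [Rn 1, Rn 1] @ [Rn n])"
      by (intro T.D_tspan[OF D_11]) auto
    then have dd: "T.D 0 (T.D 1 ?t) \<in> tspan TT ([Rn 1] @ [Rn 1, Rn n] @ [])" by simp
    have "T.M 1 (T.D 0 (T.D 1 ?t)) \<in> tspan TT ([Rn 1] @ [Rn (Suc n)] @ [])"
      by (rule T.mult_tspan[OF _ _ _ _ dd]) (simp_all add: Rn_mult_Suc)
    then show ?case unfolding eq by simp
  qed (auto simp: lin_add[OF l] lin_smult[OF l] intro: subsp_add[OF sub] subsp_smult[OF sub])
qed

text \<open>Stated for any span of words that contains with each word all tensors of its degree, so
  that it serves for T itself and for the filtration.\<close>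

lemma D_span:
  assumes A: "A \<subseteq> wrd" and S: "S = lspan TA (pt ` A)" and h: "\<And>xs. xs \<in> A ==> Rn (length xs) \<subseteq> S"
  shows "t \<in> tspan TT [Rn 1, S] ==> T.D 0 t \<in> tspan TT [S, Rn 1]"
    and "t \<in> tspan TT [S, Rn 1] ==> T.D 0 t \<in> tspan TT [Rn 1, S]"
proof -
  have SC: "S \<subseteq> CT" unfolding S using A by (intro lspan_least[OF R.subsp_carrier]) auto
  have sub: "subsp T.TA (tspan TT [S, Rn 1])" "subsp T.TA (tspan TT [Rn 1, S])"
    by (rule T.tspan_subsp; use SC in simp)+
  have 1: "T.D 0 (T.pt [v, s]) \<in> tspan TT [S, Rn 1]" if v: "v \<in> Rn 1" and s: "s \<in> S" for v s
  proof (rule lspan_image_subset[OF lin_comp[OF pt2_linear(1) T.D_linear] R.vsp T.R.vsp sub(1)])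
    show "v \<in> CT" using v by simp
    show "s \<in> lspan TA (pt ` A)" using s S by simp
    show "pt ` A \<subseteq> CT" using A by auto
    fix x assume "x \<in> pt ` A"
    then obtain xs where xs: "x = pt xs" "xs \<in> A" by auto
    then have "T.D 0 (T.pt [v, x]) \<in> tspan TT [Rn (length xs), Rn 1]"
      using A v by (intro D_homogeneous_right) auto
    then show "T.D 0 (T.pt [v, x]) \<in> tspan TT [S, Rn 1]"
      using T.tspan_mono[of "[Rn (length xs), Rn 1]" "[S, Rn 1]"] h[OF xs(2)] SC by auto
  qed
  have 2: "T.D 0 (T.pt [s, v]) \<in> tspan TT [Rn 1, S]" if v: "v \<in> Rn 1" and s: "s \<in> S" for v s
  proof (rule lspan_image_subset[OF lin_comp[OF pt2_linear(2) T.D_linear] R.vsp T.R.vsp sub(2)])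
    show "v \<in> CT" using v by simp
    show "s \<in> lspan TA (pt ` A)" using s S by simp
    show "pt ` A \<subseteq> CT" using A by auto
    fix x assume "x \<in> pt ` A"
    then obtain xs where xs: "x = pt xs" "xs \<in> A" by auto
    then have "T.D 0 (T.pt [x, v]) \<in> tspan TT [Rn 1, Rn (length xs)]"
      using A v by (intro D_homogeneous_left) auto
    then show "T.D 0 (T.pt [x, v]) \<in> tspan TT [Rn 1, S]"
      using T.tspan_mono[of "[Rn 1, Rn (length xs)]" "[Rn 1, S]"] h[OF xs(2)] SC by auto
  qed
  show "t \<in> tspan TT [Rn 1, S] ==> T.D 0 t \<in> tspan TT [S, Rn 1]"
    by (rule T.tspan_imageI[OF T.D_linear _ sub(1)]) (use SC in \<open>auto simp: list_all2_Cons2 intro: 1\<close>)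
  show "t \<in> tspan TT [S, Rn 1] ==> T.D 0 t \<in> tspan TT [Rn 1, S]"
    by (rule T.tspan_imageI[OF T.D_linear _ sub(2)]) (use SC in \<open>auto simp: list_all2_Cons2 intro: 2\<close>)
qed

lemmas D_right = D_span(1)[OF order_refl carrier_TA_span R1_sub]
  and D_left = D_span(2)[OF order_refl carrier_TA_span R1_sub]

lemma pt_cons: "[|s \<in> CT; ss \<in> lists CT|] ==> T.pt (s # ss) = T.pt [s] \<star> T.pt ss"
  using T.pure_cons[of s ss] by simp

lemma shift1:
  assumes "s \<in> T.Rn 1" "t \<in> T.CT"
  shows "T.D (Suc i) (s \<star> t) = s \<star> T.D i t" "T.M (Suc i) (s \<star> t) = s \<star> T.M i t" "T.Cm (Suc i) (s \<star> t) = s \<star> T.Cm i t"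
  using T.whisker_left[OF T.braid_hom assms, of i] T.whisker_left[OF T.mult_map_hom assms, of i]
    T.whisker_left[OF T.comult_hom assms, of i] by simp_all

text \<open>A braided coalgebra axiom, for a letter in the second factor. In the induction on words
  the two summands of \<open>comult_mult_op\<close> are carried through separately: the first by a
  hexagon identity, the second by the braid relation as well.\<close>

lemma comult_braid_right:
  assumes t: "t \<in> tspan TT [CT, Rn 1]"
  shows "T.Cm 1 (T.D 0 t) = T.D 0 (T.D 1 (T.Cm 0 t))"
proof (rule T.tspan_eqI[OF lin_comp[OF T.D_linear T.Cm_linear]
      lin_comp[OF lin_comp[OF T.Cm_linear T.D_linear] T.D_linear] T.R.vsp _ _ t])
  fix ss assume "list_all2 (\<in>) ss [CT, Rn 1]"
  then obtain s v where ss: "ss = [s, v]" "s \<in> CT" "v \<in> Rn 1" by (auto simp: list_all2_Cons2)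
  have vc: "v \<in> CT" using ss by simp
  note l1 = lin_comp[OF lin_comp[OF pt2_linear(2)[OF vc] T.D_linear] T.Cm_linear]
  note l2 = lin_comp[OF lin_comp[OF lin_comp[OF pt2_linear(2)[OF vc] T.Cm_linear] T.D_linear] T.D_linear]
  from ss(2) have "T.Cm 1 (T.D 0 (T.pt [s, v])) = T.D 0 (T.D 1 (T.Cm 0 (T.pt [s, v])))"
  proof (induction s rule: TA_word_induct)
    case one
    have "T.Cm 0 (T.pt [oneT, v]) = T.pt [oneT] \<star> T.pt [oneT, v]"
      using vc by (simp add: Cm_pure0 one_word flip: T.pure_append)
    then have "T.D 0 (T.D 1 (T.Cm 0 (T.pt [oneT, v]))) = T.D 0 (T.pt [oneT] \<star> T.pt [v, oneT])"
      using shift1(1)[of "T.pt [oneT]" "T.pt [oneT, v]" 0] T.D_one(2)[of v] vc by (simp add: T.Rn_pure)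
    also have "T.pt [oneT] \<star> T.pt [v, oneT] = T.pt [oneT, v] \<star> T.pt [oneT]"
      using vc by (simp flip: T.pure_append)
    also have "T.D 0 (T.pt [oneT, v] \<star> T.pt [oneT]) = T.pt [v, oneT] \<star> T.pt [oneT]"
      using T.whisker_right[OF T.braid_hom T.Rn_pure, of "[oneT, v]" 2 0 "T.pt [oneT]"] T.D_one(2)[of v] vc by simp
    finally show ?case
      using T.D_one(2)[of v] vc by (simp add: Cm_pure1 one_word flip: T.pure_append)
  next
    case (cons x s)
    let ?v = "T.pt [pt [x]]" and ?t = "T.pt [s, v]"
    define t3 where "t3 = ?v \<star> ?t"
    define w where "w = T.Cm 1 t3"
    have c: "?v \<in> T.Rn 1" "?t \<in> T.Rn 2" "t3 \<in> T.CT" "w \<in> T.CT"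
      using cons vc by (auto simp: t3_def w_def intro!: T.Rn_pure)
    have t3p: "t3 = T.pt [pt [x], s, v]" using cons vc pt_cons[of "pt [x]" "[s, v]"] by (simp add: t3_def)
    have t3s: "t3 \<in> tspan TT ([Rn 1] @ [CT, Rn 1] @ [])" "t3 \<in> tspan TT ([] @ [Rn 1, CT] @ [Rn 1])"
      unfolding t3p using cons ss by (auto intro!: T.tspan_pure Rn_pure)
    have "T.D 1 t3 \<in> tspan TT ([Rn 1] @ [Rn 1, CT] @ [])"
      by (rule T.D_tspan[OF D_left t3s(1)]) auto
    then have "T.D 1 t3 \<in> tspan TT ([] @ [Rn 1, Rn 1] @ [CT])" by simp
    then have us: "T.D 0 (T.D 1 t3) \<in> tspan TT ([] @ [Rn 1, Rn 1] @ [CT])"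
      by (rule T.D_tspan[OF D_11, rotated]) auto
    \<comment> \<open>The induction hypothesis, moved one position to the right by the letter
      \<open>x\<close>.\<close>
    have IH: "T.Cm 2 (T.D 1 t3) = T.D 1 (T.D 2 w)"
      using shift1(1)[of ?v ?t 0] shift1(3)[of ?v "T.D 0 ?t" 1] shift1(3)[of ?v ?t 0] shift1(1)[of ?v "T.Cm 0 ?t" 1]
        shift1(1)[of ?v "T.D 1 (T.Cm 0 ?t)" 0] c cons.IH
      by (simp add: t3_def w_def)
    have "T.Cm 1 (T.D 0 (T.M 0 t3)) = T.Cm 1 (T.M 1 (T.D 0 (T.D 1 t3)))"
      using T.hex1[of 1 0 t3] c by simp
    also have "\<dots> = T.M 1 (T.Cm 2 (T.D 0 (T.D 1 t3))) \<oplus>\<^bsub>T.TA\<^esub> T.M 2 (T.D 1 (T.Cm 2 (T.D 0 (T.D 1 t3))))"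
      using comult_mult_op[of "T.D 0 (T.D 1 t3)" "[Rn 1]" "[]" 1] us by simp
    also have "T.Cm 2 (T.D 0 (T.D 1 t3)) = T.D 0 (T.D 1 (T.D 2 w))"
      using T.whisker_commute[OF T.braid_hom T.comult_hom, of "T.D 1 t3" 0 0] c IH by simp
    also have "T.M 1 (T.D 0 (T.D 1 (T.D 2 w))) = T.D 0 (T.D 1 (T.M 0 w))"
      using T.M_D[of 0 1 w] T.hex1[of 1 0 "T.D 2 w"] c by simp
    \<comment> \<open>The braid relation turns the crossings at 1, 0, 1 into crossings at 0, 1, 0;
      the outer one then leaves past the product and the inner one reaches \<open>w\<close>.\<close>
    also have "T.M 2 (T.D 1 (T.D 0 (T.D 1 (T.D 2 w)))) = T.D 0 (T.D 1 (T.M 1 (T.D 0 w)))"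
      using T.hex1[of 2 1 "T.D 0 w"] T.D_M[of 0 2 "T.D 1 (T.D 2 (T.D 0 w))"] T.D_D[of 0 2 w] T.braid_rel[of 1 0 "T.D 2 w"] c
      by simp
    also have "T.D 0 (T.D 1 (T.M 0 w)) \<oplus>\<^bsub>T.TA\<^esub> T.D 0 (T.D 1 (T.M 1 (T.D 0 w))) = T.D 0 (T.D 1 (T.M 0 w \<oplus>\<^bsub>T.TA\<^esub> T.M 1 (T.D 0 w)))"
      using c by (simp add: lin_add[OF T.D_linear])
    also have "T.M 0 w \<oplus>\<^bsub>T.TA\<^esub> T.M 1 (T.D 0 w) = T.Cm 0 (T.M 0 t3)"
      using comult_mult_op[of t3 "[]" "[Rn 1]" 0] t3s by (simp add: w_def)
    finally show ?case using M_pt3(1)[of "pt [x]" s v] cons vc by (simp add: t3p)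
  qed (use vc in \<open>simp_all add: lin_add[OF l1] lin_smult[OF l1] lin_add[OF l2] lin_smult[OF l2]\<close>)
  then show "T.Cm 1 (T.D 0 (T.pt ss)) = T.D 0 (T.D 1 (T.Cm 0 (T.pt ss)))" using ss by simp
qed simp

text \<open>Here \<open>v\<close> first crosses the leading letter of the word, which yields other
  letters in its place, so the induction is over all \<open>v\<close>. The singleton
  \<open>{s}\<close> keeps the rest of the word fixed in the meantime.\<close>

lemma comult_braid_left:
  assumes t: "t \<in> tspan TT [Rn 1, CT]"
  shows "T.Cm 0 (T.D 0 t) = T.D 1 (T.D 0 (T.Cm 1 t))"
proof -
  have "\<forall>v\<in>Rn 1. T.Cm 0 (T.D 0 (T.pt [v, s])) = T.D 1 (T.D 0 (T.Cm 1 (T.pt [v, s])))" if "s \<in> CT" for s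
    using that
  proof (induction s rule: TA_word_induct)
    case one
    show ?case
    proof
      fix v assume "v \<in> Rn 1"
      then have vc: "v \<in> CT" by simp
      have "T.Cm 1 (T.pt [v, oneT]) = T.pt [v, oneT] \<star> T.pt [oneT]"
        using vc by (simp add: Cm_pure1 one_word flip: T.pure_append)
      then have "T.D 0 (T.Cm 1 (T.pt [v, oneT])) = T.pt [oneT, v] \<star> T.pt [oneT]"
        using T.whisker_right[OF T.braid_hom T.Rn_pure, of "[v, oneT]" 2 0 "T.pt [oneT]"] T.D_one(1)[of v] vc by simp
      also have "\<dots> = T.pt [oneT] \<star> T.pt [v, oneT]" using vc by (simp flip: T.pure_append)
      finally have "T.D 1 (T.D 0 (T.Cm 1 (T.pt [v, oneT]))) = T.pt [oneT] \<star> T.pt [oneT, v]"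
        using shift1(1)[of "T.pt [oneT]" "T.pt [v, oneT]" 0] T.D_one(1)[of v] vc by (simp add: T.Rn_pure)
      then show "T.Cm 0 (T.D 0 (T.pt [v, oneT])) = T.D 1 (T.D 0 (T.Cm 1 (T.pt [v, oneT])))"
        using T.D_one(1)[of v] vc by (simp add: Cm_pure0 one_word flip: T.pure_append)
    qed
  next
    case (cons x s)
    show ?case
    proof
      fix v assume v: "v \<in> Rn 1"
      then have vc: "v \<in> CT" by simp
      define t3 where "t3 = T.pt [v, pt [x], s]"
      define w where "w = T.Cm 2 t3"
      have c: "t3 \<in> T.CT" "w \<in> T.CT" using cons vc by (auto simp: t3_def w_def)
      have t3s: "t3 \<in> tspan TT ([Rn 1] @ [Rn 1, CT] @ [])" "t3 \<in> tspan TT ([] @ [Rn 1, Rn 1] @ [{s}])"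
        unfolding t3_def using cons v by (auto intro!: T.tspan_pure Rn_pure)
      have d0s: "T.D 0 t3 \<in> tspan TT ([] @ [Rn 1, Rn 1] @ [{s}])"
        by (rule T.D_tspan[OF D_11 t3s(2)]) (use cons in auto)
      then have d0s': "T.D 0 t3 \<in> tspan TT ([Rn 1] @ [Rn 1, {s}] @ [])" by simp
      have us: "T.D 1 (T.D 0 t3) \<in> tspan TT ([Rn 1] @ [CT, Rn 1] @ [])"
        by (rule T.D_tspan[OF D_right])
          (use subsetD[OF T.tspan_mono d0s', of "[Rn 1, Rn 1, CT]"] cons in auto)
      have "T.Cm 1 (T.D 1 (T.D 0 t3)) = T.D 2 (T.D 1 (T.Cm 2 (T.D 0 t3)))"
      proof (rule T.local_at_eq[OF T.local_at_comp[OF local_Cm(2)[of 1] T.local_D0[of 1]]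
            T.local_at_comp[OF T.local_D(2)[of 1, simplified] T.local_at_comp[OF T.local_D(1)[of 1] local_Cm(3)[of 1, simplified]]]])
        show "T.D 0 t3 \<in> tspan TT ([Rn 1] @ [Rn 1, {s}] @ [])" by (rule d0s')
        fix t assume t: "t \<in> tspan TT [Rn 1, {s}]"
        show "T.Cm 0 (T.D 0 t) = T.D 1 (T.D 0 (T.Cm 1 t))"
          by (rule T.tspan_eqI[OF lin_comp[OF T.D_linear T.Cm_linear]
              lin_comp[OF lin_comp[OF T.Cm_linear T.D_linear] T.D_linear] T.R.vsp _ _ t])
            (use cons in \<open>auto simp: list_all2_Cons2\<close>)
      qed (use cons deg_Cm T.deg3 T.DM_deg(1)[of _ 2 0] in auto)
      also have "T.Cm 2 (T.D 0 t3) = T.D 0 w"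
        using T.whisker_commute[OF T.braid_hom T.comult_hom, of t3 0 0] c by (simp add: w_def)
      finally have IH: "T.Cm 1 (T.D 1 (T.D 0 t3)) = T.D 2 (T.D 1 (T.D 0 w))" .
      have "T.Cm 0 (T.D 0 (T.M 1 t3)) = T.Cm 0 (T.M 0 (T.D 1 (T.D 0 t3)))"
        using T.hex2[of 1 0 t3] c by simp
      also have "\<dots> = T.M 0 (T.D 2 (T.D 1 (T.D 0 w))) \<oplus>\<^bsub>T.TA\<^esub> T.M 1 (T.D 0 (T.D 2 (T.D 1 (T.D 0 w))))"
        using comult_mult_op[of "T.D 1 (T.D 0 t3)" "[]" "[Rn 1]" 0] us IH by simp
      also have "T.M 0 (T.D 2 (T.D 1 (T.D 0 w))) = T.D 1 (T.D 0 (T.M 1 w))"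
        using T.hex2[of 1 0 w] T.M_D[of 0 1 "T.D 1 (T.D 0 w)"] c by simp
      also have "T.M 1 (T.D 0 (T.D 2 (T.D 1 (T.D 0 w)))) = T.D 1 (T.D 0 (T.M 2 (T.D 1 w)))"
        using T.D_M[of 0 2 "T.D 1 w"] T.hex2[of 2 1 "T.D 0 (T.D 1 w)"] T.braid_rel[of 1 0 w] T.D_D[of 0 2 "T.D 1 (T.D 0 w)"] c
        by simp
      also have "T.D 1 (T.D 0 (T.M 1 w)) \<oplus>\<^bsub>T.TA\<^esub> T.D 1 (T.D 0 (T.M 2 (T.D 1 w))) = T.D 1 (T.D 0 (T.M 1 w \<oplus>\<^bsub>T.TA\<^esub> T.M 2 (T.D 1 w)))"
        using c by (simp add: lin_add[OF T.D_linear])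
      also have "T.M 1 w \<oplus>\<^bsub>T.TA\<^esub> T.M 2 (T.D 1 w) = T.Cm 1 (T.M 1 t3)"
        using comult_mult_op[of t3 "[Rn 1]" "[]" 1] t3s by (simp add: w_def)
      finally show "T.Cm 0 (T.D 0 (T.pt [v, pt [x] \<bullet> s])) = T.D 1 (T.D 0 (T.Cm 1 (T.pt [v, pt [x] \<bullet> s])))"
        using M_pt3(2)[of v "pt [x]" s] cons vc by (simp add: t3_def)
    qed
  next
    case (add s s')
    then show ?case
      by (auto simp: lin_add[OF pt2_linear(1)] lin_add[OF T.D_linear] lin_add[OF T.Cm_linear] Rn_cl)
  next
    case (smult a s)
    then show ?case
      by (auto simp: lin_smult[OF pt2_linear(1)] lin_smult[OF T.D_linear] lin_smult[OF T.Cm_linear] Rn_cl)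
  qed
  then show ?thesis
    by (intro T.tspan_eqI[OF lin_comp[OF T.D_linear T.Cm_linear]
      lin_comp[OF lin_comp[OF T.Cm_linear T.D_linear] T.D_linear] T.R.vsp _ _ t]) (auto simp: list_all2_Cons2)
qed

lemma comult_emb: "x \<in> C ==> comult TT (pt [x]) = T.pt [pt [x], oneT] \<oplus>\<^bsub>T.TA\<^esub> T.pt [oneT, pt [x]]"
proof -
  assume x: "x \<in> C"
  let ?v = "pt [x]"
  have v: "?v \<in> CT" using x by simp
  have "T.pt [?v] \<star> T.pt [oneT, oneT] = T.pt [?v, oneT] \<star> T.pt [oneT]" using v by (simp flip: T.pure_append)
  then have "T.D 0 (T.pt [?v] \<star> T.pt [oneT, oneT]) = T.pt [oneT, ?v, oneT]"
    using T.whisker_right[OF T.braid_hom T.Rn_pure, of "[?v, oneT]" 2 0 "T.pt [oneT]"] T.D_one(1)[of ?v] v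
    by (simp flip: T.pure_append)
  then show ?thesis
    using comult_cons[OF x, of "oneT"] M_pt3(1)[of ?v "oneT" "oneT"] M_pt3(2)[of "oneT" ?v "oneT"] v
    by (simp add: one_word flip: T.pure_append)
qed

text \<open>Multiplicativity against a letter on the right. The recursion adds letters on the left,
  so this is proved by induction on those; it is what carries the coideal property through right
  multiplication.\<close>

lemma comult_right:
  assumes t: "t \<in> CT" and y: "y \<in> C"
  shows "comult TT (t \<bullet> pt [y]) = T.M 0 (T.D 1 (comult TT t \<star> T.pt [pt [y]])) \<oplus>\<^bsub>T.TA\<^esub> T.M 1 (comult TT t \<star> T.pt [pt [y]])"
proof -
  let ?v = "pt [y]" and ?s = "T.pt [pt [y]]"
  have v: "?v \<in> CT" "?s \<in> T.CT" using y by simp_all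
  have cc: "comult TT u \<in> T.Rn 2" if "u \<in> CT" for u using T.comult_cl that by simp
  have cc': "comult TT u \<in> T.CT" if "u \<in> CT" for u using cc[OF that] by (rule T.Rn_cl)
  note lc = lin_add[OF comult_word(1)] lin_smult[OF comult_word(1)]
  show ?thesis
    using t
  proof (induction t rule: TA_word_induct)
    case one
    have "T.D 1 (T.pt [oneT, oneT] \<star> ?s) = T.pt [oneT, ?v, oneT]"
      using shift1(1)[of "T.pt [oneT]" "T.pt [oneT, ?v]" 0] T.D_one(2)[of ?v] v
      by (simp add: T.Rn_pure flip: T.pure_append)
    then show ?case
      using comult_emb[OF y] M_pt3(1)[of "oneT" ?v "oneT"] M_pt3(2)[of "oneT" "oneT" ?v] v
      by (simp add: one_word flip: T.pure_append)
  next
    case (cons x t)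
    let ?x = "T.pt [pt [x]]"
    have xc: "?x \<in> T.Rn 1" using cons by (auto intro!: T.Rn_pure)
    define q where "q = ?x \<star> comult TT t"
    have q: "q \<in> T.Rn 3" using T.Rn_mult[OF xc cc[OF cons(2)]] by (simp add: q_def)
    define p where "p = q \<star> ?s"
    have p: "p \<in> T.CT" "p = ?x \<star> (comult TT t \<star> ?s)"
      using q v xc cc[OF cons(2)] by (simp_all add: p_def q_def T.R.A.m_assoc T.Rn_cl)
    let ?z = "comult TT t \<star> ?s"
    have z: "?z \<in> T.CT" using cc[OF cons(2)] v by (simp add: T.Rn_cl)
    have "?x \<star> comult TT (t \<bullet> ?v) = T.M 1 (T.D 2 p) \<oplus>\<^bsub>T.TA\<^esub> T.M 2 p"
      using cons.IH z xc shift1(1)[OF xc z, of 1] shift1(2)[OF xc, of "T.D 1 ?z" 0] shift1(2)[OF xc z, of 1]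
      by (simp add: p(2) T.R.A.r_distr T.Rn_cl)
    then have "comult TT (pt [x] \<bullet> (t \<bullet> ?v)) =
        T.M 0 (T.M 1 (T.D 2 p) \<oplus>\<^bsub>T.TA\<^esub> T.M 2 p) \<oplus>\<^bsub>T.TA\<^esub> T.M 1 (T.D 0 (T.M 1 (T.D 2 p) \<oplus>\<^bsub>T.TA\<^esub> T.M 2 p))"
      using comult_cons[of x "t \<bullet> ?v"] cons v by simp
    also have "\<dots> = (T.M 0 (T.M 1 (T.D 2 p)) \<oplus>\<^bsub>T.TA\<^esub> T.M 1 (T.D 0 (T.M 1 (T.D 2 p)))) \<oplus>\<^bsub>T.TA\<^esub>
        (T.M 0 (T.M 2 p) \<oplus>\<^bsub>T.TA\<^esub> T.M 1 (T.D 0 (T.M 2 p)))"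
      using p(1) by (simp add: lin_add[OF T.M_linear] lin_add[OF T.D_linear] T.R.add4)
    also have "T.M 0 (T.M 1 (T.D 2 p)) = T.M 0 (T.D 1 (T.M 0 p))"
      using T.M_assoc[of 1 0 "T.D 2 p"] T.M_D[of 0 1 p] p(1) by simp
    also have "T.M 1 (T.D 0 (T.M 1 (T.D 2 p))) = T.M 0 (T.D 1 (T.M 1 (T.D 0 p)))"
      using T.hex2[of 1 0 "T.D 2 p"] T.hex1[of 2 1 "T.D 0 p"] T.M_M[of 0 1 "T.D 1 (T.D 2 (T.D 0 p))"] T.D_D[of 0 2 p] p(1)
      by simp
    also have "T.M 0 (T.M 2 p) = T.M 1 (T.M 0 p)" using T.M_M[of 0 1 p] p(1) by simp
    also have "T.M 1 (T.D 0 (T.M 2 p)) = T.M 1 (T.M 1 (T.D 0 p))"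
      using T.D_M[of 0 2 p] T.M_assoc[of 2 1 "T.D 0 p"] p(1) by simp
    also have "(T.M 0 (T.D 1 (T.M 0 p)) \<oplus>\<^bsub>T.TA\<^esub> T.M 0 (T.D 1 (T.M 1 (T.D 0 p)))) \<oplus>\<^bsub>T.TA\<^esub> (T.M 1 (T.M 0 p) \<oplus>\<^bsub>T.TA\<^esub> T.M 1 (T.M 1 (T.D 0 p)))
        = T.M 0 (T.D 1 (T.M 0 p \<oplus>\<^bsub>T.TA\<^esub> T.M 1 (T.D 0 p))) \<oplus>\<^bsub>T.TA\<^esub> T.M 1 (T.M 0 p \<oplus>\<^bsub>T.TA\<^esub> T.M 1 (T.D 0 p))"
      using p(1) by (simp add: lin_add[OF T.M_linear] lin_add[OF T.D_linear])
    also have "T.M 0 p \<oplus>\<^bsub>T.TA\<^esub> T.M 1 (T.D 0 p) = comult TT (pt [x] \<bullet> t) \<star> ?s"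
    proof -
      have "T.M 0 p = T.M 0 q \<star> ?s" using T.whisker_right[OF T.mult_map_hom q, of 0 ?s] v by (simp add: p_def)
      moreover have "T.D 0 p = T.D 0 q \<star> ?s" using T.whisker_right[OF T.braid_hom q, of 0 ?s] v by (simp add: p_def)
      moreover have "T.M 1 (T.D 0 q \<star> ?s) = T.M 1 (T.D 0 q) \<star> ?s"
        using T.whisker_right[OF T.mult_map_hom T.D_Rn[OF q], of 1 ?s] v by simp
      ultimately show ?thesis
        using comult_cons[OF cons(1,2)] q v by (simp add: T.R.A.l_distr T.Rn_cl flip: q_def)
    qed
    finally show ?case using cons v by (simp add: R.A.m_assoc)
  next
    case (add s t)
    then show ?case
      using v by (simp add: R.A.l_distr T.R.A.l_distr lc lin_add[OF T.M_linear] lin_add[OF T.D_linear] T.R.add4 cc')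
  next
    case (smult a t)
    then show ?case
      using v by (simp add: R.smult_mult T.R.smult_mult lc lin_smult[OF T.M_linear] lin_smult[OF T.D_linear] T.R.smult_add cc')
  qed
qed

section \<open>The filtration by word length\<close>

definition "fil k = lspan TA (pt ` {xs \<in> wrd. length xs \<le> k})"

lemma fil_subsp: "subsp TA (fil k)"
  unfolding fil_def by (rule R.lspan_subsp) auto

lemma fil_sub [simp]: "fil k \<subseteq> CT"
  using fil_subsp by (simp add: subsp_def)

lemma fil_cl: "x \<in> fil k ==> x \<in> CT"
  using fil_sub by blast

lemma pure_fil: "xs \<in> wrd ==> length xs \<le> k ==> pt xs \<in> fil k"
  unfolding fil_def by (rule lspan.base) simp

lemma Rn_fil: "n \<le> k ==> Rn n \<subseteq> fil k"
  unfolding Rn_span by (rule lspan_least[OF fil_subsp]) (auto intro: pure_fil)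

lemma fil_mono: "k \<le> l ==> fil k \<subseteq> fil l"
  unfolding fil_def[of k] by (rule lspan_least[OF fil_subsp]) (auto intro: pure_fil)

lemma fil_exhausts: "t \<in> CT ==> \<exists>k. t \<in> fil k"
proof (induction rule: tensor_induct)
  case (pure xs)
  then show ?case by (blast intro: pure_fil)
next
  case (add s t)
  then obtain k l where "s \<in> fil k" "t \<in> fil l" by blast
  then have "s \<in> fil (max k l)" "t \<in> fil (max k l)"
    using fil_mono[of k "max k l"] fil_mono[of l "max k l"] by auto
  then show ?case by (blast intro: subsp_add[OF fil_subsp])
next
  case (smult a s)
  then show ?case by (blast intro: subsp_smult[OF fil_subsp])
qed

lemma D_fil: "t \<in> tspan TT [Rn 1, fil k] ==> T.D 0 t \<in> tspan TT [fil k, Rn 1]"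
  by (rule D_span(1)[OF _ fil_def]) (auto dest: Rn_fil)

lemma cons_fil: "v \<in> Rn 1 ==> s \<in> fil k ==> v \<bullet> s \<in> fil (Suc k)"
proof (rule lspan_image_subset[OF lmult_linear R.vsp R.vsp fil_subsp])
  assume v: "v \<in> Rn 1" and s: "s \<in> fil k"
  show "v \<in> CT" using v by simp
  show "s \<in> lspan TA (pt ` {xs \<in> wrd. length xs \<le> k})" using s by (simp add: fil_def)
  fix x assume "x \<in> pt ` {xs \<in> wrd. length xs \<le> k}"
  then obtain xs where xs: "x = pt xs" "xs \<in> wrd" "length xs \<le> k" by auto
  obtain y where y: "y \<in> C" "v = pt [y]" using v by (rule Rn1_E)
  show "v \<bullet> x \<in> fil (Suc k)" using xs y by (simp flip: pure_append add: pure_fil)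
qed auto

lemma comult_eq_pr: "x \<in> CT ==>
  comult TT x = T.pr x \<oplus>\<^bsub>T.TA\<^esub> (T.pt [x, oneT] \<oplus>\<^bsub>T.TA\<^esub> T.pt [oneT, x])"
  unfolding T.pr_def using T.comult_cl[of x] by simp

text \<open>This lowering of the filtration by word length is what makes the induction in \<open>kk_kernel\<close> work.\<close>

lemma pr_fil:
  assumes "x \<in> fil (Suc k)"
  shows "T.pr x \<in> tspan TT [fil k, fil k]"
proof (rule lspan_image_subset[OF _ R.vsp T.R.vsp T.tspan_subsp])
  show "T.pr \<in> linear_maps TA T.TA" using T.pr_linear by (auto simp: linear_maps_def)
  show "x \<in> lspan TA (pt ` {xs \<in> wrd. length xs \<le> Suc k})" using assms by (simp add: fil_def)
  have "T.pr (pt xs) \<in> tspan TT [fil k, fil k]" if "xs \<in> wrd" "length xs \<le> Suc k" for xs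
    using that
  proof (induction xs arbitrary: k rule: list.induct)
    case Nil
    \<comment> \<open>On the empty word \<open>T.pr\<close> is \<open>-(1 \<otimes> 1)\<close>,
      whose factors lie in every \<open>fil k\<close>.\<close>
    have o: "oneT \<in> fil k" using pure_fil[of "[]" k] by (simp add: pure_Nil)
    have sub: "subsp T.TA (tspan TT [fil k, fil k])" by (rule T.tspan_subsp) simp
    have e: "T.pt [oneT, oneT] \<in> tspan TT [fil k, fil k]" using o by (intro T.tspan_pure) simp
    then show ?case
      unfolding T.pr_def using T.R.subsp_minus[OF sub e subsp_add[OF sub e e]] by (simp add: pure_Nil one_word)
  next
    case (Cons x xs)
    then have x: "x \<in> C" and xs: "xs \<in> wrd" "length xs \<le> k" by simp_all
    have sub: "subsp T.TA (tspan TT [fil k, fil k])" by (rule T.tspan_subsp) simp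
    let ?v = "pt [x]" and ?s = "pt xs"
    have v: "?v \<in> Rn 1" "?v \<in> CT" "?s \<in> CT" using x xs by auto
    have vs: "pt (x # xs) = ?v \<bullet> ?s" using pure_append[of "[x]" xs] x xs by simp
    show ?case
    proof (cases xs)
      case Nil
      have "T.pr ?v = T.zeroT"
        unfolding T.pr_def using comult_emb[OF x] v by simp
      then show ?thesis using Nil subsp_zero[OF sub] by simp
    next
      case (Cons y ys)
      \<comment> \<open>The word has at least two letters, so the induction hypothesis puts the
        reduced comultiplication of its tail into \<open>fil k' \<otimes> fil k'\<close>; the
        additional letter raises one degree to at most \<open>k\<close>.\<close>
      then obtain k' where k: "k = Suc k'" using xs(2) by (cases k) auto
      define p where "p = T.pr ?s"
      have p: "p \<in> tspan TT [fil k', fil k']" using Cons.IH[OF xs(1), of k'] xs(2) k by (simp add: p_def)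
      have pc: "p \<in> T.CT" using T.tspan_cl[OF _ p] by simp
      let ?w = "T.pt [?v]"
      have wc: "?w \<in> T.CT" using v by simp
      have wp: "?w \<star> p \<in> tspan TT ([] @ [Rn 1, fil k'] @ [fil k'])"
        using T.tspan_mult[of "[Rn 1]" "[fil k', fil k']" ?w p] p v by (auto intro: T.tspan_pure)
      have d: "T.D 0 (?w \<star> p) \<in> tspan TT ([] @ [fil k', Rn 1] @ [fil k'])"
        by (rule T.D_tspan[OF D_fil wp]) auto
      have m0: "T.M 0 (?w \<star> p) \<in> tspan TT ([] @ [fil k] @ [fil k'])"
        by (rule T.mult_tspan[OF _ _ _ _ wp]) (simp_all add: cons_fil k)
      have d': "T.D 0 (?w \<star> p) \<in> tspan TT ([fil k'] @ [Rn 1, fil k'] @ [])" using d by simp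
      have m1: "T.M 1 (T.D 0 (?w \<star> p)) \<in> tspan TT ([fil k'] @ [fil k] @ [])"
        by (rule T.mult_tspan[OF _ _ _ _ d']) (simp_all add: cons_fil k)
      have mm: "T.M 0 (?w \<star> p) \<in> tspan TT [fil k, fil k]" "T.M 1 (T.D 0 (?w \<star> p)) \<in> tspan TT [fil k, fil k]"
        using subsetD[OF T.tspan_mono m0, of "[fil k, fil k]"] subsetD[OF T.tspan_mono m1, of "[fil k, fil k]"]
          fil_mono[of k' k] k by simp_all
      let ?q = "T.D 0 (T.pt [?v, ?s])"
      have vk: "?v \<in> fil k" "?s \<in> fil k" using Rn_fil[of 1 k] v k pure_fil[OF xs] by auto
      have q: "?q \<in> tspan TT [fil k, fil k]"
      proof -
        have "?q \<in> tspan TT [fil k, Rn 1]" using vk v by (intro D_fil T.tspan_pure) simp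
        then show ?thesis using subsetD[OF T.tspan_mono[of "[fil k, Rn 1]" "[fil k, fil k]"]] Rn_fil[of 1 k] k by simp
      qed
      have qR: "?q \<in> T.Rn 2" using T.D_Rn[OF T.Rn_pure] v by simp
      have w2: "?w \<star> T.pt [?s, oneT] = T.pt [?v, ?s] \<star> T.pt [oneT]" "?w \<star> T.pt [oneT, ?s] = T.pt [?v, oneT] \<star> T.pt [?s]"
        using v by (simp_all flip: T.pure_append)
      \<comment> \<open>The comultiplication of the tail is its reduced part plus
        \<open>?s \<otimes> 1\<close> and \<open>1 \<otimes> ?s\<close>; the terms of full degree
        come from these last two.\<close>
      have wd: "?w \<star> comult TT ?s = ?w \<star> p \<oplus>\<^bsub>T.TA\<^esub> (T.pt [?v, ?s] \<star> T.pt [oneT] \<oplus>\<^bsub>T.TA\<^esub> T.pt [?v, oneT] \<star> T.pt [?s])"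
        unfolding comult_eq_pr[OF v(3)] p_def[symmetric] using v pc by (simp add: T.R.A.r_distr w2)
      have dd: "T.D 0 (T.pt [?v, ?s] \<star> T.pt [oneT]) = ?q \<star> T.pt [oneT]"
        "T.D 0 (T.pt [?v, oneT] \<star> T.pt [?s]) = T.pt [oneT, ?v] \<star> T.pt [?s]"
        using T.whisker_right[OF T.braid_hom T.Rn_pure, of "[?v, ?s]" 2 0 "T.pt [oneT]"]
          T.whisker_right[OF T.braid_hom T.Rn_pure, of "[?v, oneT]" 2 0 "T.pt [?s]"] v T.D_one(1)[of ?v] by simp_all
      have q1: "T.M 1 (?q \<star> T.pt [oneT]) = ?q"
      proof -
        have "?q \<star> T.pt [oneT] = T.E 2 ?q"
          using T.whisker_key[OF T.unit_map_hom qR T.Rn_pure[of "[]"], of "T.oneT"] qR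
          by (simp add: T.unit_map_pure[unfolded T.pure_Nil] T.pure_Nil)
        then show ?thesis using T.M_E(2)[OF qR, of 1] by simp
      qed
      have m: "T.M 0 (T.pt [?v, ?s] \<star> T.pt [oneT]) = T.pt [?v \<bullet> ?s, oneT]" "T.M 0 (T.pt [?v, oneT] \<star> T.pt [?s]) = T.pt [?v, ?s]"
        "T.M 1 (T.pt [oneT, ?v] \<star> T.pt [?s]) = T.pt [oneT, ?v \<bullet> ?s]"
        using M_pt3(1)[of ?v ?s "oneT"] M_pt3(1)[of ?v "oneT" ?s] M_pt3(2)[of "oneT" ?v ?s] v
        by (simp_all flip: T.pure_append)
      \<comment> \<open>All mixed terms: what remains of the comultiplication of
        \<open>?v \<bullet> ?s\<close> once \<open>?L\<close> and \<open>?Rr\<close> are set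
        aside.\<close>
      define W where "W = (T.M 0 (?w \<star> p) \<oplus>\<^bsub>T.TA\<^esub> T.M 1 (T.D 0 (?w \<star> p))) \<oplus>\<^bsub>T.TA\<^esub> (T.pt [?v, ?s] \<oplus>\<^bsub>T.TA\<^esub> ?q)"
      have Ws: "W \<in> tspan TT [fil k, fil k]"
        unfolding W_def using mm q vk by (intro subsp_add[OF sub] T.tspan_pure) simp_all
      have Wc: "W \<in> T.CT" using T.tspan_cl[OF _ Ws] by simp
      let ?L = "T.pt [?v \<bullet> ?s, oneT]" and ?Rr = "T.pt [oneT, ?v \<bullet> ?s]"
      have "comult TT (?v \<bullet> ?s) = (T.M 0 (?w \<star> p) \<oplus>\<^bsub>T.TA\<^esub> (?L \<oplus>\<^bsub>T.TA\<^esub> T.pt [?v, ?s])) \<oplus>\<^bsub>T.TA\<^esub>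
          (T.M 1 (T.D 0 (?w \<star> p)) \<oplus>\<^bsub>T.TA\<^esub> (?q \<oplus>\<^bsub>T.TA\<^esub> ?Rr))"
        unfolding comult_cons[OF x v(3)] wd using wc pc v qR
        by (simp add: lin_add[OF T.M_linear] lin_add[OF T.D_linear] dd m q1 T.Rn_cl)
      also have "\<dots> = W \<oplus>\<^bsub>T.TA\<^esub> (?L \<oplus>\<^bsub>T.TA\<^esub> ?Rr)"
        unfolding W_def using wc pc v qR by (simp add: T.R.M.a_ac T.Rn_cl)
      finally have "T.pr (?v \<bullet> ?s) = W"
        unfolding T.pr_def using Wc v by simp
      then show ?thesis using Ws vs by simp
    qed
  qed
  then show "\<And>y. y \<in> pt ` {xs \<in> wrd. length xs \<le> Suc k} ==> T.pr y \<in> tspan TT [fil k, fil k]" by auto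
qed auto

end

section \<open>The infinitesimal part\<close>

locale bialg = fixes A :: "('k::field, 'a) braided_bialg"
  assumes bialg: "braided_bialgebra A"
begin

sublocale A: bcoalg A
  using bialg by unfold_locales
    (simp_all add: braided_bialgebra_def braided_coalgebra_def counital_coalgebra_def)

abbreviation "Pr \<equiv> primitives A"
abbreviation "PV \<equiv> infinitesimal_part A"
abbreviation (input) "incl \<equiv> (\<lambda>x::'a. x)"

lemma comult_braid:
  assumes t: "t \<in> A.Rn 2"
  shows "A.Cm 1 (A.D 0 t) = A.D 0 (A.D 1 (A.Cm 0 t))" "A.Cm 0 (A.D 0 t) = A.D 1 (A.D 0 (A.Cm 1 t))"
proof -
  have c: "braid A t \<in> A.Rn 2" by (rule lin_cl[OF A.braid_hom t])
  have cm: "A.Cm 0 u \<in> A.Rn 3" "A.Cm 1 u \<in> A.Rn 3" if "u \<in> A.Rn 2" for u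
    using A.whisker_deg[OF A.comult_hom that, of 0 1] A.whisker_deg[OF A.comult_hom that, of 1 0] by simp_all
  have l: "map_tensor A 1 1 (comult_map A) id u = A.Cm 0 u" "map_tensor A 1 1 id (comult_map A) u = A.Cm 1 u" if "u \<in> A.Rn 2" for u
    using A.map_tensor_left[OF A.comult_hom, of u 1] A.map_tensor_right[OF A.comult_hom, of u 1] that by simp_all
  have d: "map_tensor A 2 1 (braid A) id u = A.D 0 u" "map_tensor A 1 2 id (braid A) u = A.D 1 u" if "u \<in> A.Rn 3" for u
    using A.map_tensor_left[OF A.braid_hom, of u 1] A.map_tensor_right[OF A.braid_hom, of u 1] that by simp_all
  have "map_tensor A 1 1 (comult_map A) id (braid A t)
           = map_tensor A 1 2 id (braid A) (map_tensor A 2 1 (braid A) id (map_tensor A 1 1 id (comult_map A) t)) \<and>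
         map_tensor A 1 1 id (comult_map A) (braid A t)
           = map_tensor A 2 1 (braid A) id (map_tensor A 1 2 id (braid A) (map_tensor A 1 1 (comult_map A) id t))"
    using bialg t unfolding braided_bialgebra_def braided_coalgebra_def Let_def by blast
  then show "A.Cm 1 (A.D 0 t) = A.D 0 (A.D 1 (A.Cm 0 t))" "A.Cm 0 (A.D 0 t) = A.D 1 (A.D 0 (A.Cm 1 t))"
    using t c cm by (simp_all add: l d A.D_Rn A.D_0[OF t])
qed

end

lemma tmap_power:
  assumes V: "tens V" and W: "tens W" and f: "f \<in> linear_maps V W"
  shows "tmap W f \<in> linear_maps (tensor_power V n) (tensor_power W n)"
proof (rule linI)
  fix s t a assume s: "s \<in> carrier (tensor_power V n)" and t: "t \<in> carrier (tensor_power V n)"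
  note cl = tens.Rn_cl[OF V s] tens.Rn_cl[OF V t]
  show "tmap W f (s \<oplus>\<^bsub>tensor_power V n\<^esub> t) = tmap W f s \<oplus>\<^bsub>tensor_power W n\<^esub> tmap W f t"
    using tmap_add[OF V W f cl] by simp
next
  fix s a assume s: "s \<in> carrier (tensor_power V n)"
  show "tmap W f (a \<odot>\<^bsub>tensor_power V n\<^esub> s) = a \<odot>\<^bsub>tensor_power W n\<^esub> tmap W f s"
    using tmap_smult[OF V W f tens.Rn_cl[OF V s]] by simp
qed (rule tmap_Rn[OF V W f])

text \<open>Tensor powers preserve surjections, since every letter of a pure tensor has a
  preimage.\<close>

lemma tmap_surj:
  assumes V: "tens V" and W: "tens W" and f: "f \<in> linear_maps V W" and surj: "f ` carrier V = carrier W"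
    and t: "t \<in> carrier (tensor_power W n)"
  obtains s where "s \<in> carrier (tensor_power V n)" "tmap W f s = t"
proof -
  interpret V: tens V by (rule V)
  interpret W: tens W by (rule W)
  have sub: "subsp W.TA (tmap W f ` V.Rn n)"
    by (rule subsp_image[OF tmap_linear[OF V W f] V.R.vsp W.R.vsp V.Rn_subsp])
  have "W.Rn n \<subseteq> tmap W f ` V.Rn n"
    unfolding W.Rn_span
  proof (rule lspan_least[OF sub], safe)
    fix xs assume xs: "xs \<in> lists W.C"
    define ys where "ys = map (inv_into V.C f) xs"
    have fx: "f (inv_into V.C f x) = x" if "x \<in> W.C" for x using f_inv_into_f[of x f V.C] surj that by simp
    have "map f ys = xs" unfolding ys_def map_map comp_def using fx xs by (intro map_idI) (auto simp: in_lists_conv_set)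
    moreover have ys: "ys \<in> V.wrd" unfolding ys_def using xs surj by (auto simp: in_lists_conv_set inv_into_into)
    moreover have "length ys = length xs" by (simp add: ys_def)
    ultimately have "W.pt xs = tmap W f (V.pt ys)" "V.pt ys \<in> V.Rn (length xs)"
      using tmap_pure[OF V W f ys] by auto
    then show "W.pt xs \<in> tmap W f ` V.Rn (length xs)" by blast
  qed
  then show ?thesis using that t by blast
qed

section \<open>Transport of structure\<close>

text \<open>The structure maps of \<open>L\<close> are tied to those of \<open>A\<close> along the
  bijection \<open>g\<close> only; each coalgebra or braiding axiom of \<open>L\<close> holds
  because it compares tensors that come from \<open>A\<close>.\<close>

locale bialg_transport = A: bcoalg A for A :: "('k::field, 'a) braided_bialg" +
  fixes L :: "('k, 'b) braided_bialg" and g :: "'a => 'b"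
  assumes A_bialg: "braided_bialgebra A" and L_ua: "unital_algebra L"
    and g_map: "g \<in> algebra_maps A L" and g_bij: "bij_betw g (carrier A) (carrier L)"
    and g_braid: "\<And>t. t \<in> A.Rn 2 ==> braid L (tmap L g t) = tmap L g (braid A t)"
    and g_comult: "\<And>x. x \<in> A.C ==> comult L (g x) = tmap L g (comult A x)"
    and g_counit: "\<And>x. x \<in> A.C ==> counit L (g x) = counit A x"
begin

sublocale L: talg L by (rule talg.intro[OF L_ua])

abbreviation "G \<equiv> tmap L g"
abbreviation "mA \<equiv> map_tensor A"
abbreviation "mL \<equiv> map_tensor L"

definition "h = inv_into A.C g"

lemma g_linear: "g \<in> linear_maps A L"
  and g_mult: "[|x \<in> A.C; y \<in> A.C|] ==> g (x \<otimes>\<^bsub>A\<^esub> y) = g x \<otimes>\<^bsub>L\<^esub> g y" and g_one: "g \<one>\<^bsub>A\<^esub> = \<one>\<^bsub>L\<^esub>"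
  using g_map by (auto simp: algebra_maps_def ring_hom_def)

lemma h_cl: "y \<in> L.C ==> h y \<in> A.C" and g_h: "y \<in> L.C ==> g (h y) = y" and h_g: "x \<in> A.C ==> h (g x) = x"
  using g_bij by (auto simp: h_def bij_betw_def inv_into_into f_inv_into_f)

lemma h_linear: "h \<in> linear_maps L A"
proof (rule linI)
  fix x y a assume x: "x \<in> L.C" and y: "y \<in> L.C"
  show "h (x \<oplus>\<^bsub>L\<^esub> y) = h x \<oplus>\<^bsub>A\<^esub> h y"
    using lin_add[OF g_linear h_cl[OF x] h_cl[OF y]] h_g[of "h x \<oplus>\<^bsub>A\<^esub> h y"] h_cl x y by (simp add: g_h)
next
  fix x a assume x: "x \<in> L.C"
  show "h (a \<odot>\<^bsub>L\<^esub> x) = a \<odot>\<^bsub>A\<^esub> h x"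
    using lin_smult[OF g_linear h_cl[OF x]] h_g[of "a \<odot>\<^bsub>A\<^esub> h x"] h_cl x by (simp add: g_h)
qed (rule h_cl)

lemmas G_linear = tmap_linear[OF A.tns L.tns g_linear]
  and G_pure = tmap_pure[OF A.tns L.tns g_linear]
  and G_Rn = tmap_Rn[OF A.tns L.tns g_linear]
  and G_power = tmap_power[OF A.tns L.tns g_linear]
  and H_power = tmap_power[OF L.tns A.tns h_linear]
  and H_Rn = tmap_Rn[OF L.tns A.tns h_linear]

lemma G_H: "t \<in> L.Rn n ==> G (tmap A h t) = t"
proof -
  assume t: "t \<in> L.Rn n"
  have "G (tmap A h t) = tmap L (\<lambda>x. g (h x)) t"
    by (rule tmap_comp[OF L.tns A.tns L.tns h_linear g_linear L.Rn_cl[OF t]])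
  also have "\<dots> = t"
    by (rule L.tmap_id_tspan[OF lin_comp[OF h_linear g_linear], of "replicate n L.C"])
      (use t L.Rn_tspan g_h in \<open>auto simp: in_lists_conv_set\<close>)
  finally show ?thesis .
qed

text \<open>A transfer relation: \<open>corr\<close> pairs tensors, and \<open>nat_pair\<close>
  pairs operators that respect it. Each side of an axiom in \<open>L\<close> is paired with the same
  side in \<open>A\<close>, and \<open>corr_eq\<close> concludes.\<close>

definition "corr n s t \<longleftrightarrow> s \<in> A.Rn n \<and> t = G s"
definition "nat_pair j k f f' \<longleftrightarrow> f \<in> hom_power A j k \<and> (\<forall>s\<in>A.Rn j. f' (G s) = G (f s))"

lemma corr_E: assumes "t \<in> L.Rn n" obtains s where "corr n s t"
  using H_Rn[OF assms] G_H[OF assms] unfolding corr_def by metis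

lemma corr_fun: "nat_pair j k f f' ==> corr j s t ==> corr k (f s) (f' t)"
  unfolding corr_def nat_pair_def by (auto intro: lin_cl)

lemma corr_eq: "corr n s t ==> corr n s t' ==> t = t'"
  by (simp add: corr_def)

lemma corr_Rn: "corr n s t ==> s \<in> A.Rn n" "corr n s t ==> t \<in> L.Rn n"
  unfolding corr_def by (auto intro: G_Rn)

lemma nat_hom: assumes "nat_pair j k f f'" shows "f' \<in> hom_power L j k"
proof (rule lin_cong[OF lin_comp[OF lin_comp[OF H_power] G_power] L.vspace_Rn])
  show "f \<in> hom_power A j k" using assms by (simp add: nat_pair_def)
  fix t assume t: "t \<in> L.Rn j"
  show "f' t = G (f (tmap A h t))"
    using assms G_H[OF t] H_Rn[OF t] unfolding nat_pair_def by metis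
qed

lemma nat_id: "nat_pair j j id id"
  using A.hom_id by (simp add: nat_pair_def)

lemma corr_tensor:
  assumes f: "nat_pair j j' f f'" and r: "nat_pair k k' r r'" and n: "n = j + k" "n' = j' + k'" and s: "corr n s t"
  shows "corr n' (mA j k f r s) (mL j k f' r' t)"
proof -
  have fA: "f \<in> hom_power A j j'" and rA: "r \<in> hom_power A k k'"
    and fn: "\<And>s. s \<in> A.Rn j ==> G (f s) = f' (G s)" and rn: "\<And>s. s \<in> A.Rn k ==> G (r s) = r' (G s)"
    using f r by (simp_all add: nat_pair_def)
  note fL = nat_hom[OF f] and rL = nat_hom[OF r]
  have sR: "s \<in> A.Rn (j + k)" and t: "t = G s" using s n by (simp_all add: corr_def)
  define u where "u = A.Wh j k r s"
  have u: "u \<in> A.Rn (j + k')" using A.whisker_deg[OF rA sR, of j 0] by (simp add: u_def)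
  have Gu: "G u = L.Wh j k r' t"
    unfolding u_def t
    by (rule tmap_local_at_Rn[OF A.tns L.tns g_linear A.local_at_whisker[OF rA] L.local_at_whisker[OF rL] order_refl rn sR])
  have "G (A.Wh 0 j f u) = L.Wh 0 j f' (G u)"
    by (rule tmap_local_at_Rn[OF A.tns L.tns g_linear A.local_at_whisker[OF fA] L.local_at_whisker[OF fL] _ fn u]) simp_all
  moreover have "A.Wh 0 j f u \<in> A.Rn n'" using A.whisker_deg[OF fA u, of 0 k'] n by simp
  moreover have "t \<in> L.Rn (j + k)" unfolding t by (rule G_Rn[OF sR])
  ultimately show ?thesis
    unfolding corr_def using A.map_tensor_eq[OF fA rA sR] L.map_tensor_eq[OF fL rL, of t] Gu by (simp add: u_def)
qed

lemma nat_pairI: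
  assumes "f \<in> hom_power A j k" "f' \<in> hom_power L j k"
    "\<And>xs. xs \<in> A.wrd ==> length xs = j ==> f' (L.pt (map g xs)) = G (f (A.pt xs))"
  shows "nat_pair j k f f'"
proof -
  have "f' (G s) = G (f s)" if "s \<in> A.Rn j" for s
    by (rule A.hom_eq_pure[OF lin_comp[OF G_power assms(2)] lin_comp[OF assms(1) G_power] _ that])
      (use assms(3) G_pure in auto)
  then show ?thesis using assms(1) by (simp add: nat_pair_def)
qed

lemma nat_mult: "nat_pair 2 1 (mult_map A) (mult_map L)"
proof (rule nat_pairI[OF A.mult_map_hom L.mult_map_hom])
  fix xs assume "xs \<in> A.wrd" "length xs = 2"
  then obtain x y where xs: "xs = [x, y]" "x \<in> A.C" "y \<in> A.C" by (auto simp: length_2_iff)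
  then show "mult_map L (L.pt (map g xs)) = G (mult_map A (A.pt xs))"
    using G_pure[of "[x \<otimes>\<^bsub>A\<^esub> y]"] lin_cl[OF g_linear] by (simp add: A.mult_map_pure L.mult_map_pure g_mult)
qed

lemma nat_unit: "nat_pair 0 1 (unit_map A) (unit_map L)"
  by (rule nat_pairI[OF A.unit_map_hom L.unit_map_hom])
    (use G_pure[of "[\<one>\<^bsub>A\<^esub>]"] in \<open>simp add: A.unit_map_pure L.unit_map_pure g_one\<close>)

lemma nat_braid: "nat_pair 2 2 (braid A) (braid L)"
  using A.braid_hom g_braid by (simp add: nat_pair_def)

lemma comult_L: "comult L \<in> linear_maps L (tensor_power L 2)"
proof (rule lin_cong[OF lin_comp[OF lin_comp[OF h_linear A.comult_linear] G_power] L.A.vsp])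
  fix y assume y: "y \<in> L.C"
  show "comult L y = G (comult A (h y))" using g_comult[OF h_cl[OF y]] g_h[OF y] by simp
qed

lemma counit_A: "counit A \<in> algebra_maps A ground_algebra"
  using A_bialg by (simp add: braided_bialgebra_def)

lemma counit_L: "counit L \<in> algebra_maps L ground_algebra"
proof -
  have "counit L \<in> linear_maps L ground_algebra"
  proof (rule lin_cong[OF lin_comp[OF h_linear] L.A.vsp])
    show "counit A \<in> linear_maps A ground_algebra" using counit_A by (simp add: algebra_maps_def)
    fix y assume y: "y \<in> L.C"
    show "counit L y = counit A (h y)" using g_counit[OF h_cl[OF y]] g_h[OF y] by simp
  qed
  moreover have "counit L (x \<otimes>\<^bsub>L\<^esub> y) = counit L x \<otimes>\<^bsub>ground_algebra\<^esub> counit L y" if x: "x \<in> L.C" and y: "y \<in> L.C" for x y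
  proof -
    have "counit A (h x \<otimes>\<^bsub>A\<^esub> h y) = counit A (h x) \<otimes>\<^bsub>ground_algebra\<^esub> counit A (h y)"
      using counit_A h_cl x y by (simp add: algebra_maps_def ring_hom_def)
    then show ?thesis
      using g_counit[of "h x \<otimes>\<^bsub>A\<^esub> h y"] g_counit[OF h_cl[OF x]] g_counit[OF h_cl[OF y]] g_mult[of "h x" "h y"]
        g_h x y h_cl by simp
  qed
  moreover have "counit L \<one>\<^bsub>L\<^esub> = \<one>\<^bsub>ground_algebra\<^esub>"
    using counit_A g_counit[of "\<one>\<^bsub>A\<^esub>"] g_one by (simp add: algebra_maps_def ring_hom_def)
  ultimately show ?thesis
    by (auto simp: algebra_maps_def ring_hom_def linear_maps_def)
qed

lemma nat_comult: "nat_pair 1 2 (comult_map A) (comult_map L)"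
proof (rule nat_pairI[OF A.comult_hom])
  show "comult_map L \<in> hom_power L 1 2"
    using L.hom_1_I(1)[OF comult_L] by (simp add: comult_map_def)
  fix xs assume "xs \<in> A.wrd" "length xs = 1"
  then obtain x where xs: "xs = [x]" "x \<in> A.C" by (auto simp: length_1_iff)
  then show "comult_map L (L.pt (map g xs)) = G (comult_map A (A.pt xs))"
    using L.hom_1_I(2)[OF comult_L, of "g x", folded comult_map_def] lin_cl[OF g_linear]
    by (simp add: A.comult_map_pure g_comult)
qed

lemma counit_map_props:
  fixes B :: "('k, 'c) braided_bialg"
  assumes B: "tens B" and c: "counit B \<in> algebra_maps B ground_algebra"
  shows "counit_map B \<in> hom_power B 1 0"
    and "x \<in> carrier B ==> counit_map B (pure_tensor B [x]) = counit B x \<odot>\<^bsub>tensor_algebra B\<^esub> pure_tensor B []"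
proof -
  interpret B: tens B by (rule B)
  have l: "counit B \<in> linear_maps B ground_algebra" using c by (simp add: algebra_maps_def)
  have h: "(\<lambda>x. counit B x \<odot>\<^bsub>B.TA\<^esub> B.pt []) \<in> linear_maps B (tensor_power B 0)"
    by (rule linI) (simp_all add: lin_add[OF l] lin_smult[OF l] ground_algebra_def
        B.R.add_smult B.R.smult_smult B.Rn_smult[OF B.Rn_pure])
  show "counit_map B \<in> hom_power B 1 0"
    and "x \<in> carrier B ==> counit_map B (pure_tensor B [x]) = counit B x \<odot>\<^bsub>tensor_algebra B\<^esub> pure_tensor B []"
    using B.hom_1_I[OF h] by (simp_all add: counit_map_def)
qed

lemma nat_counit: "nat_pair 1 0 (counit_map A) (counit_map L)"
proof (rule nat_pairI[OF counit_map_props(1)[OF A.tns counit_A] counit_map_props(1)[OF L.tns counit_L]])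
  fix xs assume "xs \<in> A.wrd" "length xs = 1"
  then obtain x where xs: "xs = [x]" "x \<in> A.C" by (auto simp: length_1_iff)
  then show "counit_map L (L.pt (map g xs)) = G (counit_map A (A.pt xs))"
    using lin_cl[OF g_linear, of x] lin_smult[OF G_linear, of "A.pt []" "counit A x"] G_pure[of "[]"]
    by (simp add: counit_map_props(2)[OF A.tns counit_A] counit_map_props(2)[OF L.tns counit_L] g_counit)
qed

lemmas tensor_left = corr_tensor[OF _ nat_id] and tensor_right = corr_tensor[OF nat_id]

lemma c_maps:
  "corr 3 s t ==> corr 3 (mA 2 1 (braid A) id s) (mL 2 1 (braid L) id t)"
  "corr 3 s t ==> corr 3 (mA 1 2 id (braid A) s) (mL 1 2 id (braid L) t)"
  "corr 3 s t ==> corr 2 (mA 2 1 (mult_map A) id s) (mL 2 1 (mult_map L) id t)"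
  "corr 3 s t ==> corr 2 (mA 1 2 id (mult_map A) s) (mL 1 2 id (mult_map L) t)"
  "corr 1 s t ==> corr 2 (mA 0 1 (unit_map A) id s) (mL 0 1 (unit_map L) id t)"
  "corr 1 s t ==> corr 2 (mA 1 0 id (unit_map A) s) (mL 1 0 id (unit_map L) t)"
  "corr 2 s t ==> corr 3 (mA 1 1 (comult_map A) id s) (mL 1 1 (comult_map L) id t)"
  "corr 2 s t ==> corr 3 (mA 1 1 id (comult_map A) s) (mL 1 1 id (comult_map L) t)"
  "corr 2 s t ==> corr 1 (mA 1 1 (counit_map A) id s) (mL 1 1 (counit_map L) id t)"
  "corr 2 s t ==> corr 1 (mA 1 1 id (counit_map A) s) (mL 1 1 id (counit_map L) t)"
  "corr 2 s t ==> corr 4 (mA 1 1 (comult_map A) (comult_map A) s) (mL 1 1 (comult_map L) (comult_map L) t)"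
  "corr 2 s t ==> corr 2 (braid A s) (braid L t)" "corr 2 s t ==> corr 1 (mult_map A s) (mult_map L t)"
  "corr 1 s t ==> corr 2 (comult_map A s) (comult_map L t)"
  by (rule tensor_left[OF nat_braid] tensor_right[OF nat_braid] tensor_left[OF nat_mult] tensor_right[OF nat_mult]
      tensor_left[OF nat_unit] tensor_right[OF nat_unit] tensor_left[OF nat_comult] tensor_right[OF nat_comult]
      tensor_left[OF nat_counit] tensor_right[OF nat_counit] corr_tensor[OF nat_comult nat_comult]
      corr_fun[OF nat_braid] corr_fun[OF nat_mult] corr_fun[OF nat_comult]; simp)+

lemma c_braided_mult: "corr 4 s t ==> corr 2 (braided_mult A s) (braided_mult L t)"
proof -
  assume st: "corr 4 s t"
  \<comment> \<open>\<open>braided_mult\<close> nests two tensor products of maps, so the inner one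
    is paired before \<open>corr_tensor\<close> applies to the outer one.\<close>
  have nb: "nat_pair 3 3 (mA 2 1 (braid A) id) (mL 2 1 (braid L) id)"
  proof -
    have "mA 2 1 (braid A) id \<in> hom_power A 3 3"
      by (rule lin_cong[OF A.whisker_hom[OF A.braid_hom, of 0 1, simplified] A.vspace_Rn])
        (use A.map_tensor_left[OF A.braid_hom, of _ 1] in simp)
    then show ?thesis
      unfolding nat_pair_def using c_maps(1) by (auto simp: corr_def)
  qed
  show ?thesis
    unfolding braided_mult_def
    by (rule corr_tensor[OF nat_mult nat_mult _ _ tensor_right[OF nb _ _ st]]) simp_all
qed

lemma c_pure: "xs \<in> A.wrd ==> length xs = n ==> corr n (A.pt xs) (L.pt (map g xs))"
  unfolding corr_def using G_pure by auto

lemma c_comult: "x \<in> A.C ==> corr 2 (comult A x) (comult L (g x))"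
  unfolding corr_def using g_comult A.comult_cl by auto

lemmas A_axioms = A_bialg[unfolded braided_bialgebra_def braided_algebra_def braided_coalgebra_def counital_coalgebra_def
    braided_vector_space_def Let_def]

theorem L_bialgebra: "braided_bialgebra L"
  unfolding braided_bialgebra_def braided_algebra_def braided_coalgebra_def counital_coalgebra_def
    braided_vector_space_def Let_def
proof (intro conjI ballI)
  fix t assume "t \<in> L.Rn 3"
  then obtain s where s: "corr 3 s t" by (rule corr_E)
  note sR = corr_Rn(1)[OF s]
  note B = c_maps(1)[OF c_maps(2)[OF c_maps(1)[OF s]]] c_maps(2)[OF c_maps(1)[OF c_maps(2)[OF s]]]
  have "mA 2 1 (braid A) id (mA 1 2 id (braid A) (mA 2 1 (braid A) id s)) =
      mA 1 2 id (braid A) (mA 2 1 (braid A) id (mA 1 2 id (braid A) s))"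
    using A_axioms sR by blast
  with B show "mL 2 1 (braid L) id (mL 1 2 id (braid L) (mL 2 1 (braid L) id t)) =
      mL 1 2 id (braid L) (mL 2 1 (braid L) id (mL 1 2 id (braid L) t))"
    by (metis corr_eq)
  then show "mL 2 1 (braid L) id (mL 1 2 id (braid L) (mL 2 1 (braid L) id t)) =
      mL 1 2 id (braid L) (mL 2 1 (braid L) id (mL 1 2 id (braid L) t))" .
  have "braid A (mA 2 1 (mult_map A) id s) =
      mA 1 2 id (mult_map A) (mA 2 1 (braid A) id (mA 1 2 id (braid A) s))"
    using A_axioms sR by blast
  with c_maps(12)[OF c_maps(3)[OF s]] c_maps(4)[OF c_maps(1)[OF c_maps(2)[OF s]]]
  show "braid L (mL 2 1 (mult_map L) id t) =
      mL 1 2 id (mult_map L) (mL 2 1 (braid L) id (mL 1 2 id (braid L) t))"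
    by (metis corr_eq)
  have "braid A (mA 1 2 id (mult_map A) s) =
      mA 2 1 (mult_map A) id (mA 1 2 id (braid A) (mA 2 1 (braid A) id s))"
    using A_axioms sR by blast
  with c_maps(12)[OF c_maps(4)[OF s]] c_maps(3)[OF c_maps(2)[OF c_maps(1)[OF s]]]
  show "braid L (mL 1 2 id (mult_map L) t) =
      mL 2 1 (mult_map L) id (mL 1 2 id (braid L) (mL 2 1 (braid L) id t))"
    by (metis corr_eq)
next
  fix t assume "t \<in> L.Rn 1"
  then obtain s where s: "corr 1 s t" by (rule corr_E)
  note sR = corr_Rn(1)[OF s]
  have "braid A (mA 0 1 (unit_map A) id s) = mA 1 0 id (unit_map A) s"
    "braid A (mA 1 0 id (unit_map A) s) = mA 0 1 (unit_map A) id s"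
    using A_axioms sR by blast+
  with c_maps(12)[OF c_maps(5)[OF s]] c_maps(6)[OF s] c_maps(12)[OF c_maps(6)[OF s]] c_maps(5)[OF s]
  show "braid L (mL 0 1 (unit_map L) id t) = mL 1 0 id (unit_map L) t"
    "braid L (mL 1 0 id (unit_map L) t) = mL 0 1 (unit_map L) id t"
    by (metis corr_eq)+
next
  fix t assume "t \<in> L.Rn 2"
  then obtain s where s: "corr 2 s t" by (rule corr_E)
  note sR = corr_Rn(1)[OF s]
  have "mA 1 1 (comult_map A) id (braid A s) =
      mA 1 2 id (braid A) (mA 2 1 (braid A) id (mA 1 1 id (comult_map A) s))"
    "mA 1 1 id (comult_map A) (braid A s) =
      mA 2 1 (braid A) id (mA 1 2 id (braid A) (mA 1 1 (comult_map A) id s))"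
    "mA 1 1 (counit_map A) id (braid A s) = mA 1 1 id (counit_map A) s"
    "mA 1 1 id (counit_map A) (braid A s) = mA 1 1 (counit_map A) id s"
    "comult_map A (mult_map A s) = braided_mult A (mA 1 1 (comult_map A) (comult_map A) s)"
    using A_axioms sR by blast+
  note e = this
  show "mL 1 1 (comult_map L) id (braid L t) =
      mL 1 2 id (braid L) (mL 2 1 (braid L) id (mL 1 1 id (comult_map L) t))"
    using e(1) c_maps(7)[OF c_maps(12)[OF s]] c_maps(2)[OF c_maps(1)[OF c_maps(8)[OF s]]] by (metis corr_eq)
  show "mL 1 1 id (comult_map L) (braid L t) =
      mL 2 1 (braid L) id (mL 1 2 id (braid L) (mL 1 1 (comult_map L) id t))"
    using e(2) c_maps(8)[OF c_maps(12)[OF s]] c_maps(1)[OF c_maps(2)[OF c_maps(7)[OF s]]] by (metis corr_eq)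
  show "mL 1 1 (counit_map L) id (braid L t) = mL 1 1 id (counit_map L) t"
    using e(3) c_maps(9)[OF c_maps(12)[OF s]] c_maps(10)[OF s] by (metis corr_eq)
  show "mL 1 1 id (counit_map L) (braid L t) = mL 1 1 (counit_map L) id t"
    using e(4) c_maps(10)[OF c_maps(12)[OF s]] c_maps(9)[OF s] by (metis corr_eq)
  show "comult_map L (mult_map L t) = braided_mult L (mL 1 1 (comult_map L) (comult_map L) t)"
    using e(5) c_maps(14)[OF c_maps(13)[OF s]] c_braided_mult[OF c_maps(11)[OF s]] by (metis corr_eq)
next
  fix y assume y: "y \<in> L.C"
  define x where "x = h y"
  have x: "x \<in> A.C" "g x = y" using h_cl[OF y] g_h[OF y] by (simp_all add: x_def)
  have e: "mA 1 1 (comult_map A) id (comult A x) = mA 1 1 id (comult_map A) (comult A x)"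
    "mA 1 1 (counit_map A) id (comult A x) = A.pt [x]"
    "mA 1 1 id (counit_map A) (comult A x) = A.pt [x]"
    using A_axioms x(1) by blast+
  note c = c_comult[OF x(1), unfolded x(2)]
  have p: "corr 1 (A.pt [x]) (L.pt [y])" using c_pure[of "[x]" 1] x by simp
  show "mL 1 1 (comult_map L) id (comult L y) = mL 1 1 id (comult_map L) (comult L y)"
    using e(1) c_maps(7)[OF c] c_maps(8)[OF c] by (metis corr_eq)
  show "mL 1 1 (counit_map L) id (comult L y) = L.pt [y]"
    using e(2) c_maps(9)[OF c] p by (metis corr_eq)
  show "mL 1 1 id (counit_map L) (comult L y) = L.pt [y]"
    using e(3) c_maps(10)[OF c] p by (metis corr_eq)
next
  have "comult A \<one>\<^bsub>A\<^esub> = A.pt [\<one>\<^bsub>A\<^esub>, \<one>\<^bsub>A\<^esub>]" using A_axioms by blast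
  then show "comult L \<one>\<^bsub>L\<^esub> = L.pt [\<one>\<^bsub>L\<^esub>, \<one>\<^bsub>L\<^esub>]"
    using c_comult[of "\<one>\<^bsub>A\<^esub>"] c_pure[of "[\<one>\<^bsub>A\<^esub>, \<one>\<^bsub>A\<^esub>]" 2] corr_eq by (auto simp: g_one)
qed (use L_ua L.tens_vs nat_hom[OF nat_braid] comult_L counit_L in \<open>auto simp: algebra_maps_def\<close>)

theorem transport_isomorphic: "isomorphic_braided_bialgebras A L"
proof -
  have mp: "map_power L 2 g t = G t" if "t \<in> A.Rn 2" for t
    by (rule A.map_power_eq[OF L.tns g_linear that])
  have "g \<in> braided_bialgebra_maps A L"
    unfolding braided_bialgebra_maps_def braided_maps_def
    using g_map g_linear g_comult g_counit g_braid mp A.comult_cl lin_cl[OF A.braid_hom] by auto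
  then show ?thesis
    unfolding isomorphic_braided_bialgebras_def using A_bialg L_bialgebra g_bij by blast
qed

end

section \<open>The direct limit\<close>

lemma transition_add: "transition f n (i + j) x = transition f (n + i) j (transition f n i x)"
  by (induction j) (simp_all add: add.assoc)

text \<open>Each stage is compared with \<open>A\<close> by a surjection \<open>q n\<close> that
  carries its braiding, comultiplication and counit to those of \<open>A\<close>. Injectivity in the
  limit comes from \<open>q_eq\<close>: elements with equal image are identified at some later
  stage.\<close>

locale limit_setup = A: bcoalg A for A :: "('k::field, 'a) braided_bialg" +
  fixes B :: "nat => ('k, 'u) braided_bialg" and tr :: "nat => 'u => 'u" and q :: "nat => 'u => 'a"
  assumes A_bialg: "braided_bialgebra A" and B_ua: "\<And>n. unital_algebra (B n)"
    and q_map: "\<And>n. q n \<in> algebra_maps (B n) A" and q_surj: "\<And>n. q n ` carrier (B n) = A.C"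
    and tr_cl: "\<And>n x. x \<in> carrier (B n) ==> tr n x \<in> carrier (B (Suc n))"
    and q_tr: "\<And>n x. x \<in> carrier (B n) ==> q (Suc n) (tr n x) = q n x"
    and q_eq: "\<And>n x y. [|x \<in> carrier (B n); y \<in> carrier (B n); q n x = q n y|] ==>
      \<exists>i. transition tr n i x = transition tr n i y"
    and q_comult: "\<And>n x. x \<in> carrier (B n) ==> comult (B n) x \<in> carrier (tensor_power (B n) 2)"
      "\<And>n x. x \<in> carrier (B n) ==> tmap A (q n) (comult (B n) x) = comult A (q n x)"
    and q_braid: "\<And>n s. s \<in> carrier (tensor_power (B n) 2) ==> braid (B n) s \<in> carrier (tensor_power (B n) 2)"
      "\<And>n s. s \<in> carrier (tensor_power (B n) 2) ==> tmap A (q n) (braid (B n) s) = braid A (tmap A (q n) s)"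
    and q_counit: "\<And>n x. x \<in> carrier (B n) ==> counit (B n) x = counit A (q n x)"
begin

lemma B_tens: "tens (B n)"
  using B_ua[of n] by (simp add: tens_def unital_algebra_def)

lemma q_linear: "q n \<in> linear_maps (B n) A"
  and q_mult: "[|x \<in> carrier (B n); y \<in> carrier (B n)|] ==> q n (x \<otimes>\<^bsub>B n\<^esub> y) = q n x \<otimes>\<^bsub>A\<^esub> q n y"
  and q_one: "q n \<one>\<^bsub>B n\<^esub> = \<one>\<^bsub>A\<^esub>"
  using q_map[of n] by (auto simp: algebra_maps_def ring_hom_def)

lemma q_lift: assumes "a \<in> A.C" obtains x where "x \<in> carrier (B n)" "q n x = a"
  using q_surj[of n] assms by (metis imageE)

lemma transition_props: "x \<in> carrier (B n) ==> transition tr n i x \<in> carrier (B (n + i)) \<and> q (n + i) (transition tr n i x) = q n x"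
proof (induction i)
  case (Suc i)
  then show ?case using tr_cl[of "transition tr n i x" "n + i"] q_tr[of "transition tr n i x" "n + i"] by simp
qed simp

text \<open>The inverse of the map from the limit to \<open>A\<close>: an element of the limit, as a
  set of pairs, consists of all elements of all stages that lie over one \<open>a\<close>.\<close>

definition "g a = {(m, y). y \<in> carrier (B m) \<and> q m y = a}"

lemma limit_map_g:
  assumes x: "x \<in> carrier (B n)"
  shows "limit_map B tr n x = g (q n x)"
proof (intro subset_antisym subrelI)
  fix m y assume "(m, y) \<in> limit_map B tr n x"
  then obtain i j where y: "y \<in> carrier (B m)" and ij: "n + i = m + j" "transition tr n i x = transition tr m j y"
    by (auto simp: limit_map_def)
  have "q m y = q (m + j) (transition tr m j y)" using transition_props[OF y, of j] by simp
  also have "\<dots> = q n x" using transition_props[OF x, of i] ij by simp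
  finally show "(m, y) \<in> g (q n x)" using y by (simp add: g_def)
next
  fix m y assume "(m, y) \<in> g (q n x)"
  then have y: "y \<in> carrier (B m)" "q m y = q n x" by (auto simp: g_def)
  \<comment> \<open>Both elements are brought to the common stage \<open>n + m\<close>, where
    \<open>q_eq\<close> applies.\<close>
  have "transition tr n m x \<in> carrier (B (n + m))" "transition tr m n y \<in> carrier (B (n + m))"
    "q (n + m) (transition tr n m x) = q (n + m) (transition tr m n y)"
    using transition_props[OF x, of m] transition_props[OF y(1), of n] y(2) by (simp_all add: add.commute)
  then obtain k where "transition tr (n + m) k (transition tr n m x) = transition tr (n + m) k (transition tr m n y)"
    using q_eq by blast
  then have "transition tr n (m + k) x = transition tr m (n + k) y"
    by (simp add: transition_add add.commute[of m n])
  moreover have "n + (m + k) = m + (n + k)" by simp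
  ultimately show "(m, y) \<in> limit_map B tr n x" unfolding limit_map_def using y(1) by blast
qed

lemma g_inj: "[|a \<in> A.C; b \<in> A.C; g a = g b|] ==> a = b"
proof -
  assume a: "a \<in> A.C" and "b \<in> A.C" "g a = g b"
  obtain x where "x \<in> carrier (B 0)" "q 0 x = a" by (rule q_lift[OF a])
  then have "(0, x) \<in> g b" using \<open>g a = g b\<close> by (auto simp: g_def)
  then show "a = b" using \<open>q 0 x = a\<close> by (simp add: g_def)
qed

abbreviation "L0 \<equiv> limit_algebra B tr"
abbreviation "L \<equiv> limit_bialgebra B tr"

lemma q_cl: "x \<in> carrier (B n) ==> q n x \<in> A.C"
  by (rule lin_cl[OF q_linear])

text \<open>The operations of the limit are choices among results at arbitrary stages. Every such
  result is forced by \<open>A\<close>, and one exists at stage 0 because \<open>q 0\<close> is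
  surjective.\<close>

lemma L0_ops:
  "carrier L0 = g ` A.C" "\<zero>\<^bsub>L0\<^esub> = g \<zero>\<^bsub>A\<^esub>" "\<one>\<^bsub>L0\<^esub> = g \<one>\<^bsub>A\<^esub>"
  "[|a \<in> A.C; b \<in> A.C|] ==> g a \<oplus>\<^bsub>L0\<^esub> g b = g (a \<oplus>\<^bsub>A\<^esub> b)"
  "[|a \<in> A.C; b \<in> A.C|] ==> g a \<otimes>\<^bsub>L0\<^esub> g b = g (a \<otimes>\<^bsub>A\<^esub> b)"
  "a \<in> A.C ==> c \<odot>\<^bsub>L0\<^esub> g a = g (c \<odot>\<^bsub>A\<^esub> a)"
proof -
  interpret B: ualg "B n" for n by (rule ualg.intro[OF B_ua])
  have "limit_map B tr n ` carrier (B n) = g ` A.C" for n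
  proof -
    have "limit_map B tr n ` carrier (B n) = (\<lambda>x. g (q n x)) ` carrier (B n)"
      by (rule image_cong) (simp_all add: limit_map_g)
    then show ?thesis using q_surj[of n] by (simp add: image_image[symmetric])
  qed
  then show "carrier L0 = g ` A.C" by (simp add: limit_algebra_def)
  show "\<zero>\<^bsub>L0\<^esub> = g \<zero>\<^bsub>A\<^esub>" "\<one>\<^bsub>L0\<^esub> = g \<one>\<^bsub>A\<^esub>"
    using lin_zero[OF q_linear[of 0] B.vsp A.A.vsp] limit_map_g[of "\<zero>\<^bsub>B 0\<^esub>" 0] limit_map_g[of "\<one>\<^bsub>B 0\<^esub>" 0] q_one[of 0]
    by (simp_all add: limit_algebra_def)
  show "g a \<oplus>\<^bsub>L0\<^esub> g b = g (a \<oplus>\<^bsub>A\<^esub> b)" if a: "a \<in> A.C" and b: "b \<in> A.C"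
  proof -
    let ?P = "\<lambda>r. \<exists>n. \<exists>x\<in>carrier (B n). \<exists>y\<in>carrier (B n).
       g a = limit_map B tr n x \<and> g b = limit_map B tr n y \<and> r = limit_map B tr n (x \<oplus>\<^bsub>B n\<^esub> y)"
    have u: "r = g (a \<oplus>\<^bsub>A\<^esub> b)" if r: "?P r" for r
    proof -
      obtain n x y where xy: "x \<in> carrier (B n)" "y \<in> carrier (B n)" "g a = g (q n x)" "g b = g (q n y)"
        "r = limit_map B tr n (x \<oplus>\<^bsub>B n\<^esub> y)" using r limit_map_g by auto
      have "r = g (q n (x \<oplus>\<^bsub>B n\<^esub> y))" using xy limit_map_g by simp
      then show ?thesis
        using lin_add[OF q_linear xy(1,2)] g_inj[OF a q_cl[OF xy(1)] xy(3)] g_inj[OF b q_cl[OF xy(2)] xy(4)] by simp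
    qed
    obtain x y where "x \<in> carrier (B 0)" "q 0 x = a" "y \<in> carrier (B 0)" "q 0 y = b"
      using q_lift[OF a, of 0] q_lift[OF b, of 0] by metis
    then have "?P (limit_map B tr 0 (x \<oplus>\<^bsub>B 0\<^esub> y))" using limit_map_g by blast
    then have "?P (SOME r. ?P r)" by (rule someI)
    then show ?thesis using u by (simp add: limit_algebra_def)
  qed
  show "g a \<otimes>\<^bsub>L0\<^esub> g b = g (a \<otimes>\<^bsub>A\<^esub> b)" if a: "a \<in> A.C" and b: "b \<in> A.C"
  proof -
    let ?P = "\<lambda>r. \<exists>n. \<exists>x\<in>carrier (B n). \<exists>y\<in>carrier (B n).
       g a = limit_map B tr n x \<and> g b = limit_map B tr n y \<and> r = limit_map B tr n (x \<otimes>\<^bsub>B n\<^esub> y)"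
    have u: "r = g (a \<otimes>\<^bsub>A\<^esub> b)" if r: "?P r" for r
    proof -
      obtain n x y where xy: "x \<in> carrier (B n)" "y \<in> carrier (B n)" "g a = g (q n x)" "g b = g (q n y)"
        "r = limit_map B tr n (x \<otimes>\<^bsub>B n\<^esub> y)" using r limit_map_g by auto
      have "r = g (q n (x \<otimes>\<^bsub>B n\<^esub> y))" using xy limit_map_g by simp
      then show ?thesis
        using q_mult[OF xy(1,2)] g_inj[OF a q_cl[OF xy(1)] xy(3)] g_inj[OF b q_cl[OF xy(2)] xy(4)] by simp
    qed
    obtain x y where "x \<in> carrier (B 0)" "q 0 x = a" "y \<in> carrier (B 0)" "q 0 y = b"
      using q_lift[OF a, of 0] q_lift[OF b, of 0] by metis
    then have "?P (limit_map B tr 0 (x \<otimes>\<^bsub>B 0\<^esub> y))" using limit_map_g by blast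
    then have "?P (SOME r. ?P r)" by (rule someI)
    then show ?thesis using u by (simp add: limit_algebra_def)
  qed
  show "c \<odot>\<^bsub>L0\<^esub> g a = g (c \<odot>\<^bsub>A\<^esub> a)" if a: "a \<in> A.C"
  proof -
    let ?P = "\<lambda>r. \<exists>n. \<exists>x\<in>carrier (B n). g a = limit_map B tr n x \<and> r = limit_map B tr n (c \<odot>\<^bsub>B n\<^esub> x)"
    have u: "r = g (c \<odot>\<^bsub>A\<^esub> a)" if r: "?P r" for r
    proof -
      obtain n x where x: "x \<in> carrier (B n)" "g a = g (q n x)" "r = limit_map B tr n (c \<odot>\<^bsub>B n\<^esub> x)"
        using r limit_map_g by auto
      have "r = g (q n (c \<odot>\<^bsub>B n\<^esub> x))" using x limit_map_g by simp
      then show ?thesis using lin_smult[OF q_linear x(1)] g_inj[OF a q_cl[OF x(1)] x(2)] by simp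
    qed
    obtain x where "x \<in> carrier (B 0)" "q 0 x = a" by (rule q_lift[OF a])
    then have "?P (limit_map B tr 0 (c \<odot>\<^bsub>B 0\<^esub> x))" using limit_map_g by blast
    then have "?P (SOME r. ?P r)" by (rule someI)
    then show ?thesis using u by (simp add: limit_algebra_def)
  qed
qed

lemma L_fields: "same_alg L0 L"
  "braid L = (\<lambda>T. SOME S. \<exists>n. \<exists>t\<in>carrier (tensor_power (B n) 2).
     T = map_power L0 2 (limit_map B tr n) t \<and> S = map_power L0 2 (limit_map B tr n) (braid (B n) t))"
  "comult L = (\<lambda>p. SOME S. \<exists>n. \<exists>x\<in>carrier (B n). p = limit_map B tr n x \<and> S = map_power L0 2 (limit_map B tr n) (comult (B n) x))"
  "counit L = (\<lambda>p. SOME a. \<exists>n. \<exists>x\<in>carrier (B n). p = limit_map B tr n x \<and> a = counit (B n) x)"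
  by (simp_all add: limit_bialgebra_def Let_def same_alg_def module.defs braided.defs braided_bialg.defs)

lemma L0_ua: "unital_algebra L0" and g_map0: "g \<in> algebra_maps A L0"
  using unital_algebra_image[OF A.talg_ua L0_ops] by blast+

lemma L_ua: "unital_algebra L"
  by (rule unital_algebra_cong[OF L_fields(1) L0_ua])

lemma g_map: "g \<in> algebra_maps A L"
  using g_map0 L_fields(1) by (simp add: algebra_maps_def linear_maps_def ring_hom_def same_alg_def)

lemma g_linear: "g \<in> linear_maps A L0"
  using g_map0 by (simp add: algebra_maps_def)

lemma L0_tens: "tens L0"
  using L0_ua by (simp add: tens_def unital_algebra_def)

text \<open>Through \<open>limit_map_g\<close> the canonical map of a stage factors over
  \<open>A\<close>, so computations in the limit become computations in \<open>A\<close>.\<close>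

lemma map_power_limit:
  assumes s: "s \<in> carrier (tensor_power (B n) 2)"
  shows "map_power L0 2 (limit_map B tr n) s = tmap L0 g (tmap A (q n) s)"
proof -
  interpret B: tens "B n" by (rule B_tens)
  have gq: "(\<lambda>x. g (q n x)) \<in> linear_maps (B n) L0" by (rule lin_comp[OF q_linear g_linear])
  have l: "limit_map B tr n \<in> linear_maps (B n) L0"
    by (rule lin_cong[OF gq B.V.vsp limit_map_g])
  have "map_power L0 2 (limit_map B tr n) s = tmap L0 (limit_map B tr n) s"
    by (rule B.map_power_eq[OF L0_tens l s])
  also have "\<dots> = tmap L0 (\<lambda>x. g (q n x)) s"
    by (rule tmap_cong_tspan[OF B_tens L0_tens gq l, of "[B.C, B.C]"])
      (use s B.Rn_tspan2(1) limit_map_g in auto)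
  also have "\<dots> = tmap L0 g (tmap A (q n) s)"
    using tmap_comp[OF B_tens A.tns L0_tens q_linear g_linear B.Rn_cl[OF s]] by simp
  finally show ?thesis .
qed

text \<open>A linear left inverse of \<open>g\<close> induces one on tensor squares. It makes the
  braiding of the limit unambiguous, which is chosen over all representing tensors.\<close>

lemma tmap_g_inj:
  assumes s: "s \<in> A.Rn 2" and t: "t \<in> A.Rn 2" and eq: "tmap L0 g s = tmap L0 g t"
  shows "s = t"
proof -
  obtain h where h: "h \<in> linear_maps L0 A" "\<And>x. x \<in> A.C ==> g (h (g x)) = g x"
  proof -
    interpret L0: tens L0 by (rule L0_tens)
    show ?thesis using generalized_inverse[OF g_linear A.A.vsp L0.V.vsp] that by blast
  qed
  have hg: "h (g x) = x" if "x \<in> A.C" for x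
    using g_inj[OF lin_cl[OF h(1) lin_cl[OF g_linear that]] that] h(2)[OF that] by simp
  have "tmap A h (tmap L0 g u) = u" if u: "u \<in> A.Rn 2" for u
  proof -
    have "tmap A h (tmap L0 g u) = tmap A (\<lambda>x. h (g x)) u"
      by (rule tmap_comp[OF A.tns L0_tens A.tns g_linear h(1) A.Rn_cl[OF u]])
    also have "\<dots> = u"
      by (rule A.tmap_id_tspan[OF lin_comp[OF g_linear h(1)], of "[A.C, A.C]"])
        (use hg u A.Rn_tspan2(1) in auto)
    finally show ?thesis .
  qed
  then show ?thesis using s t eq by metis
qed

lemma tmap_q_Rn: "s \<in> carrier (tensor_power (B n) 2) ==> tmap A (q n) s \<in> A.Rn 2"
  by (rule tmap_Rn[OF B_tens A.tns q_linear])

lemma braid_L: "t \<in> A.Rn 2 ==> braid L (tmap L0 g t) = tmap L0 g (braid A t)"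
proof -
  assume t: "t \<in> A.Rn 2"
  let ?P = "\<lambda>S. \<exists>n. \<exists>s\<in>carrier (tensor_power (B n) 2).
     tmap L0 g t = map_power L0 2 (limit_map B tr n) s \<and> S = map_power L0 2 (limit_map B tr n) (braid (B n) s)"
  have u: "S = tmap L0 g (braid A t)" if P: "?P S" for S
  proof -
    obtain n s where s: "s \<in> carrier (tensor_power (B n) 2)" "tmap L0 g t = tmap L0 g (tmap A (q n) s)"
      "S = tmap L0 g (tmap A (q n) (braid (B n) s))"
      using P map_power_limit q_braid(1) by auto
    have "t = tmap A (q n) s" by (rule tmap_g_inj[OF t tmap_q_Rn[OF s(1)] s(2)])
    then show ?thesis using s(3) q_braid(2)[OF s(1)] by simp
  qed
  obtain s where s: "s \<in> carrier (tensor_power (B 0) 2)" "tmap A (q 0) s = t"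
    by (rule tmap_surj[OF B_tens A.tns q_linear q_surj t])
  have "?P (map_power L0 2 (limit_map B tr 0) (braid (B 0) s))"
    using s map_power_limit[OF s(1)] by (intro exI[of _ 0] bexI[of _ s]) simp_all
  then have "(SOME S. ?P S) = tmap L0 g (braid A t)" by (rule u[OF someI])
  then show ?thesis by (simp only: L_fields(2))
qed

lemma comult_L: "a \<in> A.C ==> comult L (g a) = tmap L0 g (comult A a)"
proof -
  assume a: "a \<in> A.C"
  let ?P = "\<lambda>S. \<exists>n. \<exists>x\<in>carrier (B n). g a = limit_map B tr n x \<and> S = map_power L0 2 (limit_map B tr n) (comult (B n) x)"
  have u: "S = tmap L0 g (comult A a)" if P: "?P S" for S
  proof -
    obtain n x where x: "x \<in> carrier (B n)" "g a = g (q n x)" "S = tmap L0 g (tmap A (q n) (comult (B n) x))"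
      using P map_power_limit q_comult(1) limit_map_g by auto
    have "a = q n x" by (rule g_inj[OF a q_cl[OF x(1)] x(2)])
    then show ?thesis using x(3) q_comult(2)[OF x(1)] by simp
  qed
  obtain x where x: "x \<in> carrier (B 0)" "q 0 x = a" by (rule q_lift[OF a])
  have "?P (map_power L0 2 (limit_map B tr 0) (comult (B 0) x))"
    using x limit_map_g[OF x(1)] by (intro exI[of _ 0] bexI[of _ x]) simp_all
  then have "(SOME S. ?P S) = tmap L0 g (comult A a)" by (rule u[OF someI])
  then show ?thesis by (simp only: L_fields(3))
qed

lemma counit_L: "a \<in> A.C ==> counit L (g a) = counit A a"
proof -
  assume a: "a \<in> A.C"
  let ?P = "\<lambda>c. \<exists>n. \<exists>x\<in>carrier (B n). g a = limit_map B tr n x \<and> c = counit (B n) x"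
  have u: "c = counit A a" if P: "?P c" for c
  proof -
    obtain n x where x: "x \<in> carrier (B n)" "g a = g (q n x)" "c = counit (B n) x"
      using P limit_map_g by auto
    have "a = q n x" by (rule g_inj[OF a q_cl[OF x(1)] x(2)])
    then show ?thesis using x(3) q_counit[OF x(1)] by simp
  qed
  obtain x where x: "x \<in> carrier (B 0)" "q 0 x = a" by (rule q_lift[OF a])
  have "?P (counit (B 0) x)"
    using x limit_map_g[OF x(1)] by (intro exI[of _ 0] bexI[of _ x]) simp_all
  then have "(SOME c. ?P c) = counit A a" by (rule u[OF someI])
  then show ?thesis by (simp only: L_fields(4))
qed

theorem limit_isomorphic: "isomorphic_braided_bialgebras A L"
proof -
  have tm: "tmap L g = tmap L0 g"
    using same_alg_tensor(1,2)[OF L_fields(1)] by (simp add: tmap_def)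
  have c: "carrier L = g ` A.C" using L_fields(1) L0_ops(1) by (simp add: same_alg_def)
  interpret bialg_transport A L g
  proof unfold_locales
    show "bij_betw g A.C (carrier L)"
      unfolding c by (rule inj_on_imp_bij_betw) (auto intro: inj_onI g_inj)
  qed (use A_bialg L_ua g_map braid_L comult_L counit_L in \<open>simp_all only: tm\<close>)
  show ?thesis by (rule transport_isomorphic)
qed

end

context bialg begin

text \<open>Primitivity is primitivity modulo zero, which makes the braiding lemmas for
  \<open>prim_mod\<close> available for \<open>Pr\<close>.\<close>

lemma prim_eq: "Pr = A.prim_mod {\<zero>\<^bsub>A\<^esub>}"
proof -
  have "A.pr x \<in> A.Nker {\<zero>\<^bsub>A\<^esub>} \<longleftrightarrow> comult A x = A.pt [x, \<one>\<^bsub>A\<^esub>] \<oplus>\<^bsub>A.TA\<^esub> A.pt [\<one>\<^bsub>A\<^esub>, x]" if "x \<in> A.C" for x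
  proof -
    have "A.zeroT \<in> A.Nker {\<zero>\<^bsub>A\<^esub>}" by (rule subsp_zero[OF A.Nker_subsp]) simp
    then have "A.pr x \<in> A.Nker {\<zero>\<^bsub>A\<^esub>} \<longleftrightarrow> A.pr x = A.zeroT"
      by (metis A.Nker_zero)
    then show ?thesis
      unfolding A.pr_def using A.comult_cl[OF that] that by (subst A.R.minus_zero_iff[symmetric]) simp_all
  qed
  then show ?thesis unfolding primitives_def A.prim_mod_def by auto
qed

lemma Pr_subsp: "subsp A Pr"
  unfolding prim_eq by (rule A.prim_mod_subsp) simp

lemma Pr_sub: "Pr \<subseteq> A.C"
  using Pr_subsp by (simp add: subsp_def)

lemma Pr_cl: "x \<in> Pr ==> x \<in> A.C"
  using Pr_sub by blast

lemma zero_tspan: "t \<in> tspan A [{\<zero>\<^bsub>A\<^esub>}, A.C] ==> t = A.zeroT" "t \<in> tspan A [A.C, {\<zero>\<^bsub>A\<^esub>}] ==> t = A.zeroT"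
  using A.Nker_incl[of "{\<zero>\<^bsub>A\<^esub>}"] A.Nker_zero by auto

text \<open>The braiding lemmas for \<open>prim_mod\<close> with \<open>K\<close> zero and
  \<open>S\<close> all of \<open>A\<close>; the coalgebra axioms of \<open>A\<close> supply their
  hypothesis on \<open>Cm\<close>.\<close>

lemma braid_Pr:
  "t \<in> tspan A [Pr, A.C] ==> braid A t \<in> tspan A [A.C, Pr]" "t \<in> tspan A [A.C, Pr] ==> braid A t \<in> tspan A [Pr, A.C]"
proof -
  have a: "braid A t \<in> tspan A [A.C, A.C]" if "t \<in> tspan A [A.C, A.C]" for t
    using lin_cl[OF A.braid_hom, of t] that by (simp add: A.Rn_tspan2)
  have z: "braid A A.zeroT = A.zeroT" using lin_zero[OF A.braid_hom A.vspace_Rn A.vspace_Rn] by simp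
  have zz: "A.zeroT \<in> tspan A [A.C, {\<zero>\<^bsub>A\<^esub>}]" "A.zeroT \<in> tspan A [{\<zero>\<^bsub>A\<^esub>}, A.C]"
    by (rule subsp_zero[OF A.tspan_subsp]; simp)+
  show "t \<in> tspan A [Pr, A.C] ==> braid A t \<in> tspan A [A.C, Pr]"
    unfolding prim_eq by (rule A.braid_prim_mod_right[OF A.A.subsp_carrier])
      (use a z zz in \<open>auto dest: zero_tspan simp: A.Rn_tspan2(1)[symmetric] comult_braid\<close>)
  show "t \<in> tspan A [A.C, Pr] ==> braid A t \<in> tspan A [Pr, A.C]"
    unfolding prim_eq by (rule A.braid_prim_mod_left[OF A.A.subsp_carrier])
      (use a z zz in \<open>auto dest: zero_tspan simp: A.Rn_tspan2(1)[symmetric] comult_braid\<close>)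
qed

lemma PV_fields [simp]: "carrier PV = Pr" "x \<oplus>\<^bsub>PV\<^esub> y = x \<oplus>\<^bsub>A\<^esub> y" "a \<odot>\<^bsub>PV\<^esub> x = a \<odot>\<^bsub>A\<^esub> x" "\<zero>\<^bsub>PV\<^esub> = \<zero>\<^bsub>A\<^esub>"
  by (simp_all add: infinitesimal_part_def Let_def braided.defs)

lemma PV_tens: "tens PV"
  by (rule tensI, rule vspace_cong[OF A.A.subsp_vspace[OF Pr_subsp]])
    (simp_all add: infinitesimal_part_def Let_def braided.defs)

sublocale tens "infinitesimal_part A"
  by (rule PV_tens)

lemma incl_linear: "incl \<in> linear_maps PV A"
  by (intro linI) (auto simp: Pr_cl)

text \<open>A linear retraction of \<open>A\<close> onto its primitives; by functoriality it makes
  the tensor powers of \<open>Pr\<close> embed into those of \<open>A\<close>.\<close>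

definition "ret = (SOME r. r \<in> linear_maps A PV \<and> (\<forall>x\<in>Pr. r x = x))"

lemma ret: "ret \<in> linear_maps A PV" "x \<in> Pr ==> ret x = x"
proof -
  obtain g where "g \<in> linear_maps A PV" "\<And>x. x \<in> Pr ==> g x = x"
    using generalized_inverse[OF incl_linear V.vsp A.A.vsp] by auto
  then have "\<exists>r. r \<in> linear_maps A PV \<and> (\<forall>x\<in>Pr. r x = x)" by blast
  then have "ret \<in> linear_maps A PV \<and> (\<forall>x\<in>Pr. ret x = x)" unfolding ret_def by (rule someI_ex)
  then show "ret \<in> linear_maps A PV" "x \<in> Pr ==> ret x = x" by auto
qed

lemma ret_incl: "t \<in> CT ==> tmap PV ret (tmap A incl t) = t"
proof -
  assume t: "t \<in> CT"
  have "tmap PV ret (tmap A incl t) = tmap PV (\<lambda>x. ret x) t"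
    by (rule tmap_comp[OF tns A.tns tns incl_linear ret(1) t])
  also have "\<dots> = tmap PV (\<lambda>x. x) t"
  proof (rule linear_eq_on_TA[OF tmap_linear[OF tns tns lin_comp[OF incl_linear ret(1)]]
        tmap_linear[OF tns tns id_linear] _ t])
    fix xs assume xs: "xs \<in> wrd"
    then have "map (\<lambda>x. ret x) xs = map (\<lambda>x. x) xs"
      using ret(2) by (intro map_cong) (auto simp: in_lists_conv_set)
    then show "tmap PV (\<lambda>x. ret x) (pt xs) = tmap PV (\<lambda>x. x) (pt xs)"
      unfolding tmap_pure[OF tns tns lin_comp[OF incl_linear ret(1)] xs]
        tmap_pure[OF tns tns id_linear xs] by (simp only:)
  qed
  finally show ?thesis using tmap_id[OF t] by simp
qed

lemma incl_inj: "[|s \<in> CT; t \<in> CT; tmap A incl s = tmap A incl t|] ==> s = t"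
  by (metis ret_incl)

lemma tmap_incl_image: "t \<in> tspan A [Pr, Pr] ==> \<exists>s\<in>Rn 2. tmap A incl s = t"
proof -
  assume t: "t \<in> tspan A [Pr, Pr]"
  have sub: "subsp A.TA (tmap A incl ` Rn 2)"
    by (rule subsp_image[OF tmap_linear[OF tns A.tns incl_linear] R.vsp A.R.vsp Rn_subsp])
  have "tspan A [Pr, Pr] \<subseteq> tmap A incl ` Rn 2"
  proof (rule A.tspan_least[OF sub])
    fix xs assume "list_all2 (\<in>) xs [Pr, Pr]"
    then have "xs \<in> wrd" "length xs = 2" by (auto simp: list_all2_Cons2)
    then have "A.pt xs = tmap A incl (pt xs)" "pt xs \<in> Rn 2"
      using tmap_pure[OF tns A.tns incl_linear, of xs] by simp_all
    then show "A.pt xs \<in> tmap A incl ` Rn 2" by blast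
  qed
  then show ?thesis using t by blast
qed

lemma tmap_incl_Rn: "t \<in> Rn 2 ==> tmap A incl t \<in> tspan A [Pr, Pr]"
  by (rule tmap_tspan[OF tns A.tns incl_linear, of "[Pr, Pr]"]) (use Pr_sub in \<open>auto simp: Rn_tspan2(1)\<close>)

text \<open>\<open>Pr \<otimes> Pr\<close> is the intersection of \<open>Pr \<otimes> A\<close> and
  \<open>A \<otimes> Pr\<close>: the retraction in the first slot fixes the elements of the former
  and sends the latter into \<open>Pr \<otimes> Pr\<close>.\<close>

lemma braid_PrPr:
  assumes t: "t \<in> tspan A [Pr, Pr]"
  shows "braid A t \<in> tspan A [Pr, Pr]"
proof -
  let ?h = "\<lambda>x. A.pt [ret x]"
  have h: "?h \<in> linear_maps A (tensor_power A 1)"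
    by (rule lin_comp[OF lin_comp[OF ret(1) incl_linear] A.pure1_linear(2)])
  define rh where "rh = multilinear_lift A.TA 1 (\<lambda>xs. ?h (xs ! 0))"
  have rh: "rh \<in> hom_power A 1 1" "\<And>x. x \<in> A.C ==> rh (A.pt [x]) = A.pt [ret x]"
    unfolding rh_def using A.hom_1_I[OF h] by auto
  have rP: "ret x \<in> Pr" if "x \<in> A.C" for x using lin_cl[OF ret(1) that] by simp
  have mono: "t \<in> tspan A [Pr, A.C]" "t \<in> tspan A [A.C, Pr]"
    using subsetD[OF A.tspan_mono t, of "[Pr, A.C]"] subsetD[OF A.tspan_mono t, of "[A.C, Pr]"] Pr_sub by auto
  have b: "braid A t \<in> tspan A [A.C, Pr]" "braid A t \<in> tspan A [Pr, A.C]" using braid_Pr mono by auto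
  have idP: "rh u = u" if "u \<in> tspan A [Pr]" for u
    using that rh(2) ret(2) Pr_cl unfolding A.tspan1[OF Pr_subsp] by auto
  have toP: "rh u \<in> tspan A [Pr]" if "u \<in> tspan A [A.C]" for u
    using that rh(2) rP unfolding A.tspan1[OF Pr_subsp] A.tspan1[OF A.A.subsp_carrier] by auto
  have "whisker A 1 1 rh (braid A t) = braid A t"
    by (rule A.local_at_eq[OF A.local_at_whisker[OF rh(1)] A.local_at_id, of "[A.C]" "[Pr]" "[]"])
      (use Pr_sub b idP in auto)
  moreover have "whisker A 0 1 rh (braid A t) = braid A t"
    by (rule A.local_at_eq[OF A.local_at_whisker[OF rh(1)] A.local_at_id, of "[]" "[Pr]" "[A.C]"])
      (use Pr_sub b idP in auto)
  moreover have "whisker A 0 1 rh (braid A t) \<in> tspan A ([] @ [Pr] @ [Pr])"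
    by (rule A.local_at_tspan[OF A.local_at_whisker[OF rh(1)], of "[]" "[A.C]" "[Pr]"])
      (use Pr_sub b toP in auto)
  ultimately show ?thesis by simp
qed

lemma PV_braid:
  assumes t: "t \<in> Rn 2"
  shows "braid PV t \<in> Rn 2" "tmap A incl (braid PV t) = braid A (tmap A incl t)"
proof -
  \<comment> \<open>The definition inverts the inclusion on the tensor square of the record before
    its braiding is replaced; tensor powers do not see that field.\<close>
  define W where "W = braided.truncate (A\<lparr>carrier := Pr\<rparr>)"
  have tw: "tensor_power W = tensor_power PV"
  proof -
    have "same_alg PV W"
      by (simp add: same_alg_def W_def infinitesimal_part_def Let_def)
    then show ?thesis by (rule same_alg_tensor)
  qed
  have "PV = W\<lparr>braid := \<lambda>t. inv_into (carrier (tensor_power W 2)) (map_power A 2 id) (braid A (map_power A 2 id t))\<rparr>"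
    by (simp add: infinitesimal_part_def Let_def W_def)
  then have "braid PV t = inv_into (carrier (tensor_power W 2)) (map_power A 2 id) (braid A (map_power A 2 id t))"
    by (metis (no_types, lifting) braided.select_convs(1) braided.surjective braided.update_convs(1))
  then have eq: "braid PV t = inv_into (Rn 2) (map_power A 2 id) (braid A (map_power A 2 id t))"
    unfolding tw .
  have mp: "map_power A 2 id s = tmap A incl s" if "s \<in> Rn 2" for s
    using map_power_eq[OF A.tns incl_linear that] by (simp add: id_def)
  obtain s where s: "s \<in> Rn 2" "tmap A incl s = braid A (tmap A incl t)"
    using tmap_incl_image[OF braid_PrPr[OF tmap_incl_Rn[OF t]]] by blast
  then have im: "braid A (map_power A 2 id t) \<in> map_power A 2 id ` Rn 2"
    using mp t by (metis image_eqI)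
  show b: "braid PV t \<in> Rn 2" unfolding eq by (rule inv_into_into[OF im])
  show "tmap A incl (braid PV t) = braid A (tmap A incl t)"
    using f_inv_into_f[OF im] mp[OF b] mp[OF t] unfolding eq by simp
qed

text \<open>The braid relation holds in the tensor cube of \<open>A\<close>, into which that of
  \<open>Pr\<close> embeds by \<open>incl_inj\<close>.\<close>

lemma PV_braided: "braided_vector_space PV"
proof -
  note ir = ret_incl[OF Rn_cl]
  have lj: "tmap A incl \<in> linear_maps TA A.TA" by (rule tmap_linear[OF tns A.tns incl_linear])
  have j2: "tmap A incl t \<in> A.Rn n" if "t \<in> Rn n" for t n
    by (rule tmap_Rn[OF tns A.tns incl_linear that])
  have hom: "braid PV \<in> hom_power PV 2 2"
  proof (rule lin_cong[OF lin_comp[OF tmap_power[OF tns A.tns incl_linear]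
        lin_comp[OF A.braid_hom tmap_power[OF A.tns tns ret(1)]]] vspace_Rn])
    fix t assume t: "t \<in> Rn 2"
    show "braid PV t = tmap PV ret (braid A (tmap A incl t))"
      using ir[OF PV_braid(1)[OF t]] PV_braid(2)[OF t] by (simp only:)
  qed
  have m: "map_tensor PV 2 1 (braid PV) id u = Wh 0 2 (braid PV) u" "map_tensor PV 1 2 id (braid PV) u = Wh 1 2 (braid PV) u"
    if "u \<in> Rn 3" for u
    using map_tensor_left[OF hom, of u 1] map_tensor_right[OF hom, of u 1] that by simp_all
  have W3: "Wh 0 2 (braid PV) u \<in> Rn 3" "Wh 1 2 (braid PV) u \<in> Rn 3" if "u \<in> Rn 3" for u
    using whisker_deg[OF hom that, of 0 1] whisker_deg[OF hom that, of 1 0] by simp_all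
  have nat: "tmap A incl (Wh i 2 (braid PV) u) = A.D i (tmap A incl u)" if "i + 2 \<le> 3" "u \<in> Rn 3" for u i
    by (rule tmap_local_at_Rn[OF tns A.tns incl_linear local_at_whisker[OF hom] A.local_at_whisker[OF A.braid_hom] that(1) _ that(2)])
      (rule PV_braid(2))
  have "Wh 0 2 (braid PV) (Wh 1 2 (braid PV) (Wh 0 2 (braid PV) t)) = Wh 1 2 (braid PV) (Wh 0 2 (braid PV) (Wh 1 2 (braid PV) t))"
    if t: "t \<in> Rn 3" for t
  proof -
    have "tmap A incl (Wh 0 2 (braid PV) (Wh 1 2 (braid PV) (Wh 0 2 (braid PV) t)))
        = tmap A incl (Wh 1 2 (braid PV) (Wh 0 2 (braid PV) (Wh 1 2 (braid PV) t)))"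
      using A.braid_rel[of 1 0 "tmap A incl t"] lin_cl[OF lj Rn_cl[OF t]]
      by (simp only: nat[of 0, OF _ W3(2)[OF W3(1)[OF t]]] nat[of 1, OF _ W3(1)[OF t]] nat[of 0, OF _ t]
          nat[of 1, OF _ W3(1)[OF W3(2)[OF t]]] nat[of 0, OF _ W3(2)[OF t]] nat[of 1, OF _ t])
    then show ?thesis
      by (rule incl_inj[OF Rn_cl[OF W3(1)[OF W3(2)[OF W3(1)[OF t]]]] Rn_cl[OF W3(2)[OF W3(1)[OF W3(2)[OF t]]]]])
  qed
  then show ?thesis
    unfolding braided_vector_space_def Let_def using hom by (auto simp: m W3 tens_vs)
qed

end

sublocale bialg \<subseteq> tbialg "infinitesimal_part A"
  by (unfold_locales) (rule PV_braided)

lemma ground_algebra_simps [simp]: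
  "carrier (ground_algebra :: ('k::field, 'k) module) = UNIV" "x \<oplus>\<^bsub>ground_algebra\<^esub> y = x + (y::'k::field)"
  "x \<otimes>\<^bsub>ground_algebra\<^esub> y = x * (y::'k::field)" "a \<odot>\<^bsub>ground_algebra\<^esub> y = a * (y::'k::field)"
  "\<zero>\<^bsub>ground_algebra\<^esub> = (0::'k::field)" "\<one>\<^bsub>ground_algebra\<^esub> = (1::'k::field)"
  by (simp_all add: ground_algebra_def)

lemma ground_unital_algebra: "unital_algebra (ground_algebra :: ('k::field, 'k) module)"
proof -
  have ab: "abelian_group (ground_algebra :: ('k, 'k) module)"
  proof (rule abelian_groupI)
    fix x :: 'k
    show "\<exists>y\<in>carrier ground_algebra. y \<oplus>\<^bsub>ground_algebra\<^esub> x = \<zero>\<^bsub>ground_algebra\<^esub>"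
      by (intro bexI[of _ "- x"]) simp_all
  qed (simp_all add: add.assoc add.commute)
  have "module (\<bbbK> :: 'k ring) (ground_algebra :: ('k, 'k) module)"
    by (intro moduleI cring_ground ab) (simp_all add: algebra_simps)
  moreover have "ring (ground_algebra :: ('k, 'k) module)"
    by (rule ringI[OF ab monoidI]) (simp_all add: algebra_simps)
  ultimately show ?thesis
    by (simp add: unital_algebra_def vector_space_over_field_def)
qed

lemma (in tens) tensor_algebra_lift:
  fixes B :: "('k, 'b, 'n) module_scheme"
  assumes B: "unital_algebra B" and f: "f \<in> linear_maps V B"
  shows "tensor_algebra_lift B f \<in> linear_maps TA B"
    and "tensor_algebra_lift B f oneT = \<one>\<^bsub>B\<^esub>"
    and "[|x \<in> C; t \<in> CT|] ==> tensor_algebra_lift B f (pt [x] \<bullet> t) = f x \<otimes>\<^bsub>B\<^esub> tensor_algebra_lift B f t"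
    and "x \<in> C ==> tensor_algebra_lift B f (pt [x]) = f x"
    and "[|s \<in> CT; t \<in> CT|] ==>
      tensor_algebra_lift B f (s \<bullet> t) = tensor_algebra_lift B f s \<otimes>\<^bsub>B\<^esub> tensor_algebra_lift B f t"
proof -
  interpret B: ualg B by (rule ualg.intro[OF B])
  let ?L = "tensor_algebra_lift B f"
  note fc = lin_cl[OF f]
  have l: "\<forall>b\<in>carrier B. (\<lambda>x. f x \<otimes>\<^bsub>B\<^esub> b) \<in> linear_maps V B"
    by (intro ballI linI) (simp_all add: fc lin_add[OF f] lin_smult[OF f] B.A.l_distr B.smult_mult)
  have r: "\<forall>x\<in>C. (\<lambda>b. f x \<otimes>\<^bsub>B\<^esub> b) \<in> linear_maps B B"
    by (intro ballI linI) (simp_all add: fc B.A.r_distr B.mult_smult)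
  note L = tensor_algebra_lift_linear[OF B.vsp B.A.one_closed l r]
  show lin: "?L \<in> linear_maps TA B" and L1: "?L oneT = \<one>\<^bsub>B\<^esub>" by (rule L(1,2))+
  show "?L (pt [x] \<bullet> t) = f x \<otimes>\<^bsub>B\<^esub> ?L t" if "x \<in> C" "t \<in> CT" for x t by (rule L(3)[OF that])
  show "?L (pt [x]) = f x" if "x \<in> C" for x using L(3)[OF that R.A.one_closed] L1 fc[OF that] that by simp
  show "?L (s \<bullet> t) = ?L s \<otimes>\<^bsub>B\<^esub> ?L t" if "s \<in> CT" and t: "t \<in> CT" for s t
    using that(1)
  proof (induction s rule: TA_word_induct)
    case one
    then show ?case using t lin_cl[OF lin t] L1 by simp
  next
    case (cons x s)
    then show ?case using t L(3) lin_cl[OF lin] fc by (simp add: R.A.m_assoc B.A.m_assoc)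
  next
    case (add s s')
    then show ?case using t by (simp add: R.A.l_distr B.A.l_distr lin_add[OF lin] lin_cl[OF lin])
  next
    case (smult a s)
    then show ?case using t by (simp add: R.smult_mult B.smult_mult lin_smult[OF lin] lin_cl[OF lin])
  qed
qed

lemma (in vspace) id_linear': "(\<lambda>x. x) \<in> linear_maps V V"
  by (rule linI) simp_all

lemma algebra_maps_comp: "[|f \<in> algebra_maps A B; g \<in> algebra_maps B D|] ==> (\<lambda>x. g (f x)) \<in> algebra_maps A D"
  using lin_comp[of f A B g D] ring_hom_trans[of f A B g D]
  by (simp add: algebra_maps_def comp_def)

lemma same_alg_maps:
  fixes M :: "('k::field, 'v, 'm) module_scheme" and M' :: "('k, 'v, 'n) module_scheme"
  assumes "same_alg M M'"
  shows "algebra_maps N M' = algebra_maps N M" "linear_maps N M' = linear_maps N M" "tmap M' = tmap M"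
  using assms same_alg_tensor(1,2)[OF assms]
  by (simp_all add: same_alg_def algebra_maps_def linear_maps_def ring_hom_def tmap_def fun_eq_iff)

context bialg begin

section \<open>The map from T to \<open>A\<close> that extends the inclusion of the
  primitives\<close>

definition "psi = tensor_algebra_lift A (\<lambda>x. x)"

lemmas psi_lift = tensor_algebra_lift[OF A.talg_ua incl_linear, folded psi_def]

lemma psi_linear: "psi \<in> linear_maps TA A" and psi_one: "psi oneT = \<one>\<^bsub>A\<^esub>"
  and psi_cons: "[|x \<in> Pr; t \<in> CT|] ==> psi (pt [x] \<bullet> t) = x \<otimes>\<^bsub>A\<^esub> psi t"
  and psi_emb: "x \<in> Pr ==> psi (pt [x]) = x"
  and psi_mult: "[|s \<in> CT; t \<in> CT|] ==> psi (s \<bullet> t) = psi s \<otimes>\<^bsub>A\<^esub> psi t"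
  using psi_lift(1,2) psi_lift(3)[of x t] psi_lift(4)[of x] psi_lift(5)[of s t] by simp_all

lemma psi_linear_TT: "psi \<in> linear_maps TT A"
  using psi_linear by (simp only: linear_TT)

lemmas psi_cl = lin_cl[OF psi_linear]

text \<open>The image is a subalgebra that contains the primitives; primitive generation enters
  here.\<close>

lemma psi_surj:
  assumes "primitively_generated A"
  shows "psi ` CT = A.C"
proof -
  let ?S = "psi ` CT"
  have sub: "subsp A ?S"
    by (rule subsp_image[OF psi_linear R.vsp A.A.vsp R.subsp_carrier])
  have S: "?S \<subseteq> A.C" using sub by (simp add: subsp_def)
  have neg: "\<ominus>\<^bsub>A\<^esub> a \<in> ?S" if "a \<in> ?S" for a
    using subsp_smult[OF sub that, of "- 1"] A.A.neg_smult[OF subsetD[OF S that]] by simp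
  have one: "\<one>\<^bsub>A\<^esub> \<in> ?S" using psi_one by (metis R.A.one_closed image_eqI)
  have mult: "a \<otimes>\<^bsub>A\<^esub> b \<in> ?S" if "a \<in> ?S" "b \<in> ?S" for a b
  proof -
    obtain s t where st: "s \<in> CT" "t \<in> CT" "a = psi s" "b = psi t" using \<open>a \<in> ?S\<close> \<open>b \<in> ?S\<close> by blast
    show ?thesis
      unfolding st(3,4) by (rule image_eqI[where f = psi, OF psi_mult[OF st(1,2), symmetric] R.mult_cl[OF st(1,2)]])
  qed
  have "submodule ?S \<bbbK> A"
    using subsp_add[OF sub] subsp_smult[OF sub] subsp_zero[OF sub] neg S by (intro A.A.submoduleI) auto
  moreover have "subring ?S A"
    using subsp_add[OF sub] neg one mult S by (intro A.A.A.subringI) auto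
  moreover have "Pr \<subseteq> ?S"
  proof
    fix x assume x: "x \<in> Pr"
    then have "pt [x] \<in> CT" by simp
    then show "x \<in> ?S" using psi_emb[OF x] by (metis image_eqI)
  qed
  ultimately show ?thesis using assms unfolding primitively_generated_def by blast
qed

lemma prim_comult: "x \<in> Pr ==> comult A x = A.pt [x, \<one>\<^bsub>A\<^esub>] \<oplus>\<^bsub>A.TA\<^esub> A.pt [\<one>\<^bsub>A\<^esub>, x]"
  by (simp add: primitives_def)

lemma counit_props: "counit A \<in> algebra_maps A ground_algebra"
  "x \<in> A.C ==> map_tensor A 1 1 (counit_map A) id (comult A x) = A.pt [x]"
  using bialg by (auto simp: braided_bialgebra_def braided_coalgebra_def counital_coalgebra_def)

lemma counit_linear: "counit A \<in> linear_maps A ground_algebra" and counit_one: "counit A \<one>\<^bsub>A\<^esub> = 1"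
  and counit_mult: "[|x \<in> A.C; y \<in> A.C|] ==> counit A (x \<otimes>\<^bsub>A\<^esub> y) = counit A x * counit A y"
  using counit_props(1) by (auto simp: algebra_maps_def ring_hom_def)

text \<open>\<open>counit \<otimes> id\<close> turns \<open>x \<otimes> 1 + 1 \<otimes> x\<close>
  into \<open>\<epsilon>(x) 1 + x\<close>, which must be \<open>x\<close>. Applying the counit to
  \<open>\<epsilon>(x) 1 = 0\<close> finishes, as it sends the unit to 1.\<close>

lemma counit_prim: "x \<in> Pr ==> counit A x = 0"
proof -
  assume x: "x \<in> Pr"
  then have xc: "x \<in> A.C" by (rule Pr_cl)
  have h: "(\<lambda>x. counit A x \<odot>\<^bsub>A.TA\<^esub> A.pt []) \<in> linear_maps A (tensor_power A 0)"
    by (rule linI) (simp_all add: lin_add[OF counit_linear] lin_smult[OF counit_linear]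
        A.R.add_smult A.R.smult_smult A.Rn_smult[OF A.Rn_pure])
  have cm: "counit_map A \<in> hom_power A 1 0" "\<And>x. x \<in> A.C ==> counit_map A (A.pt [x]) = counit A x \<odot>\<^bsub>A.TA\<^esub> A.pt []"
    using A.hom_1_I[OF h] by (simp_all add: counit_map_def)
  have W: "A.Wh 0 1 (counit_map A) (A.pt [y, z]) = counit A y \<odot>\<^bsub>A.TA\<^esub> A.pt [z]" if "y \<in> A.C" "z \<in> A.C" for y z
    using A.whisker_pure[OF cm(1), of "[]" "[y]" "[z]" 0] that
    by (simp add: A.pure_Nil cm(2) A.R.smult_mult)
  have "A.pt [x] = map_tensor A 1 1 (counit_map A) id (comult A x)" using counit_props(2)[OF xc] by simp
  also have "\<dots> = A.Wh 0 1 (counit_map A) (comult A x)"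
    using A.map_tensor_left[OF cm(1), of "comult A x" 1] A.comult_cl[OF xc] by simp
  also have "\<dots> = counit A x \<odot>\<^bsub>A.TA\<^esub> A.pt [\<one>\<^bsub>A\<^esub>] \<oplus>\<^bsub>A.TA\<^esub> A.pt [x]"
    using xc by (simp add: prim_comult[OF x] lin_add[OF A.whisker_linear[OF cm(1)]] W counit_one)
  finally have "counit A x \<odot>\<^bsub>A.TA\<^esub> A.pt [\<one>\<^bsub>A\<^esub>] = A.zeroT"
    using xc A.R.add_minus_cancel[of "counit A x \<odot>\<^bsub>A.TA\<^esub> A.pt [\<one>\<^bsub>A\<^esub>]" "A.pt [x]"] by simp
  then have "A.unpure (counit A x \<odot>\<^bsub>A.TA\<^esub> A.pt [\<one>\<^bsub>A\<^esub>]) = \<zero>\<^bsub>A\<^esub>"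
    using lin_zero[OF A.unpure_linear A.R.vsp A.A.vsp] by simp
  then have "counit A x \<odot>\<^bsub>A\<^esub> \<one>\<^bsub>A\<^esub> = \<zero>\<^bsub>A\<^esub>"
    using lin_smult[OF A.unpure_linear, of "A.pt [\<one>\<^bsub>A\<^esub>]" "counit A x"] by simp
  then show ?thesis
    using lin_smult[OF counit_linear, of "\<one>\<^bsub>A\<^esub>" "counit A x"] lin_smult[OF counit_linear, of "\<one>\<^bsub>A\<^esub>" 0]
    by (simp add: counit_one)
qed

lemma counit_psi: "t \<in> CT ==> counit TT t = counit A (psi t)"
proof -
  have l: "(\<lambda>v. 0) \<in> linear_maps PV ground_algebra" by (rule linI) simp_all
  note cT = tensor_algebra_lift[OF ground_unital_algebra l, folded TT_TB(4)]
  show "t \<in> CT ==> counit TT t = counit A (psi t)"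
  proof (induction t rule: TA_word_induct)
    case one
    show ?case using cT(2) by (simp add: psi_one counit_one)
  next
    case (cons x t)
    then show ?case using cT(3)[of x t] by (simp add: psi_cons counit_mult Pr_cl psi_cl counit_prim)
  next
    case (add s t)
    then show ?case
      using lin_add[OF cT(1), of s t] by (simp add: lin_add[OF psi_linear] lin_add[OF counit_linear] psi_cl)
  next
    case (smult a s)
    then show ?case
      using lin_smult[OF cT(1), of s a] by (simp add: lin_smult[OF psi_linear] lin_smult[OF counit_linear] psi_cl)
  qed
qed

section \<open>Compatibility of \<open>psi\<close> with braiding and comultiplication\<close>

abbreviation "PS \<equiv> tmap A psi"

lemmas PS_linear = tmap_linear[OF T.tns A.tns psi_linear_TT]
  and PS_pure = tmap_pure[OF T.tns A.tns psi_linear_TT]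
  and PS_cl = tmap_cl[OF T.tns A.tns psi_linear_TT]
  and PS_add = tmap_add[OF T.tns A.tns psi_linear_TT]
  and PS_minus = tmap_minus[OF T.tns A.tns psi_linear_TT]
  and PS_mult = tmap_mult[OF T.tns A.tns psi_linear_TT]
  and PS_Rn = tmap_Rn[OF T.tns A.tns psi_linear_TT]
  and PS_power = tmap_power[OF T.tns A.tns psi_linear_TT]
  and PS_local = tmap_local_at[OF T.tns A.tns psi_linear_TT]
  and PS_local_Rn = tmap_local_at_Rn[OF T.tns A.tns psi_linear_TT]

lemma PS_M:
  assumes "t \<in> T.Rn n" "i + 2 \<le> n"
  shows "PS (T.M i t) = A.M i (PS t)"
proof (rule PS_local_Rn[OF T.local_at_whisker[OF T.mult_map_hom] A.local_at_whisker[OF A.mult_map_hom] assms(2) _ assms(1)])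
  fix t assume t: "t \<in> T.Rn 2"
  show "PS (mult_map TT t) = mult_map A (PS t)"
  proof (rule T.hom_eq_pure[OF lin_comp[OF T.mult_map_hom PS_power] lin_comp[OF PS_power A.mult_map_hom] _ t])
    fix xs assume "xs \<in> T.wrd" "length xs = 2"
    then obtain x y where xs: "xs = [x, y]" "x \<in> CT" "y \<in> CT"
      by (auto simp: length_2_iff)
    show "PS (mult_map TT (T.pt xs)) = mult_map A (PS (T.pt xs))"
      using xs T.mult_map_pure[of x y] A.mult_map_pure[of "psi x" "psi y"] PS_pure[of "[x \<bullet> y]"] PS_pure[of "[x, y]"]
      by (simp add: psi_cl psi_mult)
  qed
qed

lemma PS_D_pairI:
  assumes t: "t \<in> tspan TT [S1, S2]" and S: "S1 \<subseteq> CT" "S2 \<subseteq> CT"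
    and eq: "\<And>x y. [|x \<in> S1; y \<in> S2|] ==> PS (T.D 0 (T.pt [x, y])) = A.D 0 (PS (T.pt [x, y]))"
  shows "PS (T.D 0 t) = A.D 0 (PS t)"
proof (rule T.tspan_eqI[OF lin_comp[OF T.D_linear PS_linear] lin_comp[OF PS_linear A.D_linear] A.R.vsp _ _ t])
  fix ss assume "list_all2 (\<in>) ss [S1, S2]"
  then obtain x y where "ss = [x, y]" "x \<in> S1" "y \<in> S2" by (auto simp: list_all2_Cons2)
  then show "PS (T.D 0 (T.pt ss)) = A.D 0 (PS (T.pt ss))" using eq by (simp only:)
qed (use S in simp)

text \<open>On letters both sides come from the braiding of \<open>A\<close> restricted to
  \<open>Pr\<close>. The hexagon identities extend this in \<open>PS_D1\<close> to words in the
  second factor and then in \<open>PS_D2\<close> to words in the first.\<close>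

lemma PS_D11: "t \<in> tspan TT [Rn 1, Rn 1] ==> PS (T.D 0 t) = A.D 0 (PS t)"
proof (rule T.tspan_eqI[OF lin_comp[OF T.D_linear PS_linear] lin_comp[OF PS_linear A.D_linear] A.R.vsp])
  fix ss assume "list_all2 (\<in>) ss [Rn 1, Rn 1]"
  then obtain x y where ss: "ss = [pt [x], pt [y]]" "x \<in> Pr" "y \<in> Pr"
    by (auto simp: list_all2_Cons2 elim!: Rn1_E)
  have e: "PS (tmap TT (\<lambda>x. pt [x]) w) = tmap A incl w" if "w \<in> Rn 2" for w
  proof -
    have "PS (tmap TT (\<lambda>x. pt [x]) w) = tmap A (\<lambda>x. psi (pt [x])) w"
      using that by (intro tmap_comp[OF tns T.tns A.tns emb_linear psi_linear_TT]) (rule Rn_cl)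
    also have "\<dots> = tmap A incl w"
    proof (rule tmap_cong_tspan[OF tns A.tns incl_linear lin_comp[OF emb_linear psi_linear_TT]])
      show "w \<in> tspan PV [Pr, Pr]" using that Rn_tspan2(1)[of w] by simp
    qed (auto simp: psi_emb)
    finally show ?thesis .
  qed
  have xy: "pt [x, y] \<in> Rn 2" "A.pt [x, y] \<in> A.Rn 2" using ss Pr_cl by (simp_all add: Rn_pure A.Rn_pure)
  have j: "tmap A incl (pt [x, y]) = A.pt [x, y]"
    using tmap_pure[OF tns A.tns incl_linear, of "[x, y]"] ss by simp
  have "PS (T.D 0 (T.pt ss)) = PS (braid TT (T.pt ss))" using ss T.D_0[OF T.Rn_pure, of ss] by simp
  also have "\<dots> = PS (tmap TT (\<lambda>x. pt [x]) (braid PV (pt [x, y])))"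
    using ss xy by (simp add: pt_emb braid_emb)
  also have "\<dots> = tmap A incl (braid PV (pt [x, y]))" by (rule e[OF PV_braid(1)[OF xy(1)]])
  also have "\<dots> = braid A (A.pt [x, y])" using PV_braid(2)[OF xy(1)] j by simp
  also have "\<dots> = A.D 0 (A.pt [x, y])" using A.D_0[OF xy(2)] by simp
  also have "A.pt [x, y] = PS (T.pt ss)" using PS_pure[of ss] ss by (simp add: psi_emb)
  finally show "PS (T.D 0 (T.pt ss)) = A.D 0 (PS (T.pt ss))" .
qed auto

lemma PS_D1: "[|s \<in> CT; v \<in> Rn 1|] ==> PS (T.D 0 (T.pt [v, s])) = A.D 0 (PS (T.pt [v, s]))"
proof (induction s arbitrary: v rule: TA_word_induct)
  case one
  then have v: "v \<in> CT" by simp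
  show ?case
    using T.D_one(1)[of v] A.D_one(1)[of "psi v"] PS_pure[of "[v, oneT]"] PS_pure[of "[oneT, v]"] v
    by (simp add: psi_one psi_cl)
next
  case (cons x s)
  then have v: "v \<in> CT" by simp
  define t3 where "t3 = T.pt [v, pt [x], s]"
  have t3: "t3 \<in> T.Rn 3" "t3 \<in> T.CT" unfolding t3_def using cons v by (auto intro!: T.Rn_pure)
  have t3s: "t3 \<in> tspan TT ([] @ [Rn 1, Rn 1] @ [{s}])"
    unfolding t3_def using cons v by (auto intro!: T.tspan_pure)
  have "T.D 0 t3 \<in> tspan TT ([] @ [Rn 1, Rn 1] @ [{s}])"
    by (rule T.D_tspan[OF D_11 t3s]) (use cons in auto)
  then have d0s: "T.D 0 t3 \<in> tspan TT ([Rn 1] @ [Rn 1, {s}] @ [])" by simp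
  have a: "PS (T.D 0 t3) = A.D 0 (PS t3)"
    by (rule PS_local[OF T.local_D2 A.local_D2 _ _ _ PS_D11 t3s]) (use cons in auto)
  have b: "PS (T.D 1 (T.D 0 t3)) = A.D 1 (PS (T.D 0 t3))"
  proof (rule PS_local[OF T.local_D2 A.local_D2 _ _ _ _ d0s])
    fix t assume "t \<in> tspan TT [Rn 1, {s}]"
    then show "PS (T.D 0 t) = A.D 0 (PS t)"
      by (rule PS_D_pairI) (use cons in simp_all)
  qed (use cons in auto)
  have "PS (T.D 0 (T.M 1 t3)) = PS (T.M 0 (T.D 1 (T.D 0 t3)))" using T.hex2[of 1 0 t3] t3 by simp
  also have "\<dots> = A.M 0 (A.D 1 (A.D 0 (PS t3)))"
    using PS_M[of "T.D 1 (T.D 0 t3)" 3 0] T.deg3 t3 a b by simp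
  also have "\<dots> = A.D 0 (A.M 1 (PS t3))" using A.hex2[of 1 0 "PS t3"] PS_cl[OF t3(2)] by simp
  also have "A.M 1 (PS t3) = PS (T.M 1 t3)" using PS_M[of t3 3 1] t3 by simp
  also have "T.M 1 t3 = T.pt [v, pt [x] \<bullet> s]" unfolding t3_def using M_pt3(2)[of v "pt [x]" s] cons v by simp
  finally show ?case .
next
  case (add s s')
  then have v: "v \<in> CT" by simp
  note l = pt2_linear(1)[OF v]
  show ?case using add lin_add[OF lin_comp[OF lin_comp[OF l T.D_linear[of 0]] PS_linear], of s s']
      lin_add[OF lin_comp[OF lin_comp[OF l PS_linear] A.D_linear[of 0]], of s s'] by simp
next
  case (smult a s)
  then have v: "v \<in> CT" by simp
  note l = pt2_linear(1)[OF v]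
  show ?case using smult lin_smult[OF lin_comp[OF lin_comp[OF l T.D_linear[of 0]] PS_linear], of s a]
      lin_smult[OF lin_comp[OF lin_comp[OF l PS_linear] A.D_linear[of 0]], of s a] by simp
qed

lemma PS_D2: "[|u \<in> CT; s \<in> CT|] ==> PS (T.D 0 (T.pt [u, s])) = A.D 0 (PS (T.pt [u, s]))"
proof (induction u rule: TA_word_induct)
  case one
  show ?case
    using T.D_one(2)[of s] A.D_one(2)[of "psi s"] PS_pure[of "[s, oneT]"] PS_pure[of "[oneT, s]"] one
    by (simp add: psi_one psi_cl)
next
  case (cons x u)
  define t3 where "t3 = T.pt [pt [x], u, s]"
  have t3: "t3 \<in> T.Rn 3" "t3 \<in> T.CT" unfolding t3_def using cons by (auto intro!: T.Rn_pure)
  have t3s: "t3 \<in> tspan TT ([Rn 1] @ [{u}, {s}] @ [])"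
    unfolding t3_def using cons by (auto intro!: T.tspan_pure Rn_pure)
  have t3s': "t3 \<in> tspan TT ([Rn 1] @ [CT, CT] @ [])"
    unfolding t3_def using cons by (auto intro!: T.tspan_pure Rn_pure)
  have "T.D 1 t3 \<in> tspan TT ([Rn 1] @ [CT, CT] @ [])"
    by (rule T.D_tspan[OF _ t3s']) (auto simp: T.Rn_tspan2(1)[simplified, symmetric] intro: T.D_Rn)
  then have d1s: "T.D 1 t3 \<in> tspan TT ([] @ [Rn 1, CT] @ [CT])" by simp
  have a: "PS (T.D 1 t3) = A.D 1 (PS t3)"
  proof (rule PS_local[OF T.local_D2 A.local_D2 _ _ _ _ t3s])
    fix t assume "t \<in> tspan TT [{u}, {s}]"
    then show "PS (T.D 0 t) = A.D 0 (PS t)"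
      by (rule PS_D_pairI) (use cons in simp_all)
  qed (use cons in auto)
  have b: "PS (T.D 0 (T.D 1 t3)) = A.D 0 (PS (T.D 1 t3))"
  proof (rule PS_local[OF T.local_D2 A.local_D2 _ _ _ _ d1s])
    fix t assume "t \<in> tspan TT [Rn 1, CT]"
    then show "PS (T.D 0 t) = A.D 0 (PS t)"
      by (rule PS_D_pairI) (simp_all add: PS_D1)
  qed auto
  have "PS (T.D 0 (T.M 0 t3)) = PS (T.M 1 (T.D 0 (T.D 1 t3)))" using T.hex1[of 1 0 t3] t3 by simp
  also have "\<dots> = A.M 1 (A.D 0 (A.D 1 (PS t3)))"
    using PS_M[of "T.D 0 (T.D 1 t3)" 3 1] T.deg3 t3 a b by simp
  also have "\<dots> = A.D 0 (A.M 0 (PS t3))" using A.hex1[of 1 0 "PS t3"] PS_cl[OF t3(2)] by simp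
  also have "A.M 0 (PS t3) = PS (T.M 0 t3)" using PS_M[of t3 3 0] t3 by simp
  also have "T.M 0 t3 = T.pt [pt [x] \<bullet> u, s]" unfolding t3_def using M_pt3(1)[of "pt [x]" u s] cons by simp
  finally show ?case .
next
  case (add u u')
  note l = pt2_linear(2)[OF \<open>s \<in> CT\<close>]
  show ?case using add lin_add[OF lin_comp[OF lin_comp[OF l T.D_linear[of 0]] PS_linear], of u u']
      lin_add[OF lin_comp[OF lin_comp[OF l PS_linear] A.D_linear[of 0]], of u u'] by simp
next
  case (smult a u)
  note l = pt2_linear(2)[OF \<open>s \<in> CT\<close>]
  show ?case using smult lin_smult[OF lin_comp[OF lin_comp[OF l T.D_linear[of 0]] PS_linear], of u a]
      lin_smult[OF lin_comp[OF lin_comp[OF l PS_linear] A.D_linear[of 0]], of u a] by simp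
qed

lemma PS_D0: "t \<in> T.Rn 2 ==> PS (T.D 0 t) = A.D 0 (PS t)"
  by (rule PS_D_pairI[of _ "CT" "CT"]) (use T.Rn_tspan2(1)[of t] PS_D2 in simp_all)

lemma PS_D:
  assumes "t \<in> T.Rn n" "i + 2 \<le> n"
  shows "PS (T.D i t) = A.D i (PS t)"
  by (rule PS_local_Rn[OF T.local_D2 A.local_D2 assms(2) PS_D0 assms(1)])

lemma PS_braid: "t \<in> T.Rn 2 ==> PS (braid TT t) = braid A (PS t)"
  using PS_D0[of t] T.D_0[of t] A.D_0[OF PS_Rn, of t] by simp

text \<open>The bialgebra axiom gives in \<open>A\<close> the recursion that
  \<open>comult_cons\<close> gives in T, so the two comultiplications can be compared letter by
  letter.\<close>

lemma comult_prim_mult: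
  assumes x: "x \<in> Pr" and y: "y \<in> A.C"
  shows "comult A (x \<otimes>\<^bsub>A\<^esub> y) = A.M 0 (A.pt [x] \<otimes>\<^bsub>A.TA\<^esub> comult A y) \<oplus>\<^bsub>A.TA\<^esub> A.M 1 (A.D 0 (A.pt [x] \<otimes>\<^bsub>A.TA\<^esub> comult A y))"
proof -
  have xc: "x \<in> A.C" using x by (rule Pr_cl)
  have xy: "A.pt [x, y] \<in> A.Rn 2" "A.pt [x, y] = A.pt [x] \<otimes>\<^bsub>A.TA\<^esub> (A.pt [y] \<otimes>\<^bsub>A.TA\<^esub> A.pt [])" 
    using xc y by (simp_all add: A.Rn_pure flip: A.pure_append)
  have r: "A.pt [x] \<in> A.Rn 1" "A.pt [y] \<in> A.Rn 1" "comult A y \<in> A.Rn 2" "comult A y \<in> A.CT"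
    using xc y A.comult_cl[OF y] by (simp_all add: A.Rn_pure A.Rn_cl)
  have "A.Cm 1 (A.pt [x, y]) = A.pt [x] \<otimes>\<^bsub>A.TA\<^esub> comult A y"
    unfolding xy(2) using A.whisker_key[OF A.comult_hom r(1,2), of "A.pt []"] y r by (simp add: A.comult_map_pure A.pure_Nil)
  moreover have "A.Cm 0 (A.pt [x] \<otimes>\<^bsub>A.TA\<^esub> comult A y) = comult A x \<otimes>\<^bsub>A.TA\<^esub> comult A y"
    using A.whisker_key[OF A.comult_hom A.Rn_one r(1), of "comult A y"] r A.Rn_cl[OF A.comult_cl[OF xc]] xc by (simp add: A.comult_map_pure)
  moreover have "map_tensor A 1 1 (comult_map A) (comult_map A) (A.pt [x, y]) = A.Cm 0 (A.Cm 1 (A.pt [x, y]))"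
    using A.map_tensor_eq[OF A.comult_hom A.comult_hom, of "A.pt [x, y]"] xy by simp
  moreover have "comult_map A (mult_map A (A.pt [x, y])) = braided_mult A (map_tensor A 1 1 (comult_map A) (comult_map A) (A.pt [x, y]))"
    using bialg xy(1) unfolding braided_bialgebra_def by blast
  ultimately show ?thesis
    using A.mult_map_pure[OF xc y] A.comult_map_pure[of "x \<otimes>\<^bsub>A\<^esub> y"] xc y A.braided_mult_primitive[OF xc r(3)]
    by (simp add: prim_comult[OF x])
qed

lemma PS_comult: "t \<in> CT ==> PS (comult TT t) = comult A (psi t)"
proof (induction t rule: TA_word_induct)
  case one
  have "comult A \<one>\<^bsub>A\<^esub> = A.pt [\<one>\<^bsub>A\<^esub>, \<one>\<^bsub>A\<^esub>]" using bialg by (simp add: braided_bialgebra_def)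
  then show ?case using PS_pure[of "[oneT, oneT]"] by (simp add: one_word psi_one)
next
  case (cons x t)
  let ?z = "T.pt [pt [x]] \<star> comult TT t"
  have z: "?z \<in> T.Rn 3"
    using T.Rn_mult[OF T.Rn_pure T.comult_cl, of "[pt [x]]" 1 t] cons by simp
  have pz: "PS ?z = A.pt [x] \<otimes>\<^bsub>A.TA\<^esub> comult A (psi t)"
    using PS_mult[of "T.pt [pt [x]]" "comult TT t"] PS_pure[of "[pt [x]]"] cons T.Rn_cl[OF T.comult_cl[of t]]
    by (simp add: psi_emb)
  have "PS (comult TT (pt [x] \<bullet> t)) = PS (T.M 0 ?z) \<oplus>\<^bsub>A.TA\<^esub> PS (T.M 1 (T.D 0 ?z))"
    using comult_cons[of x t] cons PS_add[of "T.M 0 ?z" "T.M 1 (T.D 0 ?z)"] z T.Rn_cl[OF z] by simp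
  also have "\<dots> = comult A (x \<otimes>\<^bsub>A\<^esub> psi t)"
    using PS_M[OF z, of 0] PS_M[of "T.D 0 ?z" 3 1] PS_D[OF z, of 0] T.D_Rn[OF z] comult_prim_mult[of x "psi t"] cons
    by (simp add: pz psi_cl)
  finally show ?case using cons by (simp add: psi_cons)
next
  case (add s t)
  note l = lin_comp[OF comult_word(1) PS_power] and l' = lin_comp[OF psi_linear A.comult_linear]
  show ?case using add lin_add[OF l, of s t] lin_add[OF l', of s t] by simp
next
  case (smult a s)
  note l = lin_comp[OF comult_word(1) PS_power] and l' = lin_comp[OF psi_linear A.comult_linear]
  show ?case using smult lin_smult[OF l, of s a] lin_smult[OF l', of s a] by simp
qed

lemma PS_pr: "t \<in> CT ==> PS (T.pr t) = A.pr (psi t)"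
  unfolding T.pr_def A.pr_def
  using PS_pure[of "[t, oneT]"] PS_pure[of "[oneT, t]"] T.Rn_cl[OF T.comult_cl[of t]]
  by (simp add: PS_minus PS_add PS_comult psi_one psi_cl)

section \<open>The chain of ideals\<close>

lemma subsp_TT: "subsp TT S \<longleftrightarrow> subsp TA S"
  by (simp add: subsp_def)

lemma ideal_TT:
  assumes "ideal K TT"
  shows "subsp TA K" "K \<subseteq> CT" "[|a \<in> CT; x \<in> K|] ==> a \<bullet> x \<in> K" "[|a \<in> CT; x \<in> K|] ==> x \<bullet> a \<in> K"
proof -
  show s: "subsp TA K" using T.A.ideal_subsp[OF assms] by (simp only: subsp_TT)
  show "K \<subseteq> CT" using s by (simp add: subsp_def)
  show "[|a \<in> CT; x \<in> K|] ==> a \<bullet> x \<in> K" "[|a \<in> CT; x \<in> K|] ==> x \<bullet> a \<in> K"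
    using ideal.I_l_closed[OF assms, of x a] ideal.I_r_closed[OF assms, of x a] by simp_all
qed

lemma ideal_TTI:
  assumes "subsp TA K" "\<And>a x. [|a \<in> CT; x \<in> K|] ==> a \<bullet> x \<in> K" "\<And>a x. [|a \<in> CT; x \<in> K|] ==> x \<bullet> a \<in> K"
  shows "ideal K TT"
  by (rule T.A.idealI_subsp) (use assms in \<open>simp_all add: subsp_TT\<close>)

lemma braid_D0: "[|t \<in> tspan TT [S1, S2]; S1 \<subseteq> CT; S2 \<subseteq> CT|] ==> braid TT t = T.D 0 t"
  by (rule T.D_0[symmetric], rule T.tspan_Rn'[of _ "[S1, S2]"]) simp_all

text \<open>An invariant strong enough to pass from \<open>K\<close> to \<open>kstep K\<close>: the
  braiding clauses feed \<open>prim_mod_props\<close>, and the coideal clause yields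
  \<open>kstep_incl\<close>.\<close>

definition "admissible K \<longleftrightarrow> ideal K TT \<and> (\<forall>x\<in>K. psi x = \<zero>\<^bsub>A\<^esub>) \<and>
  (\<forall>t\<in>tspan TT [K, Rn 1]. T.D 0 t \<in> tspan TT [Rn 1, K]) \<and>
  (\<forall>t\<in>tspan TT [Rn 1, K]. T.D 0 t \<in> tspan TT [K, Rn 1]) \<and> (\<forall>x\<in>K. comult TT x \<in> T.Nker K)"

text \<open>Lifts to T of the elements \<open>x - i (b x)\<close> that generate the ideal of the
  next stage.\<close>

definition "gens K = (\<lambda>x. x \<ominus>\<^bsub>TA\<^esub> pt [psi x]) ` T.prim_mod K"
definition "kstep K = Idl\<^bsub>TT\<^esub> (gens K)"

text \<open>\<open>psi \<otimes> psi\<close> kills \<open>Nker K\<close>, whence elements primitive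
  modulo \<open>K\<close> have primitive images. The braiding statements are
  \<open>braid_prim_mod_right\<close> and \<open>braid_prim_mod_left\<close> with \<open>S\<close>
  the space of letters.\<close>

lemma prim_mod_props:
  assumes "admissible K"
  shows "T.prim_mod K \<subseteq> CT" "subsp TA (T.prim_mod K)" "x \<in> T.prim_mod K ==> psi x \<in> Pr"
    "t \<in> tspan TT [T.prim_mod K, Rn 1] ==> T.D 0 t \<in> tspan TT [Rn 1, T.prim_mod K]"
    "t \<in> tspan TT [Rn 1, T.prim_mod K] ==> T.D 0 t \<in> tspan TT [T.prim_mod K, Rn 1]"
proof -
  have K: "ideal K TT" "\<And>x. x \<in> K ==> psi x = \<zero>\<^bsub>A\<^esub>"
    and cD: "\<And>t. t \<in> tspan TT [K, Rn 1] ==> T.D 0 t \<in> tspan TT [Rn 1, K]" "\<And>t. t \<in> tspan TT [Rn 1, K] ==> T.D 0 t \<in> tspan TT [K, Rn 1]"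
    using assms by (simp_all add: admissible_def)
  note Ks = ideal_TT(2)[OF K(1)]
  have KC: "K \<subseteq> T.C" using Ks by simp
  show sub: "T.prim_mod K \<subseteq> CT" by (auto simp: T.prim_mod_def)
  show "subsp TA (T.prim_mod K)" using T.prim_mod_subsp[OF KC] by (simp only: subsp_TT)
  show "psi x \<in> Pr" if "x \<in> T.prim_mod K"
  proof -
    have x: "x \<in> CT" "T.pr x \<in> T.Nker K" using that by (simp_all add: T.prim_mod_def)
    have "PS (T.pr x) = A.zeroT" by (rule T.tmap_Nker[OF A.tns psi_linear_TT KC K(2) x(2)])
    then have "A.pr (psi x) \<in> A.Nker {\<zero>\<^bsub>A\<^esub>}"
      using PS_pr[OF x(1)] subsp_zero[OF A.Nker_subsp[of "{\<zero>\<^bsub>A\<^esub>}"]] by simp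
    then show ?thesis unfolding prim_eq A.prim_mod_def using psi_cl[OF x(1)] by simp
  qed
  have R1: "subsp TT (Rn 1)" using Rn_subsp by (simp only: subsp_TT)
  have b1: "braid TT t = T.D 0 t" if "t \<in> tspan TT [S, Rn 1]" "S \<subseteq> CT" for t S
    by (rule braid_D0[OF that R1_sub])
  have b2: "braid TT t = T.D 0 t" if "t \<in> tspan TT [Rn 1, S]" "S \<subseteq> CT" for t S
    by (rule braid_D0[OF that(1) R1_sub that(2)])
  show "T.D 0 t \<in> tspan TT [Rn 1, T.prim_mod K]" if t: "t \<in> tspan TT [T.prim_mod K, Rn 1]"
  proof -
    have "braid TT t \<in> tspan TT [Rn 1, T.prim_mod K]"
    proof (rule T.braid_prim_mod_right[OF R1 KC _ _ _ t])
      fix t assume t: "t \<in> tspan TT [T.C, Rn 1]"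
      then have t': "t \<in> tspan TT [CT, Rn 1]" by simp
      show "braid TT t \<in> tspan TT [Rn 1, T.C]" using b1[OF t'] D_left[OF t'] by simp
      show "T.Cm 1 (T.D 0 t) = T.D 0 (T.D 1 (T.Cm 0 t))" by (rule comult_braid_right[OF t'])
    next
      fix t assume t: "t \<in> tspan TT [K, Rn 1]"
      show "braid TT t \<in> tspan TT [Rn 1, K]" using b1[OF t Ks] cD(1)[OF t] by simp
    qed
    then show ?thesis using b1[OF t sub] by simp
  qed
  show "T.D 0 t \<in> tspan TT [T.prim_mod K, Rn 1]" if t: "t \<in> tspan TT [Rn 1, T.prim_mod K]"
  proof -
    have "braid TT t \<in> tspan TT [T.prim_mod K, Rn 1]"
    proof (rule T.braid_prim_mod_left[OF R1 KC _ _ _ t])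
      fix t assume t: "t \<in> tspan TT [Rn 1, T.C]"
      then have t': "t \<in> tspan TT [Rn 1, CT]" by simp
      show "braid TT t \<in> tspan TT [T.C, Rn 1]" using b2[OF t'] D_right[OF t'] by simp
      show "T.Cm 0 (T.D 0 t) = T.D 1 (T.D 0 (T.Cm 1 t))" by (rule comult_braid_left[OF t'])
    next
      fix t assume t: "t \<in> tspan TT [Rn 1, K]"
      show "braid TT t \<in> tspan TT [K, Rn 1]" using b2[OF t Ks] cD(2)[OF t] by simp
    qed
    then show ?thesis using b2[OF t sub] by simp
  qed
qed

text \<open>On \<open>prim_mod K\<close> this is \<open>pt [psi x]\<close>. Composition with
  \<open>ret\<close> makes it a linear map on all of T, so that it can be applied in a slot of a
  tensor.\<close>

definition "th x = pt [ret (psi x)]"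
definition "th1 = multilinear_lift T.TA 1 (\<lambda>xs. T.pt [th (xs ! 0)])"

lemma th_linear: "th \<in> linear_maps TT TT"
  unfolding th_def using lin_comp[OF lin_comp[OF psi_linear ret(1)] pure1_linear(1)] by (simp only: linear_TT)

lemma th_Rn: "x \<in> CT ==> th x \<in> Rn 1" and th_cl: "x \<in> CT ==> th x \<in> CT"
proof -
  show "x \<in> CT ==> th x \<in> Rn 1"
    unfolding th_def using lin_cl[OF lin_comp[OF psi_linear ret(1)], of x] by (intro Rn_pure) simp_all
  then show "x \<in> CT ==> th x \<in> CT" by (rule Rn_cl)
qed

lemma th_prim: "psi x \<in> Pr ==> th x = pt [psi x]"
  by (simp add: th_def ret(2))

lemma th_id: "v \<in> Rn 1 ==> th v = v"
  by (erule Rn1_E) (simp add: th_def psi_emb ret(2))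

lemma psi_th: "psi x \<in> Pr ==> psi (th x) = psi x"
  by (simp add: th_prim psi_emb)

lemma th1: "th1 \<in> hom_power TT 1 1" "x \<in> CT ==> th1 (T.pt [x]) = T.pt [th x]"
  using T.hom_1_I[OF lin_comp[OF th_linear T.pure1_linear(2)]] by (simp_all add: th1_def)

lemma th1_pure: "[|x \<in> CT; y \<in> CT|] ==> T.Wh 0 1 th1 (T.pt [x, y]) = T.pt [th x, y]"
  "[|x \<in> CT; y \<in> CT|] ==> T.Wh 1 1 th1 (T.pt [x, y]) = T.pt [x, th y]"
proof -
  assume x: "x \<in> CT" and y: "y \<in> CT"
  show "T.Wh 0 1 th1 (T.pt [x, y]) = T.pt [th x, y]"
    using T.whisker_pure[OF th1(1), of "[]" "[x]" "[y]" 0] x y th_cl[OF x]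
    by (simp add: th1(2) T.pure_Nil flip: T.pure_append)
  show "T.Wh 1 1 th1 (T.pt [x, y]) = T.pt [x, th y]"
    using T.whisker_pure[OF th1(1), of "[x]" "[y]" "[]" 1] x y th_cl[OF y]
    by (simp add: th1(2) T.pure_Nil flip: T.pure_append)
qed

text \<open>On letters \<open>psi\<close> is the identity of \<open>Pr\<close>, so
  \<open>ret\<close> leads back to the letter, and likewise on pairs of letters.\<close>

lemma PS_inj_11:
  assumes "s \<in> tspan TT [Rn 1, Rn 1]" "t \<in> tspan TT [Rn 1, Rn 1]" "PS s = PS t"
  shows "s = t"
proof -
  have l: "(\<lambda>a. pt [ret a]) \<in> linear_maps A TT"
    using lin_comp[OF ret(1) pure1_linear(1)] by (simp only: linear_TT)
  have r: "tmap TT (\<lambda>a. pt [ret a]) (PS t) = t" if t: "t \<in> tspan TT [Rn 1, Rn 1]" for t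
  proof -
    have "tmap TT (\<lambda>a. pt [ret a]) (PS t) = tmap TT (\<lambda>x. pt [ret (psi x)]) t"
      by (rule tmap_comp[OF T.tns A.tns T.tns psi_linear_TT l T.tspan_cl[OF _ t]]) simp
    also have "\<dots> = t"
    proof (rule T.tmap_id_tspan[OF th_linear[unfolded th_def] _ _ t])
      fix S x assume "S \<in> set [Rn 1, Rn 1]" "x \<in> S"
      then have "x \<in> Rn 1" by (simp only: list.set insert_iff empty_iff simp_thms) 
      then show "pt [ret (psi x)] = x" by (rule th_id[unfolded th_def])
    qed simp
    finally show ?thesis .
  qed
  show ?thesis by (rule trans[OF r[OF assms(1), unfolded assms(3), symmetric] r[OF assms(2)]])
qed

lemma gens_sub: "admissible K ==> gens K \<subseteq> CT"
proof
  fix z assume K: "admissible K" and "z \<in> gens K"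
  then obtain x where x: "x \<in> T.prim_mod K" "z = x \<ominus>\<^bsub>TA\<^esub> pt [psi x]" by (auto simp: gens_def)
  then show "z \<in> CT"
    using subsetD[OF prim_mod_props(1)[OF K] x(1)] prim_mod_props(3)[OF K x(1)] by simp
qed

lemma D_pairI:
  assumes t: "t \<in> tspan TT [S1, S2]" and S: "S1 \<subseteq> CT" "S2 \<subseteq> CT" and Z: "subsp T.TA Z"
    and eq: "\<And>x y. [|x \<in> S1; y \<in> S2|] ==> T.D 0 (T.pt [x, y]) \<in> Z"
  shows "T.D 0 t \<in> Z"
proof (rule T.tspan_imageI[OF T.D_linear _ Z _ t])
  fix ss assume "list_all2 (\<in>) ss [S1, S2]"
  then obtain x y where "ss = [x, y]" "x \<in> S1" "y \<in> S2" by (auto simp: list_all2_Cons2)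
  then show "T.D 0 (T.pt ss) \<in> Z" using eq by (simp only:)
qed (use S in simp)

text \<open>A hexagon identity crosses a product with a letter by crossing its factors one after the
  other. The sets are left open so that multiplication of an ideal element from either side is
  covered.\<close>

lemma hex_right:
  assumes S: "S1 \<subseteq> CT" "S2 \<subseteq> CT" "S1' \<subseteq> CT" "S2' \<subseteq> CT" "S3 \<subseteq> CT"
    and d1: "\<And>t. t \<in> tspan TT [S1, Rn 1] ==> T.D 0 t \<in> tspan TT [Rn 1, S1']"
    and d2: "\<And>t. t \<in> tspan TT [S2, Rn 1] ==> T.D 0 t \<in> tspan TT [Rn 1, S2']"
    and m: "\<And>x y. [|x \<in> S1'; y \<in> S2'|] ==> x \<bullet> y \<in> S3" and a: "a \<in> S1" and x: "x \<in> S2" and v: "v \<in> Rn 1"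
  shows "T.D 0 (T.pt [a \<bullet> x, v]) \<in> tspan TT [Rn 1, S3]"
proof -
  have c: "a \<in> CT" "x \<in> CT" "v \<in> CT" using S a x v by auto
  define t3 where "t3 = T.pt [a, x, v]"
  have t3c: "t3 \<in> T.CT" using c by (simp add: t3_def)
  have s0: "t3 \<in> tspan TT ([S1] @ [S2, Rn 1] @ [])"
    unfolding t3_def using a x v by (intro T.tspan_pure) simp
  have "T.D 1 t3 \<in> tspan TT ([S1] @ [Rn 1, S2'] @ [])"
    by (rule T.D_tspan[OF d2 s0]) (use S in simp_all)
  then have s1: "T.D 1 t3 \<in> tspan TT ([] @ [S1, Rn 1] @ [S2'])" by simp
  have "T.D 0 (T.D 1 t3) \<in> tspan TT ([] @ [Rn 1, S1'] @ [S2'])"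
    by (rule T.D_tspan[OF d1 s1]) (use S in simp_all)
  then have s2: "T.D 0 (T.D 1 t3) \<in> tspan TT ([Rn 1] @ [S1', S2'] @ [])" by simp
  have "T.M 1 (T.D 0 (T.D 1 t3)) \<in> tspan TT ([Rn 1] @ [S3] @ [])"
    by (rule T.mult_tspan[OF _ _ _ _ s2]) (use S m in simp_all)
  then show ?thesis using T.hex1[of 1 0 t3] t3c M_pt3(1)[OF c] by (simp add: t3_def)
qed

lemma hex_left:
  assumes S: "S1 \<subseteq> CT" "S2 \<subseteq> CT" "S1' \<subseteq> CT" "S2' \<subseteq> CT" "S3 \<subseteq> CT"
    and d1: "\<And>t. t \<in> tspan TT [Rn 1, S1] ==> T.D 0 t \<in> tspan TT [S1', Rn 1]"
    and d2: "\<And>t. t \<in> tspan TT [Rn 1, S2] ==> T.D 0 t \<in> tspan TT [S2', Rn 1]"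
    and m: "\<And>x y. [|x \<in> S1'; y \<in> S2'|] ==> x \<bullet> y \<in> S3" and a: "a \<in> S1" and x: "x \<in> S2" and v: "v \<in> Rn 1"
  shows "T.D 0 (T.pt [v, a \<bullet> x]) \<in> tspan TT [S3, Rn 1]"
proof -
  have c: "v \<in> CT" "a \<in> CT" "x \<in> CT" using S a x v by auto
  define t3 where "t3 = T.pt [v, a, x]"
  have t3c: "t3 \<in> T.CT" using c by (simp add: t3_def)
  have s0: "t3 \<in> tspan TT ([] @ [Rn 1, S1] @ [S2])"
    unfolding t3_def using a x v by (intro T.tspan_pure) simp
  have "T.D 0 t3 \<in> tspan TT ([] @ [S1', Rn 1] @ [S2])"
    by (rule T.D_tspan[OF d1 s0]) (use S in simp_all)
  then have s1: "T.D 0 t3 \<in> tspan TT ([S1'] @ [Rn 1, S2] @ [])" by simp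
  have "T.D 1 (T.D 0 t3) \<in> tspan TT ([S1'] @ [S2', Rn 1] @ [])"
    by (rule T.D_tspan[OF d2 s1]) (use S in simp_all)
  then have s2: "T.D 1 (T.D 0 t3) \<in> tspan TT ([] @ [S1', S2'] @ [Rn 1])" by simp
  have "T.M 0 (T.D 1 (T.D 0 t3)) \<in> tspan TT ([] @ [S3] @ [Rn 1])"
    by (rule T.mult_tspan[OF _ _ _ _ s2]) (use S m in simp_all)
  then show ?thesis using T.hex2[of 1 0 t3] t3c M_pt3(2)[OF c] by (simp add: t3_def)
qed

context
  fixes K
  assumes K: "admissible K"
begin

lemma gen_in: "y \<in> T.prim_mod K ==> y \<ominus>\<^bsub>TA\<^esub> th y \<in> gens K"
  using th_prim[OF prim_mod_props(3)[OF K]] by (auto simp: gens_def)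

text \<open>Replacing a factor that is primitive modulo \<open>K\<close> by its letter is invisible
  to \<open>PS\<close>, and the error has a generator in that slot.\<close>

lemma th_slot:
  assumes i: "length As = i" and ok: "As @ [T.prim_mod K] @ Cs \<in> lists (Pow T.C)"
    and w: "w \<in> tspan TT (As @ [T.prim_mod K] @ Cs)"
  shows "T.Wh i 1 th1 w \<in> tspan TT (As @ [Rn 1] @ Cs)" "PS (T.Wh i 1 th1 w) = PS w"
    "w \<ominus>\<^bsub>T.TA\<^esub> T.Wh i 1 th1 w \<in> tspan TT (As @ [gens K] @ Cs)"
proof -
  note pm = prim_mod_props[OF K]
  have E: "\<exists>x. u = T.pt [x] \<and> x \<in> T.prim_mod K \<and> x \<in> CT" if "u \<in> tspan TT [T.prim_mod K]" for u
    using that pm(1,2) by (auto simp: T.tspan1 subsp_TT)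
  have th: "th1 u \<in> tspan TT [Rn 1]" "PS (th1 u) = PS u" "u \<ominus>\<^bsub>T.TA\<^esub> th1 u \<in> tspan TT [gens K]"
    if u: "u \<in> tspan TT [T.prim_mod K]" for u
  proof -
    obtain x where x: "u = T.pt [x]" "x \<in> T.prim_mod K" "x \<in> CT" using E[OF u] by blast
    note eq = x(1) th1(2)[OF x(3)]
    show "th1 u \<in> tspan TT [Rn 1]" unfolding eq by (rule T.tspan_pure) (use th_Rn[OF x(3)] in simp)
    show "PS (th1 u) = PS u"
      unfolding eq using PS_pure[of "[th x]"] PS_pure[of "[x]"] x(3) th_cl[OF x(3)] psi_th[OF pm(3)[OF x(2)]] by simp
    have "T.pt [x] \<ominus>\<^bsub>T.TA\<^esub> T.pt [th x] = T.pt [x \<ominus>\<^bsub>TA\<^esub> th x]"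
      using lin_minus[OF T.pure1_linear(1)[unfolded linear_TT] R.vsp T.R.vsp x(3) th_cl[OF x(3)]] by simp
    then show "u \<ominus>\<^bsub>T.TA\<^esub> th1 u \<in> tspan TT [gens K]"
      unfolding eq using gen_in[OF x(2)] by (auto intro!: T.tspan_pure)
  qed
  note F = T.local_at_whisker[OF th1(1), of i]
  have len: "length [T.prim_mod K] = 1" by simp
  show "T.Wh i 1 th1 w \<in> tspan TT (As @ [Rn 1] @ Cs)"
    by (rule T.local_at_tspan[OF F ok _ i len th(1) w]) simp
  show "PS (T.Wh i 1 th1 w) = PS w"
    by (rule PS_local[OF F A.local_at_id ok i len th(2) w])
  show "w \<ominus>\<^bsub>T.TA\<^esub> T.Wh i 1 th1 w \<in> tspan TT (As @ [gens K] @ Cs)"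
    by (rule T.local_at_tspan[OF T.local_at_diff[OF T.local_at_id F] ok _ i len th(3) w]) (use gens_sub[OF K] in simp)
qed

lemma slot1:
  assumes "w \<in> tspan TT [Rn 1, T.prim_mod K]"
  shows "T.Wh 1 1 th1 w \<in> tspan TT [Rn 1, Rn 1]" "PS (T.Wh 1 1 th1 w) = PS w"
    "w \<ominus>\<^bsub>T.TA\<^esub> T.Wh 1 1 th1 w \<in> tspan TT [Rn 1, gens K]"
  using th_slot[of "[Rn 1]" 1 "[]" w] assms prim_mod_props(1)[OF K] by simp_all

lemma slot0:
  assumes "w \<in> tspan TT [T.prim_mod K, Rn 1]"
  shows "T.Wh 0 1 th1 w \<in> tspan TT [Rn 1, Rn 1]" "PS (T.Wh 0 1 th1 w) = PS w"
    "w \<ominus>\<^bsub>T.TA\<^esub> T.Wh 0 1 th1 w \<in> tspan TT [gens K, Rn 1]"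
  using th_slot[of "[]" 0 "[Rn 1]" w] assms prim_mod_props(1)[OF K] by simp_all

text \<open>Crossing commutes with the replacement of \<open>x\<close> by \<open>th x\<close>: both
  results are tensors of two letters with the same image under \<open>PS\<close>, which is injective
  on these. By subtraction, a generator crosses to generators.\<close>

lemma braid_gens:
  assumes z: "z \<in> gens K" and v: "v \<in> Rn 1"
  shows "T.D 0 (T.pt [z, v]) \<in> tspan TT [Rn 1, gens K]" "T.D 0 (T.pt [v, z]) \<in> tspan TT [gens K, Rn 1]"
proof -
  note pm = prim_mod_props[OF K]
  obtain x where x: "x \<in> T.prim_mod K" "z = x \<ominus>\<^bsub>TA\<^esub> pt [psi x]" using z by (auto simp: gens_def)
  have zth: "z = x \<ominus>\<^bsub>TA\<^esub> th x" using x th_prim[OF pm(3)[OF x(1)]] by simp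
  have xc: "x \<in> CT" using pm(1) x(1) by blast
  have vc: "v \<in> CT" using v by simp
  have R2: "t \<in> T.Rn 2" if "t \<in> tspan TT [S1, S2]" "S1 \<subseteq> CT" "S2 \<subseteq> CT" for t S1 S2
    by (rule T.tspan_Rn'[OF that(1)]) (use that in simp_all)
  note th = th_cl[OF xc]
  have t: "T.pt [x, v] \<in> tspan TT [T.prim_mod K, Rn 1]" "T.pt [v, x] \<in> tspan TT [Rn 1, T.prim_mod K]"
    using x(1) v by (auto intro!: T.tspan_pure)
  note d = pm(4)[OF t(1)] pm(5)[OF t(2)]
  have "T.D 0 (T.Wh 0 1 th1 (T.pt [x, v])) = T.Wh 1 1 th1 (T.D 0 (T.pt [x, v]))"
    by (rule PS_inj_11[OF D_11[OF slot0(1)[OF t(1)]] slot1(1)[OF d(1)]])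
      (simp only: slot1(2)[OF d(1)] slot0(2)[OF t(1)] PS_D0[OF R2[OF slot0(1)[OF t(1)] R1_sub R1_sub]] PS_D0[OF R2[OF t(1) pm(1) R1_sub]])
  then have "T.D 0 (T.pt [x, v] \<ominus>\<^bsub>T.TA\<^esub> T.pt [th x, v]) = T.D 0 (T.pt [x, v]) \<ominus>\<^bsub>T.TA\<^esub> T.Wh 1 1 th1 (T.D 0 (T.pt [x, v]))"
    using lin_minus[OF T.D_linear[of 0] T.R.vsp T.R.vsp, of "T.pt [x, v]" "T.pt [th x, v]"] xc vc th
    by (simp add: th1_pure(1)[OF xc vc])
  moreover have "T.pt [x, v] \<ominus>\<^bsub>T.TA\<^esub> T.pt [th x, v] = T.pt [z, v]"
    using lin_minus[OF pt2_linear(2)[OF vc] R.vsp T.R.vsp xc th] zth by simp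
  ultimately show "T.D 0 (T.pt [z, v]) \<in> tspan TT [Rn 1, gens K]" using slot1(3)[OF d(1)] by simp
  have "T.D 0 (T.Wh 1 1 th1 (T.pt [v, x])) = T.Wh 0 1 th1 (T.D 0 (T.pt [v, x]))"
    by (rule PS_inj_11[OF D_11[OF slot1(1)[OF t(2)]] slot0(1)[OF d(2)]])
      (simp only: slot0(2)[OF d(2)] slot1(2)[OF t(2)] PS_D0[OF R2[OF slot1(1)[OF t(2)] R1_sub R1_sub]] PS_D0[OF R2[OF t(2) R1_sub pm(1)]])
  then have "T.D 0 (T.pt [v, x] \<ominus>\<^bsub>T.TA\<^esub> T.pt [v, th x]) = T.D 0 (T.pt [v, x]) \<ominus>\<^bsub>T.TA\<^esub> T.Wh 0 1 th1 (T.D 0 (T.pt [v, x]))"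
    using lin_minus[OF T.D_linear[of 0] T.R.vsp T.R.vsp, of "T.pt [v, x]" "T.pt [v, th x]"] xc vc th
    by (simp add: th1_pure(2)[OF vc xc])
  moreover have "T.pt [v, x] \<ominus>\<^bsub>T.TA\<^esub> T.pt [v, th x] = T.pt [v, z]"
    using lin_minus[OF pt2_linear(1)[OF vc] R.vsp T.R.vsp xc th] zth by simp
  ultimately show "T.D 0 (T.pt [v, z]) \<in> tspan TT [gens K, Rn 1]" using slot0(3)[OF d(2)] by simp
qed

lemma kstep_ideal: "ideal (kstep K) TT" and gens_kstep: "gens K \<subseteq> kstep K"
  using T.A.A.genideal_ideal[of "gens K"] T.A.A.genideal_self[of "gens K"] gens_sub[OF K] by (simp_all add: kstep_def)

lemma kstep_least: "ideal J TT ==> gens K \<subseteq> J ==> kstep K \<subseteq> J"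
  unfolding kstep_def by (rule T.A.A.genideal_minimal)

lemma kstep_psi: "x \<in> kstep K ==> psi x = \<zero>\<^bsub>A\<^esub>"
proof -
  have "ideal {t \<in> CT. psi t \<in> {\<zero>\<^bsub>A\<^esub>}} TT"
  proof (rule ideal_TTI)
    show "subsp TA {t \<in> CT. psi t \<in> {\<zero>\<^bsub>A\<^esub>}}"
      by (rule subsp_vimage[OF psi_linear R.vsp A.A.vsp A.A.subsp_0])
  qed (auto simp: psi_mult psi_cl)
  moreover have "gens K \<subseteq> {t \<in> CT. psi t \<in> {\<zero>\<^bsub>A\<^esub>}}"
  proof
    fix z assume z: "z \<in> gens K"
    then obtain x where x: "x \<in> T.prim_mod K" "z = x \<ominus>\<^bsub>TA\<^esub> pt [psi x]" by (auto simp: gens_def)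
    note px = prim_mod_props(3)[OF K x(1)]
    have xc: "x \<in> CT" using prim_mod_props(1)[OF K] x by blast
    have "psi z = \<zero>\<^bsub>A\<^esub>"
      using lin_minus[OF psi_linear R.vsp A.A.vsp xc, of "pt [psi x]"] px psi_cl[OF xc] x(2)
      by (simp add: psi_emb)
    then show "z \<in> {t \<in> CT. psi t \<in> {\<zero>\<^bsub>A\<^esub>}}" using z gens_sub[OF K] by auto
  qed
  ultimately show "x \<in> kstep K ==> psi x = \<zero>\<^bsub>A\<^esub>" using kstep_least by blast
qed

text \<open>An element of \<open>K\<close> is primitive modulo the coideal \<open>K\<close> and is
  killed by \<open>psi\<close>, so the generator attached to it is the element itself.\<close>

lemma kstep_incl: "K \<subseteq> kstep K"
proof
  fix k assume k: "k \<in> K"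
  have Kp: "ideal K TT" "psi k = \<zero>\<^bsub>A\<^esub>" "comult TT k \<in> T.Nker K" using K k by (simp_all add: admissible_def)
  note Ks = ideal_TT(2)[OF Kp(1)]
  have KC: "K \<subseteq> T.C" using Ks by simp
  have kc: "k \<in> CT" using Ks k by blast
  note sub = T.Nker_subsp[OF KC]
  have "T.pt [k, oneT] \<in> tspan TT [K, T.C]" "T.pt [oneT, k] \<in> tspan TT [T.C, K]"
    by (rule T.tspan_pure; use k in simp)+
  then have "T.pt [k, oneT] \<in> T.Nker K" "T.pt [oneT, k] \<in> T.Nker K"
    using T.Nker_incl[OF KC] by auto
  then have "T.pr k \<in> T.Nker K"
    unfolding T.pr_def using T.R.subsp_minus[OF sub Kp(3) subsp_add[OF sub]] by simp
  then have "k \<in> T.prim_mod K" using kc by (simp add: T.prim_mod_def)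
  moreover have "pt [\<zero>\<^bsub>A\<^esub>] = zeroT"
    using lin_zero[OF pure1_linear(1) V.vsp R.vsp] by simp
  ultimately have "k \<ominus>\<^bsub>TA\<^esub> zeroT \<in> gens K" unfolding gens_def using Kp(2) by force
  then show "k \<in> kstep K" using gens_kstep kc by auto
qed

lemma kstep_braid:
  shows "t \<in> tspan TT [kstep K, Rn 1] ==> T.D 0 t \<in> tspan TT [Rn 1, kstep K]"
    and "t \<in> tspan TT [Rn 1, kstep K] ==> T.D 0 t \<in> tspan TT [kstep K, Rn 1]"
proof -
  let ?K = "kstep K"
  note kid = ideal_TT[OF kstep_ideal]
  note gK = gens_kstep
  have sub: "subsp T.TA (tspan TT [Rn 1, ?K])" "subsp T.TA (tspan TT [?K, Rn 1])"
    by (rule T.tspan_subsp, use kid(2) in simp)+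
  have mono: "tspan TT [Rn 1, gens K] \<subseteq> tspan TT [Rn 1, ?K]" "tspan TT [gens K, Rn 1] \<subseteq> tspan TT [?K, Rn 1]"
    by (rule T.tspan_mono; use gK kid(2) in simp)+
  \<comment> \<open>The elements that cross every letter into the right place form an ideal by
    \<open>hex_right\<close>, so it suffices to look at the generators; \<open>J\<close> is its
    mirror image.\<close>
  define I where "I = {t \<in> CT. \<forall>v\<in>Rn 1. T.D 0 (T.pt [t, v]) \<in> tspan TT [Rn 1, ?K]}"
  define J where "J = {t \<in> CT. \<forall>v\<in>Rn 1. T.D 0 (T.pt [v, t]) \<in> tspan TT [?K, Rn 1]}"
  have Ix: "T.D 0 t \<in> tspan TT [Rn 1, ?K]" if "x \<in> I" "t \<in> tspan TT [{x}, Rn 1]" for x t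
    by (rule D_pairI[OF that(2) _ R1_sub sub(1)]) (use that(1) in \<open>auto simp: I_def\<close>)
  have Jx: "T.D 0 t \<in> tspan TT [?K, Rn 1]" if "x \<in> J" "t \<in> tspan TT [Rn 1, {x}]" for x t
    by (rule D_pairI[OF that(2) R1_sub _ sub(2)]) (use that(1) in \<open>auto simp: J_def\<close>)
  have "ideal I TT"
  proof (rule ideal_TTI)
    show "subsp TA I" unfolding I_def
    proof (rule subsp_All[OF R.vsp])
      fix v assume "v \<in> Rn 1"
      then have v: "v \<in> CT" by simp
      show "subsp TA {t \<in> CT. T.D 0 (T.pt [t, v]) \<in> tspan TT [Rn 1, ?K]}"
        by (rule subsp_vimage[OF lin_comp[OF pt2_linear(2)[OF v] T.D_linear[of 0]] R.vsp T.R.vsp sub(1)])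
    qed
    fix a x assume a: "a \<in> CT" and x: "x \<in> I"
    have xc: "{x} \<subseteq> CT" using x by (simp add: I_def)
    have "T.D 0 (T.pt [a \<bullet> x, v]) \<in> tspan TT [Rn 1, ?K]" if "v \<in> Rn 1" for v
      by (rule hex_right[OF order_refl xc order_refl kid(2) kid(2) D_left Ix[OF x] kid(3) a _ that]) simp_all
    then show "a \<bullet> x \<in> I" using a xc by (simp add: I_def)
    have "T.D 0 (T.pt [x \<bullet> a, v]) \<in> tspan TT [Rn 1, ?K]" if "v \<in> Rn 1" for v
      by (rule hex_right[OF xc order_refl kid(2) order_refl kid(2) Ix[OF x] D_left kid(4) _ a that]) simp_all
    then show "x \<bullet> a \<in> I" using a xc by (simp add: I_def)
  qed
  moreover have "gens K \<subseteq> I"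
    using braid_gens(1) mono(1) gens_sub[OF K] unfolding I_def by blast
  ultimately have KI: "?K \<subseteq> I" by (rule kstep_least)
  have "ideal J TT"
  proof (rule ideal_TTI)
    show "subsp TA J" unfolding J_def
    proof (rule subsp_All[OF R.vsp])
      fix v assume "v \<in> Rn 1"
      then have v: "v \<in> CT" by simp
      show "subsp TA {t \<in> CT. T.D 0 (T.pt [v, t]) \<in> tspan TT [?K, Rn 1]}"
        by (rule subsp_vimage[OF lin_comp[OF pt2_linear(1)[OF v] T.D_linear[of 0]] R.vsp T.R.vsp sub(2)])
    qed
    fix a x assume a: "a \<in> CT" and x: "x \<in> J"
    have xc: "{x} \<subseteq> CT" using x by (simp add: J_def)
    have "T.D 0 (T.pt [v, a \<bullet> x]) \<in> tspan TT [?K, Rn 1]" if "v \<in> Rn 1" for v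
      by (rule hex_left[OF order_refl xc order_refl kid(2) kid(2) D_right Jx[OF x] kid(3) a _ that]) simp_all
    then show "a \<bullet> x \<in> J" using a xc by (simp add: J_def)
    have "T.D 0 (T.pt [v, x \<bullet> a]) \<in> tspan TT [?K, Rn 1]" if "v \<in> Rn 1" for v
      by (rule hex_left[OF xc order_refl kid(2) order_refl kid(2) Jx[OF x] D_right kid(4) _ a that]) simp_all
    then show "x \<bullet> a \<in> J" using a xc by (simp add: J_def)
  qed
  moreover have "gens K \<subseteq> J"
    using braid_gens(2) mono(2) gens_sub[OF K] unfolding J_def by blast
  ultimately have KJ: "?K \<subseteq> J" by (rule kstep_least)
  show "t \<in> tspan TT [?K, Rn 1] ==> T.D 0 t \<in> tspan TT [Rn 1, ?K]"
    by (erule D_pairI[OF _ kid(2) R1_sub sub(1)]) (use KI in \<open>auto simp: I_def\<close>)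
  show "t \<in> tspan TT [Rn 1, ?K] ==> T.D 0 t \<in> tspan TT [?K, Rn 1]"
    by (erule D_pairI[OF _ R1_sub kid(2) sub(2)]) (use KJ in \<open>auto simp: J_def\<close>)
qed

text \<open>These are the four operators in \<open>comult_cons\<close> and
  \<open>comult_right\<close>. Their stability on \<open>Nker\<close> gives the coideal property
  under multiplication by a letter from either side.\<close>

lemma kstep_Nker:
  assumes y: "y \<in> Pr" and t: "t \<in> T.Nker (kstep K)"
  shows "T.M 0 (T.pt [pt [y]] \<star> t) \<in> T.Nker (kstep K)" "T.M 1 (T.D 0 (T.pt [pt [y]] \<star> t)) \<in> T.Nker (kstep K)"
    "T.M 0 (T.D 1 (t \<star> T.pt [pt [y]])) \<in> T.Nker (kstep K)" "T.M 1 (t \<star> T.pt [pt [y]]) \<in> T.Nker (kstep K)"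
proof -
  let ?K = "kstep K" and ?v = "T.pt [pt [y]]"
  note kid = ideal_TT[OF kstep_ideal]
  have KC: "?K \<subseteq> T.C" using kid(2) by simp
  note N = T.Nker_incl[OF KC, simplified] and subN = T.Nker_subsp[OF KC]
  have v: "?v \<in> tspan TT [Rn 1]" "?v \<in> T.CT" using y by (auto intro!: T.tspan_pure)
  have ok: "[Rn 1] \<in> lists (Pow T.C)" "[?K, CT] \<in> lists (Pow T.C)" "[CT, ?K] \<in> lists (Pow T.C)"
    using kid(2) by simp_all
  have F: "F t \<in> T.Nker ?K" if F: "F \<in> linear_maps T.TA T.TA" and "\<And>t. t \<in> tspan TT [?K, CT] ==> F t \<in> T.Nker ?K"
    "\<And>t. t \<in> tspan TT [CT, ?K] ==> F t \<in> T.Nker ?K" for F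
  proof -
    have "T.Nker ?K \<subseteq> {t \<in> T.CT. F t \<in> T.Nker ?K}"
      by (rule T.Nker_least[OF subsp_vimage[OF F T.R.vsp T.R.vsp subN]])
        (use that(2,3) T.tspan_cl[OF ok(2)] T.tspan_cl[OF ok(3)] in auto)
    then show ?thesis using t by blast
  qed
  have vl: "?v \<star> t \<in> tspan TT [Rn 1, ?K, CT]" if "t \<in> tspan TT [?K, CT]" for t
    using T.tspan_mult[OF ok(1,2) v(1) that] by simp
  have vr: "?v \<star> t \<in> tspan TT [Rn 1, CT, ?K]" if "t \<in> tspan TT [CT, ?K]" for t
    using T.tspan_mult[OF ok(1,3) v(1) that] by simp
  have lv: "t \<star> ?v \<in> tspan TT [?K, CT, Rn 1]" if "t \<in> tspan TT [?K, CT]" for t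
    using T.tspan_mult[OF ok(2,1) that v(1)] by simp
  have rv: "t \<star> ?v \<in> tspan TT [CT, ?K, Rn 1]" if "t \<in> tspan TT [CT, ?K]" for t
    using T.tspan_mult[OF ok(3,1) that v(1)] by simp
  have m0: "T.M 0 t \<in> tspan TT [S3, S]" if "t \<in> tspan TT [S1, S2, S]" "S1 \<subseteq> CT" "S2 \<subseteq> CT" "S3 \<subseteq> CT" "S \<subseteq> CT"
    "\<And>x y. [|x \<in> S1; y \<in> S2|] ==> x \<bullet> y \<in> S3" for t S1 S2 S3 S
    using T.mult_tspan[of S1 S2 S3 t "[]" "[S]" 0] that by simp
  have m1: "T.M 1 t \<in> tspan TT [S, S3]" if "t \<in> tspan TT [S, S1, S2]" "S1 \<subseteq> CT" "S2 \<subseteq> CT" "S3 \<subseteq> CT" "S \<subseteq> CT"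
    "\<And>x y. [|x \<in> S1; y \<in> S2|] ==> x \<bullet> y \<in> S3" for t S1 S2 S3 S
    using T.mult_tspan[of S1 S2 S3 t "[S]" "[]" 1] that by simp
  have R1m: "x \<bullet> y \<in> ?K" if "x \<in> Rn 1" "y \<in> ?K" for x y using kid(3)[OF _ that(2)] that(1) by simp
  have mR1: "y \<bullet> x \<in> ?K" if "x \<in> Rn 1" "y \<in> ?K" for x y using kid(4)[OF _ that(2)] that(1) by simp
  note c = order_refl[of "CT"]
  have cm: "x \<bullet> y \<in> CT" if "x \<in> Rn 1 \<or> x \<in> CT" "y \<in> Rn 1 \<or> y \<in> CT" for x y using that by auto
  have d0: "T.D 0 t \<in> tspan TT [S3, S4, S]" if "t \<in> tspan TT [S1, S2, S]" "S1 \<subseteq> CT" "S2 \<subseteq> CT" "S3 \<subseteq> CT"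
    "S4 \<subseteq> CT" "S \<subseteq> CT" "\<And>t. t \<in> tspan TT [S1, S2] ==> T.D 0 t \<in> tspan TT [S3, S4]" for t S1 S2 S3 S4 S
    using T.D_tspan[of S1 S2 S3 S4 t "[]" "[S]" 0] that by simp
  have d1: "T.D 1 t \<in> tspan TT [S, S3, S4]" if "t \<in> tspan TT [S, S1, S2]" "S1 \<subseteq> CT" "S2 \<subseteq> CT" "S3 \<subseteq> CT"
    "S4 \<subseteq> CT" "S \<subseteq> CT" "\<And>t. t \<in> tspan TT [S1, S2] ==> T.D 0 t \<in> tspan TT [S3, S4]" for t S1 S2 S3 S4 S
    using T.D_tspan[of S1 S2 S3 S4 t "[S]" "[]" 1] that by simp
  note kb = kstep_braid
  note k = kid(2)
  show "T.M 0 (?v \<star> t) \<in> T.Nker ?K"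
  proof (rule F[OF lin_comp[OF T.lmult_linear[OF v(2)] T.M_linear]])
    show "T.M 0 (?v \<star> t) \<in> T.Nker ?K" if "t \<in> tspan TT [?K, CT]" for t
      by (rule subsetD[OF N(1) m0[OF vl[OF that] R1_sub k k c R1m]])
    show "T.M 0 (?v \<star> t) \<in> T.Nker ?K" if "t \<in> tspan TT [CT, ?K]" for t
      by (rule subsetD[OF N(2) m0[OF vr[OF that] R1_sub c c k cm]]) simp_all
  qed
  show "T.M 1 (T.D 0 (?v \<star> t)) \<in> T.Nker ?K"
  proof (rule F[OF lin_comp[OF lin_comp[OF T.lmult_linear[OF v(2)] T.D_linear] T.M_linear]])
    show "T.M 1 (T.D 0 (?v \<star> t)) \<in> T.Nker ?K" if "t \<in> tspan TT [?K, CT]" for t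
      by (rule subsetD[OF N(1) m1[OF d0[OF vl[OF that] R1_sub k k R1_sub c kb(2)] R1_sub c c k cm]]) simp_all
    show "T.M 1 (T.D 0 (?v \<star> t)) \<in> T.Nker ?K" if "t \<in> tspan TT [CT, ?K]" for t
      by (rule subsetD[OF N(2) m1[OF d0[OF vr[OF that] R1_sub c c R1_sub k D_right] R1_sub k k c R1m]])
  qed
  show "T.M 0 (T.D 1 (t \<star> ?v)) \<in> T.Nker ?K"
  proof (rule F[OF lin_comp[OF lin_comp[OF T.rmult_linear[OF v(2)] T.D_linear] T.M_linear]])
    show "T.M 0 (T.D 1 (t \<star> ?v)) \<in> T.Nker ?K" if "t \<in> tspan TT [?K, CT]" for t
      by (rule subsetD[OF N(1) m0[OF d1[OF lv[OF that] c R1_sub R1_sub c k D_left] k R1_sub k c mR1]])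
    show "T.M 0 (T.D 1 (t \<star> ?v)) \<in> T.Nker ?K" if "t \<in> tspan TT [CT, ?K]" for t
      by (rule subsetD[OF N(2) m0[OF d1[OF rv[OF that] k R1_sub R1_sub k c kb(1)] c R1_sub c k cm]]) simp_all
  qed
  show "T.M 1 (t \<star> ?v) \<in> T.Nker ?K"
  proof (rule F[OF lin_comp[OF T.rmult_linear[OF v(2)] T.M_linear]])
    show "T.M 1 (t \<star> ?v) \<in> T.Nker ?K" if "t \<in> tspan TT [?K, CT]" for t
      by (rule subsetD[OF N(1) m1[OF lv[OF that] c R1_sub c k cm]]) simp_all
    show "T.M 1 (t \<star> ?v) \<in> T.Nker ?K" if "t \<in> tspan TT [CT, ?K]" for t
      by (rule subsetD[OF N(2) m1[OF rv[OF that] k R1_sub k c mR1]])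
  qed
qed

text \<open>The elements whose comultiplication lies in \<open>Nker (kstep K)\<close> form an ideal.
  A generator differs from an element primitive modulo \<open>K\<close> by a letter, whose reduced
  comultiplication vanishes, and the two other terms of its comultiplication contain the generator
  itself.\<close>

lemma kstep_coideal: "x \<in> kstep K ==> comult TT x \<in> T.Nker (kstep K)"
proof -
  let ?K = "kstep K"
  note kid = ideal_TT[OF kstep_ideal]
  have KC: "?K \<subseteq> T.C" using kid(2) by simp
  note N = T.Nker_incl[OF KC] and sub = T.Nker_subsp[OF KC]
  define I where "I = {t \<in> CT. comult TT t \<in> T.Nker ?K}"
  note cl = comult_word(1)
  have clin: "comult TT \<in> linear_maps TA T.TA" using cl by (auto simp: linear_maps_def)
  have Isub: "subsp TA I"
    unfolding I_def by (rule subsp_vimage[OF clin R.vsp T.R.vsp sub])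
  have Ic: "t \<in> CT" "comult TT t \<in> T.Nker ?K" if "t \<in> I" for t using that by (simp_all add: I_def)
  have "ideal I TT"
  proof (rule ideal_TTI[OF Isub])
    fix a x assume a: "a \<in> CT" and x: "x \<in> I"
    note xc = Ic(1)[OF x]
    from a show "a \<bullet> x \<in> I"
    proof (induction a rule: TA_word_induct)
      case (cons y a)
      have ax: "a \<bullet> x \<in> CT" using cons xc by simp
      have "comult TT (pt [y] \<bullet> (a \<bullet> x)) \<in> T.Nker ?K"
        unfolding comult_cons[OF cons(1) ax]
        using cons(1) by (intro subsp_add[OF sub] kstep_Nker(1,2) Ic(2)[OF cons(3)]) simp_all
      then show ?case using cons(1,2) xc by (simp add: I_def R.A.m_assoc)
    next
      case (add s t)
      then show ?case using xc subsp_add[OF Isub, of "s \<bullet> x" "t \<bullet> x"] by (simp add: R.A.l_distr)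
    next
      case (smult b s)
      then show ?case using xc subsp_smult[OF Isub, of "s \<bullet> x" b] by (simp add: R.smult_mult)
    qed (use x xc in simp)
    \<comment> \<open>On the right the letters are absorbed into \<open>x\<close>, which therefore
      varies in the induction.\<close>
    from a x show "x \<bullet> a \<in> I"
    proof (induction a arbitrary: x rule: TA_word_induct)
      case (cons y a)
      note xc = Ic(1)[OF cons(4)]
      have "comult TT (x \<bullet> pt [y]) \<in> T.Nker ?K"
        unfolding comult_right[OF xc cons(1)]
        using cons(1) by (intro subsp_add[OF sub] kstep_Nker(3,4) Ic(2)[OF cons(4)]) simp_all
      then have "(x \<bullet> pt [y]) \<bullet> a \<in> I" using cons(1) xc by (intro cons(3)) (simp add: I_def)
      then show ?case using cons(1,2) xc by (simp add: R.A.m_assoc)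
    next
      case (add s t)
      note xc = Ic(1)[OF add(5)]
      show ?case using add(1,2) xc subsp_add[OF Isub add(3)[OF add(5)] add(4)[OF add(5)]] by (simp add: R.A.r_distr)
    next
      case (smult b s)
      note xc = Ic(1)[OF smult(3)]
      show ?case using smult(1) xc subsp_smult[OF Isub smult(2)[OF smult(3)], of b] by (simp add: R.mult_smult)
    next
      case one
      then show ?case using Ic(1) by simp
    qed
  qed
  moreover have "gens K \<subseteq> I"
  proof
    fix z assume z: "z \<in> gens K"
    then obtain x where x: "x \<in> T.prim_mod K" "z = x \<ominus>\<^bsub>TA\<^esub> pt [psi x]" by (auto simp: gens_def)
    note px = prim_mod_props(3)[OF K x(1)]
    have zc: "z \<in> CT" using z gens_sub[OF K] by blast
    have xc: "x \<in> CT" using prim_mod_props(1)[OF K] x by blast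
    have prl: "T.pr \<in> linear_maps TA T.TA" using T.pr_linear by (auto simp: linear_maps_def)
    have "T.pr (pt [psi x]) = T.zeroT"
      unfolding T.pr_def using comult_emb[of "psi x"] px by simp
    then have "T.pr z = T.pr x"
      using lin_minus[OF prl R.vsp T.R.vsp xc, of "pt [psi x]"] px x(2) lin_cl[OF prl xc] by simp
    then have "T.pr z \<in> T.Nker K" using x(1) by (simp add: T.prim_mod_def)
    then have p: "T.pr z \<in> T.Nker ?K" using T.Nker_mono[OF kstep_incl KC] by blast
    have zK: "z \<in> ?K" using z gens_kstep by blast
    have "T.pt [z, oneT] \<in> tspan TT [?K, T.C]" "T.pt [oneT, z] \<in> tspan TT [T.C, ?K]"
      by (rule T.tspan_pure; use zK in simp)+
    then have "comult TT z \<in> T.Nker ?K"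
      unfolding comult_eq_pr[OF zc] using N p by (intro subsp_add[OF sub]) auto
    then show "z \<in> I" using zc by (simp add: I_def)
  qed
  ultimately have "?K \<subseteq> I" by (rule kstep_least)
  then show "x \<in> kstep K ==> comult TT x \<in> T.Nker (kstep K)" by (auto simp: I_def)
qed

lemma kstep_admissible: "admissible (kstep K)"
  unfolding admissible_def using kstep_ideal kstep_psi kstep_braid kstep_coideal by blast

end

section \<open>The chain of ideals and its union\<close>

definition "kk n = (kstep ^^ n) {zeroT}"

lemma kk_simps: "kk 0 = {zeroT}" "kk (Suc n) = kstep (kk n)"
  by (simp_all add: kk_def)

lemma kk_admissible: "admissible (kk n)"
proof (induction n)
  case 0
  let ?Z = "{\<zero>\<^bsub>TT\<^esub>}"
  have c: "?Z \<subseteq> T.C" by simp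
  have zz: "T.zeroT \<in> tspan TT [Rn 1, ?Z]" "T.zeroT \<in> tspan TT [?Z, Rn 1]" "T.zeroT \<in> T.Nker ?Z"
    by (rule subsp_zero, rule T.tspan_subsp T.Nker_subsp, simp)+
  have m: "tspan TT [?Z, Rn 1] \<subseteq> tspan TT [?Z, T.C]" "tspan TT [Rn 1, ?Z] \<subseteq> tspan TT [T.C, ?Z]"
    by (rule T.tspan_mono; simp)+
  have t0: "t = T.zeroT" if "t \<in> tspan TT [?Z, Rn 1] \<or> t \<in> tspan TT [Rn 1, ?Z]" for t
    using that m T.Nker_incl[OF c] by (intro T.Nker_zero) blast
  have D0: "T.D 0 T.zeroT = T.zeroT" by (rule T.whisker_zero[OF T.braid_hom])
  have "comult TT zeroT = T.zeroT"
    using lin_zero[OF comult_word(1) R.vsp T.vspace_Rn] by simp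
  moreover have "psi zeroT = \<zero>\<^bsub>A\<^esub>" by (rule lin_zero[OF psi_linear R.vsp A.A.vsp])
  moreover have "ideal ?Z TT" by (rule T.A.A.zeroideal)
  moreover have "T.D 0 t \<in> tspan TT [Rn 1, ?Z]" if "t \<in> tspan TT [?Z, Rn 1]" for t
    using t0[of t] that D0 zz(1) by simp
  moreover have "T.D 0 t \<in> tspan TT [?Z, Rn 1]" if "t \<in> tspan TT [Rn 1, ?Z]" for t
    using t0[of t] that D0 zz(2) by simp
  ultimately show ?case
    unfolding kk_simps admissible_def using zz(3) by simp
qed (simp only: kk_simps kstep_admissible)

text \<open>An element of filtration degree at most \<open>Suc k\<close> that is killed by \<open>psi\<close> is primitive modulo \<open>kk k\<close>,
  since its reduced comultiplication lives in degree at most \<open>k\<close>.\<close>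

lemma kk_kernel: "[|x \<in> fil k; psi x = \<zero>\<^bsub>A\<^esub>|] ==> x \<in> kk k"
proof (induction k arbitrary: x)
  case 0
  have "fil 0 = lspan TA {oneT}"
  proof -
    have "{xs \<in> wrd. length xs \<le> 0} = {[]}" by auto
    then show ?thesis by (simp add: fil_def pure_Nil)
  qed
  moreover have sub: "subsp TA {a \<odot>\<^bsub>TA\<^esub> oneT | a. True}"
  proof (rule subspI)
    show "zeroT \<in> {a \<odot>\<^bsub>TA\<^esub> oneT | a. True}"
      by (intro CollectI exI[of _ 0]) simp
    fix x y assume "x \<in> {a \<odot>\<^bsub>TA\<^esub> oneT | a. True}" "y \<in> {a \<odot>\<^bsub>TA\<^esub> oneT | a. True}"
    then obtain a b where "x = a \<odot>\<^bsub>TA\<^esub> oneT" "y = b \<odot>\<^bsub>TA\<^esub> oneT" by blast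
    then have "x \<oplus>\<^bsub>TA\<^esub> y = (a + b) \<odot>\<^bsub>TA\<^esub> oneT" by (simp add: R.add_smult)
    then show "x \<oplus>\<^bsub>TA\<^esub> y \<in> {a \<odot>\<^bsub>TA\<^esub> oneT | a. True}" by blast
  next
    fix c x assume "x \<in> {a \<odot>\<^bsub>TA\<^esub> oneT | a. True}"
    then obtain a where "x = a \<odot>\<^bsub>TA\<^esub> oneT" by blast
    then have "c \<odot>\<^bsub>TA\<^esub> x = (c * a) \<odot>\<^bsub>TA\<^esub> oneT" by (simp add: R.smult_smult)
    then show "c \<odot>\<^bsub>TA\<^esub> x \<in> {a \<odot>\<^bsub>TA\<^esub> oneT | a. True}" by blast
  qed auto
  ultimately have "fil 0 \<subseteq> {a \<odot>\<^bsub>TA\<^esub> oneT | a. True}"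
    using lspan_least[OF sub, of "{oneT}"] R.one_smult[of "oneT"] by (metis (mono_tags, lifting) R.A.one_closed empty_subsetI insert_subset mem_Collect_eq)
  then obtain a where a: "x = a \<odot>\<^bsub>TA\<^esub> oneT" using 0 by blast
  then have "a \<odot>\<^bsub>A\<^esub> \<one>\<^bsub>A\<^esub> = \<zero>\<^bsub>A\<^esub>" using 0(2) lin_smult[OF psi_linear, of "oneT" a] by (simp add: psi_one)
  \<comment> \<open>The counit detects the scalar, because it sends the unit of \<open>A\<close> to
    1.\<close>
  then have "counit A (a \<odot>\<^bsub>A\<^esub> \<one>\<^bsub>A\<^esub>) = 0" using lin_smult[OF counit_linear, of "\<one>\<^bsub>A\<^esub>" 0] by simp
  then have "a = 0" using lin_smult[OF counit_linear, of "\<one>\<^bsub>A\<^esub>" a] by (simp add: counit_one)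
  then show ?case using a by (simp add: kk_simps)
next
  case (Suc k)
  note xc = fil_cl[OF Suc(2)]
  have sub: "subsp TT (fil k)" using fil_subsp by (simp only: subsp_TT)
  have "PS (T.pr x) = A.pr \<zero>\<^bsub>A\<^esub>" using PS_pr[OF xc] Suc(3) by simp
  also have "\<dots> = A.zeroT" using lin_zero[OF A.pr_linear A.A.vsp A.vspace_Rn] by simp
  \<comment> \<open>Exactness is applied within \<open>fil k\<close>, so that the kernel elements
    occurring as tensor factors are within reach of the induction hypothesis.\<close>
  finally have "T.pr x \<in> T.Nker {y \<in> fil k. psi y = \<zero>\<^bsub>A\<^esub>}"
    by (rule T.tmap_kernel[OF A.tns psi_linear_TT sub pr_fil[OF Suc(2)]])
  moreover have "{y \<in> fil k. psi y = \<zero>\<^bsub>A\<^esub>} \<subseteq> kk k" using Suc(1) by blast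
  moreover have KC: "kk k \<subseteq> T.C" using ideal_TT(2) kk_admissible[of k] by (simp add: admissible_def)
  ultimately have "T.pr x \<in> T.Nker (kk k)" using T.Nker_mono by blast
  then have xp: "x \<in> T.prim_mod (kk k)" using xc by (simp add: T.prim_mod_def)
  have "pt [\<zero>\<^bsub>A\<^esub>] = zeroT"
    using lin_zero[OF pure1_linear(1) V.vsp R.vsp] by simp
  \<comment> \<open>Since \<open>psi x\<close> is zero, the generator attached to \<open>x\<close>
    is \<open>x\<close> itself.\<close>
  then have e: "x \<ominus>\<^bsub>TA\<^esub> pt [psi x] = x" using Suc(3) xc by simp
  have "x \<in> gens (kk k)"
    unfolding gens_def by (rule image_eqI[where f = "\<lambda>x. x \<ominus>\<^bsub>TA\<^esub> pt [psi x]", OF e[symmetric] xp])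
  then show ?case using gens_kstep[OF kk_admissible] by (auto simp: kk_simps)
qed

lemma kk_exhausts: "[|x \<in> CT; psi x = \<zero>\<^bsub>A\<^esub>|] ==> \<exists>k. x \<in> kk k"
  using fil_exhausts kk_kernel by blast

lemma kk_mono: "m \<le> n ==> kk m \<subseteq> kk n"
  by (rule lift_Suc_mono_le[of kk]) (simp_all add: kk_simps kstep_incl[OF kk_admissible])

section \<open>The stages\<close>

text \<open>The braiding of \<open>U\<close> is only compared with that of \<open>A\<close> along \<open>q\<close>. This makes the arbitrary
  preimages in \<open>quotient_bialgebra\<close> harmless: no compatibility of the braiding with \<open>K\<close> is needed.\<close>

definition "stage_inv U i q K p \<longleftrightarrow> unital_algebra U \<and> p \<in> algebra_maps TT U \<and> p ` CT = carrier U \<and>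
  (\<forall>t\<in>CT. p t = \<zero>\<^bsub>U\<^esub> \<longleftrightarrow> t \<in> K) \<and> (\<forall>v\<in>Pr. i v = p (pt [v])) \<and> (\<forall>t\<in>CT. q (p t) = psi t) \<and>
  (\<forall>t\<in>CT. comult U (p t) = tmap U p (comult TT t)) \<and>
  (\<forall>s\<in>carrier (tensor_power U 2). braid U s \<in> carrier (tensor_power U 2) \<and> tmap A q (braid U s) = braid A (tmap A q s)) \<and>
  (\<forall>t\<in>CT. counit U (p t) = counit A (psi t))"

context
  fixes U :: "('k, 'a list \<Rightarrow>\<^sub>0 'k) braided_bialg" and i q K p
  assumes K: "admissible K" and inv: "stage_inv U i q K p"
begin

lemma stage:
  "unital_algebra U" "p \<in> algebra_maps TT U" "p ` CT = carrier U"
  "t \<in> CT ==> p t = \<zero>\<^bsub>U\<^esub> \<longleftrightarrow> t \<in> K" "v \<in> Pr ==> i v = p (pt [v])" "t \<in> CT ==> q (p t) = psi t"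
  "t \<in> CT ==> comult U (p t) = tmap U p (comult TT t)"
  "s \<in> carrier (tensor_power U 2) ==> braid U s \<in> carrier (tensor_power U 2)"
  "s \<in> carrier (tensor_power U 2) ==> tmap A q (braid U s) = braid A (tmap A q s)"
  "t \<in> CT ==> counit U (p t) = counit A (psi t)"
  using inv unfolding stage_inv_def by blast+

interpretation U: talg U by (rule talg.intro[OF stage(1)])

lemma p_linear: "p \<in> linear_maps TT U" and p_mult: "[|s \<in> CT; t \<in> CT|] ==> p (s \<bullet> t) = p s \<otimes>\<^bsub>U\<^esub> p t"
  and p_one: "p oneT = \<one>\<^bsub>U\<^esub>"
  using stage(2) by (simp_all add: algebra_maps_def ring_hom_def)

lemma p_linear': "p \<in> linear_maps TA U"
  using p_linear by (simp only: linear_TT)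

lemma p_cl: "t \<in> CT ==> p t \<in> carrier U"
  by (rule lin_cl[OF p_linear'])

lemma p_E: assumes "x \<in> carrier U" obtains t where "t \<in> CT" "x = p t"
  using stage(3) assms by blast

lemma K_sub: "K \<subseteq> CT"
  using K ideal_TT(2) by (simp add: admissible_def)

lemma p_minus: "[|s \<in> CT; t \<in> CT|] ==> p (s \<ominus>\<^bsub>TA\<^esub> t) = p s \<ominus>\<^bsub>U\<^esub> p t"
  by (rule lin_minus[OF p_linear' R.vsp U.A.vsp])

lemma p_eq: "[|s \<in> CT; t \<in> CT|] ==> p s = p t \<longleftrightarrow> s \<ominus>\<^bsub>TA\<^esub> t \<in> K"
  using stage(4)[of "s \<ominus>\<^bsub>TA\<^esub> t"] p_minus[of s t] U.A.minus_zero_iff[OF p_cl p_cl, of s t] by simp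

text \<open>Everything about \<open>q\<close> is read off from \<open>psi\<close> on lifts to T,
  since \<open>p\<close> is onto and \<open>q (p t) = psi t\<close>.\<close>

lemma q_map: "q \<in> algebra_maps U A"
proof -
  have "q \<in> linear_maps U A"
  proof (rule linI)
    fix x y assume "x \<in> carrier U" "y \<in> carrier U"
    then obtain s t where st: "s \<in> CT" "x = p s" "t \<in> CT" "y = p t" by (metis p_E)
    show "q (x \<oplus>\<^bsub>U\<^esub> y) = q x \<oplus>\<^bsub>A\<^esub> q y"
      using stage(6)[of "s \<oplus>\<^bsub>TA\<^esub> t"] stage(6)[OF st(1)] stage(6)[OF st(3)] st lin_add[OF p_linear' st(1,3)]
        lin_add[OF psi_linear st(1,3)] by simp
  next
    fix a x assume "x \<in> carrier U"
    then obtain s where st: "s \<in> CT" "x = p s" by (rule p_E)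
    show "q (a \<odot>\<^bsub>U\<^esub> x) = a \<odot>\<^bsub>A\<^esub> q x"
      using stage(6)[of "a \<odot>\<^bsub>TA\<^esub> s"] stage(6)[OF st(1)] st lin_smult[OF p_linear' st(1)]
        lin_smult[OF psi_linear st(1)] by simp
  next
    fix x assume "x \<in> carrier U"
    then obtain s where st: "s \<in> CT" "x = p s" by (rule p_E)
    then show "q x \<in> A.C" using stage(6)[OF st(1)] psi_cl by simp
  qed
  moreover have "q (x \<otimes>\<^bsub>U\<^esub> y) = q x \<otimes>\<^bsub>A\<^esub> q y" if "x \<in> carrier U" "y \<in> carrier U" for x y
  proof -
    obtain s t where st: "s \<in> CT" "x = p s" "t \<in> CT" "y = p t" using \<open>x \<in> carrier U\<close> \<open>y \<in> carrier U\<close> by (metis p_E)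
    show ?thesis
      using stage(6)[of "s \<bullet> t"] stage(6)[OF st(1)] stage(6)[OF st(3)] st p_mult[OF st(1,3)] psi_mult[OF st(1,3)] by simp
  qed
  moreover have "q \<one>\<^bsub>U\<^esub> = \<one>\<^bsub>A\<^esub>" using stage(6)[of "oneT"] by (simp add: p_one psi_one)
  ultimately show ?thesis by (auto simp: algebra_maps_def ring_hom_def linear_maps_def)
qed

lemma q_linear: "q \<in> linear_maps U A"
  using q_map by (simp add: algebra_maps_def)

lemma comult_U:
  assumes "x \<in> carrier U"
  shows "comult U x \<in> carrier (tensor_power U 2)" "tmap A q (comult U x) = comult A (q x)"
proof -
  obtain t where t: "t \<in> CT" "x = p t" using assms by (rule p_E)
  have ct: "comult TT t \<in> T.Rn 2" using T.comult_cl[of t] t by simp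
  show "comult U x \<in> carrier (tensor_power U 2)"
    using tmap_Rn[OF T.tns U.tns p_linear ct] stage(7)[OF t(1)] t(2) by simp
  have "tmap A q (tmap U p (comult TT t)) = tmap A (\<lambda>x. q (p x)) (comult TT t)"
    by (rule tmap_comp[OF T.tns U.tns A.tns p_linear q_linear T.Rn_cl[OF ct]])
  also have "\<dots> = PS (comult TT t)"
    by (rule tmap_cong_tspan[OF T.tns A.tns psi_linear_TT lin_comp[OF p_linear q_linear], of "[CT, CT]"])
      (use ct T.Rn_tspan2(1)[of "comult TT t"] stage(6) in auto)
  finally show "tmap A q (comult U x) = comult A (q x)"
    using PS_comult[OF t(1)] stage(6,7)[OF t(1)] t(2) by simp
qed

text \<open>\<open>p\<close> has kernel \<open>K\<close>, so the kernel of
  \<open>p \<otimes> p\<close> on the tensor square is \<open>Nker K\<close>; primitivity of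
  \<open>p t\<close> thus becomes a condition on \<open>t\<close> in T.\<close>

lemma prims: "t \<in> CT ==> p t \<in> primitives U \<longleftrightarrow> t \<in> T.prim_mod K"
proof -
  assume t: "t \<in> CT"
  have ct: "comult TT t \<in> T.CT" using T.Rn_cl[OF T.comult_cl[of t]] t by simp
  note tm = tmap_minus[OF T.tns U.tns p_linear] and ta = tmap_add[OF T.tns U.tns p_linear]
    and tp = tmap_pure[OF T.tns U.tns p_linear] and tc = tmap_cl[OF T.tns U.tns p_linear]
  have "tmap U p (T.pr t) = comult U (p t) \<ominus>\<^bsub>U.TA\<^esub> (U.pt [p t, \<one>\<^bsub>U\<^esub>] \<oplus>\<^bsub>U.TA\<^esub> U.pt [\<one>\<^bsub>U\<^esub>, p t])"
    unfolding T.pr_def using ct t tp[of "[t, oneT]"] tp[of "[oneT, t]"] by (simp add: tm ta p_one stage(7)[OF t])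
  moreover have "comult U (p t) \<in> U.CT" using tc[OF ct] stage(7)[OF t] by simp
  ultimately have "p t \<in> primitives U \<longleftrightarrow> tmap U p (T.pr t) = U.zeroT"
    unfolding primitives_def using p_cl[OF t] by (simp add: U.R.minus_zero_iff)
  also have "\<dots> \<longleftrightarrow> T.pr t \<in> T.Nker K"
  proof
    have eq: "{x \<in> carrier TT. p x = \<zero>\<^bsub>U\<^esub>} = K" using stage(4) K_sub by auto
    have "T.pr t \<in> T.Rn 2" using lin_cl[OF T.pr_linear, of t] t by simp
    then have "T.pr t \<in> tspan TT [carrier TT, carrier TT]" using T.Rn_tspan2(1)[of "T.pr t"] by simp
    then show "T.pr t \<in> T.Nker K" if "tmap U p (T.pr t) = U.zeroT"
      using T.tmap_kernel[OF U.tns p_linear T.A.subsp_carrier _ that] unfolding eq by blast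
    show "tmap U p (T.pr t) = U.zeroT" if "T.pr t \<in> T.Nker K"
      by (rule T.tmap_Nker[OF U.tns p_linear _ _ that]) (use K_sub stage(4) in auto)
  qed
  finally show ?thesis using t by (simp add: T.prim_mod_def)
qed

lemma primitives_U: "primitives U = p ` T.prim_mod K"
proof (intro subset_antisym subsetI)
  fix x assume x: "x \<in> primitives U"
  then have "x \<in> carrier U" by (simp add: primitives_def)
  then obtain t where "t \<in> CT" "x = p t" by (rule p_E)
  then show "x \<in> p ` T.prim_mod K" using x prims by blast
next
  fix x assume "x \<in> p ` T.prim_mod K"
  then show "x \<in> primitives U" using prims subsetD[OF prim_mod_props(1)[OF K]] by blast
qed

abbreviation (input) "br \<equiv> induced_bracket (U, i) q"
abbreviation (input) "J \<equiv> stage_ideal (U, i) (induced_bracket (U, i) q)"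

lemma J_eq: "J = Idl\<^bsub>U\<^esub> (p ` gens K)"
proof -
  have "(\<lambda>x. x \<ominus>\<^bsub>U\<^esub> i (br x)) ` primitives U = p ` gens K"
    unfolding primitives_U gens_def image_image
  proof (rule image_cong[OF refl])
    fix t assume t: "t \<in> T.prim_mod K"
    then have tc: "t \<in> CT" using prim_mod_props(1)[OF K] by blast
    note px = prim_mod_props(3)[OF K t]
    have "p t \<in> primitives U" using prims[OF tc] t by simp
    then have "br (p t) = psi t" by (simp add: induced_bracket_def stage(6)[OF tc])
    then show "p t \<ominus>\<^bsub>U\<^esub> i (br (p t)) = p (t \<ominus>\<^bsub>TA\<^esub> pt [psi t])"
      using p_minus[OF tc, of "pt [psi t]"] px by (simp add: stage(5))
  qed
  then show ?thesis by (simp add: stage_ideal_def)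
qed

lemma J_ideal: "ideal J U"
  unfolding J_eq using gens_sub[OF K] p_cl by (intro U.A.A.genideal_ideal) blast

text \<open>\<open>J\<close> is the image of \<open>kstep K\<close>, and the kernel \<open>K\<close>
  of \<open>p\<close> is contained in \<open>kstep K\<close>, so nothing is gained on pulling
  back.\<close>

lemma J_iff: "t \<in> CT ==> p t \<in> J \<longleftrightarrow> t \<in> kstep K"
proof
  note kid = ideal_TT[OF kstep_ideal[OF K]]
  assume t: "t \<in> CT"
  show "p t \<in> J" if "t \<in> kstep K"
  proof -
    have "ideal {t \<in> CT. p t \<in> J} TT"
      by (rule ideal_TTI[OF subsp_vimage[OF p_linear' R.vsp U.A.vsp U.A.ideal_subsp[OF J_ideal]]])
        (auto simp: p_mult p_cl ideal.I_l_closed[OF J_ideal] ideal.I_r_closed[OF J_ideal])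
    moreover have "gens K \<subseteq> {t \<in> CT. p t \<in> J}"
      unfolding J_eq using U.A.A.genideal_self[of "p ` gens K"] gens_sub[OF K] p_cl by blast
    ultimately have "kstep K \<subseteq> {t \<in> CT. p t \<in> J}" by (rule kstep_least[OF K])
    then show ?thesis using that by blast
  qed
  show "t \<in> kstep K" if pJ: "p t \<in> J"
  proof -
    have "ideal (p ` kstep K) U"
    proof (rule U.A.idealI_subsp)
      show "subsp U (p ` kstep K)"
        by (rule subsp_image[OF p_linear' R.vsp U.A.vsp kid(1)])
      fix a x assume "a \<in> carrier U" "x \<in> p ` kstep K"
      then obtain b y where bb: "b \<in> CT" "a = p b" "y \<in> kstep K" "x = p y" by (metis p_E imageE)
      then have yc: "y \<in> CT" using kid(2) by blast
      show "a \<otimes>\<^bsub>U\<^esub> x \<in> p ` kstep K"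
        unfolding bb(2,4) by (rule image_eqI[where f = p, OF p_mult[OF bb(1) yc, symmetric] kid(3)[OF bb(1,3)]])
      show "x \<otimes>\<^bsub>U\<^esub> a \<in> p ` kstep K"
        unfolding bb(2,4) by (rule image_eqI[where f = p, OF p_mult[OF yc bb(1), symmetric] kid(4)[OF bb(1,3)]])
    qed
    then have "J \<subseteq> p ` kstep K"
      unfolding J_eq by (rule U.A.A.genideal_minimal) (use gens_kstep[OF K] in blast)
    then obtain s where s: "s \<in> kstep K" "p t = p s" using pJ by blast
    have sc: "s \<in> CT" using s kid(2) by blast
    have "t \<ominus>\<^bsub>TA\<^esub> s \<in> kstep K" using p_eq[OF t sc] s(2) kstep_incl[OF K] by blast
    then have "(t \<ominus>\<^bsub>TA\<^esub> s) \<oplus>\<^bsub>TA\<^esub> s \<in> kstep K" by (rule subsp_add[OF kid(1) _ s(1)])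
    then show ?thesis using t sc by simp
  qed
qed

lemma next_inv:
  "stage_inv (fst (next_stage (U, i) br)) (snd (next_stage (U, i) br))
     (q \<circ> inv_into (carrier U) (stage_projection (U, i) br)) (kstep K) (stage_projection (U, i) br \<circ> p)"
proof -
  define pj where "pj = coset_rep U J"
  define Q where "Q = quotient_algebra U J"
  define U' where "U' = quotient_bialgebra U J"
  have eqs: "stage_projection (U, i) br = pj" "fst (next_stage (U, i) br) = U'" "snd (next_stage (U, i) br) = pj \<circ> i"
    by (simp_all add: stage_projection_def next_stage_def pj_def U'_def)
  have Q: "unital_algebra Q" and pj: "pj \<in> algebra_maps U Q"
    unfolding Q_def pj_def by (rule U.A.quotient_unital_algebra[OF J_ideal], rule U.A.coset_rep_algebra_map[OF J_ideal])
  have same: "same_alg Q U'"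
    and U'_fields: "braid U' = (\<lambda>t. map_power Q 2 pj (braid U (inv_into (carrier (tensor_power U 2)) (map_power Q 2 pj) t)))"
      "comult U' = (\<lambda>x. map_power Q 2 pj (comult U (inv_into (carrier U) pj x)))"
      "counit U' = (\<lambda>x. counit U (inv_into (carrier U) pj x))"
    by (simp_all add: U'_def Q_def pj_def quotient_bialgebra_def Let_def same_alg_def module.defs braided.defs braided_bialg.defs)
  have fields: "carrier U' = carrier Q" "\<zero>\<^bsub>U'\<^esub> = \<zero>\<^bsub>Q\<^esub>" using same by (simp_all add: same_alg_def)
  note sm = same_alg_maps[OF same] and st = same_alg_tensor[OF same]
  interpret Q: talg Q by (rule talg.intro[OF Q])
  have pjl: "pj \<in> linear_maps U Q" using pj by (simp add: algebra_maps_def)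
  have Qc: "carrier Q = pj ` carrier U" by (simp add: Q_def quotient_algebra_def pj_def)
  define p' where "p' = (\<lambda>t. pj (p t))"
  have p'l: "p' \<in> linear_maps TT Q" unfolding p'_def by (rule lin_comp[OF p_linear pjl])
  have mp: "map_power Q 2 pj w = tmap Q pj w" if "w \<in> U.Rn 2" for w
    by (rule U.map_power_eq[OF Q.tns pjl that])
  have pjeq: "[|x \<in> carrier U; y \<in> carrier U|] ==> pj x = pj y \<longleftrightarrow> x \<ominus>\<^bsub>U\<^esub> y \<in> J" for x y
    unfolding pj_def by (rule U.A.coset_rep_iff(1)[OF J_ideal])
  \<comment> \<open>The preimage picked by \<open>inv_into\<close> may be any element of its fibre.
    A lift of it to T differs from \<open>t\<close> by an element of \<open>kstep K\<close>, and the
    data read off from it are invariant under \<open>kstep K\<close>.\<close>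
  have choice: "\<exists>s\<in>CT. inv_into (carrier U) pj (p' t) = p s \<and> s \<ominus>\<^bsub>TA\<^esub> t \<in> kstep K" if t: "t \<in> CT" for t
  proof -
    let ?y = "inv_into (carrier U) pj (p' t)"
    have im: "p' t \<in> pj ` carrier U" using p_cl[OF t] by (simp add: p'_def)
    have y: "?y \<in> carrier U" "pj ?y = pj (p t)" using inv_into_into[OF im] f_inv_into_f[OF im] by (simp_all add: p'_def)
    obtain s where s: "s \<in> CT" "?y = p s" using y(1) by (rule p_E)
    have "p s \<ominus>\<^bsub>U\<^esub> p t \<in> J" using pjeq[OF y(1) p_cl[OF t]] y(2) s(2) by simp
    then have "s \<ominus>\<^bsub>TA\<^esub> t \<in> kstep K" using J_iff[of "s \<ominus>\<^bsub>TA\<^esub> t"] p_minus[OF s(1) t] s(1) t by simp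
    then show ?thesis using s by blast
  qed
  have psi_eq: "psi s = psi t" if "s \<in> CT" "t \<in> CT" "s \<ominus>\<^bsub>TA\<^esub> t \<in> kstep K" for s t
    using kstep_psi[OF K that(3)] lin_minus[OF psi_linear R.vsp A.A.vsp that(1,2)]
      A.A.minus_zero_iff[OF psi_cl[OF that(1)] psi_cl[OF that(2)]] by simp
  define q' where "q' = (\<lambda>x. q (inv_into (carrier U) pj x))"
  have q'p': "q' (p' t) = psi t" if t: "t \<in> CT" for t
    using choice[OF t] psi_eq[OF _ t] stage(6) by (auto simp: q'_def)
  have q'pj: "q' (pj x) = q x" if x: "x \<in> carrier U" for x
  proof -
    obtain t where "t \<in> CT" "x = p t" using x by (rule p_E)
    then show ?thesis using q'p'[of t] stage(6)[of t] by (simp add: p'_def)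
  qed
  have kp': "p' t = \<zero>\<^bsub>Q\<^esub> \<longleftrightarrow> t \<in> kstep K" if "t \<in> CT" for t
    using U.A.coset_rep_zero_iff[OF J_ideal p_cl[OF that]] J_iff[OF that] by (simp add: p'_def pj_def Q_def)
  have q'l: "q' \<in> linear_maps Q A"
  proof (rule linI)
    fix x y assume "x \<in> carrier Q" "y \<in> carrier Q"
    then obtain a b where ab: "a \<in> carrier U" "x = pj a" "b \<in> carrier U" "y = pj b" unfolding Qc by blast
    show "q' (x \<oplus>\<^bsub>Q\<^esub> y) = q' x \<oplus>\<^bsub>A\<^esub> q' y"
      using lin_add[OF pjl ab(1,3)] lin_add[OF q_linear ab(1,3)] q'pj[of "a \<oplus>\<^bsub>U\<^esub> b"] q'pj[OF ab(1)] q'pj[OF ab(3)] ab by simp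
  next
    fix c x assume "x \<in> carrier Q"
    then obtain a where a: "a \<in> carrier U" "x = pj a" unfolding Qc by blast
    show "q' (c \<odot>\<^bsub>Q\<^esub> x) = c \<odot>\<^bsub>A\<^esub> q' x"
      using lin_smult[OF pjl a(1)] lin_smult[OF q_linear a(1)] q'pj[of "c \<odot>\<^bsub>U\<^esub> a"] q'pj[OF a(1)] a by simp
  next
    fix x assume "x \<in> carrier Q"
    then obtain a where a: "a \<in> carrier U" "x = pj a" unfolding Qc by blast
    then show "q' x \<in> A.C" using q'pj[OF a(1)] lin_cl[OF q_linear a(1)] by simp
  qed
  have cm: "comult U' (p' t) = tmap U' p' (comult TT t)" if t: "t \<in> CT" for t
  proof -
    obtain s where s: "s \<in> CT" "inv_into (carrier U) pj (p' t) = p s" "s \<ominus>\<^bsub>TA\<^esub> t \<in> kstep K" using choice[OF t] by blast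
    have cs: "comult TT s \<in> T.CT" "comult TT t \<in> T.CT" "comult U (p s) \<in> U.Rn 2"
      using T.Rn_cl[OF T.comult_cl[of s]] T.Rn_cl[OF T.comult_cl[of t]] comult_U(1)[OF p_cl[OF s(1)]] s t by simp_all
    have "comult U' (p' t) = tmap Q pj (tmap U p (comult TT s))"
      using s(2) mp[OF cs(3)] stage(7)[OF s(1)] by (simp add: U'_fields)
    also have "\<dots> = tmap Q p' (comult TT s)"
      unfolding p'_def by (rule tmap_comp[OF T.tns U.tns Q.tns p_linear pjl cs(1)])
    also have "\<dots> = tmap Q p' (comult TT t)"
    proof -
      have KC: "kstep K \<subseteq> T.C" using ideal_TT(2)[OF kstep_ideal[OF K]] by simp
      \<comment> \<open>The coideal property makes the comultiplication independent of the
        lift.\<close>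
      have "comult TT (s \<ominus>\<^bsub>TA\<^esub> t) \<in> T.Nker (kstep K)" by (rule kstep_coideal[OF K s(3)])
      then have "tmap Q p' (comult TT (s \<ominus>\<^bsub>TA\<^esub> t)) = Q.zeroT"
        using kp' KC by (intro T.tmap_Nker[OF Q.tns p'l KC]) auto
      moreover have "comult TT (s \<ominus>\<^bsub>TA\<^esub> t) = comult TT s \<ominus>\<^bsub>T.TA\<^esub> comult TT t"
        using lin_minus[OF _ R.vsp T.R.vsp s(1) t, of "comult TT"] comult_word(1)
        by (auto simp: linear_maps_def)
      ultimately have "tmap Q p' (comult TT s) \<ominus>\<^bsub>Q.TA\<^esub> tmap Q p' (comult TT t) = Q.zeroT"
        using tmap_minus[OF T.tns Q.tns p'l cs(1,2)] by simp
      then show ?thesis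
        using Q.R.minus_zero_iff[OF tmap_cl[OF T.tns Q.tns p'l cs(1)] tmap_cl[OF T.tns Q.tns p'l cs(2)]] by simp
    qed
    finally show ?thesis by (simp add: sm(3))
  qed
  have br': "braid U' s \<in> Q.Rn 2 \<and> tmap A q' (braid U' s) = braid A (tmap A q' s)" if s: "s \<in> Q.Rn 2" for s
  proof -
    obtain w where w: "w \<in> U.Rn 2" "tmap Q pj w = s"
      by (rule tmap_surj[OF U.tns Q.tns pjl Qc[symmetric] s])
    then have im: "s \<in> map_power Q 2 pj ` U.Rn 2" using mp[OF w(1)] by (intro image_eqI[of _ _ w]) simp_all
    define y where "y = inv_into (U.Rn 2) (map_power Q 2 pj) s"
    have y: "y \<in> U.Rn 2" "tmap Q pj y = s"
      using inv_into_into[OF im] f_inv_into_f[OF im] mp by (simp_all add: y_def)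
    \<comment> \<open>The braiding is evaluated at the arbitrary preimage \<open>y\<close>; the
      image of the result in \<open>A\<close> depends on \<open>s\<close> alone.\<close>
    have b: "braid U' s = tmap Q pj (braid U y)" using mp[OF stage(8)[OF y(1)]] by (simp add: U'_fields y_def)
    have tq: "tmap A q' (tmap Q pj z) = tmap A q z" if z: "z \<in> U.Rn 2" for z
    proof -
      have "tmap A q' (tmap Q pj z) = tmap A (\<lambda>x. q' (pj x)) z"
        by (rule tmap_comp[OF U.tns Q.tns A.tns pjl q'l U.Rn_cl[OF z]])
      also have "\<dots> = tmap A q z"
        by (rule tmap_cong_tspan[OF U.tns A.tns q_linear lin_comp[OF pjl q'l], of "[U.C, U.C]"])
          (use z U.Rn_tspan2(1)[of z] q'pj in auto)
      finally show ?thesis .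
    qed
    have "tmap A q' (braid U' s) = tmap A q (braid U y)" unfolding b by (rule tq[OF stage(8)[OF y(1)]])
    also have "\<dots> = braid A (tmap A q' s)" using stage(9)[OF y(1)] tq[OF y(1)] y(2) by simp
    finally show ?thesis
      unfolding b using tmap_Rn[OF U.tns Q.tns pjl stage(8)[OF y(1)]] by simp
  qed
  have cu: "counit U' (p' t) = counit A (psi t)" if t: "t \<in> CT" for t
    using choice[OF t] psi_eq[OF _ t] stage(10) by (auto simp: U'_fields)
  have "p' ` CT = carrier U'"
    unfolding fields Qc stage(3)[symmetric] by (simp add: p'_def image_image)
  moreover have "p' \<in> algebra_maps TT U'"
    unfolding sm p'_def by (rule algebra_maps_comp[OF stage(2) pj])
  moreover have "unital_algebra U'" by (rule unital_algebra_cong[OF same Q])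
  ultimately have "stage_inv U' (\<lambda>v. pj (i v)) q' (kstep K) p'"
    unfolding stage_inv_def fields st using kp' q'p' cm br' cu stage(5) by (simp add: p'_def)
  then show ?thesis unfolding eqs by (simp add: q'_def p'_def comp_def)
qed

end

lemma base_inv: "stage_inv TT (\<lambda>v. pt [v]) psi {zeroT} (\<lambda>t. t)"
proof -
  have "(\<lambda>t. t) \<in> algebra_maps TT TT" using T.A.id_linear' by (auto simp: algebra_maps_def ring_hom_def)
  moreover have "tmap TT (\<lambda>t. t) (comult TT t) = comult TT t" if "t \<in> CT" for t
    by (rule T.tmap_id[OF T.Rn_cl[OF T.comult_cl[of t]]]) (use that in simp)
  moreover have "braid TT s \<in> T.Rn 2" if "s \<in> T.Rn 2" for s by (rule lin_cl[OF T.braid_hom that])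
  ultimately show ?thesis
    unfolding stage_inv_def using T.talg_ua PS_braid counit_psi by simp
qed

abbreviation "ev \<equiv> enveloping_stage PV (infinitesimal_bracket A)"
abbreviation "proj \<equiv> enveloping_projection PV (infinitesimal_bracket A)"
abbreviation "ps n \<equiv> snd (infinitesimal_stage A n)"

text \<open>The recursion that produces the bracket carries its own copy of the stages; it agrees
  with the enveloping stages formed from the finished bracket.\<close>

lemma stage_eq: "fst (infinitesimal_stage A n) = ev n"
  by (induction n) (auto simp: infinitesimal_bracket_def Let_def split: prod.split)

text \<open>Identifies the data of stage \<open>n\<close>: the projection from T is the composite of
  the transition maps, its kernel is \<open>kk n\<close>, and the map to \<open>A\<close> is the one
  that induces the bracket.\<close>

lemma inv_n: "stage_inv (fst (ev n)) (snd (ev n)) (ps n) (kk n) (transition proj 0 n)"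
proof (induction n)
  case 0
  show ?case using base_inv by (simp add: initial_stage_def psi_def kk_simps id_def)
next
  case (Suc n)
  obtain U i \<psi> where s: "infinitesimal_stage A n = ((U, i), \<psi>)" by (metis surj_pair)
  have e: "ev n = (U, i)" using stage_eq[of n] s by simp
  have b: "infinitesimal_bracket A n = induced_bracket (U, i) \<psi>" by (simp add: infinitesimal_bracket_def s)
  have pn: "proj n = stage_projection (U, i) (induced_bracket (U, i) \<psi>)"
    by (simp add: enveloping_projection_def e b)
  have "stage_inv U i \<psi> (kk n) (transition proj 0 n)" using Suc by (simp add: e s)
  from next_inv[OF kk_admissible this] show ?case
    by (simp add: e b s kk_simps Let_def pn comp_def)
qed

lemma trans_E:
  assumes "x \<in> carrier (fst (ev n))"
  obtains t where "t \<in> CT" "x = transition proj 0 n t"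
  using stage(3)[OF kk_admissible inv_n, of n] assms by blast

lemma trans_cl: "t \<in> CT ==> transition proj 0 n t \<in> carrier (fst (ev n))"
  using stage(3)[OF kk_admissible inv_n, of n] by blast

lemma ps_trans: "t \<in> CT ==> ps n (transition proj 0 n t) = psi t"
  by (rule stage(6)[OF kk_admissible inv_n])

lemma proj_cl: "x \<in> carrier (fst (ev n)) ==> proj n x \<in> carrier (fst (ev (Suc n)))"
  and ps_proj: "x \<in> carrier (fst (ev n)) ==> ps (Suc n) (proj n x) = ps n x"
proof -
  assume "x \<in> carrier (fst (ev n))"
  then obtain t where t: "t \<in> CT" "x = transition proj 0 n t" by (rule trans_E)
  then have e: "proj n x = transition proj 0 (Suc n) t" by simp
  show "proj n x \<in> carrier (fst (ev (Suc n)))" unfolding e by (rule trans_cl[OF t(1)])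
  show "ps (Suc n) (proj n x) = ps n x" unfolding e ps_trans[OF t(1)] unfolding t(2) ps_trans[OF t(1)] by (rule refl)
qed

text \<open>Lifts to T differ by an element of the kernel of \<open>psi\<close>, which some ideal of
  the chain contains; a later stage therefore identifies them.\<close>

lemma ps_eq:
  assumes "x \<in> carrier (fst (ev n))" "y \<in> carrier (fst (ev n))" "ps n x = ps n y"
  shows "\<exists>j. transition proj n j x = transition proj n j y"
proof -
  obtain s t where st: "s \<in> CT" "x = transition proj 0 n s" "t \<in> CT" "y = transition proj 0 n t"
    using assms(1,2) by (metis trans_E)
  have "psi s = psi t" using assms(3) unfolding st(2,4) ps_trans[OF st(1)] ps_trans[OF st(3)] .
  then have "psi (s \<ominus>\<^bsub>TA\<^esub> t) = \<zero>\<^bsub>A\<^esub>"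
    using lin_minus[OF psi_linear R.vsp A.A.vsp st(1,3)] psi_cl[OF st(3)] by simp
  then obtain k where "s \<ominus>\<^bsub>TA\<^esub> t \<in> kk k" using kk_exhausts[of "s \<ominus>\<^bsub>TA\<^esub> t"] st by auto
  \<comment> \<open>The index is raised to \<open>n + k\<close>, a stage that is reached from
    \<open>n\<close> by \<open>k\<close> transitions.\<close>
  then have "s \<ominus>\<^bsub>TA\<^esub> t \<in> kk (n + k)" using kk_mono[of k "n + k"] by auto
  then have "transition proj 0 (n + k) s = transition proj 0 (n + k) t"
    using p_eq[OF kk_admissible inv_n st(1,3)] by simp
  then have "transition proj n k x = transition proj n k y" unfolding transition_add st(2,4) by simp
  then show ?thesis by blast
qed

lemmas stage_facts = stage(1)[OF kk_admissible inv_n] q_map[OF kk_admissible inv_n] comult_U[OF kk_admissible inv_n]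
  stage(8,9)[OF kk_admissible inv_n]

lemma ps_surj:
  assumes "primitively_generated A"
  shows "ps n ` carrier (fst (ev n)) = A.C"
proof -
  have "ps n ` carrier (fst (ev n)) = (\<lambda>t. ps n (transition proj 0 n t)) ` CT"
    using stage(3)[OF kk_admissible inv_n, of n] by (metis image_image)
  also have "\<dots> = psi ` CT" by (rule image_cong[OF refl ps_trans])
  finally show ?thesis using psi_surj[OF assms] by simp
qed

lemma counit_ev: "x \<in> carrier (fst (ev n)) ==> counit (fst (ev n)) x = counit A (ps n x)"
proof -
  assume "x \<in> carrier (fst (ev n))"
  then obtain t where t: "t \<in> CT" "x = transition proj 0 n t" by (rule trans_E)
  show ?thesis unfolding t(2) ps_trans[OF t(1)] by (rule stage(10)[OF kk_admissible inv_n t(1)])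
qed

theorem enveloping_isomorphic:
  assumes "primitively_generated A"
  shows "isomorphic_braided_bialgebras A (universal_enveloping PV (infinitesimal_bracket A))"
proof -
  have "limit_setup A (\<lambda>n. fst (ev n)) proj (\<lambda>n. ps n)"
    by (rule limit_setup.intro[OF A.bcoalg_axioms limit_setup_axioms.intro])
      (rule bialg stage_facts ps_surj[OF assms] proj_cl ps_proj ps_eq counit_ev; assumption?)+
  then show ?thesis unfolding universal_enveloping_def by (rule limit_setup.limit_isomorphic)
qed

end

theorem theorem6p9:
  fixes A :: "('k::field, 'a) braided_bialg"
  assumes "braided_bialgebra A"
    and "primitively_generated A"
  shows "isomorphic_braided_bialgebras A
           (universal_enveloping (infinitesimal_part A) (infinitesimal_bracket A))"
  using bialg.enveloping_isomorphic[OF bialg.intro[OF assms(1)] assms(2)] .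

end
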